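(* Suppose the Schröder case ($p_0+p_1>0$), so that the Schröder constant $\alpha$ lies in $(0,\infty)$, and suppose that $\mathbf{E}(X_1^+)^{1+\alpha}<\infty$, where $X_1^+=X_1\vee 0$. Let $\varepsilon_n>0$ satisfy $\varepsilon_n\to0$ and $\varepsilon_n^2m^n\to\infty$ as $n\to\infty$. Then \[ 0< V_*\Gamma_\alpha\le \liminf_{n\to\infty}\varepsilon_n^{2\alpha}m^{\alpha n}\,\mathbf{P}(R_n\ge\varepsilon_n)\le\limsup_{n\to\infty}\varepsilon_n^{2\alpha}m^{\alpha n}\,\mathbf{P}(R_n\ge\varepsilon_n)\le V^*\Gamma_\alpha<\infty, \] where $V_*:=\liminf_{u\downarrow0}u^{1-\alpha}w(u)$, $V^*:=\limsup_{u\downarrow0}u^{1-\alpha}w(u)$, and $\Gamma_\alpha:=\frac{2^{\alpha-1}\Gamma(\alpha+1/2)}{\alpha\sqrt\pi}\sigma^{2\alpha}$ ($\Gamma$ the Gamma function).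
   Context: Standing setup: $Z=(Z_n)_{n\ge0}$ is a Galton–Watson process with $Z_0=1$ and offspring law $\{p_k\}_{k\ge0}$ with mean $m=\sum_k kp_k\in(1,\infty)$ and $\mathbf{E}Z_1\log Z_1<\infty$. Independently of $Z$, $(X_n)_{n\ge1}$ are i.i.d. real random variables with $\mathbf{E}X_1=0$ and $\sigma^2:=\mathbf{E}X_1^2\in(0,\infty)$; $S_k:=X_1+\dots+X_k$. On $\{Z_n>0\}$ set $R_n:=S_{Z_n}/Z_n$; by convention $\mathbf{P}(R_n\ge x)$ means $\mathbf{P}(R_n\ge x,\ Z_n>0)$. Let $f(s)=\sum_j p_js^j$, $q$ the extinction probability, $\gamma:=f'(q)$, and define $\alpha\in(0,\infty]$ by $\gamma=m^{-\alpha}$. The Schröder case means $p_0+p_1>0$ (equivalently $\alpha<\infty$); $\alpha$ is then called the Schröder constant. $W:=\lim_n m^{-n}Z_n$ (a.s. limit), and $w$ denotes the density of $W$ restricted to $(0,\infty)$. *)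

theory Defs
  imports "HOL-Probability.Probability"
begin

fun GW :: "(nat \<Rightarrow> nat \<Rightarrow> 'a \<Rightarrow> nat) \<Rightarrow> nat \<Rightarrow> 'a \<Rightarrow> nat" where
  "GW \<xi> 0 x = 1"
| "GW \<xi> (Suc n) x = (\<Sum>i<GW \<xi> n x. \<xi> n i x)"

definition psum :: "(nat \<Rightarrow> 'a \<Rightarrow> real) \<Rightarrow> nat \<Rightarrow> 'a \<Rightarrow> real" where
  "psum X k x = (\<Sum>i\<in>{1..k}. X i x)"

definition gen_fun :: "(nat \<Rightarrow> real) \<Rightarrow> real \<Rightarrow> real" where
  "gen_fun p s = (\<Sum>j. p j * s ^ j)"

definition joint_family ::
  "(nat \<Rightarrow> nat \<Rightarrow> 'a \<Rightarrow> nat) \<Rightarrow> (nat \<Rightarrow> 'a \<Rightarrow> real) \<Rightarrow> (nat \<times> nat) + nat \<Rightarrow> 'a \<Rightarrow> real" where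
  "joint_family \<xi> X j x = (case j of Inl (n, i) \<Rightarrow> real (\<xi> n i x) | Inr k \<Rightarrow> X k x)"

definition joint_index :: "((nat \<times> nat) + nat) set" where
  "joint_index = range Inl \<union> Inr ` {1..}"

end

theory Submission
  imports Defs
begin

text \<open>
  Write \<open>N\<^sub>n = \<epsilon>\<^sub>n\<^sup>2 m\<^sup>n\<close>. Given \<open>Z\<^sub>n = k\<close>, the central limit theorem makes the probability of \<open>R\<^sub>n \<ge> \<epsilon>\<^sub>n\<close> close to
  \<open>\<psi> (\<epsilon>\<^sub>n\<^sup>2 k)\<close>, where \<open>\<psi> y\<close> is the Gaussian tail at \<open>sqrt y / \<sigma>\<close>; the event is therefore produced by
  \<open>Z\<^sub>n\<close> of order \<open>\<epsilon>\<^sub>n\<^sup>-\<^sup>2\<close>, much below \<open>m\<^sup>n\<close>. The bound \<open>P (0 < Z\<^sub>n \<le> x) = O ((x / m\<^sup>n)\<^sup>\<alpha>)\<close> removes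
  bounded \<open>k\<close>, and a Fuk-Nagaev inequality together with the moment condition on \<open>X\<^sub>1\<^sup>+\<close> removes \<open>k\<close> much larger
  than \<open>\<epsilon>\<^sub>n\<^sup>-\<^sup>2\<close>.

  Next, \<open>N\<^sub>n\<^sup>\<alpha> (E \<psi> (\<epsilon>\<^sub>n\<^sup>2 Z\<^sub>n) - E \<psi> (N\<^sub>n W))\<close>, restricted to survival, tends to 0: for exponentials this follows
  from iterating the generating function, which contracts by \<open>\<gamma> = m\<^sup>-\<^sup>\<alpha>\<close> per generation near \<open>q\<close>, and
  the passage to \<open>\<psi>\<close> is a Weierstrass approximation in the variable \<open>exp (- \<mu> y)\<close>. With \<open>g u = u powr (1 - \<alpha>) * w u\<close>,
  \<open>N\<^sup>\<alpha> E \<psi> (N W)\<close> is the integral of \<open>\<psi> v * v powr (\<alpha> - 1) * g (v / N)\<close>, hence is squeezed between the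
  lower and upper limits of \<open>g\<close> at 0 times the integral of \<open>\<psi> v * v powr (\<alpha> - 1)\<close>, which is \<open>\<Gamma>\<^sub>\<alpha>\<close>.

  Boundedness of \<open>g\<close> near 0 comes from Fourier inversion of a tilted law of \<open>W\<close>. For the lower bound, the branching
  property gives \<open>g u \<le> g (u / m)\<close>, so it is enough that \<open>w\<close> is positive on a fundamental interval close to 0; this
  follows by propagating positivity of \<open>w\<close> through sums of independent copies of \<open>W\<close>.
\<close>

section \<open>Generating functions\<close>

text \<open>One estimate drives the analytic part: on a disc of radius s < 1 the iterates satisfy
  |f_n(a) - f_n(b)| \<le> C \<gamma>^n |a - b|, because f_i(s) tends to q geometrically and so the
  product of the f'(f_i(s)) is at most a constant times \<gamma>^n. Complex arguments give decay of
  order |t|^(-1-\<alpha>) for the derivative of the transform of W; real ones give the bound on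
  small values of Z_n and the comparison of Laplace transforms. The obstacle is that errors are
  measured on the scale N_n^(-\<alpha>), so weak convergence of Z_n / m^n alone says nothing. Hence
  approximations keep a factor exp(-\<mu> y), whose mean has exactly this order. The transform of W
  itself would only be bounded by |t|^(-\<alpha>), which is not integrable for \<alpha> \<le> 1;
  differentiating once repairs this. The constant \<Gamma>_\<alpha> comes from Fubini: the Gaussian
  tail integrated against v^(\<alpha>-1) is the mean of (\<sigma> G)^(2\<alpha>) / \<alpha> over G >
  0 for a standard normal G, and s = G^2 / 2 makes this a Gamma integral.\<close>

lemma one_minus_sum_le_prod:
  fixes a :: "nat \<Rightarrow> real"
  assumes "\<And>i. 0 \<le> a i" "\<And>i. a i \<le> 1"
  shows "1 - (\<Sum>i<n. a i) \<le> (\<Prod>i<n. 1 - a i)"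
proof (induction n)
  case (Suc n)
  have "(\<Prod>i<n. 1 - a i) \<le> 1" using assms by (intro prod_le_1) auto
  then have "(\<Prod>i<n. 1 - a i) * a n \<le> a n" using assms by (intro mult_left_le_one_le prod_nonneg) auto
  with Suc show ?case by (simp add: algebra_simps)
qed simp

locale offspring_law =
  fixes p :: "nat \<Rightarrow> real" and m :: real
  assumes p_nonneg: "\<And>k. p k \<ge> 0"
    and p_sums: "p sums 1"
    and m_def: "m = (\<Sum>k. real k * p k)"
    and m_summ: "summable (\<lambda>k. real k * p k)"
    and m_gt1: "m > 1"
begin

text \<open>Polymorphic, so that the same function and its iterates serve real arguments
  (probabilities, Laplace transforms) and complex ones (Fourier transforms).\<close>

definition pgf :: "'b::{real_normed_field,banach} \<Rightarrow> 'b" where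
  "pgf z = (\<Sum>k. of_real (p k) * z ^ k)"

definition dpgf :: "real \<Rightarrow> real" where
  "dpgf s = (\<Sum>k. real k * p k * s ^ (k - 1))"

text \<open>The chord slope (f(s) - f(t)) / (s - t) as a power series with nonnegative coefficients:
  it makes sense at s = t and is visibly monotone, which replaces convexity arguments.\<close>

definition spgf :: "real \<Rightarrow> real \<Rightarrow> real" where
  "spgf s t = (\<Sum>k. p k * (\<Sum>i<k. s ^ i * t ^ (k - Suc i)))"

lemma p_summable: "summable p"
  using p_sums by (rule sums_summable)

lemma pgf_summable_norm: "norm z \<le> 1 \<Longrightarrow> summable (\<lambda>k. norm (of_real (p k) * z ^ k))"
  for z :: "'b::{real_normed_field,banach}"
  by (rule summable_comparison_test'[OF p_summable, of 0])
     (auto simp: norm_mult norm_power p_nonneg intro!: mult_right_le_one_le power_le_one)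

lemma pgf_summable: "norm z \<le> 1 \<Longrightarrow> summable (\<lambda>k. of_real (p k) * z ^ k)"
  for z :: "'b::{real_normed_field,banach}"
  by (rule summable_norm_cancel[OF pgf_summable_norm])

lemma dpgf_summable: "0 \<le> s \<Longrightarrow> s \<le> 1 \<Longrightarrow> summable (\<lambda>k. real k * p k * s ^ (k - 1))"
  by (rule summable_comparison_test'[OF m_summ, of 0])
     (auto simp: p_nonneg intro!: mult_right_le_one_le power_le_one)

lemma spgf_summand_le:
  assumes "0 \<le> s" "s \<le> 1" "0 \<le> t" "t \<le> 1"
  shows "(\<Sum>i<k. s ^ i * t ^ (k - Suc i)) \<le> real k"
proof -
  have "(\<Sum>i<k. s ^ i * t ^ (k - Suc i)) \<le> (\<Sum>i<k. 1)"
    using assms by (intro sum_mono mult_le_one power_le_one) auto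
  then show ?thesis by simp
qed

lemma spgf_summable:
  assumes "0 \<le> s" "s \<le> 1" "0 \<le> t" "t \<le> 1"
  shows "summable (\<lambda>k. p k * (\<Sum>i<k. s ^ i * t ^ (k - Suc i)))"
proof (rule summable_comparison_test'[OF m_summ, of 0])
  fix k :: nat
  have "0 \<le> (\<Sum>i<k. s ^ i * t ^ (k - Suc i))"
    using assms by (intro sum_nonneg) auto
  with spgf_summand_le[OF assms, of k] p_nonneg[of k]
  show "norm (p k * (\<Sum>i<k. s ^ i * t ^ (k - Suc i))) \<le> real k * p k"
    by (simp add: abs_mult mult_left_mono mult.commute[of "real k"])
qed

lemma pgf_of_real: "norm z \<le> 1 \<Longrightarrow> pgf (of_real z) = (of_real (pgf z) :: 'b::{real_normed_field,banach})"
  for z :: real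
  using suminf_of_real[OF pgf_summable[of z], where 'a='b] unfolding pgf_def by simp

lemma pgf_1 [simp]: "pgf 1 = (1 :: real)"
  using p_sums by (simp add: pgf_def sums_iff)

lemma pgf_nonneg: "0 \<le> s \<Longrightarrow> s \<le> 1 \<Longrightarrow> 0 \<le> (pgf s :: real)"
  unfolding pgf_def using pgf_summable[of s] by (intro suminf_nonneg) (auto simp: p_nonneg)

lemma norm_pgf_le: "norm z \<le> s \<Longrightarrow> s \<le> 1 \<Longrightarrow> norm (pgf z) \<le> pgf s"
  for z :: "'b::{real_normed_field,banach}"
proof -
  assume *: "norm z \<le> s" "s \<le> 1"
  then have "0 \<le> s" using norm_ge_zero order_trans by blast
  have "norm (pgf z) \<le> (\<Sum>k. norm (of_real (p k) * z ^ k))"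
    unfolding pgf_def using * by (intro summable_norm pgf_summable_norm) auto
  also have "\<dots> \<le> (\<Sum>k. of_real (p k) * s ^ k)"
    using * \<open>0 \<le> s\<close>
    by (intro suminf_le pgf_summable_norm pgf_summable)
       (auto simp: norm_mult norm_power p_nonneg intro!: mult_left_mono power_mono)
  finally show ?thesis by (simp add: pgf_def)
qed

lemma pgf_mono: "0 \<le> s \<Longrightarrow> s \<le> t \<Longrightarrow> t \<le> 1 \<Longrightarrow> pgf s \<le> (pgf t :: real)"
  using norm_pgf_le[of s t] by auto

lemma pgf_le_1: "0 \<le> s \<Longrightarrow> s \<le> 1 \<Longrightarrow> pgf s \<le> (1::real)"
  using pgf_mono[of s 1] by simp

lemma norm_pgf_le_1: "norm z \<le> 1 \<Longrightarrow> norm (pgf z) \<le> 1"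
  for z :: "'b::{real_normed_field,banach}"
  using norm_pgf_le[of z 1] by simp

lemma dpgf_1: "dpgf 1 = m"
  by (simp add: dpgf_def m_def)

lemma dpgf_nonneg: "0 \<le> s \<Longrightarrow> s \<le> 1 \<Longrightarrow> 0 \<le> dpgf s"
  unfolding dpgf_def using dpgf_summable[of s] by (intro suminf_nonneg) (auto simp: p_nonneg)

lemma norm_power_diff_le:
  fixes a b :: "'b::real_normed_field"
  assumes "norm a \<le> s" "norm b \<le> s"
  shows "norm (a ^ k - b ^ k) \<le> real k * s ^ (k - 1) * norm (a - b)"
proof (cases k)
  case (Suc n)
  have s: "0 \<le> s" using assms(1) norm_ge_zero order_trans by blast
  have "norm (\<Sum>i<Suc n. a ^ i * b ^ (n - i)) \<le> (\<Sum>i<Suc n. s ^ n)"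
  proof (rule sum_norm_le)
    fix i assume "i \<in> {..<Suc n}"
    then have "s ^ n = s ^ i * s ^ (n - i)" by (simp flip: power_add)
    then show "norm (a ^ i * b ^ (n - i)) \<le> s ^ n"
      using assms s by (auto simp: norm_mult norm_power intro!: mult_mono power_mono)
  qed
  then show ?thesis
    using mult_left_mono[of "norm (\<Sum>i<Suc n. a ^ i * b ^ (n - i))" "\<Sum>i<Suc n. s ^ n" "norm (a - b)"]
    unfolding Suc power_diff_sumr2 norm_mult by (simp add: mult_ac del: sum.lessThan_Suc)
qed simp

text \<open>Nonnegative coefficients make the derivative at the radius \<open>s\<close> a majorant
  of the derivative on the whole disc, also for complex arguments.\<close>

lemma pgf_lipschitz:
  fixes a b :: "'b::{real_normed_field,banach}"
  assumes "norm a \<le> s" "norm b \<le> s" "s \<le> 1"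
  shows "norm (pgf a - pgf b) \<le> dpgf s * norm (a - b)"
proof -
  have s: "0 \<le> s" using assms(1) norm_ge_zero order_trans by blast
  have sa: "summable (\<lambda>k. of_real (p k) * a ^ k)" and sb: "summable (\<lambda>k. of_real (p k) * b ^ k)"
    using assms by (auto intro!: pgf_summable)
  have sd: "summable (\<lambda>k. (real k * p k * s ^ (k - 1)) * norm (a - b))"
    by (rule summable_mult2[OF dpgf_summable]) (use s assms in auto)
  have le: "norm (of_real (p k) * a ^ k - of_real (p k) * b ^ k) \<le> (real k * p k * s ^ (k - 1)) * norm (a - b)" for k
  proof -
    have "norm (of_real (p k) * a ^ k - of_real (p k) * b ^ k) = p k * norm (a ^ k - b ^ k)"
      by (simp add: norm_mult p_nonneg flip: right_diff_distrib)
    also have "\<dots> \<le> p k * (real k * s ^ (k - 1) * norm (a - b))"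
      by (intro mult_left_mono norm_power_diff_le assms p_nonneg)
    finally show ?thesis by (simp add: mult_ac)
  qed
  have "norm (pgf a - pgf b) = norm (\<Sum>k. of_real (p k) * a ^ k - of_real (p k) * b ^ k)"
    unfolding pgf_def by (simp add: suminf_diff[OF sa sb])
  also have "\<dots> \<le> (\<Sum>k. (real k * p k * s ^ (k - 1)) * norm (a - b))"
    by (rule norm_suminf_le[OF le sd])
  also have "\<dots> = dpgf s * norm (a - b)"
    unfolding dpgf_def by (rule suminf_mult2[symmetric, OF dpgf_summable]) (use s assms in auto)
  finally show ?thesis .
qed

lemma pgf_lipschitz_1:
  fixes a b :: "'b::{real_normed_field,banach}"
  shows "norm a \<le> 1 \<Longrightarrow> norm b \<le> 1 \<Longrightarrow> norm (pgf a - pgf b) \<le> m * norm (a - b)"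
  using pgf_lipschitz[of a 1 b] by (simp add: dpgf_1)

lemma pgf_diff_eq:
  assumes "0 \<le> s" "s \<le> 1" "0 \<le> t" "t \<le> 1"
  shows "pgf s - pgf t = (s - t) * spgf s t"
proof -
  have "pgf s - pgf t = (\<Sum>k. p k * s ^ k - p k * t ^ k)"
    unfolding pgf_def using pgf_summable[of s] pgf_summable[of t] assms by (subst suminf_diff) auto
  also have "\<dots> = (\<Sum>k. (s - t) * (p k * (\<Sum>i<k. s ^ i * t ^ (k - Suc i))))"
  proof (intro suminf_cong)
    fix k
    show "p k * s ^ k - p k * t ^ k = (s - t) * (p k * (\<Sum>i<k. s ^ i * t ^ (k - Suc i)))"
    proof (cases k)
      case (Suc n)
      have "p k * s ^ k - p k * t ^ k = p k * (s ^ Suc n - t ^ Suc n)"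
        unfolding Suc by (simp add: right_diff_distrib)
      then show ?thesis unfolding power_diff_sumr2 Suc
        by (simp add: mult.left_commute mult.commute del: sum.lessThan_Suc)
    qed simp
  qed
  also have "\<dots> = (s - t) * spgf s t"
    unfolding spgf_def using assms by (intro suminf_mult spgf_summable) auto
  finally show ?thesis .
qed

lemma spgf_diag: "spgf s s = dpgf s"
proof -
  have "p k * (\<Sum>i<k. s ^ i * s ^ (k - Suc i)) = real k * p k * s ^ (k - 1)" for k
  proof -
    have "(\<Sum>i<k. s ^ i * s ^ (k - Suc i)) = (\<Sum>i<k. s ^ (k - 1))"
      by (intro sum.cong refl) (simp flip: power_add)
    then show ?thesis by simp
  qed
  then show ?thesis unfolding spgf_def dpgf_def by presburger
qed

lemma spgf_mono:
  assumes "0 \<le> s" "s \<le> s'" "s' \<le> 1" "0 \<le> t" "t \<le> 1"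
  shows "spgf s t \<le> spgf s' t"
  unfolding spgf_def using assms p_nonneg
  by (intro suminf_le spgf_summable mult_left_mono sum_mono mult_right_mono power_mono) auto

lemma ex_two_children: "\<exists>k\<ge>2. p k > 0"
proof (rule ccontr)
  assume "\<not> ?thesis"
  then have z: "p k = 0" if "k \<ge> 2" for k
    using that p_nonneg[of k] by force
  have "m = (\<Sum>k<2. real k * p k)"
    unfolding m_def using z by (intro suminf_finite) (auto simp: not_less)
  also have "\<dots> = p 1" by (simp add: numeral_2_eq_2)
  also have "\<dots> \<le> 1"
    using sum_le_suminf[OF p_summable, of "{1}"] p_nonneg p_sums by (auto simp: sums_iff)
  finally show False using m_gt1 by simp
qed

text \<open>Strictness comes from one charged k \<ge> 2, which exists because m > 1.\<close>

lemma spgf_strict_mono: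
  assumes "0 \<le> s" "s < s'" "s' \<le> 1" "0 < t" "t \<le> 1"
  shows "spgf s t < spgf s' t"
proof -
  obtain k where k: "k \<ge> 2" "p k > 0" using ex_two_children by blast
  let ?h = "\<lambda>s k. p k * (\<Sum>i<k. s ^ i * t ^ (k - Suc i))"
  have le: "?h s j \<le> ?h s' j" for j
    using assms p_nonneg by (intro mult_left_mono sum_mono mult_right_mono power_mono) auto
  have "(\<Sum>i<k. s ^ i * t ^ (k - Suc i)) < (\<Sum>i<k. s' ^ i * t ^ (k - Suc i))"
  proof (rule sum_strict_mono_ex1)
    show "\<forall>i\<in>{..<k}. s ^ i * t ^ (k - Suc i) \<le> s' ^ i * t ^ (k - Suc i)"
      using assms by (auto intro!: mult_right_mono power_mono)
    show "\<exists>i\<in>{..<k}. s ^ i * t ^ (k - Suc i) < s' ^ i * t ^ (k - Suc i)"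
      \<comment> \<open>The term i = 1 is s * t^(k-2), and t^(k-2) is positive because 0 <
        t.\<close>
      by (rule bexI[of _ 1]) (use assms k in auto)
  qed simp
  then have "?h s k < ?h s' k" using k by simp
  then have "0 < (\<Sum>j. ?h s' j - ?h s j)"
    using le assms by (intro suminf_pos2[of _ k] summable_diff spgf_summable) auto
  also have "\<dots> = spgf s' t - spgf s t"
    unfolding spgf_def using assms by (intro suminf_diff[symmetric] spgf_summable) auto
  finally show ?thesis by simp
qed

lemma spgf_fixed_point: "0 \<le> s \<Longrightarrow> s < 1 \<Longrightarrow> pgf s = s \<Longrightarrow> spgf s 1 = 1"
  using pgf_diff_eq[of s 1] by simp

text \<open>At a fixed point below 1 the chord to (1, 1) has slope 1, and this slope is strictly
  increasing in the other endpoint.\<close>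

lemma fixed_point_unique:
  fixes s t :: real
  assumes "0 \<le> s" "s < 1" "pgf s = s" "0 \<le> t" "t < 1" "pgf t = t"
  shows "s = t"
  using spgf_fixed_point[of s] spgf_fixed_point[of t] spgf_strict_mono[of s t 1] spgf_strict_mono[of t s 1] assms
  by (cases s t rule: linorder_cases) auto

lemma deriv_gen_fun:
  assumes "0 \<le> s" "s < 1"
  shows "deriv (gen_fun p) s = dpgf s"
proof -
  have "((\<lambda>x. \<Sum>n. p n * x ^ n) has_field_derivative (\<Sum>n. diffs p n * s ^ n)) (at s)"
    by (rule termdiffs_strong'[of 1]) (use assms pgf_summable[where 'b=real] in auto)
  moreover have "(\<lambda>x. \<Sum>n. p n * x ^ n) = gen_fun p" by (simp add: gen_fun_def fun_eq_iff)
  moreover have "(\<Sum>n. diffs p n * s ^ n) = dpgf s"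
  proof -
    have "dpgf s = (\<Sum>n. real (Suc n) * p (Suc n) * s ^ n)"
      unfolding dpgf_def using suminf_split_head[OF dpgf_summable[of s]] assms by simp
    then show ?thesis by (simp add: diffs_def)
  qed
  ultimately show ?thesis by (metis DERIV_imp_deriv)
qed

lemma funpow_pgf_of_real:
  assumes "0 \<le> s" "s \<le> 1"
  shows "0 \<le> (pgf ^^ n) s" "(pgf ^^ n) s \<le> 1"
    "(pgf ^^ n) (of_real s) = (of_real ((pgf ^^ n) s) :: 'b::{real_normed_field,banach})"
proof (induction n)
  case (Suc n)
  { case 1 then show ?case using Suc by (simp add: pgf_nonneg) }
  { case 2 then show ?case using Suc by (simp add: pgf_le_1) }
  { case 3 then show ?case using Suc by (simp add: pgf_of_real) }
qed (use assms in auto)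

lemma norm_funpow_pgf_le: "norm z \<le> s \<Longrightarrow> s \<le> 1 \<Longrightarrow> norm ((pgf ^^ n) z) \<le> (pgf ^^ n) s"
  for z :: "'b::{real_normed_field,banach}"
proof (induction n)
  case (Suc n)
  then have "0 \<le> s" using norm_ge_zero order_trans by blast
  then show ?case using Suc norm_pgf_le[of "(pgf ^^ n) z"] funpow_pgf_of_real(2)[of s n] by simp
qed simp

lemma norm_funpow_pgf_le_1: "norm z \<le> 1 \<Longrightarrow> norm ((pgf ^^ n) z) \<le> 1"
  for z :: "'b::{real_normed_field,banach}"
proof (induction n)
  case (Suc n)
  then show ?case using norm_pgf_le_1[of "(pgf ^^ n) z"] by simp
qed simp

lemma funpow_pgf_mono: "0 \<le> s \<Longrightarrow> s \<le> t \<Longrightarrow> t \<le> 1 \<Longrightarrow> (pgf ^^ n) s \<le> (pgf ^^ n) (t::real)"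
  using norm_funpow_pgf_le[of s t n] by simp

lemma funpow_pgf_lipschitz_1:
  fixes a b :: "'b::{real_normed_field,banach}"
  assumes "norm a \<le> 1" "norm b \<le> 1"
  shows "norm ((pgf ^^ n) a - (pgf ^^ n) b) \<le> m ^ n * norm (a - b)"
proof (induction n)
  case (Suc n)
  have "norm ((pgf ^^ Suc n) a - (pgf ^^ Suc n) b) \<le> m * norm ((pgf ^^ n) a - (pgf ^^ n) b)"
    using pgf_lipschitz_1[OF norm_funpow_pgf_le_1[OF assms(1)] norm_funpow_pgf_le_1[OF assms(2)]] by simp
  also have "\<dots> \<le> m * (m ^ n * norm (a - b))"
    using m_gt1 Suc by (intro mult_left_mono) auto
  finally show ?case by simp
qed simp

lemma funpow_pgf_lt_1: "0 \<le> s \<Longrightarrow> s < 1 \<Longrightarrow> (pgf ^^ n) s < (1::real)"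
proof (induction n)
  case (Suc n)
  define x where "x = (pgf ^^ n) s"
  have x: "0 \<le> x" "x < 1" using Suc funpow_pgf_of_real(1)[of s n] by (auto simp: x_def)
  have "0 < spgf 0 1"
  proof -
    obtain k where k: "k \<ge> 2" "p k > 0" using ex_two_children by blast
    have "0 < (\<Sum>i<k. (0::real) ^ i)" using k by (intro sum_pos2[of _ 0]) auto
    then show ?thesis unfolding spgf_def using k
      by (intro suminf_pos2[of _ k] spgf_summable) (auto intro!: mult_nonneg_nonneg sum_nonneg simp: p_nonneg)
  qed
  then have "0 < spgf x 1" using spgf_mono[of 0 x 1] x by auto
  then have "(x - 1) * spgf x 1 < 0" using x by (simp add: mult_less_0_iff)
  with pgf_diff_eq[of x 1] x show ?case by (simp add: x_def)
qed simp

text \<open>\<open>defect x\<close> bounds the error in \<open>1 - pgf (1 - x) \<approx> m * x\<close>; the \<open>Z log Z\<close> condition says exactly that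
  these errors are summable along \<open>x = m^(-i)\<close>, so the martingale limit keeps a positive mass.\<close>

definition defect :: "real \<Rightarrow> real" where
  "defect x = (\<Sum>k. real k * p k * min 1 (real k * x))"

lemma defect_summable: "0 \<le> x \<Longrightarrow> summable (\<lambda>k. real k * p k * min 1 (real k * x))"
  by (rule summable_comparison_test'[OF m_summ, of 0])
     (auto simp: p_nonneg abs_mult intro!: mult_right_le_one_le)

lemma defect_nonneg: "0 \<le> x \<Longrightarrow> 0 \<le> defect x"
  unfolding defect_def using defect_summable[of x] by (intro suminf_nonneg) (auto simp: p_nonneg)

lemma defect_le: "0 \<le> x \<Longrightarrow> defect x \<le> m"
  unfolding defect_def m_def using defect_summable[of x] m_summ
  by (intro suminf_le) (auto simp: p_nonneg intro!: mult_right_le_one_le)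

lemma defect_mono: "0 \<le> x \<Longrightarrow> x \<le> y \<Longrightarrow> defect x \<le> defect y"
  unfolding defect_def using defect_summable[of x] defect_summable[of y]
  by (intro suminf_le) (auto simp: p_nonneg intro!: mult_left_mono min.mono)

text \<open>Bernoulli's inequality (1 - x)^i \<ge> 1 - i x \<ge> 1 - k x for i < k, applied to every
  term of the chord slope at (1 - x, 1).\<close>

lemma one_minus_pgf_ge:
  assumes "0 \<le> x" "x \<le> 1"
  shows "1 - pgf (1 - x) \<ge> x * (m - defect x)"
proof -
  have "m - defect x \<le> spgf (1 - x) 1"
  proof -
    have "m - defect x = (\<Sum>k. real k * p k - real k * p k * min 1 (real k * x))"
      unfolding m_def defect_def using m_summ defect_summable[of x] assms by (intro suminf_diff) auto
    also have "\<dots> \<le> (\<Sum>k. p k * (\<Sum>i<k. (1 - x) ^ i * 1 ^ (k - Suc i)))"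
    proof (intro suminf_le summable_diff m_summ defect_summable spgf_summable)
      fix k
      have "real k - real k * min 1 (real k * x) = (\<Sum>i<k. 1 - min 1 (real k * x))"
        by (simp add: right_diff_distrib)
      also have "\<dots> \<le> (\<Sum>i<k. (1 - x) ^ i * 1 ^ (k - Suc i))"
      proof (rule sum_mono)
        fix i assume "i \<in> {..<k}"
        have "1 - real i * x \<le> (1 - x) ^ i" using Bernoulli_inequality[of "-x" i] assms by simp
        moreover have "real i * x \<le> real k * x" using \<open>i \<in> _\<close> assms by (intro mult_right_mono) auto
        moreover have "0 \<le> (1 - x) ^ i" using assms by simp
        ultimately show "1 - min 1 (real k * x) \<le> (1 - x) ^ i * 1 ^ (k - Suc i)" by simp
      qed
      finally have "p k * (real k - real k * min 1 (real k * x)) \<le> p k * (\<Sum>i<k. (1 - x) ^ i * 1 ^ (k - Suc i))"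
        using p_nonneg by (rule mult_left_mono)
      then show "real k * p k - real k * p k * min 1 (real k * x) \<le> p k * (\<Sum>i<k. (1 - x) ^ i * 1 ^ (k - Suc i))"
        by (simp add: algebra_simps)
    qed (use assms in auto)
    finally show ?thesis by (simp add: spgf_def)
  qed
  then have "x * (m - defect x) \<le> x * spgf (1 - x) 1" using assms by (intro mult_left_mono) auto
  then show ?thesis using pgf_diff_eq[of "1 - x" 1] assms by simp
qed

text \<open>The origin of the logarithm: about log k / log m indices i have m^i \<le> k and
  contribute at most 1 each; the remaining terms are dominated by a geometric series.\<close>

lemma sum_min_le_log:
  assumes "k \<ge> 1"
  shows "(\<Sum>i<n. min 1 (real k * (1 / m) ^ i)) \<le> ln (real k) / ln m + (1 + m / (m - 1))"
proof -
  define L where "L = ln (real k) / ln m"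
  define j where "j = nat \<lceil>L\<rceil>"
  have L: "0 \<le> L" using assms m_gt1 by (auto simp: L_def)
  have j: "L \<le> real j" "real j \<le> L + 1" using L unfolding j_def by linarith+
  have kj: "real k \<le> m ^ j"
  proof -
    have "ln (real k) = L * ln m" using m_gt1 by (simp add: L_def)
    also have "\<dots> \<le> real j * ln m" using j m_gt1 by (intro mult_right_mono) auto
    also have "\<dots> = ln (m ^ j)" using m_gt1 by (simp add: ln_realpow)
    finally show ?thesis using assms m_gt1 by (subst (asm) ln_le_cancel_iff) auto
  qed
  have "(\<Sum>i<n. min 1 (real k * (1 / m) ^ i)) \<le> (\<Sum>i<j + n. min 1 (real k * (1 / m) ^ i))"
    using m_gt1 by (intro sum_mono2) auto
  also have "\<dots> = (\<Sum>i<j. min 1 (real k * (1 / m) ^ i)) + (\<Sum>i<n. min 1 (real k * (1 / m) ^ (i + j)))"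
    by (induction n) (simp_all add: add.commute)
  also have "(\<Sum>i<j. min 1 (real k * (1 / m) ^ i)) \<le> (\<Sum>i<j. 1)" by (intro sum_mono) auto
  also have "(\<Sum>i<n. min 1 (real k * (1 / m) ^ (i + j))) \<le> (\<Sum>i<n. (1 / m) ^ i)"
  proof (rule sum_mono)
    fix i
    have "real k * (1 / m) ^ (i + j) \<le> m ^ j * (1 / m) ^ (i + j)" using kj m_gt1 by (intro mult_right_mono) auto
    also have "\<dots> = (1 / m) ^ i" using m_gt1 by (simp add: power_add power_divide)
    finally show "min 1 (real k * (1 / m) ^ (i + j)) \<le> (1 / m) ^ i" by simp
  qed
  also have "(\<Sum>i<n. (1 / m) ^ i) \<le> (\<Sum>i. (1 / m) ^ i)"
    using m_gt1 by (intro sum_le_suminf summable_geometric) auto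
  also have "(\<Sum>i. (1 / m) ^ i) = m / (m - 1)"
    using m_gt1 by (subst suminf_geometric) (auto simp: field_simps)
  finally show ?thesis using j(2) by (simp add: L_def)
qed

lemma defect_summable_powers:
  assumes ZlogZ: "summable (\<lambda>k. real k * ln (real k) * p k)"
  shows "summable (\<lambda>i. defect ((1 / m) ^ i))"
proof (rule bounded_imp_summable)
  define c where "c = 1 + m / (m - 1)"
  have sm: "summable (\<lambda>k. real k * ln (real k) * p k / ln m + c * (real k * p k))"
    by (intro summable_add summable_divide ZlogZ summable_mult m_summ)
  fix n
  have "(\<Sum>i\<le>n. defect ((1 / m) ^ i)) = (\<Sum>k. \<Sum>i\<le>n. real k * p k * min 1 (real k * (1 / m) ^ i))"
    unfolding defect_def using m_gt1 by (intro suminf_sum[symmetric] defect_summable) auto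
  also have "\<dots> \<le> (\<Sum>k. real k * ln (real k) * p k / ln m + c * (real k * p k))"
  proof (intro suminf_le sm summable_sum defect_summable)
    fix k
    show "(\<Sum>i\<le>n. real k * p k * min 1 (real k * (1 / m) ^ i)) \<le> real k * ln (real k) * p k / ln m + c * (real k * p k)"
    proof (cases "k = 0")
      case False
      have "(\<Sum>i\<le>n. real k * p k * min 1 (real k * (1 / m) ^ i)) = real k * p k * (\<Sum>i<Suc n. min 1 (real k * (1 / m) ^ i))"
        by (simp only: sum_distrib_left lessThan_Suc_atMost)
      also have "\<dots> \<le> real k * p k * (ln (real k) / ln m + c)"
        unfolding c_def using False p_nonneg by (intro mult_left_mono sum_min_le_log) auto
      finally show ?thesis by (simp add: algebra_simps)
    qed simp
  qed (use m_gt1 in auto)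
  finally show "(\<Sum>i\<le>n. defect ((1 / m) ^ i)) \<le> (\<Sum>k. real k * ln (real k) * p k / ln m + c * (real k * p k))" .
next
  show "0 \<le> defect ((1 / m) ^ n)" for n using m_gt1 by (intro defect_nonneg) auto
qed

text \<open>Analytic form of the Kesten-Stigum theorem. The quantities 1 - f_j(1 - x / m^n) grow by
  at least m (1 - d_j / m) per step, where d_j is a defect; the d_j / m sum to at most 1/2, so the
  product of the correction factors stays above 1/2.\<close>

lemma kesten_stigum_pgf:
  assumes ZlogZ: "summable (\<lambda>k. real k * ln (real k) * p k)"
  obtains x where "0 < x" "x \<le> 1" "\<And>n. (pgf ^^ n) (1 - x / m ^ n) \<le> 1 - x / 2"
proof -
  have "eventually (\<lambda>k. norm (\<Sum>i. defect ((1 / m) ^ (i + k))) < 1/2 * m) sequentially"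
    using suminf_exist_split[OF _ defect_summable_powers[OF ZlogZ], of "1/2 * m"] m_gt1
    unfolding eventually_sequentially by auto
  then obtain k where k: "(\<Sum>i. defect ((1 / m) ^ (i + k))) < 1/2 * m"
    by (metis (no_types, lifting) eventually_happens' abs_ge_self le_less_trans real_norm_def sequentially_bot)
  \<comment> \<open>Starting this far down the scale leaves only a tail of the summable
    defects.\<close>
  define x where "x = (1 / m) ^ k"
  have x: "0 < x" "x \<le> 1" using m_gt1 by (auto simp: x_def intro!: power_le_one)
  have sum_le: "(\<Sum>i<n. defect (x * (1 / m) ^ Suc i) / m) \<le> 1 / 2" for n
  proof -
    have "(\<Sum>i<n. defect (x * (1 / m) ^ Suc i)) \<le> (\<Sum>i<n. defect ((1 / m) ^ (i + k)))"
    proof (rule sum_mono)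
      fix i
      have "(1 / m) ^ k * (1 / m) ^ Suc i \<le> (1 / m) ^ k * (1 / m) ^ i"
        using m_gt1 by (intro mult_left_mono power_decreasing) auto
      then show "defect (x * (1 / m) ^ Suc i) \<le> defect ((1 / m) ^ (i + k))"
        using m_gt1 by (intro defect_mono) (auto simp: x_def power_add mult_ac)
    qed
    also have "\<dots> \<le> (\<Sum>i. defect ((1 / m) ^ (i + k)))"
      using summable_ignore_initial_segment[OF defect_summable_powers[OF ZlogZ], of k] m_gt1
      by (intro sum_le_suminf) (auto intro!: defect_nonneg)
    also note k
    finally show ?thesis using m_gt1 by (simp add: divide_le_eq flip: sum_divide_distrib)
  qed
  have "(pgf ^^ n) (1 - x / m ^ n) \<le> 1 - x / 2" for n
  proof -
    define y where "y j = 1 - (pgf ^^ j) (1 - x / m ^ n)" for j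
    have xn: "0 \<le> x / m ^ n" "x / m ^ n \<le> 1"
      using x m_gt1 by (auto simp: divide_le_eq intro!: order_trans[OF _ one_le_power])
    have y0: "0 \<le> y j" "y j \<le> 1" for j
      unfolding y_def using funpow_pgf_of_real(1,2)[of "1 - x / m ^ n" j] xn by auto
    \<comment> \<open>This upper bound on \<open>y j\<close> locates the argument of the monotone
      \<open>defect\<close> at generation j.\<close>
    have yle: "y j \<le> m ^ j * (x / m ^ n)" for j
    proof -
      have one: "(pgf ^^ j) 1 = (1::real)" by (induction j) auto
      show ?thesis using funpow_pgf_lipschitz_1[of "1::real" "1 - x / m ^ n" j] xn y0[of j] x m_gt1
        unfolding one y_def by simp
    qed
    have step: "y (Suc j) \<ge> m * y j * (1 - defect (x * (1 / m) ^ (n - j)) / m)" if "j \<le> n" for j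
    proof -
      have "y j \<le> x * (1 / m) ^ (n - j)"
        using yle[of j] that m_gt1 by (simp add: power_diff power_divide field_simps)
      then have d: "defect (y j) \<le> defect (x * (1 / m) ^ (n - j))" using y0 by (intro defect_mono) auto
      have "m * y j * (1 - defect (x * (1 / m) ^ (n - j)) / m) = y j * (m - defect (x * (1 / m) ^ (n - j)))"
        using m_gt1 by (simp add: field_simps)
      also have "\<dots> \<le> y j * (m - defect (y j))" using d y0 by (intro mult_left_mono) auto
      also have "\<dots> \<le> 1 - pgf (1 - y j)" by (rule one_minus_pgf_ge) (use y0 in auto)
      also have "\<dots> = y (Suc j)" by (simp add: y_def)
      finally show ?thesis .
    qed
    have df: "0 \<le> defect (x * (1 / m) ^ i) / m" "defect (x * (1 / m) ^ i) / m \<le> 1" for i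
      using x m_gt1 by (auto simp: divide_le_eq_1 intro!: defect_nonneg defect_le divide_nonneg_pos)
    have "y j \<ge> m ^ j * (x / m ^ n) * (\<Prod>i<j. 1 - defect (x * (1 / m) ^ (n - i)) / m)" if "j \<le> n" for j
      using that
    proof (induction j)
      case (Suc j)
      have "m ^ Suc j * (x / m ^ n) * (\<Prod>i<Suc j. 1 - defect (x * (1 / m) ^ (n - i)) / m) =
        m * (m ^ j * (x / m ^ n) * (\<Prod>i<j. 1 - defect (x * (1 / m) ^ (n - i)) / m)) * (1 - defect (x * (1 / m) ^ (n - j)) / m)"
        by simp
      also have "\<dots> \<le> m * y j * (1 - defect (x * (1 / m) ^ (n - j)) / m)"
        using Suc df m_gt1 by (intro mult_right_mono mult_left_mono) auto
      also have "\<dots> \<le> y (Suc j)" using step[of j] Suc by simp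
      finally show ?case .
    qed (simp add: y_def)
    from this[of n] have "y n \<ge> x * (\<Prod>i<n. 1 - defect (x * (1 / m) ^ (n - i)) / m)"
      using m_gt1 by simp
    also have "(\<Prod>i<n. 1 - defect (x * (1 / m) ^ (n - i)) / m) = (\<Prod>i<n. 1 - defect (x * (1 / m) ^ Suc i) / m)"
      by (subst prod.nat_diff_reindex[symmetric]) (intro prod.cong refl, auto)
    finally have 1: "x * (\<Prod>i<n. 1 - defect (x * (1 / m) ^ Suc i) / m) \<le> y n" .
    have "1 - (\<Sum>i<n. defect (x * (1 / m) ^ Suc i) / m) \<le> (\<Prod>i<n. 1 - defect (x * (1 / m) ^ Suc i) / m)"
      using df by (intro one_minus_sum_le_prod) (simp_all del: power_Suc)
    with sum_le[of n] have "1 / 2 \<le> (\<Prod>i<n. 1 - defect (x * (1 / m) ^ Suc i) / m)" by linarith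
    then have "x * (1 / 2) \<le> x * (\<Prod>i<n. 1 - defect (x * (1 / m) ^ Suc i) / m)"
      using x by (intro mult_left_mono) auto
    with 1 show ?thesis by (simp add: y_def)
  qed
  with x that show ?thesis by blast
qed

end

section \<open>Contraction of the iterates near the extinction probability\<close>

locale schroeder_law = offspring_law +
  fixes q \<gamma> :: real
  assumes q_nonneg: "0 \<le> q" and q_lt_1: "q < 1" and pgf_q: "pgf q = q"
    and \<gamma>_eq: "\<gamma> = dpgf q" and \<gamma>_pos: "\<gamma> > 0"
begin

text \<open>The tangent slope at q lies strictly below the slope of the chord from q to 1, which is
  1. The strictness is taken from the term i = 0, which also works when q = 0.\<close>

lemma \<gamma>_lt_1: "\<gamma> < 1"
proof -
  obtain k where k: "k \<ge> 2" "p k > 0" using ex_two_children by blast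
  let ?h = "\<lambda>t k. p k * (\<Sum>i<k. q ^ i * t ^ (k - Suc i))"
  have le: "?h q j \<le> ?h 1 j" for j
    using q_lt_1 q_nonneg p_nonneg by (intro mult_left_mono sum_mono power_mono) auto
  have "(\<Sum>i<k. q ^ i * q ^ (k - Suc i)) < (\<Sum>i<k. q ^ i * 1 ^ (k - Suc i))"
  proof (rule sum_strict_mono_ex1)
    show "\<forall>i\<in>{..<k}. q ^ i * q ^ (k - Suc i) \<le> q ^ i * 1 ^ (k - Suc i)"
      using q_lt_1 q_nonneg by (auto intro!: mult_right_le_one_le power_le_one)
    have "q ^ (k - Suc 0) < 1" using k q_lt_1 q_nonneg by (intro power_Suc_less_one power_less_one_iff[THEN iffD2]) auto
    then show "\<exists>i\<in>{..<k}. q ^ i * q ^ (k - Suc i) < q ^ i * 1 ^ (k - Suc i)"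
      using k by (intro bexI[of _ 0]) auto
  qed simp
  then have "?h q k < ?h 1 k" using k by simp
  then have "0 < (\<Sum>j. ?h 1 j - ?h q j)"
    using le q_lt_1 q_nonneg by (intro suminf_pos2[of _ k] summable_diff spgf_summable) auto
  also have "\<dots> = spgf q 1 - spgf q q"
    unfolding spgf_def using q_lt_1 q_nonneg by (intro suminf_diff[symmetric] spgf_summable) auto
  finally show ?thesis using spgf_fixed_point[of q] q_lt_1 q_nonneg pgf_q \<gamma>_eq by (simp add: spgf_diag)
qed

lemma funpow_pgf_q [simp]: "(pgf ^^ n) q = q"
  by (induction n) (auto simp: pgf_q)

text \<open>The derivative f' is itself convex, so on [q, s] it lies below its chord;
  \<open>B\<close> is the slope of that chord.\<close>

lemma dpgf_bound:
  assumes "q < s" "s < 1"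
  obtains B where "B \<ge> 0" "\<And>x. q \<le> x \<Longrightarrow> x \<le> s \<Longrightarrow> dpgf x \<le> \<gamma> + B * (x - q)"
proof -
  define B where "B = (dpgf s - \<gamma>) / (s - q)"
  have pw: "(s - q) * (x ^ k - q ^ k) \<le> (x - q) * (s ^ k - q ^ k)" if "q \<le> x" "x \<le> s" for x k
  proof (cases k)
    case (Suc n)
    have "(\<Sum>i<Suc n. x ^ i * q ^ (n - i)) \<le> (\<Sum>i<Suc n. s ^ i * q ^ (n - i))"
      using that q_nonneg by (intro sum_mono mult_right_mono power_mono) auto
    then have "(s - q) * (x - q) * (\<Sum>i<Suc n. x ^ i * q ^ (n - i)) \<le> (s - q) * (x - q) * (\<Sum>i<Suc n. s ^ i * q ^ (n - i))"
      using that assms by (intro mult_left_mono mult_nonneg_nonneg) auto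
    then show ?thesis unfolding Suc power_diff_sumr2 by (simp add: mult_ac del: sum.lessThan_Suc)
  qed simp
  have main: "(s - q) * (dpgf x - \<gamma>) \<le> (x - q) * (dpgf s - \<gamma>)" if "q \<le> x" "x \<le> s" for x
  proof -
    have sm: "summable (\<lambda>k. real k * p k * y ^ (k - 1))" if "q \<le> y" "y \<le> s" for y
      using that assms q_nonneg by (intro dpgf_summable) auto
    have eq: "dpgf y - \<gamma> = (\<Sum>k. real k * p k * (y ^ (k - 1) - q ^ (k - 1)))"
      and sm': "summable (\<lambda>k. real k * p k * (y ^ (k - 1) - q ^ (k - 1)))" if "q \<le> y" "y \<le> s" for y
      unfolding \<gamma>_eq dpgf_def using suminf_diff[OF sm[OF that] sm[of q]] summable_diff[OF sm[OF that] sm[of q]] assms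
      by (simp_all add: right_diff_distrib)
    have "(s - q) * (dpgf x - \<gamma>) = (\<Sum>k. (s - q) * (real k * p k * (x ^ (k - 1) - q ^ (k - 1))))"
      unfolding eq[OF that] by (rule suminf_mult[symmetric, OF sm'[OF that]])
    also have "\<dots> \<le> (\<Sum>k. (x - q) * (real k * p k * (s ^ (k - 1) - q ^ (k - 1))))"
    proof (rule suminf_le)
      fix k
      have "real k * p k * ((s - q) * (x ^ (k - 1) - q ^ (k - 1))) \<le> real k * p k * ((x - q) * (s ^ (k - 1) - q ^ (k - 1)))"
        using pw[OF that] p_nonneg by (intro mult_left_mono) auto
      then show "(s - q) * (real k * p k * (x ^ (k - 1) - q ^ (k - 1))) \<le> (x - q) * (real k * p k * (s ^ (k - 1) - q ^ (k - 1)))"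
        by (simp only: mult_ac)
    qed (use sm'[OF that] sm'[of s] assms in \<open>auto intro!: summable_mult\<close>)
    also have "\<dots> = (x - q) * (dpgf s - \<gamma>)"
      using eq[of s] sm'[of s] assms by (simp add: suminf_mult)
    finally show ?thesis .
  qed
  have "\<gamma> \<le> dpgf s" unfolding \<gamma>_eq dpgf_def using assms q_nonneg p_nonneg
    by (intro suminf_le dpgf_summable mult_left_mono power_mono) auto
  then have "B \<ge> 0" using assms by (auto simp: B_def)
  moreover have "dpgf x \<le> \<gamma> + B * (x - q)" if "q \<le> x" "x \<le> s" for x
    using main[OF that] assms by (simp add: B_def field_simps)
  ultimately show ?thesis using that by blast
qed

lemma funpow_pgf_ge_q: "q \<le> s \<Longrightarrow> s \<le> 1 \<Longrightarrow> q \<le> (pgf ^^ n) s"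
  using funpow_pgf_mono[of q s n] q_nonneg by simp

text \<open>By monotonicity of chord slopes f shrinks the distance to q at least by the chord slope
  \<theta> between q and s. This \<theta> is below 1 because f(s) < s for q < s < 1.\<close>

lemma funpow_pgf_geometric:
  assumes "q < s" "s < 1"
  obtains \<theta> where "0 \<le> \<theta>" "\<theta> < 1" "\<And>n. (pgf ^^ n) s - q \<le> \<theta> ^ n * (s - q)"
proof -
  define \<theta> where "\<theta> = spgf s q"
  have "\<theta> < 1"
  proof -
    have "1 = spgf q 1" using spgf_fixed_point q_lt_1 q_nonneg pgf_q by simp
    also have "\<dots> < spgf s 1" using assms q_nonneg by (intro spgf_strict_mono) auto
    finally have "(1 - s) * 1 < (1 - s) * spgf s 1" using assms by (intro mult_strict_left_mono) auto
    also have "\<dots> = 1 - pgf s" using pgf_diff_eq[of s 1] assms q_nonneg by (simp add: algebra_simps)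
    finally have "pgf s - q < s - q" by simp
    moreover have "pgf s - q = (s - q) * \<theta>"
      using pgf_diff_eq[of s q] assms q_nonneg pgf_q by (simp add: \<theta>_def)
    ultimately show ?thesis using assms by simp
  qed
  moreover have "0 \<le> \<theta>" unfolding \<theta>_def spgf_def using assms q_nonneg
    by (intro suminf_nonneg spgf_summable) (auto intro!: mult_nonneg_nonneg sum_nonneg simp: p_nonneg)
  moreover have "(pgf ^^ n) s - q \<le> \<theta> ^ n * (s - q)" for n
  proof (induction n)
    case (Suc n)
    define x where "x = (pgf ^^ n) s"
    have x: "q \<le> x" "x \<le> s"
    proof -
      show "q \<le> x" unfolding x_def using assms by (intro funpow_pgf_ge_q) auto
      have "\<theta> ^ n * (s - q) \<le> 1 * (s - q)"
        using \<open>0 \<le> \<theta>\<close> \<open>\<theta> < 1\<close> assms by (intro mult_right_mono power_le_one) auto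
      then show "x \<le> s" using Suc by (simp add: x_def)
    qed
    have "pgf x - q = (x - q) * spgf x q"
      using pgf_diff_eq[of x q] x assms q_nonneg pgf_q by simp
    also have "\<dots> \<le> (x - q) * \<theta>"
      unfolding \<theta>_def using x assms q_nonneg by (intro mult_left_mono spgf_mono) auto
    also have "\<dots> \<le> (\<theta> ^ n * (s - q)) * \<theta>" using Suc \<open>0 \<le> \<theta>\<close> by (intro mult_right_mono) (auto simp: x_def)
    finally show ?case by (simp add: x_def mult_ac)
  qed (use assms in simp)
  ultimately show ?thesis using that by blast
qed

lemma funpow_pgf_lipschitz_prod:
  fixes a b :: "'b::{real_normed_field,banach}"
  assumes "norm a \<le> s" "norm b \<le> s" "s \<le> 1"
  shows "norm ((pgf ^^ n) a - (pgf ^^ n) b) \<le> (\<Prod>i<n. dpgf ((pgf ^^ i) s)) * norm (a - b)"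
proof (induction n)
  case (Suc n)
  have s: "0 \<le> s" using assms(1) norm_ge_zero order_trans by blast
  have "norm ((pgf ^^ Suc n) a - (pgf ^^ Suc n) b) \<le> dpgf ((pgf ^^ n) s) * norm ((pgf ^^ n) a - (pgf ^^ n) b)"
    using pgf_lipschitz[OF norm_funpow_pgf_le[OF assms(1,3), of n] norm_funpow_pgf_le[OF assms(2,3), of n]]
      assms funpow_pgf_of_real(2)[of s] s by simp
  also have "\<dots> \<le> dpgf ((pgf ^^ n) s) * ((\<Prod>i<n. dpgf ((pgf ^^ i) s)) * norm (a - b))"
    using Suc s assms by (intro mult_left_mono dpgf_nonneg funpow_pgf_of_real) auto
  finally show ?case by (simp add: mult_ac)
qed simp

text \<open>The chain rule bounds the Lipschitz constant of f_n by the product of the f'(f_i(s)).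
  Each factor is at most \<gamma> (1 + K \<theta>^i), and the product of the brackets stays below
  exp(K / (1 - \<theta>)).\<close>

lemma funpow_pgf_lipschitz:
  assumes "s < 1"
  obtains C where "C > 0" "\<And>n (a::'b::{real_normed_field,banach}) b. norm a \<le> s \<Longrightarrow> norm b \<le> s \<Longrightarrow>
    norm ((pgf ^^ n) a - (pgf ^^ n) b) \<le> C * \<gamma> ^ n * norm (a - b)"
proof -
  \<comment> \<open>The radius is enlarged so that it exceeds q, as the convexity bound and the
    geometric rate both start from a point above q.\<close>
  define s' where "s' = max s ((1 + q) / 2)"
  have s': "s \<le> s'" "q < s'" "s' < 1" using assms q_lt_1 by (auto simp: s'_def less_max_iff_disj)
  obtain B where B: "B \<ge> 0" "\<And>x. q \<le> x \<Longrightarrow> x \<le> s' \<Longrightarrow> dpgf x \<le> \<gamma> + B * (x - q)"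
    using dpgf_bound[OF s'(2,3)] by blast
  obtain \<theta> where \<theta>: "0 \<le> \<theta>" "\<theta> < 1" "\<And>n. (pgf ^^ n) s' - q \<le> \<theta> ^ n * (s' - q)"
    using funpow_pgf_geometric[OF s'(2,3)] by blast
  define K where "K = B * (s' - q) / \<gamma>"
  have K: "0 \<le> K" using B s' \<gamma>_pos by (auto simp: K_def)
  define C where "C = exp (K / (1 - \<theta>))"
  have prod: "(\<Prod>i<n. dpgf ((pgf ^^ i) s')) \<le> C * \<gamma> ^ n" for n
  proof -
    have "dpgf ((pgf ^^ i) s') \<le> \<gamma> * exp (K * \<theta> ^ i)" for i
    proof -
      have "\<theta> ^ i * (s' - q) \<le> 1 * (s' - q)"
        using \<theta> s' by (intro mult_right_mono power_le_one) auto
      then have "(pgf ^^ i) s' \<le> s'" using \<theta>(3)[of i] by simp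
      then have "dpgf ((pgf ^^ i) s') \<le> \<gamma> + B * ((pgf ^^ i) s' - q)"
        using B s' by (intro B funpow_pgf_ge_q) auto
      also have "\<dots> \<le> \<gamma> + B * (\<theta> ^ i * (s' - q))" using B \<theta> by (intro add_left_mono mult_left_mono) auto
      also have "\<dots> = \<gamma> * (1 + K * \<theta> ^ i)" using \<gamma>_pos by (simp add: K_def field_simps)
      also have "\<dots> \<le> \<gamma> * exp (K * \<theta> ^ i)" using \<gamma>_pos by (intro mult_left_mono) auto
      finally show ?thesis .
    qed
    then have "(\<Prod>i<n. dpgf ((pgf ^^ i) s')) \<le> (\<Prod>i<n. \<gamma> * exp (K * \<theta> ^ i))"
      using s' q_nonneg by (intro prod_mono conjI dpgf_nonneg funpow_pgf_of_real) auto
    also have "\<dots> = \<gamma> ^ n * exp (\<Sum>i<n. K * \<theta> ^ i)" by (simp add: prod.distrib exp_sum)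
    also have "\<dots> \<le> \<gamma> ^ n * C"
    proof -
      have "(\<Sum>i<n. K * \<theta> ^ i) \<le> (\<Sum>i. K * \<theta> ^ i)"
        using K \<theta> by (intro sum_le_suminf summable_mult summable_geometric) auto
      also have "\<dots> = K / (1 - \<theta>)" using \<theta> by (simp add: suminf_mult suminf_geometric summable_geometric)
      finally show ?thesis using \<gamma>_pos by (auto simp: C_def)
    qed
    finally show ?thesis by (simp add: mult_ac)
  qed
  show ?thesis
  proof (rule that[of C])
    fix n and a b :: 'b assume "norm a \<le> s" "norm b \<le> s"
    then have "norm ((pgf ^^ n) a - (pgf ^^ n) b) \<le> (\<Prod>i<n. dpgf ((pgf ^^ i) s')) * norm (a - b)"
      using s' by (intro funpow_pgf_lipschitz_prod) auto
    also have "\<dots> \<le> (C * \<gamma> ^ n) * norm (a - b)" by (intro mult_right_mono prod) auto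
    finally show "norm ((pgf ^^ n) a - (pgf ^^ n) b) \<le> C * \<gamma> ^ n * norm (a - b)" .
  qed (simp add: C_def)
qed

end

section \<open>Expectations split along the values of an integer-valued variable\<close>

lemma (in prob_space) sums_expectation_nat:
  fixes Y :: "'a \<Rightarrow> 'b::{banach, second_countable_topology}"
  assumes N[measurable]: "N \<in> measurable M (count_space (UNIV::nat set))" and Y: "integrable M Y"
  shows "(\<lambda>k. expectation (\<lambda>x. if N x = k then Y x else 0)) sums expectation Y"
proof -
  have [measurable]: "Y \<in> borel_measurable M" using Y by auto
  have int: "integrable M (\<lambda>x. if N x = k then Y x else 0)" for k
    by (rule Bochner_Integration.integrable_bound[OF Y]) auto
  have "(\<lambda>n. expectation (\<lambda>x. if N x < n then Y x else 0)) \<longlonglongrightarrow> expectation Y"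
  proof (rule integral_dominated_convergence[where w="\<lambda>x. norm (Y x)"])
    show "AE x in M. (\<lambda>n. if N x < n then Y x else 0) \<longlonglongrightarrow> Y x"
    proof (rule AE_I2)
      fix x
      have "eventually (\<lambda>n. (if N x < n then Y x else 0) = Y x) sequentially"
        using eventually_gt_at_top[of "N x"] by eventually_elim auto
      then show "(\<lambda>n. if N x < n then Y x else 0) \<longlonglongrightarrow> Y x" by (rule tendsto_eventually)
    qed
  qed (use Y in auto)
  moreover have "expectation (\<lambda>x. if N x < n then Y x else 0) = (\<Sum>k<n. expectation (\<lambda>x. if N x = k then Y x else 0))" for n
  proof -
    have "(\<Sum>k<n. if N x = k then Y x else 0) = (if N x < n then Y x else 0)" for x
      by (subst sum.delta') auto
    then show ?thesis using int by (subst Bochner_Integration.integral_sum[symmetric]) auto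
  qed
  ultimately show ?thesis by (simp add: sums_def)
qed

lemma (in prob_space) expectation_nat_sums:
  fixes h :: "nat \<Rightarrow> 'b::{banach, second_countable_topology}"
  assumes N[measurable]: "N \<in> measurable M (count_space (UNIV::nat set))" and h: "\<And>k. norm (h k) \<le> B"
  shows "(\<lambda>k. prob {x \<in> space M. N x = k} *\<^sub>R h k) sums expectation (\<lambda>x. h (N x))"
proof -
  have "integrable M (\<lambda>x. h (N x))"
    by (rule integrable_const_bound[where B=B]) (auto simp: h)
  from sums_expectation_nat[OF N this]
  have "(\<lambda>k. expectation (\<lambda>x. if N x = k then h (N x) else 0)) sums expectation (\<lambda>x. h (N x))" .
  moreover have "expectation (\<lambda>x. if N x = k then h (N x) else 0) = prob {x \<in> space M. N x = k} *\<^sub>R h k" for k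
  proof -
    have "expectation (\<lambda>x. if N x = k then h (N x) else 0) = expectation (\<lambda>x. indicator {x \<in> space M. N x = k} x *\<^sub>R h k)"
      by (intro Bochner_Integration.integral_cong) auto
    also have "\<dots> = prob {x \<in> space M. N x = k} *\<^sub>R h k"
      by (subst has_bochner_integral_integral_eq[OF has_bochner_integral_indicator]) (auto simp: emeasure_eq_measure)
    finally show ?thesis .
  qed
  ultimately show ?thesis by simp
qed

lemma exp_minus_diff_le:
  fixes a b :: complex
  assumes "0 \<le> Re a" "0 \<le> Re b"
  shows "norm (exp (- a) - exp (- b)) \<le> norm (a - b)"
proof -
  have "norm (exp (- a) - exp (- b)) \<le> 1 * norm (a - b)"
  proof (rule field_differentiable_bound[where S="{z. 0 \<le> Re z}" and f'="\<lambda>z. - exp (- z)"])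
    show "((\<lambda>a. exp (- a)) has_field_derivative - exp (- z)) (at z within {z. 0 \<le> Re z})" for z :: complex
      by (auto intro!: derivative_eq_intros)
  qed (use assms in \<open>auto simp: convex_halfspace_Re_ge\<close>)
  then show ?thesis by simp
qed

section \<open>Galton-Watson processes and the martingale limit\<close>

locale galton_watson = prob_space M + offspring_law p m
  for M :: "'a measure" and p :: "nat \<Rightarrow> real" and m :: real +
  fixes \<xi> :: "nat \<Rightarrow> nat \<Rightarrow> 'a \<Rightarrow> nat" and X :: "nat \<Rightarrow> 'a \<Rightarrow> real"
  assumes indep: "indep_vars (\<lambda>_. borel) (joint_family \<xi> X) joint_index"
    and xi_law: "\<And>n i k. measure M {x \<in> space M. \<xi> n i x = k} = p k"
begin

lemma joint_measurable: "j \<in> joint_index \<Longrightarrow> joint_family \<xi> X j \<in> borel_measurable M"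
  using indep unfolding indep_vars_def by auto

lemma xi_measurable [measurable]: "\<xi> n i \<in> measurable M (count_space UNIV)"
proof -
  have [measurable]: "(\<lambda>x. real (\<xi> n i x)) \<in> borel_measurable M"
    using joint_measurable[of "Inl (n, i)"] by (simp add: joint_family_def[abs_def] joint_index_def)
  have "(\<lambda>x. nat \<lfloor>real (\<xi> n i x)\<rfloor>) \<in> measurable M (count_space UNIV)" by measurable
  then show ?thesis by simp
qed

lemma X_measurable [measurable]: "k \<ge> 1 \<Longrightarrow> X k \<in> borel_measurable M"
  using joint_measurable[of "Inr k"] by (simp add: joint_family_def[abs_def] joint_index_def)

lemma GW_measurable [measurable]: "GW \<xi> n \<in> measurable M (count_space UNIV)"
proof (induction n)
  case (Suc n)
  note [measurable] = Suc
  have eq: "GW \<xi> (Suc n) = (\<lambda>x. (\<lambda>k x. \<Sum>i<k. \<xi> n i x) (GW \<xi> n x) x)" by (simp add: fun_eq_iff)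
  show ?case unfolding eq
    by (rule measurable_compose_countable) measurable
qed (simp add: measurable_const cong: measurable_cong)

text \<open>Reads an offspring number back from a coordinate, so that \<open>GW decode\<close> is
  the process as a function on the product space and depends visibly on the coordinates before
  generation n only.\<close>

definition decode :: "nat \<Rightarrow> nat \<Rightarrow> ((nat \<times> nat) + nat \<Rightarrow> real) \<Rightarrow> nat" where
  "decode n i \<omega> = nat \<lfloor>\<omega> (Inl (n, i))\<rfloor>"

definition earlier :: "nat \<Rightarrow> ((nat \<times> nat) + nat) set" where
  "earlier n = {Inl (l, i) | l i. l < n}"

definition later :: "nat \<Rightarrow> ((nat \<times> nat) + nat) set" where
  "later n = joint_index - earlier n"

lemma GW_decode_measurable:
  "k \<le> n \<Longrightarrow> GW decode k \<in> measurable (PiM (earlier n) (\<lambda>_. borel)) (count_space UNIV)"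
proof (induction k)
  case (Suc k)
  then have [measurable]: "GW decode k \<in> measurable (PiM (earlier n) (\<lambda>_. borel)) (count_space UNIV)" by simp
  have [measurable]: "decode k i \<in> measurable (PiM (earlier n) (\<lambda>_. borel)) (count_space UNIV)" for i
    unfolding decode_def[abs_def]
  proof -
    have "Inl (k, i) \<in> earlier n" using Suc by (auto simp: earlier_def)
    then have "(\<lambda>\<omega>. \<omega> (Inl (k, i))) \<in> borel_measurable (PiM (earlier n) (\<lambda>_. borel :: real measure))"
      by (rule measurable_component_singleton)
    moreover have "(\<lambda>r::real. nat \<lfloor>r\<rfloor>) \<in> measurable borel (count_space UNIV)" by measurable
    ultimately show "(\<lambda>\<omega>. nat \<lfloor>\<omega> (Inl (k, i))\<rfloor>) \<in> measurable (PiM (earlier n) (\<lambda>_. borel :: real measure)) (count_space UNIV)"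
      by (rule measurable_compose)
  qed
  have eq: "GW decode (Suc k) = (\<lambda>x. (\<lambda>l x. \<Sum>i<l. decode k i x) (GW decode k x) x)" by (simp add: fun_eq_iff)
  show ?case unfolding eq
    by (rule measurable_compose_countable) measurable
qed (simp add: measurable_const cong: measurable_cong)

lemma GW_decode: "k \<le> n \<Longrightarrow> GW decode k (restrict (\<lambda>j. joint_family \<xi> X j x) (earlier n)) = GW \<xi> k x"
proof (induction k)
  case (Suc k)
  have "decode k i (restrict (\<lambda>j. joint_family \<xi> X j x) (earlier n)) = \<xi> k i x" for i
    using Suc.prems by (auto simp: decode_def earlier_def joint_family_def)
  then show ?case using Suc by (simp del: restrict_apply restrict_apply' split del: if_split)
qed simp

text \<open>Z_n is a function of the \<open>earlier\<close> coordinates, and blocks of an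
  independent family are independent. The remaining block contains both the offspring numbers of
  generation n and the whole walk, so this one fact serves the branching step and the conditioning
  of the walk.\<close>

lemma indep_GW:
  assumes g: "g \<in> measurable (count_space UNIV) N'" and y: "y \<in> measurable (PiM (later n) (\<lambda>_. borel)) N"
  shows "indep_var N' (\<lambda>x. g (GW \<xi> n x)) N (\<lambda>x. y (restrict (\<lambda>j. joint_family \<xi> X j x) (later n)))"
proof -
  have "indep_var (PiM (earlier n) (\<lambda>_. borel)) (\<lambda>x. restrict (\<lambda>j. joint_family \<xi> X j x) (earlier n))
     (PiM (later n) (\<lambda>_. borel)) (\<lambda>x. restrict (\<lambda>j. joint_family \<xi> X j x) (later n))"
    by (rule indep_var_restrict[OF indep]) (auto simp: earlier_def later_def joint_index_def)
  from indep_var_compose[OF this measurable_compose[OF GW_decode_measurable[OF order_refl] g] y]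
  show ?thesis by (simp add: comp_def GW_decode)
qed

lemma expectation_xi: "norm z \<le> 1 \<Longrightarrow> expectation (\<lambda>x. z ^ \<xi> n i x) = pgf z" for z :: complex
  using expectation_nat_sums[OF xi_measurable[of n i], of "\<lambda>k. z ^ k" 1]
  by (simp add: norm_power power_le_one xi_law pgf_def sums_iff scaleR_conv_of_real)

lemma expectation_prod_xi:
  fixes z :: complex
  assumes "norm z \<le> 1"
  shows "expectation (\<lambda>x. \<Prod>i<k. z ^ \<xi> n i x) = pgf z ^ k"
proof -
  let ?J = "(\<lambda>i. Inl (n, i)) ` {..<k} :: ((nat \<times> nat) + nat) set"
  have "indep_vars (\<lambda>_. borel) (joint_family \<xi> X) ?J"
    by (rule indep_vars_subset[OF indep]) (auto simp: joint_index_def)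
  then have iv: "indep_vars (\<lambda>_. borel) (\<lambda>j x. z ^ nat \<lfloor>joint_family \<xi> X j x\<rfloor>) ?J"
    by (rule indep_vars_compose2) measurable
  have int: "integrable M (\<lambda>x. z ^ \<xi> n i x)" for i
    by (rule integrable_const_bound[where B=1]) (auto simp: norm_power assms power_le_one)
  have "expectation (\<lambda>x. \<Prod>j\<in>?J. z ^ nat \<lfloor>joint_family \<xi> X j x\<rfloor>) = (\<Prod>j\<in>?J. expectation (\<lambda>x. z ^ nat \<lfloor>joint_family \<xi> X j x\<rfloor>))"
    by (rule indep_vars_lebesgue_integral[OF _ iv]) (auto simp: joint_family_def int)
  then show ?thesis
    by (simp add: expectation_xi[OF assms] prod.reindex inj_on_def joint_family_def)
qed

text \<open>The last generation is integrated out first: given Z_n = k the next size is a sum of k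
  independent offspring numbers. This replaces \<open>z\<close> by \<open>pgf z\<close>, hence the
  induction over arbitrary \<open>z\<close>.\<close>

lemma expectation_GW: "norm z \<le> 1 \<Longrightarrow> expectation (\<lambda>x. z ^ GW \<xi> n x) = (pgf ^^ n) z" for z :: complex
proof (induction n arbitrary: z)
  case (Suc n)
  have nz: "norm (pgf z) \<le> 1" using Suc.prems by (rule norm_pgf_le_1)
  have int: "integrable M (\<lambda>x. z ^ GW \<xi> (Suc n) x)"
    by (rule integrable_const_bound[where B=1]) (use Suc in \<open>auto simp: norm_power power_le_one simp del: GW.simps\<close>)
  have "expectation (\<lambda>x. if GW \<xi> n x = k then z ^ GW \<xi> (Suc n) x else 0) = prob {x \<in> space M. GW \<xi> n x = k} *\<^sub>R pgf z ^ k" for k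
  proof -
    have "indep_var borel (\<lambda>x. (\<lambda>l. if l = k then 1 else 0 :: complex) (GW \<xi> n x)) borel
      (\<lambda>x. (\<lambda>\<omega>. \<Prod>i<k. z ^ nat \<lfloor>\<omega> (Inl (n, i))\<rfloor>) (restrict (\<lambda>j. joint_family \<xi> X j x) (later n)))"
    proof (rule indep_GW)
      show "(\<lambda>\<omega>. \<Prod>i<k. z ^ nat \<lfloor>\<omega> (Inl (n, i))\<rfloor>) \<in> borel_measurable (PiM (later n) (\<lambda>_. borel :: real measure))"
      proof (rule borel_measurable_prod)
        fix i
        have "(\<lambda>\<omega>. \<omega> (Inl (n, i))) \<in> borel_measurable (PiM (later n) (\<lambda>_. borel :: real measure))"
          by (rule measurable_component_singleton) (auto simp: later_def joint_index_def earlier_def)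
        moreover have "(\<lambda>r::real. z ^ nat \<lfloor>r\<rfloor>) \<in> borel_measurable borel" by measurable
        ultimately show "(\<lambda>\<omega>. z ^ nat \<lfloor>\<omega> (Inl (n, i))\<rfloor>) \<in> borel_measurable (PiM (later n) (\<lambda>_. borel :: real measure))"
          by (rule measurable_compose)
      qed
    qed simp
    then have ind: "indep_var borel (\<lambda>x. if GW \<xi> n x = k then 1 else 0 :: complex) borel (\<lambda>x. \<Prod>i<k. z ^ \<xi> n i x)"
      by (simp add: later_def joint_index_def earlier_def joint_family_def)
    have i1: "integrable M (\<lambda>x. if GW \<xi> n x = k then 1 else 0 :: complex)"
      by (rule integrable_const_bound[where B=1]) auto
    have i2: "integrable M (\<lambda>x. \<Prod>i<k. z ^ \<xi> n i x)"
      using Suc.prems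
      by (intro integrable_const_bound[where B=1]) (auto simp: norm_power prod_norm[symmetric] intro!: prod_le_1 power_le_one)
    have "expectation (\<lambda>x. if GW \<xi> n x = k then z ^ GW \<xi> (Suc n) x else 0) =
       expectation (\<lambda>x. (if GW \<xi> n x = k then 1 else 0) * (\<Prod>i<k. z ^ \<xi> n i x))"
      by (intro Bochner_Integration.integral_cong) (auto simp: power_sum)
    also have "\<dots> = expectation (\<lambda>x. if GW \<xi> n x = k then 1 else 0) * pgf z ^ k"
      by (subst indep_var_lebesgue_integral[OF ind i1 i2]) (simp add: expectation_prod_xi[OF Suc.prems])
    also have "expectation (\<lambda>x. if GW \<xi> n x = k then 1 else 0 :: complex) =
       expectation (\<lambda>x. indicator {x \<in> space M. GW \<xi> n x = k} x *\<^sub>R 1)"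
      by (intro Bochner_Integration.integral_cong) auto
    finally show ?thesis by (simp add: scaleR_conv_of_real)
  qed
  with sums_expectation_nat[OF GW_measurable int, of n]
  have "(\<lambda>k. prob {x \<in> space M. GW \<xi> n x = k} *\<^sub>R pgf z ^ k) sums expectation (\<lambda>x. z ^ GW \<xi> (Suc n) x)" by simp
  moreover have "(\<lambda>k. prob {x \<in> space M. GW \<xi> n x = k} *\<^sub>R pgf z ^ k) sums expectation (\<lambda>x. pgf z ^ GW \<xi> n x)"
    using nz by (intro expectation_nat_sums[where B=1]) (auto simp: norm_power power_le_one)
  ultimately have "expectation (\<lambda>x. z ^ GW \<xi> (Suc n) x) = expectation (\<lambda>x. pgf z ^ GW \<xi> n x)"
    by (rule sums_unique2)
  also have "\<dots> = (pgf ^^ n) (pgf z)" by (rule Suc.IH[OF nz])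
  finally show ?case by (simp add: funpow_swap1)
qed (simp add: prob_space)

lemma expectation_GW_real:
  fixes s :: real
  assumes "0 \<le> s" "s \<le> 1"
  shows "expectation (\<lambda>x. s ^ GW \<xi> n x) = (pgf ^^ n) s"
proof -
  have "complex_of_real (expectation (\<lambda>x. s ^ GW \<xi> n x)) = expectation (\<lambda>x. complex_of_real s ^ GW \<xi> n x)"
    by (subst integral_complex_of_real[symmetric]) (simp add: of_real_power)
  also have "\<dots> = (pgf ^^ n) (complex_of_real s)" using assms by (intro expectation_GW) auto
  also have "\<dots> = complex_of_real ((pgf ^^ n) s)" using assms by (rule funpow_pgf_of_real)
  finally show ?thesis by (simp only: of_real_eq_iff)
qed

definition tail_prob :: "real \<Rightarrow> nat \<Rightarrow> real" where
  "tail_prob e k = prob {x \<in> space M. psum X k x / real k \<ge> e}"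

lemma psum_measurable [measurable]: "psum X k \<in> borel_measurable M"
  unfolding psum_def[abs_def] by (intro borel_measurable_sum) auto

lemma tail_prob_bounds: "0 \<le> tail_prob e k" "tail_prob e k \<le> 1"
  by (auto simp: tail_prob_def)

text \<open>The walk is independent of Z_n, so on each event Z_n = k the two factors separate;
  survival excludes the value k = 0, where the ratio is a division by zero.\<close>

lemma prob_ratio_ge:
  "prob {x \<in> space M. GW \<xi> n x > 0 \<and> psum X (GW \<xi> n x) x / real (GW \<xi> n x) \<ge> e} =
   expectation (\<lambda>x. if GW \<xi> n x > 0 then tail_prob e (GW \<xi> n x) else 0)"
proof -
  let ?A = "{x \<in> space M. GW \<xi> n x > 0 \<and> psum X (GW \<xi> n x) x / real (GW \<xi> n x) \<ge> e}"
  have [measurable]: "(\<lambda>x. psum X (GW \<xi> n x) x) \<in> borel_measurable M"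
    by (rule measurable_compose_countable) measurable
  have [measurable]: "?A \<in> sets M" by measurable
  have "expectation (\<lambda>x. if GW \<xi> n x = k then indicator ?A x else 0) =
     prob {x \<in> space M. GW \<xi> n x = k} *\<^sub>R (if k > 0 then tail_prob e k else 0)" for k
  proof (cases "k > 0")
    case True
    have sub: "Inr ` {1..k} \<subseteq> later n" by (auto simp: later_def joint_index_def earlier_def)
    have "indep_var borel (\<lambda>x. (\<lambda>l. if l = k then 1 else 0 :: real) (GW \<xi> n x)) borel
      (\<lambda>x. (\<lambda>\<omega>. indicator {y. y / real k \<ge> e} (\<Sum>i\<in>{1..k}. \<omega> (Inr i))) (restrict (\<lambda>j. joint_family \<xi> X j x) (later n)))"
    proof (rule indep_GW)
      have "(\<lambda>\<omega>. \<Sum>i\<in>{1..k}. \<omega> (Inr i)) \<in> borel_measurable (PiM (later n) (\<lambda>_. borel :: real measure))"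
        using sub by (intro borel_measurable_sum measurable_component_singleton) auto
      from measurable_compose[OF this, of "indicator {y. y / real k \<ge> e}"]
      show "(\<lambda>\<omega>. indicator {y. y / real k \<ge> e} (\<Sum>i\<in>{1..k}. \<omega> (Inr i))) \<in> borel_measurable (PiM (later n) (\<lambda>_. borel :: real measure))"
        by measurable
    qed simp
    moreover have "(\<Sum>i\<in>{1..k}. restrict (\<lambda>j. joint_family \<xi> X j x) (later n) (Inr i)) = psum X k x" for x
      unfolding psum_def using sub by (intro sum.cong) (auto simp: joint_family_def image_subset_iff)
    ultimately have ind: "indep_var borel (\<lambda>x. if GW \<xi> n x = k then 1 else 0 :: real) borel
      (\<lambda>x. indicator {y. y / real k \<ge> e} (psum X k x))" by (simp only:)
    have i1: "integrable M (\<lambda>x. if GW \<xi> n x = k then 1 else 0 :: real)"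
      by (rule integrable_const_bound[where B=1]) auto
    have i2: "integrable M (\<lambda>x. indicator {y. y / real k \<ge> e} (psum X k x) :: real)"
      by (rule integrable_const_bound[where B=1]) auto
    have "expectation (\<lambda>x. if GW \<xi> n x = k then indicator ?A x else 0) =
      expectation (\<lambda>x. (if GW \<xi> n x = k then 1 else 0 :: real) * indicator {y. y / real k \<ge> e} (psum X k x))"
      using True by (intro Bochner_Integration.integral_cong refl) (auto split: split_indicator)
    also have "\<dots> = expectation (\<lambda>x. if GW \<xi> n x = k then 1 else 0) * expectation (\<lambda>x. indicator {y. y / real k \<ge> e} (psum X k x))"
      by (rule indep_var_lebesgue_integral[OF ind i1 i2])
    also have "expectation (\<lambda>x. if GW \<xi> n x = k then 1 else 0 :: real) = expectation (indicator {x \<in> space M. GW \<xi> n x = k})"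
      by (intro Bochner_Integration.integral_cong) auto
    also have "expectation (\<lambda>x. indicator {y. y / real k \<ge> e} (psum X k x) :: real) =
        expectation (indicator {x \<in> space M. psum X k x / real k \<ge> e})"
      by (intro Bochner_Integration.integral_cong) (auto simp: indicator_def)
    also have "expectation (indicator {x \<in> space M. GW \<xi> n x = k}) * expectation (indicator {x \<in> space M. psum X k x / real k \<ge> e}) =
        prob {x \<in> space M. GW \<xi> n x = k} * tail_prob e k"
      by (simp add: tail_prob_def)
    finally show ?thesis using True by simp
  next
    case False
    then have "expectation (\<lambda>x. if GW \<xi> n x = k then indicator ?A x else 0) = expectation (\<lambda>x. 0::real)"
      by (intro Bochner_Integration.integral_cong) (auto simp: indicator_def)
    then show ?thesis using False by simp
  qed
  with sums_expectation_nat[OF GW_measurable, of "indicator ?A :: _ \<Rightarrow> real" n]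
  have "(\<lambda>k. prob {x \<in> space M. GW \<xi> n x = k} *\<^sub>R (if k > 0 then tail_prob e k else 0)) sums prob ?A"
    by (simp add: integrable_indicator_iff emeasure_eq_measure)
  moreover have "(\<lambda>k. prob {x \<in> space M. GW \<xi> n x = k} *\<^sub>R (if k > 0 then tail_prob e k else 0)) sums
      expectation (\<lambda>x. if GW \<xi> n x > 0 then tail_prob e (GW \<xi> n x) else 0)"
    by (rule expectation_nat_sums[where B=1 and h="\<lambda>k. if k > 0 then tail_prob e k else 0"]) (auto simp: tail_prob_bounds)
  ultimately show ?thesis by (rule sums_unique2)
qed

lemma GW_absorbed: "GW \<xi> n x = 0 \<Longrightarrow> n \<le> k \<Longrightarrow> GW \<xi> k x = 0"
  by (induction k) (auto simp: le_Suc_eq)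

lemma prob_GW_0: "prob {x \<in> space M. GW \<xi> n x = 0} = (pgf ^^ n) 0"
proof -
  have "prob {x \<in> space M. GW \<xi> n x = 0} = expectation (indicator {x \<in> space M. GW \<xi> n x = 0})" by simp
  also have "\<dots> = expectation (\<lambda>x. (0::real) ^ GW \<xi> n x)"
    by (intro Bochner_Integration.integral_cong) (auto simp: indicator_def)
  finally show ?thesis using expectation_GW_real[of 0 n] by simp
qed

lemma pgf_continuous:
  fixes f :: "_ \<Rightarrow> 'b::{real_normed_field,banach}"
  assumes "(f \<longlongrightarrow> l) F" "eventually (\<lambda>x. norm (f x) \<le> 1) F" "norm l \<le> 1"
  shows "((\<lambda>x. pgf (f x)) \<longlongrightarrow> pgf l) F"
proof (rule Lim_null_comparison[THEN Lim_null[THEN iffD2]])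
  show "eventually (\<lambda>x. norm (pgf (f x) - pgf l) \<le> m * norm (f x - l)) F"
    using assms(2) by eventually_elim (use pgf_lipschitz_1 assms(3) in auto)
  show "((\<lambda>x. m * norm (f x - l)) \<longlongrightarrow> 0) F"
    using tendsto_mult_right_zero[OF tendsto_norm_zero[OF Lim_null[THEN iffD1, OF assms(1)]]] .
qed

definition ext :: real where "ext = prob {x \<in> space M. \<exists>n. GW \<xi> n x = 0}"

lemma funpow_pgf_0_tendsto: "(\<lambda>n. (pgf ^^ n) 0) \<longlonglongrightarrow> ext"
proof -
  have "(\<lambda>n. prob {x \<in> space M. GW \<xi> n x = 0}) \<longlonglongrightarrow> prob (\<Union>n. {x \<in> space M. GW \<xi> n x = 0})"
    by (rule finite_Lim_measure_incseq) (auto simp: incseq_def intro: GW_absorbed)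
  moreover have "(\<Union>n. {x \<in> space M. GW \<xi> n x = 0}) = {x \<in> space M. \<exists>n. GW \<xi> n x = 0}" by auto
  ultimately show ?thesis by (simp add: prob_GW_0 ext_def)
qed

lemma pgf_ext: "pgf ext = ext"
proof -
  have "(\<lambda>n. pgf ((pgf ^^ n) 0)) \<longlonglongrightarrow> pgf ext"
    by (rule pgf_continuous[OF funpow_pgf_0_tendsto])
       (use funpow_pgf_of_real(1,2)[of 0] in \<open>auto simp: ext_def\<close>)
  moreover have "(\<lambda>n. pgf ((pgf ^^ n) 0)) \<longlonglongrightarrow> ext"
    using LIMSEQ_Suc[OF funpow_pgf_0_tendsto] by simp
  ultimately show ?thesis by (rule LIMSEQ_unique)
qed

end

locale galton_watson_limit = galton_watson +
  fixes W :: "'a \<Rightarrow> real"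
  assumes ZlogZ: "summable (\<lambda>k. real k * ln (real k) * p k)"
    and W_meas [measurable]: "W \<in> borel_measurable M"
    and W_lim: "AE x in M. (\<lambda>n. real (GW \<xi> n x) / m ^ n) \<longlonglongrightarrow> W x"
begin

lemma W_nonneg: "AE x in M. 0 \<le> W x"
  using W_lim
proof eventually_elim
  case (elim x)
  then show ?case by (rule LIMSEQ_le_const) (use m_gt1 in auto)
qed

text \<open>Laplace transform of W on the closed right half-plane; on the imaginary axis it is the
  characteristic function.\<close>

definition lap :: "complex \<Rightarrow> complex" where
  "lap z = expectation (\<lambda>x. exp (- (z * of_real (W x))))"

definition rlap :: "real \<Rightarrow> real" where
  "rlap t = expectation (\<lambda>x. exp (- (t * W x)))"

lemma lap_of_real: "lap (of_real t) = of_real (rlap t)"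
  unfolding lap_def rlap_def by (subst integral_complex_of_real[symmetric]) (simp flip: exp_of_real)

lemma lap_integrable: "0 \<le> Re z \<Longrightarrow> integrable M (\<lambda>x. exp (- (z * of_real (W x))))"
  by (rule integrable_const_bound[where B=1]) (use W_nonneg in \<open>auto elim!: eventually_mono\<close>)

lemma rlap_integrable: "0 \<le> t \<Longrightarrow> integrable M (\<lambda>x. exp (- (t * W x)))"
  by (rule integrable_const_bound[where B=1]) (use W_nonneg in \<open>auto elim!: eventually_mono\<close>)

lemma lap_tendsto:
  assumes "0 \<le> Re z"
  shows "(\<lambda>n. (pgf ^^ n) (exp (- (z / of_real m ^ n)))) \<longlonglongrightarrow> lap z"
proof -
  have "(\<lambda>n. expectation (\<lambda>x. exp (- (z * of_real (real (GW \<xi> n x) / m ^ n))))) \<longlonglongrightarrow> lap z"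
    unfolding lap_def
  proof (rule integral_dominated_convergence[where w="\<lambda>_. 1"])
    show "AE x in M. (\<lambda>n. exp (- (z * of_real (real (GW \<xi> n x) / m ^ n)))) \<longlonglongrightarrow> exp (- (z * of_real (W x)))"
      using W_lim by eventually_elim (intro tendsto_intros)
    show "AE x in M. norm (exp (- (z * of_real (real (GW \<xi> n x) / m ^ n)))) \<le> 1" for n
      using assms m_gt1 by auto
  qed auto
  moreover have "expectation (\<lambda>x. exp (- (z * of_real (real (GW \<xi> n x) / m ^ n)))) = (pgf ^^ n) (exp (- (z / of_real m ^ n)))" for n
  proof -
    have "norm (exp (- (z / of_real m ^ n))) \<le> 1"
      using assms m_gt1 by (auto simp: Re_divide_of_real simp flip: of_real_power)
    moreover have "exp (- (z * of_real (real k / m ^ n))) = exp (- (z / of_real m ^ n)) ^ k" for k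
      by (simp add: mult.commute flip: exp_of_nat_mult)
    ultimately show ?thesis by (simp add: expectation_GW)
  qed
  ultimately show ?thesis by simp
qed

lemma power_m_at_top: "filterlim (\<lambda>n. m ^ n) at_top sequentially"
  using m_gt1 by (intro filterlim_at_infinity_imp_filterlim_at_top filterlim_realpow_sequentially_gt1) auto

lemma norm_exp_scaled: "0 \<le> Re z \<Longrightarrow> norm (exp (- (z / of_real m ^ n))) \<le> 1"
  using m_gt1 by (auto simp: Re_divide_of_real simp flip: of_real_power)

lemma norm_lap_le_1: "0 \<le> Re z \<Longrightarrow> norm (lap z) \<le> 1"
  by (rule LIMSEQ_le_const2[OF tendsto_norm[OF lap_tendsto]])
     (auto intro!: norm_funpow_pgf_le_1 norm_exp_scaled simp del: norm_exp_eq_Re)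

text \<open>Both sides are limits of the same sequence f_(n+1)(exp(-z / m^n)), since m z / m^(n+1) =
  z / m^n. This functional equation carries all information about W used later.\<close>

lemma lap_scale:
  assumes "0 \<le> Re z"
  shows "lap (of_real m * z) = pgf (lap z)"
proof (rule LIMSEQ_unique)
  show "(\<lambda>n. (pgf ^^ Suc n) (exp (- (z / of_real m ^ n)))) \<longlonglongrightarrow> pgf (lap z)"
    using pgf_continuous[OF lap_tendsto[OF assms] _ norm_lap_le_1[OF assms]]
      norm_funpow_pgf_le_1[OF norm_exp_scaled[OF assms]] by simp
  have "(\<lambda>n. (pgf ^^ Suc n) (exp (- ((of_real m * z) / of_real m ^ Suc n)))) \<longlonglongrightarrow> lap (of_real m * z)"
    using assms m_gt1 by (intro LIMSEQ_Suc lap_tendsto) auto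
  then show "(\<lambda>n. (pgf ^^ Suc n) (exp (- (z / of_real m ^ n)))) \<longlonglongrightarrow> lap (of_real m * z)"
    using m_gt1 by simp
qed

lemma lap_scale_power:
  assumes "0 \<le> Re z"
  shows "lap (of_real (m ^ n) * z) = (pgf ^^ n) (lap z)"
proof (induction n)
  case (Suc n)
  have "lap (of_real (m ^ Suc n) * z) = lap (of_real m * (of_real (m ^ n) * z))" by (simp add: mult_ac)
  also have "\<dots> = pgf (lap (of_real (m ^ n) * z))"
    using assms m_gt1 by (intro lap_scale) (auto simp flip: of_real_power)
  finally show ?case using Suc by simp
qed simp

lemma rlap_bounds: "0 \<le> t \<Longrightarrow> 0 \<le> rlap t" "0 \<le> t \<Longrightarrow> rlap t \<le> 1"
  using norm_lap_le_1[of "of_real t"] by (auto simp: lap_of_real rlap_def intro!: integral_nonneg)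

lemma rlap_scale_power:
  assumes "0 \<le> t"
  shows "rlap (m ^ n * t) = (pgf ^^ n) (rlap t)"
proof -
  have "complex_of_real (rlap (m ^ n * t)) = (pgf ^^ n) (of_real (rlap t))"
    using lap_scale_power[of "of_real t" n] assms by (simp add: lap_of_real flip: of_real_mult of_real_power)
  also have "\<dots> = of_real ((pgf ^^ n) (rlap t))" using rlap_bounds[OF assms] by (rule funpow_pgf_of_real)
  finally show ?thesis by (simp only: of_real_eq_iff)
qed

text \<open>The Lipschitz constant m^n of f_n cancels the scaling by m^(-n) of its argument, so the
  bound survives the limit.\<close>

lemma lap_lipschitz:
  assumes "0 \<le> Re z" "0 \<le> Re z'"
  shows "norm (lap z - lap z') \<le> norm (z - z')"
proof (rule LIMSEQ_le_const2[OF tendsto_norm[OF tendsto_diff[OF lap_tendsto lap_tendsto]]])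
  show "\<exists>N. \<forall>n\<ge>N. norm ((pgf ^^ n) (exp (- (z / of_real m ^ n))) - (pgf ^^ n) (exp (- (z' / of_real m ^ n)))) \<le> norm (z - z')"
  proof (intro exI allI impI)
    fix n
    have Re: "0 \<le> Re (z / of_real m ^ n)" "0 \<le> Re (z' / of_real m ^ n)"
      using assms m_gt1 by (auto simp: Re_divide_of_real simp flip: of_real_power)
    have "norm ((pgf ^^ n) (exp (- (z / of_real m ^ n))) - (pgf ^^ n) (exp (- (z' / of_real m ^ n)))) \<le>
      m ^ n * norm (exp (- (z / of_real m ^ n)) - exp (- (z' / of_real m ^ n)))"
      using norm_exp_scaled assms by (intro funpow_pgf_lipschitz_1)
    also have "\<dots> \<le> m ^ n * norm (z / of_real m ^ n - z' / of_real m ^ n)"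
      using Re m_gt1 by (intro mult_left_mono exp_minus_diff_le) auto
    also have "\<dots> = norm (z - z')"
      using m_gt1 by (simp add: norm_divide norm_power flip: diff_divide_distrib)
    finally show "norm ((pgf ^^ n) (exp (- (z / of_real m ^ n))) - (pgf ^^ n) (exp (- (z' / of_real m ^ n)))) \<le> norm (z - z')" .
  qed
qed (use assms in auto)

lemma rlap_lipschitz: "0 \<le> t \<Longrightarrow> 0 \<le> t' \<Longrightarrow> \<bar>rlap t - rlap t'\<bar> \<le> \<bar>t - t'\<bar>"
  using lap_lipschitz[of "of_real t" "of_real t'"] by (simp add: lap_of_real flip: of_real_diff)

lemma rlap_antimono: "0 \<le> s \<Longrightarrow> s \<le> t \<Longrightarrow> rlap t \<le> rlap s"
  unfolding rlap_def
  by (intro integral_mono_AE rlap_integrable)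
     (use W_nonneg in \<open>auto elim!: eventually_mono intro!: mult_right_mono\<close>)

lemma rlap_0: "rlap 0 = 1"
  by (simp add: rlap_def prob_space)

text \<open>Fatou's lemma for (1 - exp(-h W)) / h as h tends to 0; the means of these quotients are
  at most 1 by the Lipschitz bound on the transform.\<close>

lemma W_nn_integral_le: "(\<integral>\<^sup>+x. ennreal (W x) \<partial>M) \<le> 1"
proof -
  let ?f = "\<lambda>(n::nat) x. (1 - exp (- (inverse (real (Suc n)) * W x))) / inverse (real (Suc n))"
  have "AE x in M. ennreal (W x) = liminf (\<lambda>n. ennreal (?f n x))"
    using W_nonneg
  proof eventually_elim
    case (elim x)
    have "((\<lambda>h. exp (- (h * W x))) has_field_derivative - W x) (at 0)"
      by (auto intro!: derivative_eq_intros)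
    then have lim: "((\<lambda>h. (exp (- (h * W x)) - 1) / h) \<longlongrightarrow> - W x) (at 0)"
      by (simp add: DERIV_def)
    have "filterlim (\<lambda>n. inverse (real (Suc n))) (at 0) sequentially"
      unfolding filterlim_at using LIMSEQ_inverse_real_of_nat by auto
    from tendsto_minus[OF filterlim_compose[OF lim this]]
    have "(\<lambda>n. ?f n x) \<longlonglongrightarrow> W x" by (simp only: minus_divide_left minus_diff_eq minus_minus)
    then show ?case using elim by (intro lim_imp_Liminf[symmetric] tendsto_ennrealI) auto
  qed
  then have "(\<integral>\<^sup>+x. ennreal (W x) \<partial>M) = (\<integral>\<^sup>+x. liminf (\<lambda>n. ennreal (?f n x)) \<partial>M)" by (rule nn_integral_cong_AE)
  also have "\<dots> \<le> liminf (\<lambda>n. \<integral>\<^sup>+x. ennreal (?f n x) \<partial>M)" by (rule nn_integral_liminf) measurable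
  also have "\<dots> \<le> liminf (\<lambda>n::nat. 1)"
  proof (intro Liminf_mono always_eventually allI)
    fix n
    define h where "h = inverse (real (Suc n))"
    have h: "h > 0" by (simp add: h_def)
    have int: "integrable M (\<lambda>x. (1 - exp (- (h * W x))) / h)"
      using rlap_integrable[of h] h by (intro integrable_divide_zero Bochner_Integration.integrable_diff) auto
    have "(\<integral>\<^sup>+x. ennreal ((1 - exp (- (h * W x))) / h) \<partial>M) = ennreal (expectation (\<lambda>x. (1 - exp (- (h * W x))) / h))"
      by (rule nn_integral_eq_integral[OF int]) (use W_nonneg h in \<open>auto elim!: eventually_mono\<close>)
    also have "expectation (\<lambda>x. (1 - exp (- (h * W x))) / h) = (1 - rlap h) / h"
      using rlap_integrable[of h] h by (simp add: rlap_def prob_space)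
    also have "\<dots> \<le> ennreal 1" using rlap_lipschitz[of 0 h] h by (intro ennreal_leI) (simp add: rlap_0 divide_le_eq)
    finally show "(\<integral>\<^sup>+x. ennreal (?f n x) \<partial>M) \<le> 1" by (simp only: h_def ennreal_1)
  qed
  finally show ?thesis by (simp add: Liminf_const)
qed

lemma W_integrable: "integrable M W"
proof (rule integrableI_bounded)
  have "(\<integral>\<^sup>+x. ennreal (norm (W x)) \<partial>M) = (\<integral>\<^sup>+x. ennreal (W x) \<partial>M)"
    by (rule nn_integral_cong_AE) (use W_nonneg in \<open>auto elim!: eventually_mono\<close>)
  also have "\<dots> < \<infinity>" using W_nn_integral_le by (simp add: le_less_trans)
  finally show "(\<integral>\<^sup>+x. ennreal (norm (W x)) \<partial>M) < \<infinity>" .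
qed simp

lemma rlap_lt_1_ex: obtains t where "t > 0" "rlap t < 1"
proof -
  obtain x where x: "0 < x" "x \<le> 1" "\<And>n. (pgf ^^ n) (1 - x / m ^ n) \<le> 1 - x / 2"
    using kesten_stigum_pgf[OF ZlogZ] by blast
  \<comment> \<open>The argument is doubled because exp(-2y) \<le> 1 - y for 0 \<le> y \<le> 1/2,
    which brings the exponential below the point 1 - x / m^n of
    \<open>kesten_stigum_pgf\<close>.\<close>
  have "rlap (2 * x) \<le> 1 - x / 2"
  proof (rule LIMSEQ_le_const2)
    have "(\<lambda>n. Re ((pgf ^^ n) (exp (- (of_real (2 * x) / of_real m ^ n))))) \<longlonglongrightarrow> Re (lap (of_real (2 * x)))"
      using x by (intro tendsto_Re lap_tendsto) auto
    moreover have "Re ((pgf ^^ n) (exp (- (of_real (2 * x) / of_real m ^ n)))) = (pgf ^^ n) (exp (- (2 * x / m ^ n)))" for n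
    proof -
      have "exp (- (of_real (2 * x) / of_real m ^ n)) = complex_of_real (exp (- (2 * x / m ^ n)))"
        by (simp add: exp_of_real[symmetric])
      then show ?thesis using x m_gt1 by (simp add: funpow_pgf_of_real)
    qed
    ultimately show "(\<lambda>n. (pgf ^^ n) (exp (- (2 * x / m ^ n)))) \<longlonglongrightarrow> rlap (2 * x)" by (simp add: lap_of_real del: of_real_mult)
    have "eventually (\<lambda>n. 2 \<le> m ^ n) sequentially"
      using power_m_at_top by (auto simp: filterlim_at_top)
    then have "eventually (\<lambda>n. (pgf ^^ n) (exp (- (2 * x / m ^ n))) \<le> 1 - x / 2) sequentially"
    proof eventually_elim
      case (elim n)
      define y where "y = x / m ^ n"
      have y: "0 \<le> y" "y \<le> 1 / 2" using x elim m_gt1 by (auto simp: y_def divide_le_eq)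
      have "1 + 2 * y \<le> exp (2 * y)" by (rule exp_ge_add_one_self)
      then have "exp (- (2 * y)) \<le> 1 / (1 + 2 * y)" using y by (simp add: exp_minus field_simps)
      also have "\<dots> \<le> 1 - y"
      proof -
        have "0 \<le> y * (1 - 2 * y)" using y by simp
        then show ?thesis using y by (simp add: field_simps)
      qed
      finally have "(pgf ^^ n) (exp (- (2 * y))) \<le> (pgf ^^ n) (1 - y)"
        using y by (intro funpow_pgf_mono) auto
      also have "\<dots> \<le> 1 - x / 2" unfolding y_def by (rule x)
      finally show ?case by (simp add: y_def)
    qed
    then show "\<exists>N. \<forall>n\<ge>N. (pgf ^^ n) (exp (- (2 * x / m ^ n))) \<le> 1 - x / 2"
      by (simp add: eventually_sequentially)
  qed
  then show ?thesis using that[of "2 * x"] x by auto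
qed

lemma prob_W_0_lt_1: "prob {x \<in> space M. W x = 0} < 1"
proof (rule ccontr)
  assume "\<not> ?thesis"
  then have "prob {x \<in> space M. W x = 0} = 1" using prob_le_1 by (simp add: antisym_conv2)
  then have AE: "AE x in M. W x = 0" by (subst (asm) prob_Collect_eq_1) auto
  obtain t where t: "t > 0" "rlap t < 1" using rlap_lt_1_ex by blast
  have "rlap t = expectation (\<lambda>x. 1)" unfolding rlap_def
    by (rule integral_cong_AE) (use AE in auto)
  then show False using t by (simp add: prob_space)
qed

lemma rlap_power_tendsto:
  assumes "0 < t"
  shows "(\<lambda>n. rlap (m ^ n * t)) \<longlonglongrightarrow> prob {x \<in> space M. W x = 0}"
proof -
  have "(\<lambda>n. expectation (\<lambda>x. exp (- (m ^ n * t * W x)))) \<longlonglongrightarrow> expectation (indicator {x \<in> space M. W x = 0})"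
  proof (rule integral_dominated_convergence[where w="\<lambda>_. 1"])
    show "AE x in M. (\<lambda>n. exp (- (m ^ n * t * W x))) \<longlonglongrightarrow> indicator {x \<in> space M. W x = 0} x"
      using W_nonneg AE_space
    proof eventually_elim
      case (elim x)
      show ?case
      proof (cases "W x = 0")
        case False
        then have "filterlim (\<lambda>n. m ^ n * (t * W x)) at_top sequentially"
          using elim assms by (intro filterlim_at_top_mult_tendsto_pos[OF tendsto_const _ power_m_at_top]) auto
        then have "filterlim (\<lambda>n. - (m ^ n * t * W x)) at_bot sequentially"
          by (simp add: filterlim_uminus_at_bot mult.assoc)
        from filterlim_compose[OF exp_at_bot this] show ?thesis using False by simp
      qed (use elim in simp)
    qed
    show "AE x in M. norm (exp (- (m ^ n * t * W x))) \<le> 1" for n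
      using W_nonneg by eventually_elim (use assms m_gt1 in auto)
  qed auto
  then show ?thesis by (simp add: rlap_def)
qed

text \<open>P(W = 0) is the limit of the transform along m^n, hence a fixed point of f by the
  functional equation. It is below 1, and so is the extinction probability, which it dominates; the
  fixed point below 1 is unique.\<close>

lemma prob_W_0: "prob {x \<in> space M. W x = 0} = ext" and ext_lt_1: "ext < 1"
proof -
  let ?q = "prob {x \<in> space M. W x = 0}"
  have lim: "(\<lambda>n. rlap (m ^ n)) \<longlonglongrightarrow> ?q" using rlap_power_tendsto[of 1] by simp
  have bd: "norm (rlap (m ^ n)) \<le> 1" for n using rlap_bounds[of "m ^ n"] m_gt1 by simp
  have "(\<lambda>n. pgf (rlap (m ^ n))) \<longlonglongrightarrow> pgf ?q"
    by (rule pgf_continuous[OF lim]) (use bd in auto)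
  moreover have "pgf (rlap (m ^ n)) = rlap (m ^ Suc n)" for n
    using rlap_scale_power[of 1 n] rlap_scale_power[of 1 "Suc n"] by simp
  ultimately have "(\<lambda>n. rlap (m ^ Suc n)) \<longlonglongrightarrow> pgf ?q" by (simp only:)
  then have "pgf ?q = ?q" by (rule LIMSEQ_unique[OF _ LIMSEQ_Suc[OF lim]])
  have "ext \<le> ?q" unfolding ext_def
  proof (rule finite_measure_mono_AE)
    show "AE x in M. x \<in> {x \<in> space M. \<exists>n. GW \<xi> n x = 0} \<longrightarrow> x \<in> {x \<in> space M. W x = 0}"
      using W_lim
    proof eventually_elim
      case (elim x)
      have "W x = 0" if n: "GW \<xi> n x = 0" for n
      proof -
        have "(\<lambda>k. real (GW \<xi> k x) / m ^ k) \<longlonglongrightarrow> 0"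
          by (rule tendsto_eventually, rule eventually_mono[OF eventually_ge_at_top[of n]])
             (use GW_absorbed[OF n] in simp)
        then show ?thesis using elim LIMSEQ_unique by blast
      qed
      then show ?case by auto
    qed
  qed auto
  then show ext: "ext < 1" using prob_W_0_lt_1 by (rule le_less_trans)
  have "0 \<le> ext" by (simp add: ext_def)
  then show "?q = ext"
    by (rule fixed_point_unique[OF measure_nonneg prob_W_0_lt_1 \<open>pgf ?q = ?q\<close> _ ext pgf_ext])
qed

end

text \<open>A non-integrable function has integral 0 by convention, so the bound holds in that case
  too.\<close>

lemma norm_integral_le_of_dominated:
  fixes f :: "'a \<Rightarrow> 'b::{banach, second_countable_topology}"
  assumes "integrable M g" "\<And>x. norm (f x) \<le> g x"
  shows "norm (integral\<^sup>L M f) \<le> integral\<^sup>L M g"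
proof (cases "integrable M f")
  case True
  have "norm (integral\<^sup>L M f) \<le> (\<integral>x. norm (f x) \<partial>M)" by (rule integral_norm_bound)
  also have "\<dots> \<le> integral\<^sup>L M g" using True assms by (intro integral_mono) auto
  finally show ?thesis .
next
  case False
  have "0 \<le> g x" for x using assms(2)[of x] norm_ge_zero order_trans by blast
  then show ?thesis using False by (simp add: not_integrable_integral_eq)
qed

section \<open>The upper bound for the density near zero\<close>

text \<open>In Levy's inversion formula the kernel is at most y - x in modulus, so an integrable
  majorant of the characteristic function bounds the mass of an interval by its length. The
  prefactor 1 / (2 pi) is estimated by 1.\<close>

lemma (in real_distribution) measure_Ioc_le_char_bound:
  assumes xy: "x \<le> y" "measure M {x} = 0" "measure M {y} = 0"
    and H: "\<And>t. norm (char M t) \<le> H t" and Hi: "integrable lborel H"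
  shows "measure M {x<..y} \<le> (y - x) * (\<integral>t. H t \<partial>lborel)"
proof -
  let ?F = "\<lambda>t. (iexp (-(t * x)) - iexp (-(t * y))) / (\<i> * t) * char M t"
  have H0: "0 \<le> H t" for t using H[of t] norm_ge_zero order_trans by blast
  have F: "norm (?F t) \<le> (y - x) * H t" for t
  \<comment> \<open>At t = 0 the kernel is a division by zero and therefore has the value 0.\<close>
  proof (cases "t = 0")
    case False
    have "norm ((iexp (-(t * x)) - iexp (-(t * y))) / (\<i> * t)) \<le> y - x"
      using Levy_Inversion_aux2[of "-y" "-x" t] xy(1) False by simp
    then show ?thesis unfolding norm_mult using H[of t] xy(1) by (intro mult_mono) auto
  qed (use H0 xy in simp)
  have "norm (1 / (2 * pi) * (CLBINT t=-T..T. ?F t)) \<le> (y - x) * (\<integral>t. H t \<partial>lborel)" for T :: nat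
  proof -
    have "norm (CLBINT t=-T..T. ?F t) \<le> (\<integral>t. (y - x) * H t \<partial>lborel)"
    proof -
      have "ereal (real_of_int (- int T)) \<le> ereal (real T)" by simp
      then have "(CLBINT t=-T..T. ?F t) = (\<integral>t. indicator (einterval (ereal (real_of_int (- int T))) (ereal (real T))) t *\<^sub>R ?F t \<partial>lborel)"
        unfolding interval_lebesgue_integral_def set_lebesgue_integral_def by (simp only: if_True)
      also have "norm \<dots> \<le> (\<integral>t. (y - x) * H t \<partial>lborel)"
      proof (rule norm_integral_le_of_dominated)
      show "integrable lborel (\<lambda>t. (y - x) * H t)" by (intro integrable_mult_right Hi)
      show "norm (indicator (einterval (ereal (real_of_int (- int T))) (ereal (real T))) t *\<^sub>R ?F t) \<le> (y - x) * H t" for t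
        using F[of t] H0[of t] xy(1) by (cases "t \<in> einterval (ereal (real_of_int (- int T))) (ereal (real T))")
          (simp_all only: indicator_simps(1) indicator_simps(2) not_False_eq_True scaleR_one scaleR_zero_left norm_zero mult_nonneg_nonneg diff_ge_0_iff_ge)
      qed
      finally show ?thesis .
    qed
    also have "\<dots> = (y - x) * (\<integral>t. H t \<partial>lborel)" by simp
    finally have 1: "norm (CLBINT t=-T..T. ?F t) \<le> (y - x) * (\<integral>t. H t \<partial>lborel)" .
    have "norm (1 / (2 * pi) * (CLBINT t=-T..T. ?F t)) = 1 / (2 * pi) * norm (CLBINT t=-T..T. ?F t)"
      by (simp add: norm_mult norm_divide)
    also have "\<dots> \<le> 1 * norm (CLBINT t=-T..T. ?F t)"
      using pi_gt3 by (intro mult_right_mono) auto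
    finally show ?thesis using 1 by simp
  qed
  then have "norm (complex_of_real (measure M {x<..y})) \<le> (y - x) * (\<integral>t. H t \<partial>lborel)"
    by (intro LIMSEQ_le_const2[OF tendsto_norm[OF Levy_Inversion[OF xy]]]) auto
  then show ?thesis by simp
qed

lemma nn_integral_powr_tail:
  assumes "b > 0" "\<alpha> > (0::real)"
  shows "(\<integral>\<^sup>+t. ennreal ((1 + \<bar>t\<bar> / b) powr (- 1 - \<alpha>)) \<partial>lborel) \<le> ennreal (2 * b / \<alpha>)"
proof -
  let ?f = "\<lambda>t. (1 + t / b) powr (- 1 - \<alpha>)"
  let ?g = "\<lambda>t. ennreal ((1 + \<bar>t\<bar> / b) powr (- 1 - \<alpha>)) * indicator {0..} t"
  have half: "(\<integral>\<^sup>+t. ?g t \<partial>lborel) = ennreal (b / \<alpha>)"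
  proof -
    have "(\<integral>\<^sup>+t. ?g t \<partial>lborel) = (\<integral>\<^sup>+t. ennreal (?f t) * indicator {0..} t \<partial>lborel)"
      by (intro nn_integral_cong) (auto simp: indicator_def)
    also have "\<dots> = ennreal (0 - (- (b / \<alpha>) * (1 + 0 / b) powr (- \<alpha>)))"
    proof (rule nn_integral_FTC_atLeast[where F="\<lambda>t. - (b / \<alpha>) * (1 + t / b) powr (- \<alpha>)"])
      show "((\<lambda>t. - (b / \<alpha>) * (1 + t / b) powr (- \<alpha>)) has_real_derivative ?f x) (at x)" if "0 \<le> x" for x
      proof -
        have e: "- 1 - \<alpha> = - \<alpha> - 1" by simp
        have "1 + x / b > 0" using that assms by (simp add: add_pos_nonneg)
        then show ?thesis using assms unfolding e
          by (auto intro!: derivative_eq_intros simp: field_simps)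
      qed
      have "((\<lambda>t. (1 + t / b) powr (- \<alpha>)) \<longlongrightarrow> 0) at_top"
      proof (rule tendsto_neg_powr)
        show "filterlim (\<lambda>t. 1 + t / b) at_top at_top"
          using assms
          by (intro filterlim_tendsto_add_at_top[OF tendsto_const]
              filterlim_at_top_mult_tendsto_pos[OF tendsto_const _ filterlim_ident, of "inverse b", unfolded divide_inverse[symmetric]]) auto
      qed (use assms in auto)
      then show "((\<lambda>t. - (b / \<alpha>) * (1 + t / b) powr (- \<alpha>)) \<longlongrightarrow> 0) at_top"
        by (rule tendsto_mult_right_zero)
    qed auto
    finally show ?thesis by simp
  qed
  have "(\<integral>\<^sup>+t. ennreal ((1 + \<bar>t\<bar> / b) powr (- 1 - \<alpha>)) \<partial>lborel) \<le> (\<integral>\<^sup>+t. ?g t + ?g (0 + (-1) * t) \<partial>lborel)"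
    by (intro nn_integral_mono) (auto simp: indicator_def)
  also have "\<dots> = (\<integral>\<^sup>+t. ?g t \<partial>lborel) + (\<integral>\<^sup>+t. ?g (0 + (-1) * t) \<partial>lborel)"
    by (intro nn_integral_add) auto
  also have "(\<integral>\<^sup>+t. ?g (0 + (-1) * t) \<partial>lborel) = (\<integral>\<^sup>+t. ?g t \<partial>lborel)"
    using nn_integral_real_affine[of ?g "-1" 0] by simp
  also have "(\<integral>\<^sup>+t. ?g t \<partial>lborel) + (\<integral>\<^sup>+t. ?g t \<partial>lborel) = ennreal (2 * b / \<alpha>)"
    unfolding half using assms by (simp flip: ennreal_plus)
  finally show ?thesis .
qed

text \<open>Passes from interval masses to continuous densities: if f(u) > g(u), two constants d < c
  separate g from f on a neighbourhood of u, and the masses of a short interval there are in the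
  wrong order.\<close>

lemma continuous_le_of_nn_integral_le:
  fixes f g :: "real \<Rightarrow> real"
  assumes cont: "continuous_on {0<..} f" "continuous_on {0<..} g"
    and nonneg: "\<And>u. 0 < u \<Longrightarrow> 0 \<le> g u"
    and le: "\<And>x y. 0 < x \<Longrightarrow> x < y \<Longrightarrow>
      (\<integral>\<^sup>+u\<in>{x<..y}. ennreal (f u) \<partial>lborel) \<le> (\<integral>\<^sup>+u\<in>{x<..y}. ennreal (g u) \<partial>lborel)"
    and "0 < u"
  shows "f u \<le> g u"
proof (rule ccontr)
  assume "\<not> f u \<le> g u"
  define c where "c = (f u + g u) / 2"
  have c: "g u < c" "c < f u" using \<open>\<not> _\<close> by (auto simp: c_def)
  have c0: "0 \<le> g u" using nonneg \<open>0 < u\<close> by simp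
  define d where "d = (g u + c) / 2"
  have d: "g u < d" "d < c" "0 < d" using c c0 by (auto simp: d_def)
  have "continuous (at u) f" "continuous (at u) g"
    using cont \<open>0 < u\<close> by (auto simp: continuous_on_eq_continuous_at)
  then have "eventually (\<lambda>v. c < f v) (at u)" "eventually (\<lambda>v. g v < d) (at u)"
    using c d by (auto simp: continuous_at intro: order_tendstoD)
  then have "eventually (\<lambda>v. c < f v \<and> g v < d) (nhds u)"
    using c d by (auto simp: eventually_at_filter elim: eventually_elim2)
  then obtain e where e: "e > 0" "\<And>v. dist v u < e \<Longrightarrow> c < f v \<and> g v < d"
    by (auto simp: eventually_nhds_metric)
  define e' where "e' = min e u / 2"
  have e': "e' > 0" "e' < e" "e' < u" using e \<open>0 < u\<close> by (auto simp: e'_def min_def)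
  define x y where "x = u - e'" and "y = u + e'"
  have xy: "0 < x" "x < y" using e' by (auto simp: x_def y_def)
  have in_xy: "c < f v \<and> g v < d" if "v \<in> {x<..y}" for v
    using that e' by (intro e) (auto simp: x_def y_def dist_real_def)
  have le_xy: "c \<le> f v" "g v \<le> d" if "v \<in> {x<..y}" for v
    using in_xy[OF that] by auto
  have "ennreal c * ennreal (y - x) = (\<integral>\<^sup>+v\<in>{x<..y}. ennreal c \<partial>lborel)"
    using xy by (simp add: nn_integral_cmult_indicator)
  also have "\<dots> \<le> (\<integral>\<^sup>+v\<in>{x<..y}. ennreal (f v) \<partial>lborel)"
    using le_xy by (intro nn_integral_mono) (auto simp: indicator_def intro!: ennreal_leI)
  also have "\<dots> \<le> (\<integral>\<^sup>+v\<in>{x<..y}. ennreal (g v) \<partial>lborel)" using xy by (rule le)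
  also have "\<dots> \<le> (\<integral>\<^sup>+v\<in>{x<..y}. ennreal d \<partial>lborel)"
    using le_xy by (intro nn_integral_mono) (auto simp: indicator_def intro!: ennreal_leI)
  also have "\<dots> = ennreal d * ennreal (y - x)"
    using xy by (simp add: nn_integral_cmult_indicator)
  finally have "ennreal (c * (y - x)) \<le> ennreal (d * (y - x))"
    using c d c0 xy by (simp add: ennreal_mult)
  then have "c * (y - x) \<le> d * (y - x)" using d xy by (subst (asm) ennreal_le_iff) auto
  then show False using d xy by simp
qed

section \<open>The transforms of W and of its size-biased law\<close>

locale schroeder_gw = galton_watson_limit M p m \<xi> X W
  for M :: "'a measure" and p m \<xi> X W +
  fixes w :: "real \<Rightarrow> real" and \<alpha> :: real
  assumes dpgf_ext: "dpgf ext = m powr (- \<alpha>)"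
    and w_nonneg: "\<And>u. u > 0 \<Longrightarrow> w u \<ge> 0"
    and w_cont: "continuous_on {0<..} w"
    and w_density: "\<And>A. A \<in> sets borel \<Longrightarrow> A \<subseteq> {0<..} \<Longrightarrow>
        emeasure M {x \<in> space M. W x \<in> A} = (\<integral>\<^sup>+ u\<in>A. ennreal (w u) \<partial>lborel)"
begin

sublocale schroeder_law p m ext "m powr (- \<alpha>)"
  by unfold_locales (use ext_lt_1 pgf_ext dpgf_ext m_gt1 in \<open>auto simp: ext_def\<close>)

abbreviation \<gamma> :: real where "\<gamma> \<equiv> m powr (- \<alpha>)"

lemma alpha_pos: "\<alpha> > 0"
proof (rule ccontr)
  assume "\<not> 0 < \<alpha>"
  then have "1 \<le> m powr (- \<alpha>)" using m_gt1 by (intro ge_one_powr_ge_zero) auto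
  then show False using \<gamma>_lt_1 by simp
qed

lemma gamma_power: "\<gamma> ^ n = (m ^ n) powr (- \<alpha>)"
  using m_gt1 by (simp add: powr_powr powr_realpow[symmetric] mult.commute)

text \<open>Extension by 0, because \<open>w\<close> is only constrained on the positive half-line;
  this version is measurable on the whole line.\<close>

definition w0 :: "real \<Rightarrow> real" where "w0 u = indicator {0<..} u * w u"

lemma w0_measurable [measurable]: "w0 \<in> borel_measurable borel"
  using borel_measurable_continuous_on_indicator[OF _ w_cont] unfolding w0_def[abs_def] by simp

lemma w0_nonneg: "0 \<le> w0 u"
  using w_nonneg by (simp add: w0_def indicator_def)

lemma nn_integral_W:
  assumes [measurable]: "h \<in> borel_measurable borel"
  shows "(\<integral>\<^sup>+x. h (W x) * indicator {0<..} (W x) \<partial>M) = (\<integral>\<^sup>+u. h u * ennreal (w0 u) \<partial>lborel)"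
proof -
  let ?N = "distr (density M (\<lambda>x. indicator {0<..} (W x))) borel W"
  have "?N = density lborel (\<lambda>u. ennreal (w0 u))"
  proof (rule measure_eqI)
    fix A assume "A \<in> sets ?N"
    then have [measurable]: "A \<in> sets borel" by simp
    have "emeasure ?N A = (\<integral>\<^sup>+x. indicator {0<..} (W x) * indicator (W -` A \<inter> space M) x \<partial>M)"
      by (simp add: emeasure_distr emeasure_density)
    also have "\<dots> = (\<integral>\<^sup>+x. indicator {x \<in> space M. W x \<in> A \<inter> {0<..}} x \<partial>M)"
      by (intro nn_integral_cong) (auto simp: indicator_def)
    also have "\<dots> = emeasure M {x \<in> space M. W x \<in> A \<inter> {0<..}}" by simp
    also have "\<dots> = (\<integral>\<^sup>+u\<in>A \<inter> {0<..}. ennreal (w u) \<partial>lborel)" by (rule w_density) auto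
    also have "\<dots> = (\<integral>\<^sup>+u. ennreal (w0 u) * indicator A u \<partial>lborel)"
      by (intro nn_integral_cong) (auto simp: indicator_def w0_def)
    finally show "emeasure ?N A = emeasure (density lborel (\<lambda>u. ennreal (w0 u))) A"
      by (simp add: emeasure_density)
  qed simp
  then have "(\<integral>\<^sup>+u. h u \<partial>?N) = (\<integral>\<^sup>+u. h u \<partial>density lborel (\<lambda>u. ennreal (w0 u)))" by simp
  then show ?thesis
    by (simp add: nn_integral_distr nn_integral_density mult.commute)
qed

lemma prob_W_pos: "prob {x \<in> space M. 0 < W x} > 0"
proof -
  have "prob {x \<in> space M. 0 < W x} = prob (space M - {x \<in> space M. W x = 0})"
    by (rule finite_measure_eq_AE) (use W_nonneg in \<open>auto elim!: eventually_mono\<close>)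
  also have "\<dots> = 1 - prob {x \<in> space M. W x = 0}" by (rule prob_compl) measurable
  finally show ?thesis using prob_W_0_lt_1 by simp
qed

lemma not_AE_W_0: "\<not> (AE x in M. W x = 0)"
proof
  assume "AE x in M. W x = 0"
  then have "prob {x \<in> space M. W x = 0} = 1" by (subst prob_Collect_eq_1) auto
  then show False using prob_W_0_lt_1 by simp
qed

lemma prob_W_countable:
  assumes "countable A"
  shows "AE x in M. W x \<in> A \<longrightarrow> W x = 0"
proof -
  have [measurable]: "A \<in> sets borel" using null_setsD2[OF countable_imp_null_set_lborel[OF assms]] by simp
  have "emeasure M {x \<in> space M. W x \<in> A \<inter> {0<..}} = (\<integral>\<^sup>+u\<in>A \<inter> {0<..}. ennreal (w u) \<partial>lborel)"
    by (rule w_density) auto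
  also have "\<dots> = (\<integral>\<^sup>+(u::real). 0 \<partial>lborel)"
    by (rule nn_integral_cong_AE)
       (use AE_not_in[OF countable_imp_null_set_lborel[OF assms]] in \<open>auto elim!: eventually_mono simp: indicator_def\<close>)
  finally have "AE x in M. \<not> (W x \<in> A \<inter> {0<..})"
    by (subst AE_iff_measurable[of "{x \<in> space M. W x \<in> A \<inter> {0<..}}"]) auto
  then show ?thesis using W_nonneg by eventually_elim auto
qed

text \<open>Equality in the triangle inequality would force exp(-z W) to be almost surely constant.
  For z \<noteq> 0 this confines W to a countable set, which W can only hit at 0, and W = 0 almost
  surely is excluded.\<close>

lemma norm_lap_lt_1:
  assumes "0 \<le> Re z" "z \<noteq> 0"
  shows "norm (lap z) < 1"
proof (rule ccontr)
  assume "\<not> ?thesis"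
  then have c: "norm (lap z) = 1" using norm_lap_le_1[OF assms(1)] by simp
  \<comment> \<open>A nonnegative variable whose mean is 1 - |lap z|^2 = 0, hence almost surely
    0.\<close>
  let ?Y = "\<lambda>x. 1 - Re (cnj (lap z) * exp (- (z * of_real (W x))))"
  have int: "integrable M (\<lambda>x. cnj (lap z) * exp (- (z * of_real (W x))))"
    by (intro integrable_mult_right lap_integrable assms)
  have "expectation ?Y = 1 - Re (cnj (lap z) * lap z)"
  proof -
    have "expectation ?Y = 1 - expectation (\<lambda>x. Re (cnj (lap z) * exp (- (z * of_real (W x)))))"
      using integrable_Re[OF int] by (subst Bochner_Integration.integral_diff) (auto simp: prob_space simp del: times_complex.sel)
    then show ?thesis unfolding integral_Re[OF int] integral_mult_right_zero lap_def[symmetric] .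
  qed
  also have "cnj (lap z) * lap z = 1" using c by (simp add: complex_norm_square[symmetric] mult.commute)
  finally have Y0: "expectation ?Y = 0" by simp
  have le: "AE x in M. norm (cnj (lap z) * exp (- (z * of_real (W x)))) \<le> 1"
    using W_nonneg by eventually_elim (use assms c in \<open>auto simp: norm_mult\<close>)
  have "AE x in M. 0 \<le> ?Y x"
    using le by eventually_elim (use complex_Re_le_cmod order_trans in fastforce)
  with Y0 int have "AE x in M. ?Y x = 0"
    using integrable_Re[OF int] by (subst (asm) integral_nonneg_eq_0_iff_AE) (auto simp del: times_complex.sel)
  with le have AE_lap: "AE x in M. exp (- (z * of_real (W x))) = lap z"
  proof eventually_elim
    case (elim x)
    define v where "v = cnj (lap z) * exp (- (z * of_real (W x)))"
    have "Re v = 1" "norm v \<le> 1" using elim by (auto simp: v_def)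
    then have "v = 1"
    proof -
      have "(norm v)\<^sup>2 \<le> 1" using \<open>norm v \<le> 1\<close> by (simp add: power_le_one)
      then have "(Im v)\<^sup>2 \<le> 0" using \<open>Re v = 1\<close> by (simp add: cmod_power2)
      then show ?thesis using \<open>Re v = 1\<close> by (simp add: complex_eq_iff)
    qed
    then have "lap z * v = lap z" by simp
    moreover have "lap z * v = exp (- (z * of_real (W x)))"
      unfolding v_def using c by (simp add: mult.assoc[symmetric] complex_norm_square[symmetric])
    ultimately show ?case by simp
  qed
  have "countable {u::real. exp (- (z * of_real u)) = lap z}"
  proof -
    have "lap z \<noteq> 0" using c by auto
    have "{u::real. exp (- (z * of_real u)) = lap z} \<subseteq> range (\<lambda>n::int. Re (- (Ln (lap z) + of_int (2 * n) * pi * \<i>) / z))"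
    proof
      fix u :: real assume "u \<in> {u. exp (- (z * of_real u)) = lap z}"
      then have "exp (- (z * of_real u)) = exp (Ln (lap z))" using \<open>lap z \<noteq> 0\<close> by simp
      then obtain n where "- (z * of_real u) = Ln (lap z) + of_int (2 * n) * pi * \<i>" by (auto simp: exp_eq)
      then have "- (Ln (lap z) + of_int (2 * n) * pi * \<i>) / z = of_real u"
        using assms(2) by (metis minus_minus nonzero_mult_div_cancel_left)
      then have "u = Re (- (Ln (lap z) + of_int (2 * n) * pi * \<i>) / z)" by (simp only: Re_complex_of_real)
      then show "u \<in> range (\<lambda>n::int. Re (- (Ln (lap z) + of_int (2 * n) * pi * \<i>) / z))" by (rule range_eqI)
    qed
    then show ?thesis by (rule countable_subset) auto
  qed
  from prob_W_countable[OF this] AE_lap have "AE x in M. W x = 0" by eventually_elim auto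
  then show False using not_AE_W_0 by simp
qed

lemma rlap_lt_1: "0 < t \<Longrightarrow> rlap t < 1"
  using norm_lap_lt_1[of "of_real t"] rlap_bounds(1)[of t] by (simp add: lap_of_real)

lemma norm_lap_le_rlap: "0 \<le> t \<Longrightarrow> t \<le> Re z \<Longrightarrow> norm (lap z) \<le> rlap t"
proof -
  assume t: "0 \<le> t" "t \<le> Re z"
  have "norm (lap z) \<le> expectation (\<lambda>x. norm (exp (- (z * of_real (W x)))))"
    unfolding lap_def by (rule integral_norm_bound)
  also have "\<dots> \<le> rlap t" unfolding rlap_def
    using t by (intro integral_mono_AE integrable_norm lap_integrable rlap_integrable)
      (use W_nonneg in \<open>auto elim!: eventually_mono intro!: mult_right_mono\<close>)
  finally show ?thesis .
qed

text \<open>Minus the derivative of \<open>lap\<close>, that is, the transform of the measure u P(W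
  in du).\<close>

definition dlap :: "complex \<Rightarrow> complex" where
  "dlap z = expectation (\<lambda>x. of_real (W x) * exp (- (z * of_real (W x))))"

lemma dlap_integrable: "0 \<le> Re z \<Longrightarrow> integrable M (\<lambda>x. of_real (W x) * exp (- (z * of_real (W x))))"
  by (rule Bochner_Integration.integrable_bound[OF W_integrable])
     (use W_nonneg in \<open>auto elim!: eventually_mono simp: norm_mult mult_left_le\<close>)

lemma norm_dlap_le_1: "0 \<le> Re z \<Longrightarrow> norm (dlap z) \<le> 1"
proof -
  assume z: "0 \<le> Re z"
  have "norm (dlap z) \<le> expectation (\<lambda>x. norm (of_real (W x) * exp (- (z * of_real (W x)))))"
    unfolding dlap_def by (rule integral_norm_bound)
  also have "\<dots> \<le> expectation W"
    using z by (intro integral_mono_AE integrable_norm dlap_integrable W_integrable)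
      (use W_nonneg in \<open>auto elim!: eventually_mono simp: norm_mult mult_left_le\<close>)
  also have "ennreal (expectation W) = (\<integral>\<^sup>+x. ennreal (W x) \<partial>M)"
    by (rule nn_integral_eq_integral[symmetric, OF W_integrable W_nonneg])
  then have "ennreal (expectation W) \<le> ennreal 1" using W_nn_integral_le by simp
  then have "expectation W \<le> 1" by (subst (asm) ennreal_le_iff) auto
  finally show ?thesis .
qed

text \<open>Only positive real increments are used, so the quotients stay in the half-plane where W
  is nonnegative, and W itself dominates them.\<close>

lemma dlap_tendsto:
  assumes "0 \<le> Re z" "filterlim h (at_right 0) sequentially"
  shows "(\<lambda>k. (lap z - lap (z + of_real (h k))) / of_real (h k)) \<longlonglongrightarrow> dlap z"
proof -
  have hpos: "eventually (\<lambda>k. 0 < h k) sequentially"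
    using assms(2) by (auto simp: filterlim_at elim: eventually_mono)
  let ?f = "\<lambda>k x. exp (- (z * of_real (W x))) * of_real (if 0 < h k then (1 - exp (- (h k * W x))) / h k else 0)"
  have "(\<lambda>k. expectation (?f k)) \<longlonglongrightarrow> dlap z"
    unfolding dlap_def
  proof (rule integral_dominated_convergence[where w=W])
    show "AE x in M. (\<lambda>k. ?f k x) \<longlonglongrightarrow> of_real (W x) * exp (- (z * of_real (W x)))"
    proof (rule AE_I2)
      fix x
      have "((\<lambda>h. exp (- (h * W x))) has_field_derivative - W x) (at 0)"
        by (auto intro!: derivative_eq_intros)
      then have lim: "((\<lambda>h. (exp (- (h * W x)) - 1) / h) \<longlongrightarrow> - W x) (at 0)"
        by (simp add: DERIV_def)
      have "filterlim h (at 0) sequentially" using assms(2) filterlim_mono[OF _ at_le order_refl] by blast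
      from tendsto_minus[OF filterlim_compose[OF lim this]]
      have "(\<lambda>k. (1 - exp (- (h k * W x))) / h k) \<longlonglongrightarrow> W x"
        by (simp only: minus_divide_left minus_diff_eq minus_minus)
      then have "(\<lambda>k. if 0 < h k then (1 - exp (- (h k * W x))) / h k else 0) \<longlonglongrightarrow> W x"
        by (rule Lim_transform_eventually) (use hpos in \<open>auto elim: eventually_mono\<close>)
      then have "(\<lambda>k. ?f k x) \<longlonglongrightarrow> exp (- (z * of_real (W x))) * of_real (W x)"
        by (intro tendsto_intros)
      then show "(\<lambda>k. ?f k x) \<longlonglongrightarrow> of_real (W x) * exp (- (z * of_real (W x)))" by (simp add: mult.commute)
    qed
    show "AE x in M. norm (?f k x) \<le> W x" for k
      using W_nonneg
    proof eventually_elim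
      case (elim x)
      have "(1 - exp (- (h k * W x))) / h k \<le> W x" if "0 < h k"
        using exp_ge_add_one_self[of "- (h k * W x)"] that by (simp add: divide_le_eq mult.commute)
      moreover have "0 \<le> (1 - exp (- (h k * W x))) / h k" if "0 < h k"
        using that elim by auto
      ultimately have "norm (?f k x) \<le> 1 * W x"
        unfolding norm_mult using elim assms(1) by (intro mult_mono) auto
      then show ?case by simp
    qed
  qed (auto intro: W_integrable)
  moreover have "eventually (\<lambda>k. expectation (?f k) = (lap z - lap (z + of_real (h k))) / of_real (h k)) sequentially"
    using hpos
  proof eventually_elim
    case (elim k)
    have "expectation (?f k) = expectation (\<lambda>x. (exp (- (z * of_real (W x))) - exp (- ((z + of_real (h k)) * of_real (W x)))) / of_real (h k))"
      by (intro Bochner_Integration.integral_cong refl)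
         (use elim in \<open>simp add: field_simps exp_add[symmetric] exp_of_real[symmetric] exp_diff exp_minus\<close>)
    also have "\<dots> = (lap z - lap (z + of_real (h k))) / of_real (h k)"
      using assms(1) elim by (simp add: lap_def Bochner_Integration.integral_diff lap_integrable)
    finally show ?case .
  qed
  ultimately show ?thesis by (rule Lim_transform_eventually)
qed

text \<open>A difference quotient at m^n z is a difference of f_n at two values of the transform
  near z, divided by an increment that is m^n times longer. The contraction of f_n gives \<gamma>^n
  and the longer increment m^(-n). The transform must stay below s along a short segment because
  both endpoints enter.\<close>

lemma dlap_scale:
  assumes "s < 1"
  obtains C where "C > 0" "\<And>n z d. 0 \<le> Re z \<Longrightarrow> 0 < d \<Longrightarrow> (\<And>h. 0 \<le> h \<Longrightarrow> h \<le> d \<Longrightarrow> norm (lap (z + of_real h)) \<le> s) \<Longrightarrow>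
    norm (dlap (of_real (m ^ n) * z)) \<le> C * (\<gamma> / m) ^ n * norm (dlap z)"
proof -
  obtain C where C: "C > 0" "\<And>n (a::complex) b. norm a \<le> s \<Longrightarrow> norm b \<le> s \<Longrightarrow>
    norm ((pgf ^^ n) a - (pgf ^^ n) b) \<le> C * \<gamma> ^ n * norm (a - b)"
    using funpow_pgf_lipschitz[OF assms, where 'b=complex] by blast
  show ?thesis
  proof (rule that[OF C(1)])
    fix n z and d :: real
    assume z: "0 \<le> Re z" and d: "0 < d" and s: "\<And>h. 0 \<le> h \<Longrightarrow> h \<le> d \<Longrightarrow> norm (lap (z + of_real h)) \<le> s"
    define h where "h k = d * inverse (real (Suc k))" for k
    have h: "0 < h k" "h k \<le> d" for k using d by (auto simp: h_def field_simps)
    have h0: "h \<longlonglongrightarrow> 0" unfolding h_def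
      using tendsto_mult_right_zero[OF LIMSEQ_inverse_real_of_nat] by simp
    have f1: "filterlim h (at_right 0) sequentially"
      unfolding filterlim_at using h0 h less_imp_neq[OF h(1)] by auto
    have f2: "filterlim (\<lambda>k. m ^ n * h k) (at_right 0) sequentially"
      unfolding filterlim_at using tendsto_mult_right_zero[OF h0, of "m ^ n"] h m_gt1 less_imp_neq[OF h(1)] by (auto intro!: always_eventually)
    have Re: "0 \<le> Re (of_real (m ^ n) * z)" using z m_gt1 by (simp flip: of_real_power)
    have l1: "(\<lambda>k. norm ((lap (of_real (m ^ n) * z) - lap (of_real (m ^ n) * z + of_real (m ^ n * h k))) / of_real (m ^ n * h k)))
       \<longlonglongrightarrow> norm (dlap (of_real (m ^ n) * z))"
      by (intro tendsto_norm dlap_tendsto Re f2)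
    have l2: "(\<lambda>k. C * (\<gamma> / m) ^ n * norm ((lap z - lap (z + of_real (h k))) / of_real (h k)))
       \<longlonglongrightarrow> C * (\<gamma> / m) ^ n * norm (dlap z)"
      by (intro tendsto_intros dlap_tendsto z f1)
    show "norm (dlap (of_real (m ^ n) * z)) \<le> C * (\<gamma> / m) ^ n * norm (dlap z)"
    proof (rule LIMSEQ_le[OF l1 l2], intro exI allI impI)
      fix k
      have "lap (of_real (m ^ n) * z + of_real (m ^ n * h k)) = (pgf ^^ n) (lap (z + of_real (h k)))"
        using lap_scale_power[of "z + of_real (h k)" n] z h[of k] by (simp add: distrib_left)
      then have "norm (lap (of_real (m ^ n) * z) - lap (of_real (m ^ n) * z + of_real (m ^ n * h k))) \<le> C * \<gamma> ^ n * norm (lap z - lap (z + of_real (h k)))"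
        using lap_scale_power[of z n] z C(2)[of "lap z" "lap (z + of_real (h k))" n] s[of 0] s[of "h k"] h[of k] d by simp
      then have "norm (lap (of_real (m ^ n) * z) - lap (of_real (m ^ n) * z + of_real (m ^ n * h k))) / (m ^ n * h k) \<le> C * \<gamma> ^ n * norm (lap z - lap (z + of_real (h k))) / (m ^ n * h k)"
        using m_gt1 h[of k] by (intro divide_right_mono) auto
      then show "norm ((lap (of_real (m ^ n) * z) - lap (of_real (m ^ n) * z + of_real (m ^ n * h k))) / of_real (m ^ n * h k)) \<le> C * (\<gamma> / m) ^ n * norm ((lap z - lap (z + of_real (h k))) / of_real (h k))"
        using m_gt1 h[of k] by (simp add: norm_divide norm_mult norm_power power_divide)
    qed
  qed
qed

text \<open>Normalization behind every scaling argument below: an arbitrary scale is compared with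
  the nearest power of m beneath it.\<close>

lemma ex_power_m:
  assumes "1 \<le> (x::real)"
  obtains n where "m ^ n \<le> x" "x < m ^ Suc n"
proof -
  obtain N where "x < m ^ N" using real_arch_pow[OF m_gt1] by blast
  define n where "n = (LEAST n. x < m ^ n)"
  have 1: "x < m ^ n" unfolding n_def by (rule LeastI) (rule \<open>x < m ^ N\<close>)
  have "n \<noteq> 0" using 1 assms by (intro notI) simp
  then obtain k where k: "n = Suc k" by (cases n) auto
  have "\<not> x < m ^ k" using not_less_Least[of k "\<lambda>n. x < m ^ n"] k by (simp add: n_def)
  then show ?thesis using that[of k] 1 k by simp
qed

text \<open>Dividing by m^n \<le> |t| < m^(n+1) brings the frequency into [1, m]. There the modulus
  of the transform is bounded away from 1 by compactness, and (\<gamma> / m)^n = (m^n)^(-1-\<alpha>)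
  is of order |t|^(-1-\<alpha>).\<close>

lemma dlap_decay:
  obtains C where "C > 0" "\<And>t. norm (dlap (Complex 1 t)) \<le> C * (1 + \<bar>t\<bar>) powr (- 1 - \<alpha>)"
proof -
  \<comment> \<open>Real parts up to 2: the scaled point has real part m^(-n) \<le> 1, and
    increments up to 1 are added to it.\<close>
  define K where "K = {z. 0 \<le> Re z \<and> Re z \<le> 2 \<and> 1 \<le> \<bar>Im z\<bar> \<and> \<bar>Im z\<bar> \<le> m}"
  have K: "compact K"
  proof -
    have "closed K" unfolding K_def
      by (intro closed_Collect_conj closed_Collect_le continuous_intros)
    moreover have "norm z \<le> 2 + m" if "z \<in> K" for z
      using cmod_le[of z] that by (auto simp: K_def)
    then have "bounded K" by (auto simp: bounded_iff)
    ultimately show ?thesis by (simp add: compact_eq_bounded_closed)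
  qed
  have "Complex 0 1 \<in> K" using m_gt1 by (auto simp: K_def)
  have "continuous_on K (\<lambda>z. norm (lap z))"
  proof (intro continuous_on_norm)
    show "continuous_on K lap" unfolding continuous_on_iff
      using lap_lipschitz by (auto simp: K_def dist_norm intro: le_less_trans)
  qed
  from continuous_attains_sup[OF K _ this] \<open>Complex 0 1 \<in> K\<close>
  obtain z0 where z0: "z0 \<in> K" "\<And>z. z \<in> K \<Longrightarrow> norm (lap z) \<le> norm (lap z0)" by blast
  define s where "s = norm (lap z0)"
  have "s < 1" unfolding s_def using z0(1) by (intro norm_lap_lt_1) (auto simp: K_def)
  then obtain C where C: "C > 0" "\<And>n z d. 0 \<le> Re z \<Longrightarrow> 0 < d \<Longrightarrow> (\<And>h. 0 \<le> h \<Longrightarrow> h \<le> d \<Longrightarrow> norm (lap (z + of_real h)) \<le> s) \<Longrightarrow>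
    norm (dlap (of_real (m ^ n) * z)) \<le> C * (\<gamma> / m) ^ n * norm (dlap z)"
    using dlap_scale[OF \<open>s < 1\<close>] by blast
  \<comment> \<open>The factor absorbs 1 + |t| \<le> 2 m * m^n; for |t| < 1 it makes the trivial
    bound \<open>norm_dlap_le_1\<close> sufficient.\<close>
  define C' where "C' = max C 1 * (2 * m) powr (1 + \<alpha>)"
  have "norm (dlap (Complex 1 t)) \<le> C' * (1 + \<bar>t\<bar>) powr (- 1 - \<alpha>)" for t
  proof -
    have *: "max C 1 \<le> C' * (1 + \<bar>t\<bar>) powr (- 1 - \<alpha>)" if "\<bar>t\<bar> < 1"
    proof -
      have "(2 * m) powr (- 1 - \<alpha>) \<le> (1 + \<bar>t\<bar>) powr (- 1 - \<alpha>)"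
        using that m_gt1 alpha_pos by (intro powr_mono2') auto
      then have "max C 1 * ((2 * m) powr (1 + \<alpha>) * (2 * m) powr (- 1 - \<alpha>)) \<le> max C 1 * ((2 * m) powr (1 + \<alpha>) * (1 + \<bar>t\<bar>) powr (- 1 - \<alpha>))"
        by (intro mult_left_mono) auto
      then show ?thesis using m_gt1 by (simp add: C'_def mult.assoc flip: powr_add)
    qed
    show ?thesis
    proof (cases "\<bar>t\<bar> < 1")
      case True
      have "norm (dlap (Complex 1 t)) \<le> 1" by (rule norm_dlap_le_1) simp
      then show ?thesis using *[OF True] by simp
    next
      case False
      then obtain n where n: "m ^ n \<le> \<bar>t\<bar>" "\<bar>t\<bar> < m ^ Suc n" using ex_power_m[of "\<bar>t\<bar>"] by auto
      define z where "z = Complex (1 / m ^ n) (t / m ^ n)"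
      have mn: "m ^ n \<ge> 1" using m_gt1 by simp
      have zK: "z + of_real h \<in> K" if "0 \<le> h" "h \<le> 1" for h
      proof -
        have "h * m ^ n \<le> 1 * m ^ n" using that mn by (intro mult_right_mono) auto
        then have "1 + h * m ^ n \<le> 2 * m ^ n" using mn by linarith
        then show ?thesis using n mn that m_gt1 by (auto simp: K_def z_def field_simps)
      qed
      have "norm (dlap (of_real (m ^ n) * z)) \<le> C * (\<gamma> / m) ^ n * norm (dlap z)"
        using z0(2) zK mn by (intro C(2)[of z 1]) (auto simp: s_def z_def)
      also have "of_real (m ^ n) * z = Complex 1 t"
        using mn m_gt1 by (auto simp: z_def complex_eq_iff)
      also have "C * (\<gamma> / m) ^ n * norm (dlap z) \<le> max C 1 * (\<gamma> / m) ^ n * 1"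
        using C(1) m_gt1 mn norm_dlap_le_1[of z] by (intro mult_mono) (auto simp: z_def)
      also have "(\<gamma> / m) ^ n = (m ^ n) powr (- 1 - \<alpha>)"
      proof -
        have e: "- 1 - \<alpha> = - \<alpha> + (- 1)" by simp
        have "(m ^ n) powr (- 1 - \<alpha>) = (m ^ n) powr (- \<alpha>) * (m ^ n) powr (- 1)"
          unfolding e by (rule powr_add)
        also have "\<dots> = \<gamma> ^ n * inverse (m ^ n)"
          using mn m_gt1 unfolding gamma_power by (simp add: powr_minus)
        finally show ?thesis by (simp add: divide_inverse power_mult_distrib power_inverse)
      qed
      also have "max C 1 * (m ^ n) powr (- 1 - \<alpha>) * 1 \<le> max C 1 * ((2 * m) powr (1 + \<alpha>) * (1 + \<bar>t\<bar>) powr (- 1 - \<alpha>))"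
      proof -
        have "1 + \<bar>t\<bar> \<le> 2 * m * m ^ n" using n mn m_gt1 mult_mono[of 1 m 1 "m ^ n"] by simp
        then have "(2 * m * m ^ n) powr (- 1 - \<alpha>) \<le> (1 + \<bar>t\<bar>) powr (- 1 - \<alpha>)"
          using alpha_pos by (intro powr_mono2') auto
        then have "(2 * m) powr (1 + \<alpha>) * (2 * m * m ^ n) powr (- 1 - \<alpha>) \<le> (2 * m) powr (1 + \<alpha>) * (1 + \<bar>t\<bar>) powr (- 1 - \<alpha>)"
          by (intro mult_left_mono) auto
        moreover have "(2 * m) powr (1 + \<alpha>) * (2 * m * m ^ n) powr (- 1 - \<alpha>) = (m ^ n) powr (- 1 - \<alpha>)"
          using m_gt1 mn by (simp add: powr_mult mult.assoc[symmetric] powr_add[symmetric]) (simp add: mult_ac powr_add[symmetric])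
        ultimately show ?thesis by (simp add: mult_left_mono)
      qed
      finally show ?thesis by (simp add: C'_def mult.assoc)
    qed
  qed
  moreover have "C' > 0" using m_gt1 by (simp add: C'_def)
  ultimately show ?thesis using that by blast
qed

text \<open>The point m^k + i t is m^k times 1 + i t / m^k. On the half-plane Re z \<ge> 1 the
  transform is at most \<open>rlap 1\<close> < 1, so scaling adds (\<gamma> / m)^k to the decay on
  the line of real part 1.\<close>

lemma dlap_bound:
  obtains C where "C > 0" "\<And>k t. norm (dlap (Complex (m ^ k) t)) \<le> C * (\<gamma> / m) ^ k * (1 + \<bar>t\<bar> / m ^ k) powr (- 1 - \<alpha>)"
proof -
  obtain C0 where C0: "C0 > 0" "\<And>n z d. 0 \<le> Re z \<Longrightarrow> 0 < d \<Longrightarrow> (\<And>h. 0 \<le> h \<Longrightarrow> h \<le> d \<Longrightarrow> norm (lap (z + of_real h)) \<le> rlap 1) \<Longrightarrow>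
    norm (dlap (of_real (m ^ n) * z)) \<le> C0 * (\<gamma> / m) ^ n * norm (dlap z)"
    using dlap_scale[OF rlap_lt_1[of 1]] by auto
  obtain C1 where C1: "C1 > 0" "\<And>t. norm (dlap (Complex 1 t)) \<le> C1 * (1 + \<bar>t\<bar>) powr (- 1 - \<alpha>)"
    using dlap_decay by blast
  show ?thesis
  proof (rule that[of "C0 * C1"])
    fix k t
    have mk: "m ^ k > 0" using m_gt1 by simp
    have "Complex (m ^ k) t = of_real (m ^ k) * Complex 1 (t / m ^ k)"
      using mk m_gt1 by (simp add: complex_eq_iff)
    then have "norm (dlap (Complex (m ^ k) t)) \<le> C0 * (\<gamma> / m) ^ k * norm (dlap (Complex 1 (t / m ^ k)))"
      using C0(2)[of "Complex 1 (t / m ^ k)" 1 k] norm_lap_le_rlap[of 1] by simp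
    also have "\<dots> \<le> C0 * (\<gamma> / m) ^ k * (C1 * (1 + \<bar>t / m ^ k\<bar>) powr (- 1 - \<alpha>))"
      using C0(1) m_gt1 by (intro mult_left_mono C1) auto
    finally show "norm (dlap (Complex (m ^ k) t)) \<le> C0 * C1 * (\<gamma> / m) ^ k * (1 + \<bar>t\<bar> / m ^ k) powr (- 1 - \<alpha>)"
      using mk by (simp add: mult_ac)
  qed (use C0 C1 in auto)
qed

text \<open>Fourier inversion of the exponentially tilted, size-biased law \<open>u exp (- m^k u) w u du\<close>. Size biasing
  makes the transform integrable for every \<open>\<alpha> > 0\<close>; tilting at the scale \<open>m^k\<close> gives the factor \<open>\<gamma>^k\<close>.\<close>

lemma w_tilted_bound:
  obtains C where "C > 0" "\<And>k u. 0 < u \<Longrightarrow> u * exp (- (m ^ k * u)) * w u \<le> C * \<gamma> ^ k"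
proof -
  obtain C where C: "C > 0" "\<And>k t. norm (dlap (Complex (m ^ k) t)) \<le> C * (\<gamma> / m) ^ k * (1 + \<bar>t\<bar> / m ^ k) powr (- 1 - \<alpha>)"
    using dlap_bound by blast
  have "u * exp (- (m ^ k * u)) * w u \<le> 2 * C / \<alpha> * \<gamma> ^ k" if "0 < u" for k u
  proof -
    define a where "a = m ^ k"
    have a: "a > 0" using m_gt1 by (simp add: a_def)
    define d where "d = expectation (\<lambda>x. W x * exp (- (a * W x)))"
    have int: "integrable M (\<lambda>x. W x * exp (- (a * W x)))"
      by (rule Bochner_Integration.integrable_bound[OF W_integrable])
         (use W_nonneg a in \<open>auto elim!: eventually_mono simp: abs_mult mult_left_le\<close>)
    have nn: "AE x in M. 0 \<le> W x * exp (- (a * W x))" using W_nonneg by eventually_elim auto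
    have "d \<noteq> 0"
    proof
      assume "d = 0"
      then have "AE x in M. W x * exp (- (a * W x)) = 0"
        unfolding d_def using int nn by (subst (asm) integral_nonneg_eq_0_iff_AE) auto
      then show False using not_AE_W_0 by simp
    qed
    moreover have "d \<ge> 0" unfolding d_def using nn by (rule integral_nonneg_AE)
    ultimately have d: "d > 0" by simp
    define g where "g x = W x * exp (- (a * W x)) / d" for x
    have [measurable]: "g \<in> borel_measurable M" by (simp add: g_def[abs_def])
    have g0: "AE x in M. 0 \<le> g x" using nn by eventually_elim (use d in \<open>simp add: g_def\<close>)
    \<comment> \<open>The tilted, size-biased probability: its transform on the real line is
      \<open>dlap\<close> on the vertical line through m^k, divided by the normalization d.\<close>
    define Q where "Q = density M (\<lambda>x. ennreal (g x))"
    have "prob_space Q"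
    proof
      have "emeasure Q (space Q) = (\<integral>\<^sup>+x. ennreal (g x) \<partial>M)"
        unfolding Q_def by (subst emeasure_density) (auto intro!: nn_integral_cong)
      also have "\<dots> = ennreal (expectation g)"
        using int g0 by (intro nn_integral_eq_integral) (auto simp: g_def[abs_def])
      also have "expectation g = 1" using d by (simp add: g_def[abs_def] d_def[symmetric])
      finally show "emeasure Q (space Q) = 1" by simp
    qed
    then interpret Q: prob_space Q .
    define N where "N = distr Q borel W"
    have WQ[measurable]: "W \<in> borel_measurable Q" by (simp add: Q_def)
    interpret N: real_distribution N unfolding N_def by (rule Q.real_distribution_distr) (rule WQ)
    have emN: "emeasure N B = (\<integral>\<^sup>+v\<in>B. ennreal (v * exp (- (a * v)) / d * w v) \<partial>lborel)"
      if [measurable]: "B \<in> sets borel" and B: "B \<subseteq> {0<..}" for B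
    proof -
      have "emeasure N B = (\<integral>\<^sup>+x. ennreal (g x) * indicator (W -` B \<inter> space M) x \<partial>M)"
        unfolding N_def Q_def by (simp add: emeasure_distr emeasure_density)
      also have "\<dots> = (\<integral>\<^sup>+x. (\<lambda>v. ennreal (v * exp (- (a * v)) / d) * indicator B v) (W x) * indicator {0<..} (W x) \<partial>M)"
        using B by (intro nn_integral_cong) (auto simp: g_def indicator_def)
      also have "\<dots> = (\<integral>\<^sup>+v. ennreal (v * exp (- (a * v)) / d) * indicator B v * ennreal (w0 v) \<partial>lborel)"
        by (rule nn_integral_W) measurable
      also have "\<dots> = (\<integral>\<^sup>+v\<in>B. ennreal (v * exp (- (a * v)) / d * w v) \<partial>lborel)"
      proof (intro nn_integral_cong)
        fix v :: real
        show "ennreal (v * exp (- (a * v)) / d) * indicator B v * ennreal (w0 v) = ennreal (v * exp (- (a * v)) / d * w v) * indicator B v"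
          using B w_nonneg[of v] d
          by (cases "v \<in> B") (auto simp: w0_def subset_eq ennreal_mult'[symmetric])
      qed
      finally show ?thesis .
    qed
    have N0: "measure N {x} = 0" if "0 < x" for x
    proof -
      have "emeasure N {x} = (\<integral>\<^sup>+v\<in>{x}. ennreal (v * exp (- (a * v)) / d * w v) \<partial>lborel)"
        using that by (intro emN) auto
      also have "\<dots> = 0" by (rule nn_integral_null_set) (auto intro: countable_imp_null_set_lborel)
      finally show ?thesis by (simp add: measure_def)
    qed
    have char: "char N t = dlap (Complex a (- t)) / of_real d" for t
    proof -
      have "char N t = (\<integral>x. iexp (t * W x) \<partial>Q)"
        unfolding char_def N_def by (subst integral_distr) auto
      also have "\<dots> = expectation (\<lambda>x. g x *\<^sub>R iexp (t * W x))"
        unfolding Q_def using g0 by (subst integral_density) auto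
      also have "\<dots> = expectation (\<lambda>x. (of_real (W x) * exp (- (Complex a (- t) * of_real (W x)))) / of_real d)"
      proof (intro Bochner_Integration.integral_cong refl)
        fix x
        have e: "- (Complex a (- t) * of_real (W x)) = of_real (- (a * W x)) + \<i> * of_real (t * W x)"
          by (simp add: complex_eq_iff)
        show "g x *\<^sub>R iexp (t * W x) = (of_real (W x) * exp (- (Complex a (- t) * of_real (W x)))) / of_real d"
          unfolding e exp_add exp_of_real g_def by (simp add: scaleR_conv_of_real)
      qed
      finally show ?thesis by (simp add: dlap_def)
    qed
    define K where "K = C * (\<gamma> / m) ^ k / d"
    have K: "K > 0" using C d m_gt1 by (simp add: K_def)
    define H where "H t = K * (1 + \<bar>t\<bar> / a) powr (- 1 - \<alpha>)" for t
    have [measurable]: "H \<in> borel_measurable borel" by (simp add: H_def[abs_def])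
    \<comment> \<open>Integrating over frequencies at scale m^k costs a factor of order m^k, which
      cancels the m^(-k) in (\<gamma> / m)^k and leaves \<gamma>^k.\<close>
    have Hnn: "(\<integral>\<^sup>+t. ennreal (H t) \<partial>lborel) \<le> ennreal (K * (2 * a / \<alpha>))"
    proof -
      have "(\<integral>\<^sup>+t. ennreal (H t) \<partial>lborel) = ennreal K * (\<integral>\<^sup>+t. ennreal ((1 + \<bar>t\<bar> / a) powr (- 1 - \<alpha>)) \<partial>lborel)"
        unfolding H_def using K by (subst nn_integral_cmult[symmetric]) (auto simp: ennreal_mult)
      also have "\<dots> \<le> ennreal K * ennreal (2 * a / \<alpha>)"
        by (intro mult_left_mono nn_integral_powr_tail a alpha_pos) auto
      also have "\<dots> = ennreal (K * (2 * a / \<alpha>))" using K a alpha_pos by (intro ennreal_mult[symmetric]) auto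
      finally show ?thesis .
    qed
    have H0: "0 \<le> H t" for t using K by (simp add: H_def)
    have Hint: "integrable lborel H"
      by (rule integrableI_nonneg) (use H0 le_less_trans[OF Hnn ennreal_less_top] in auto)
    have Hle: "(\<integral>t. H t \<partial>lborel) \<le> K * (2 * a / \<alpha>)"
      using Hnn K a alpha_pos H0 by (subst (asm) nn_integral_eq_integral[OF Hint]) auto
    have charH: "norm (char N t) \<le> H t" for t
    proof -
      have "norm (char N t) = norm (dlap (Complex a (- t))) / d" using d by (simp add: char norm_divide)
      also have "\<dots> \<le> (C * (\<gamma> / m) ^ k * (1 + \<bar>- t\<bar> / a) powr (- 1 - \<alpha>)) / d"
        using C(2)[of k "- t"] d by (intro divide_right_mono) (auto simp: a_def)
      finally show ?thesis by (simp add: H_def K_def)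
    qed
    have "u * exp (- (a * u)) / d * w u \<le> K * (2 * a / \<alpha>)"
    proof (rule continuous_le_of_nn_integral_le[where f="\<lambda>u. u * exp (- (a * u)) / d * w u" and g="\<lambda>_. K * (2 * a / \<alpha>)", OF _ _ _ _ that])
      fix x y :: real assume xy: "0 < x" "x < y"
      have "(\<integral>\<^sup>+v\<in>{x<..y}. ennreal (v * exp (- (a * v)) / d * w v) \<partial>lborel) = emeasure N {x<..y}"
        using xy by (intro emN[symmetric]) auto
      also have "\<dots> = ennreal (measure N {x<..y})" by (rule N.emeasure_eq_measure)
      also have "\<dots> \<le> ennreal ((y - x) * (K * (2 * a / \<alpha>)))"
        using N.measure_Ioc_le_char_bound[OF _ N0 N0 charH Hint, of x y] xy mult_left_mono[OF Hle, of "y - x"]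
        by (intro ennreal_leI) simp
      also have "\<dots> = ennreal (K * (2 * a / \<alpha>)) * ennreal (y - x)"
        using xy K a alpha_pos by (subst mult.commute, intro ennreal_mult) auto
      also have "\<dots> = (\<integral>\<^sup>+v\<in>{x<..y}. ennreal (K * (2 * a / \<alpha>)) \<partial>lborel)"
        using xy by (subst nn_integral_cmult_indicator) auto
      finally show "(\<integral>\<^sup>+v\<in>{x<..y}. ennreal (v * exp (- (a * v)) / d * w v) \<partial>lborel) \<le> (\<integral>\<^sup>+v\<in>{x<..y}. ennreal (K * (2 * a / \<alpha>)) \<partial>lborel)" .
    qed (use K a alpha_pos d in \<open>auto intro!: continuous_intros w_cont\<close>)
    then have "d * (u * exp (- (a * u)) / d * w u) \<le> d * (K * (2 * a / \<alpha>))"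
      using d by (intro mult_left_mono) auto
    moreover have "d * (u * exp (- (a * u)) / d * w u) = u * exp (- (a * u)) * w u"
      "d * (K * (2 * a / \<alpha>)) = C * (\<gamma> / m) ^ k * (2 * a / \<alpha>)" using d by (simp_all add: K_def)
    ultimately have "u * exp (- (a * u)) * w u \<le> C * (\<gamma> / m) ^ k * (2 * a / \<alpha>)" by (simp only:)
    also have "\<dots> = 2 * C / \<alpha> * \<gamma> ^ k" using m_gt1 by (simp add: a_def power_divide)
    finally show ?thesis by (simp add: a_def)
  qed
  moreover have "2 * C / \<alpha> > 0" using C alpha_pos by simp
  ultimately show ?thesis using that by blast
qed

text \<open>The tilt is matched to the point: with m^k of order 1 / u the exponential stays above
  exp(-m), while \<gamma>^k is of order u^\<alpha>.\<close>

lemma w_upper_bound: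
  obtains C where "C > 0" "\<And>u. 0 < u \<Longrightarrow> u \<le> 1 \<Longrightarrow> u powr (1 - \<alpha>) * w u \<le> C"
proof -
  obtain C where C: "C > 0" "\<And>k u. 0 < u \<Longrightarrow> u * exp (- (m ^ k * u)) * w u \<le> C * \<gamma> ^ k"
    using w_tilted_bound by blast
  have "u powr (1 - \<alpha>) * w u \<le> C * m powr \<alpha> * exp m" if u: "0 < u" "u \<le> 1" for u
  proof -
    obtain k where k: "m ^ k \<le> 1 / u" "1 / u < m ^ Suc k" using ex_power_m[of "1 / u"] u by auto
    have "m ^ k * u \<le> m" using k(1) u m_gt1 by (simp add: field_simps)
    then have "exp (- m) \<le> exp (- (m ^ k * u))" by simp
    then have "u * exp (- m) * w u \<le> u * exp (- (m ^ k * u)) * w u"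
      using u w_nonneg[of u] by (intro mult_right_mono mult_left_mono) auto
    also have "\<dots> \<le> C * \<gamma> ^ k" using u by (intro C)
    also have "\<gamma> ^ k \<le> (m * u) powr \<alpha>"
    proof -
      have "(m ^ k) powr (- \<alpha>) \<le> (1 / (m * u)) powr (- \<alpha>)"
        using k(2) u m_gt1 alpha_pos by (intro powr_mono2') (auto simp: field_simps)
      also have "\<dots> = (m * u) powr \<alpha>" using u m_gt1 by (simp add: powr_minus powr_divide)
      finally show ?thesis by (simp only: gamma_power)
    qed
    finally have "u * exp (- m) * w u \<le> C * (m * u) powr \<alpha>" using C by simp
    then have "u * w u \<le> C * (m * u) powr \<alpha> * exp m" by (simp add: exp_minus field_simps)
    also have "\<dots> = C * m powr \<alpha> * exp m * u powr \<alpha>" using u m_gt1 by (simp add: powr_mult)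
    finally have "u powr (- \<alpha>) * (u * w u) \<le> u powr (- \<alpha>) * (C * m powr \<alpha> * exp m * u powr \<alpha>)"
      by (intro mult_left_mono) auto
    moreover have "u powr (- \<alpha>) * (u * w u) = u powr (1 - \<alpha>) * w u"
      using u by (simp add: powr_diff powr_minus field_simps)
    moreover have "u powr (- \<alpha>) * (C * m powr \<alpha> * exp m * u powr \<alpha>) = C * m powr \<alpha> * exp m"
      using u by (simp add: powr_minus)
    ultimately show ?thesis by simp
  qed
  moreover have "C * m powr \<alpha> * exp m > 0" using C m_gt1 by simp
  ultimately show ?thesis using that by blast
qed

end

section \<open>The lower bound for the density near zero\<close>

context schroeder_gw
begin

section \<open>Independent copies of W and the branching identity in law\<close>

definition law :: "real measure" where "law = distr M borel W"

text \<open>Fresh copies on a product space: the limits of the subtrees are not among the given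
  variables, so the branching property is stated for laws only.\<close>

definition copies :: "(nat \<Rightarrow> real) measure" where "copies = PiM UNIV (\<lambda>_. law)"

definition law_sum :: "nat \<Rightarrow> real measure" where
  "law_sum k = distr copies borel (\<lambda>\<omega>. \<Sum>i<k. \<omega> i)"

lemma law_real_distribution: "real_distribution law"
  unfolding law_def by (rule real_distribution_distr) simp

lemma law_prob_space: "prob_space law"
  using law_real_distribution by (simp add: real_distribution_def)

lemma sets_law [simp, measurable_cong]: "sets law = sets borel" and space_law [simp]: "space law = UNIV"
  by (simp_all add: law_def)

lemma copies_prob_space: "prob_space copies"
  unfolding copies_def using law_prob_space by (intro prob_space_PiM)

lemma copies_component_measurable: "(\<lambda>\<omega>. \<omega> i) \<in> borel_measurable copies"
proof -
  have "(\<lambda>\<omega>. \<omega> i) \<in> measurable copies law" unfolding copies_def by (rule measurable_component_singleton) simp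
  then show ?thesis by (simp cong: measurable_cong_sets)
qed

lemma distr_copies: "distr copies borel (\<lambda>\<omega>. \<omega> i) = law"
proof -
  have "distr copies borel (\<lambda>\<omega>. \<omega> i) = distr copies law (\<lambda>\<omega>. \<omega> i)"
    by (intro distr_cong) auto
  also have "\<dots> = law" unfolding copies_def
    using law_prob_space by (intro distr_PiM_component) auto
  finally show ?thesis .
qed

lemma indep_copies: "prob_space.indep_vars copies (\<lambda>_. borel) (\<lambda>i \<omega>. \<omega> i) UNIV"
proof -
  interpret C: prob_space copies by (rule copies_prob_space)
  note [measurable] = copies_component_measurable
  have s: "sets copies = sets (PiM UNIV (\<lambda>_. borel))"
    unfolding copies_def by (intro sets_PiM_cong) auto
  have "distr copies (PiM UNIV (\<lambda>_. borel)) (\<lambda>\<omega>. \<lambda>i\<in>UNIV. \<omega> i) = distr copies copies (\<lambda>\<omega>. \<omega>)"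
    using s by (intro distr_cong) auto
  also have "\<dots> = copies" by simp
  also have "\<dots> = PiM UNIV (\<lambda>i. distr copies borel (\<lambda>\<omega>. \<omega> i))"
    by (simp add: distr_copies) (simp add: copies_def)
  finally show ?thesis by (subst C.indep_vars_iff_distr_eq_PiM') auto
qed

lemma law_sum_prob_space: "prob_space (law_sum k)"
proof -
  interpret C: prob_space copies by (rule copies_prob_space)
  note [measurable] = copies_component_measurable
  show ?thesis unfolding law_sum_def by (rule C.prob_space_distr) measurable
qed

lemma sets_law_sum [simp, measurable_cong]: "sets (law_sum k) = sets borel" and space_law_sum [simp]: "space (law_sum k) = UNIV"
  by (simp_all add: law_sum_def)

lemma char_law_sum: "char (law_sum k) t = char law t ^ k"
proof -
  interpret C: prob_space copies by (rule copies_prob_space)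
  note [measurable] = copies_component_measurable
  have "C.indep_vars (\<lambda>_. borel) (\<lambda>i \<omega>. \<omega> i) {..<k}"
    using indep_copies by (rule C.indep_vars_subset) simp
  then show ?thesis unfolding law_sum_def by (subst C.char_distr_sum) (auto simp: distr_copies)
qed

lemma law_sum_Suc: "law_sum (Suc k) = convolution (law_sum k) law"
proof -
  interpret C: prob_space copies by (rule copies_prob_space)
  note [measurable] = copies_component_measurable
  have "C.indep_vars (\<lambda>_. borel) (\<lambda>i \<omega>. \<omega> i) (insert k {..<k})"
    using indep_copies by (rule C.indep_vars_subset) simp
  then have "C.indep_var borel (\<lambda>\<omega>. \<omega> k) borel (\<lambda>\<omega>. \<Sum>i<k. \<omega> i)"
    by (intro C.indep_vars_sum) auto
  then have "distr copies borel (\<lambda>\<omega>. \<omega> k + (\<Sum>i<k. \<omega> i)) = convolution law (law_sum k)"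
    unfolding law_sum_def by (subst C.sum_indep_random_variable) (auto simp: distr_copies)
  then have "law_sum (Suc k) = convolution law (law_sum k)" by (simp add: law_sum_def add.commute)
  also have "\<dots> = convolution (law_sum k) law"
    using law_prob_space law_sum_prob_space[of k]
    by (intro convolution_commutative) (auto simp: prob_space_def)
  finally show ?thesis .
qed

lemma emeasure_law_sum_Suc:
  assumes "A \<in> sets borel"
  shows "emeasure (law_sum (Suc k)) A = (\<integral>\<^sup>+y. emeasure law {a. a + y \<in> A} \<partial>law_sum k)"
  unfolding law_sum_Suc using assms law_prob_space law_sum_prob_space[of k]
  by (intro convolution_emeasure) (auto simp: prob_space_def)

definition P where "P = embed_pmf p"

lemma pmf_P: "pmf P k = p k"
  unfolding P_def
proof (rule pmf_embed_pmf)
  have "(\<integral>\<^sup>+x. ennreal (p x) \<partial>count_space UNIV) = (\<Sum>k. ennreal (p k))" by (rule nn_integral_count_space_nat)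
  also have "\<dots> = ennreal (\<Sum>k. p k)" using p_summable p_nonneg by (intro suminf_ennreal2) auto
  finally show "(\<integral>\<^sup>+x. ennreal (p x) \<partial>count_space UNIV) = 1" using p_sums by (simp add: sums_iff)
qed (rule p_nonneg)

lemma char_law: "char law t = lap (Complex 0 (- t))"
proof -
  have "\<i> * of_real (t * v) = - (Complex 0 (- t) * of_real v)" for v by (simp add: complex_eq_iff)
  then show ?thesis unfolding law_def char_def lap_def by (subst integral_distr) auto
qed

text \<open>On the imaginary axis the equation lap(m z) = f(lap z) says that m W and a sum of a
  random number of copies of W, with the offspring law for the number, have the same characteristic
  function.\<close>

lemma law_scaled: "distr M borel (\<lambda>x. m * W x) = measure_pmf P \<bind> law_sum"
proof (rule Levy_uniqueness)
  show "real_distribution (distr M borel (\<lambda>x. m * W x))" by (rule real_distribution_distr) simp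
  have K: "law_sum \<in> measurable (measure_pmf P) (subprob_algebra borel)"
    using law_sum_prob_space by (auto simp: space_subprob_algebra intro!: prob_space_imp_subprob_space)
  have sets: "sets (measure_pmf P \<bind> law_sum) = sets borel"
    by (rule sets_bind[OF _ ]) auto
  have "prob_space (measure_pmf P \<bind> law_sum)"
    by (rule measure_pmf.prob_space_bind[OF _ K]) (use law_sum_prob_space in auto)
  then show "real_distribution (measure_pmf P \<bind> law_sum)"
    using sets sets_eq_imp_space_eq[OF sets]
    by (auto simp: real_distribution_def real_distribution_axioms_def)
  show "char (distr M borel (\<lambda>x. m * W x)) = char (measure_pmf P \<bind> law_sum)"
  proof
    fix t
    have "char (distr M borel (\<lambda>x. m * W x)) t = lap (of_real m * Complex 0 (- t))"
    proof -
      have "\<i> * of_real (t * (m * v)) = - ((of_real m * Complex 0 (- t)) * of_real v)" for v by (simp add: complex_eq_iff)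
      then show ?thesis unfolding char_def lap_def by (subst integral_distr) auto
    qed
    also have "\<dots> = pgf (char law t)" by (simp add: lap_scale char_law)
    finally have 1: "char (distr M borel (\<lambda>x. m * W x)) t = pgf (char law t)" .
    have bd: "norm (char law t) \<le> 1" unfolding char_law by (rule norm_lap_le_1) simp
    have 2: "measure_pmf.expectation P (\<lambda>k. char law t ^ k) = pgf (char law t)"
      using measure_pmf.expectation_nat_sums[of id P "\<lambda>k. char law t ^ k" 1] bd
      by (simp add: norm_power power_le_one pgf_def sums_iff scaleR_conv_of_real pmf_P pmf.rep_eq[symmetric] measure_pmf_single)
    \<comment> \<open>The mixture is evaluated on real integrands and applied to cosine and sine,
      the two parts of the characteristic function.\<close>
    have real_bind: "integral\<^sup>L (measure_pmf P \<bind> law_sum) h = measure_pmf.expectation P (\<lambda>k. integral\<^sup>L (law_sum k) h)"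
      if "h \<in> borel_measurable borel" "\<And>v. \<bar>h v\<bar> \<le> 1" for h :: "real \<Rightarrow> real"
      by (rule integral_bind[where B=1 and B'=1, OF that(1) _ K])
         (use that prob_space.emeasure_space_1[OF law_sum_prob_space] in \<open>auto simp: measure_pmf.finite_measure_axioms\<close>)
    have int: "integrable N (\<lambda>v. iexp (t * v))" if "prob_space N" "sets N = sets borel" for N
    proof -
      interpret N: prob_space N by fact
      show ?thesis using that(2) by (intro N.integrable_const_bound[where B=1]) (auto simp: measurable_cong_sets[OF that(2) refl])
    qed
    have Re: "Re (char N t) = (\<integral>v. cos (t * v) \<partial>N)" "Im (char N t) = (\<integral>v. sin (t * v) \<partial>N)"
      if "prob_space N" "sets N = sets borel" for N
      using integral_Re[OF int[OF that]] integral_Im[OF int[OF that]]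
      by (auto simp: char_def Re_exp Im_exp)
    have bint: "integrable (measure_pmf P) (\<lambda>k. char (law_sum k) t)"
      using bd by (intro measure_pmf.integrable_const_bound[where B=1]) (auto simp: char_law_sum norm_power power_le_one)
    have "char (measure_pmf P \<bind> law_sum) t = measure_pmf.expectation P (\<lambda>k. char (law_sum k) t)"
    proof (rule complex_eqI)
      show "Re (char (measure_pmf P \<bind> law_sum) t) = Re (measure_pmf.expectation P (\<lambda>k. char (law_sum k) t))"
        using Re[OF \<open>prob_space (measure_pmf P \<bind> law_sum)\<close> sets] Re[OF law_sum_prob_space sets_law_sum] real_bind[of "\<lambda>v. cos (t * v)"]
        by (simp flip: integral_Re[OF bint])
      show "Im (char (measure_pmf P \<bind> law_sum) t) = Im (measure_pmf.expectation P (\<lambda>k. char (law_sum k) t))"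
        using Re[OF \<open>prob_space (measure_pmf P \<bind> law_sum)\<close> sets] Re[OF law_sum_prob_space sets_law_sum] real_bind[of "\<lambda>v. sin (t * v)"]
        by (simp flip: integral_Im[OF bint])
    qed
    then show "char (distr M borel (\<lambda>x. m * W x)) t = char (measure_pmf P \<bind> law_sum) t"
      using 1 2 by (simp add: char_law_sum)
  qed
qed

lemma emeasure_scaled:
  assumes [measurable]: "A \<in> sets borel"
  shows "emeasure M {x \<in> space M. m * W x \<in> A} = (\<Sum>k. ennreal (p k) * emeasure (law_sum k) A)"
proof -
  have K: "law_sum \<in> measurable (measure_pmf P) (subprob_algebra borel)"
    using law_sum_prob_space by (auto simp: space_subprob_algebra intro!: prob_space_imp_subprob_space)
  have "emeasure M {x \<in> space M. m * W x \<in> A} = emeasure (distr M borel (\<lambda>x. m * W x)) A"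
    by (subst emeasure_distr) (auto intro!: arg_cong[where f="emeasure M"])
  also have "\<dots> = (\<integral>\<^sup>+k. emeasure (law_sum k) A \<partial>measure_pmf P)"
    unfolding law_scaled by (rule emeasure_bind[OF _ K]) auto
  also have "\<dots> = (\<Sum>k. ennreal (p k) * emeasure (law_sum k) A)"
    by (simp add: nn_integral_measure_pmf nn_integral_count_space_nat pmf_P)
  finally show ?thesis .
qed

lemma emeasure_law: "A \<in> sets borel \<Longrightarrow> emeasure law A = emeasure M {x \<in> space M. W x \<in> A}"
  unfolding law_def by (subst emeasure_distr) (auto intro!: arg_cong[where f="emeasure M"])

lemma emeasure_law_0: "emeasure law {0} = ennreal ext"
  using prob_W_0 by (simp add: emeasure_law emeasure_eq_measure)

lemma law_sum_0: "A \<in> sets borel \<Longrightarrow> emeasure (law_sum 0) A = indicator A 0"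
proof -
  interpret C: prob_space copies by (rule copies_prob_space)
  note [measurable] = copies_component_measurable
  show "A \<in> sets borel \<Longrightarrow> emeasure (law_sum 0) A = indicator A 0"
    unfolding law_sum_def by (subst emeasure_distr) (auto simp: C.emeasure_space_1 indicator_def)
qed

lemma law_sum_atom: "emeasure (law_sum k) {0} \<ge> ennreal (ext ^ k)"
proof (induction k)
  case (Suc k)
  have "ennreal (ext ^ Suc k) = ennreal ext * ennreal (ext ^ k)"
    using q_nonneg by (simp add: ennreal_mult)
  also have "\<dots> \<le> ennreal ext * emeasure (law_sum k) {0}" using Suc by (intro mult_left_mono) auto
  also have "\<dots> = (\<integral>\<^sup>+y. ennreal ext * indicator {0} y \<partial>law_sum k)"
    by (subst nn_integral_cmult_indicator) auto
  also have "\<dots> \<le> (\<integral>\<^sup>+y. emeasure law {a. a + y \<in> {0}} \<partial>law_sum k)"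
    by (intro nn_integral_mono) (auto simp: indicator_def emeasure_law_0)
  also have "\<dots> = emeasure (law_sum (Suc k)) {0}" by (rule emeasure_law_sum_Suc[symmetric]) simp
  finally show ?case .
qed (simp add: law_sum_0)

text \<open>The sum lies in A when one copy does and the others vanish. For different choices of
  that copy these events are disjoint, as 0 is not in A. In the induction either the first k copies
  sum to 0 and the last lies in A, or the other way round.\<close>

lemma law_sum_ge:
  assumes [measurable]: "A \<in> sets borel" and A: "A \<subseteq> {0<..}"
  shows "emeasure (law_sum k) A \<ge> ennreal (real k * ext ^ (k - 1)) * emeasure law A"
proof (induction k)
  case (Suc k)
  have "ennreal (real (Suc k) * ext ^ (Suc k - 1)) * emeasure law A =
     ennreal (ext ^ k) * emeasure law A + ennreal ext * (ennreal (real k * ext ^ (k - 1)) * emeasure law A)"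
  proof -
    have "real (Suc k) * ext ^ (Suc k - 1) = ext ^ k + ext * (real k * ext ^ (k - 1))"
      by (cases k) (auto simp: algebra_simps)
    moreover have "ennreal (ext ^ k + ext * (real k * ext ^ (k - 1))) = ennreal (ext ^ k) + ennreal ext * ennreal (real k * ext ^ (k - 1))"
      using q_nonneg by (subst ennreal_plus) (auto intro!: ennreal_mult)
    ultimately show ?thesis by (simp only: distrib_right mult.assoc)
  qed
  also have "\<dots> \<le> emeasure (law_sum k) {0} * emeasure law A + ennreal ext * emeasure (law_sum k) A"
    using Suc by (intro add_mono mult_right_mono mult_left_mono law_sum_atom) auto
  also have "\<dots> = (\<integral>\<^sup>+y. emeasure law A * indicator {0} y + ennreal ext * indicator A y \<partial>law_sum k)"
  proof -
    have "(\<integral>\<^sup>+y. emeasure law A * indicator {0} y + ennreal ext * indicator A y \<partial>law_sum k) =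
        (\<integral>\<^sup>+y. emeasure law A * indicator {0} y \<partial>law_sum k) + (\<integral>\<^sup>+y. ennreal ext * indicator A y \<partial>law_sum k)"
      by (rule nn_integral_add) (auto intro!: borel_measurable_times_ennreal borel_measurable_indicator)
    also have "(\<integral>\<^sup>+y. emeasure law A * indicator {0} y \<partial>law_sum k) = emeasure law A * emeasure (law_sum k) {0}"
      by (rule nn_integral_cmult_indicator) simp
    also have "(\<integral>\<^sup>+y. ennreal ext * indicator A y \<partial>law_sum k) = ennreal ext * emeasure (law_sum k) A"
      by (rule nn_integral_cmult_indicator) simp
    finally show ?thesis by (simp only: mult.commute)
  qed
  also have "\<dots> \<le> (\<integral>\<^sup>+y. emeasure law {a. a + y \<in> A} \<partial>law_sum k)"
  proof (intro nn_integral_mono)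
    fix y
    have "ennreal ext \<le> emeasure law {a. a + y \<in> A}" if "y \<in> A"
      unfolding emeasure_law_0[symmetric] using that by (intro emeasure_mono) auto
    moreover have "y \<noteq> 0" if "y \<in> A" using that A by auto
    ultimately show "emeasure law A * indicator {0} y + ennreal ext * indicator A y \<le> emeasure law {a. a + y \<in> A}"
      by (cases "y \<in> A"; cases "y = 0") auto
  qed
  also have "\<dots> = emeasure (law_sum (Suc k)) A" by (rule emeasure_law_sum_Suc[symmetric]) simp
  finally show ?case .
qed simp

text \<open>Only the event that a single child contributes is kept; averaging k * ext^(k-1) over the
  offspring law gives f'(ext) = \<gamma>.\<close>

lemma emeasure_scaled_ge:
  assumes [measurable]: "A \<in> sets borel" and A: "A \<subseteq> {0<..}"
  shows "emeasure M {x \<in> space M. m * W x \<in> A} \<ge> ennreal \<gamma> * emeasure M {x \<in> space M. W x \<in> A}"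
proof -
  have "ennreal \<gamma> * emeasure law A = (\<Sum>k. ennreal (real k * p k * ext ^ (k - 1))) * emeasure law A"
    unfolding \<gamma>_eq dpgf_def using dpgf_summable[of ext] q_nonneg q_lt_1 p_nonneg
    by (subst suminf_ennreal2) auto
  also have "\<dots> = (\<Sum>k. ennreal (real k * p k * ext ^ (k - 1)) * emeasure law A)" by simp
  also have "\<dots> \<le> (\<Sum>k. ennreal (p k) * emeasure (law_sum k) A)"
  proof (rule suminf_le)
    fix k
    have "ennreal (real k * p k * ext ^ (k - 1)) * emeasure law A = ennreal (p k) * (ennreal (real k * ext ^ (k - 1)) * emeasure law A)"
      using p_nonneg[of k] q_nonneg by (simp add: ennreal_mult mult_ac)
    also have "\<dots> \<le> ennreal (p k) * emeasure (law_sum k) A"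
      by (intro mult_left_mono law_sum_ge assms) auto
    finally show "ennreal (real k * p k * ext ^ (k - 1)) * emeasure law A \<le> ennreal (p k) * emeasure (law_sum k) A" .
  qed auto
  finally show ?thesis by (simp add: emeasure_scaled emeasure_law)
qed

text \<open>The density form of the previous bound, since m W has density w(u / m) / m at u. As m
  \<gamma> = m^(1-\<alpha>), it says that u^(1-\<alpha>) w(u) does not decrease under u -> u /
  m.\<close>

lemma w_scale_ge:
  assumes "0 < u"
  shows "m * \<gamma> * w u \<le> w (u / m)"
proof -
  have "m * \<gamma> * w u \<le> (\<lambda>u. w (u / m)) u"
  proof (rule continuous_le_of_nn_integral_le[where f="\<lambda>u. m * \<gamma> * w u", OF _ _ _ _ assms])
    show "continuous_on {0<..} (\<lambda>u. w (u / m))"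
      using m_gt1 by (intro continuous_on_compose2[OF w_cont] continuous_intros) auto
    fix x y :: real assume xy: "0 < x" "x < y"
    have "(\<integral>\<^sup>+u\<in>{x<..y}. ennreal (m * \<gamma> * w u) \<partial>lborel) = ennreal (m * \<gamma>) * (\<integral>\<^sup>+u\<in>{x<..y}. ennreal (w u) \<partial>lborel)"
    proof -
      have eq: "ennreal (w u) * indicator {x<..y} u = ennreal (w0 u) * indicator {x<..y} u" for u
        using xy by (auto simp: w0_def indicator_def)
      have "(\<integral>\<^sup>+u\<in>{x<..y}. ennreal (m * \<gamma> * w u) \<partial>lborel) = (\<integral>\<^sup>+u. ennreal (m * \<gamma>) * (ennreal (w0 u) * indicator {x<..y} u) \<partial>lborel)"
        using m_gt1 w_nonneg xy by (intro nn_integral_cong) (auto simp: w0_def indicator_def ennreal_mult)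
      then show ?thesis unfolding eq by (subst (asm) nn_integral_cmult) auto
    qed
    also have "(\<integral>\<^sup>+u\<in>{x<..y}. ennreal (w u) \<partial>lborel) = emeasure M {z \<in> space M. W z \<in> {x<..y}}"
      using xy by (intro w_density[symmetric]) auto
    also have "ennreal (m * \<gamma>) * emeasure M {z \<in> space M. W z \<in> {x<..y}} = ennreal m * (ennreal \<gamma> * emeasure M {z \<in> space M. W z \<in> {x<..y}})"
      using m_gt1 by (simp add: ennreal_mult mult_ac)
    also have "\<dots> \<le> ennreal m * emeasure M {z \<in> space M. m * W z \<in> {x<..y}}"
      using xy by (intro mult_left_mono emeasure_scaled_ge) auto
    also have "{z \<in> space M. m * W z \<in> {x<..y}} = {z \<in> space M. W z \<in> {x / m<..y / m}}"
      using m_gt1 by (auto simp: field_simps)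
    also have "emeasure M {z \<in> space M. W z \<in> {x / m<..y / m}} = (\<integral>\<^sup>+u\<in>{x / m<..y / m}. ennreal (w u) \<partial>lborel)"
      using xy m_gt1 by (intro w_density) (auto intro: less_trans[of 0 "x / m"])
    also have "\<dots> = (\<integral>\<^sup>+u. ennreal (w0 u) * indicator {x / m<..y / m} u \<partial>lborel)"
    proof (intro nn_integral_cong)
      fix u
      have "0 < x / m" using xy m_gt1 by simp
      then show "ennreal (w u) * indicator {x / m<..y / m} u = ennreal (w0 u) * indicator {x / m<..y / m} u"
        using less_trans[of 0 "x / m" u] by (auto simp: w0_def indicator_def)
    qed
    also have "\<dots> = ennreal (inverse m) * (\<integral>\<^sup>+u. ennreal (w0 (u / m)) * indicator {x<..y} u \<partial>lborel)"
    proof -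
      have "(\<integral>\<^sup>+u. ennreal (w0 u) * indicator {x / m<..y / m} u \<partial>lborel) =
          ennreal \<bar>inverse m\<bar> * (\<integral>\<^sup>+u. ennreal (w0 (0 + inverse m * u)) * indicator {x / m<..y / m} (0 + inverse m * u) \<partial>lborel)"
        using m_gt1 by (intro nn_integral_real_affine) auto
      also have "\<dots> = ennreal (inverse m) * (\<integral>\<^sup>+u. ennreal (w0 (u / m)) * indicator {x<..y} u \<partial>lborel)"
        using m_gt1 by (intro arg_cong2[where f="(*)"] nn_integral_cong) (auto simp: indicator_def field_simps)
      finally show ?thesis .
    qed
    also have "ennreal m * (ennreal (inverse m) * (\<integral>\<^sup>+u. ennreal (w0 (u / m)) * indicator {x<..y} u \<partial>lborel)) = (\<integral>\<^sup>+u. ennreal (w0 (u / m)) * indicator {x<..y} u \<partial>lborel)"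
      using m_gt1 by (simp add: mult.assoc[symmetric] ennreal_mult[symmetric])
    also have "\<dots> = (\<integral>\<^sup>+u\<in>{x<..y}. ennreal (w (u / m)) \<partial>lborel)"
      using xy m_gt1 by (intro nn_integral_cong) (auto simp: w0_def indicator_def)
    finally show "(\<integral>\<^sup>+u\<in>{x<..y}. ennreal (m * \<gamma> * w u) \<partial>lborel) \<le> (\<integral>\<^sup>+u\<in>{x<..y}. ennreal (w (u / m)) \<partial>lborel)" .
  qed (use w_nonneg m_gt1 w_cont in \<open>auto intro!: continuous_intros\<close>)
  then show ?thesis by simp
qed

section \<open>Propagation of positivity of the density\<close>

lemma w_near:
  assumes "0 < u" "c < w u"
  obtains \<eta> where "\<eta> > 0" "\<eta> < u" "\<And>v. \<bar>v - u\<bar> \<le> \<eta> \<Longrightarrow> c < w v"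
proof -
  have "continuous (at u) w" using w_cont assms(1) by (auto simp: continuous_on_eq_continuous_at)
  then have "eventually (\<lambda>v. c < w v) (at u)" using assms by (auto simp: continuous_at intro: order_tendstoD)
  then have "eventually (\<lambda>v. c < w v) (nhds u)" using assms by (auto simp: eventually_at_filter elim: eventually_mono)
  then obtain e where e: "e > 0" "\<And>v. dist v u < e \<Longrightarrow> c < w v" by (auto simp: eventually_nhds_metric)
  show ?thesis
    by (rule that[of "min e u / 2"]) (use e assms(1) in \<open>auto simp: min_def dist_real_def split: if_splits\<close>)
qed

lemma law_interval_ge:
  assumes "0 \<le> c" "0 < x" "x \<le> y" "\<And>v. x \<le> v \<Longrightarrow> v \<le> y \<Longrightarrow> c \<le> w v"
  shows "ennreal (c * (y - x)) \<le> emeasure law {x..y}"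
proof -
  have "ennreal (c * (y - x)) = (\<integral>\<^sup>+v\<in>{x..y}. ennreal c \<partial>lborel)"
    using assms by (simp add: nn_integral_cmult_indicator ennreal_mult)
  also have "\<dots> \<le> (\<integral>\<^sup>+v\<in>{x..y}. ennreal (w v) \<partial>lborel)"
    using assms by (intro nn_integral_mono) (auto simp: indicator_def intro!: ennreal_leI)
  also have "\<dots> = emeasure M {z \<in> space M. W z \<in> {x..y}}"
    using assms by (intro w_density[symmetric]) auto
  also have "\<dots> = emeasure law {x..y}" by (rule emeasure_law[symmetric]) simp
  finally show ?thesis .
qed

lemma law_sum_interval_pos:
  assumes "0 < v" "0 < w v" "0 < \<eta>"
  shows "0 < emeasure (law_sum k) {real k * v - \<eta>..real k * v + \<eta>}"
  using assms(3)
proof (induction k arbitrary: \<eta>)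
  case 0
  then show ?case by (simp add: law_sum_0)
next
  case (Suc k)
  obtain \<delta> where d: "\<delta> > 0" "\<delta> < v" "\<And>u. \<bar>u - v\<bar> \<le> \<delta> \<Longrightarrow> w v / 2 < w u"
    using w_near[OF assms(1), of "w v / 2"] assms(2) by auto
  define \<theta> where "\<theta> = min \<delta> (\<eta> / 2)"
  have th: "0 < \<theta>" "\<theta> \<le> \<delta>" "\<theta> \<le> \<eta> / 2" using d Suc.prems by (auto simp: \<theta>_def)
  let ?c = "emeasure law {v - \<theta>..v + \<theta>}"
  have "ennreal (w v / 2 * ((v + \<theta>) - (v - \<theta>))) \<le> ?c"
    using th d assms less_imp_le[OF d(3)] by (intro law_interval_ge) (auto simp: abs_le_iff)
  moreover have "0 < ennreal (w v / 2 * ((v + \<theta>) - (v - \<theta>)))" using th assms by simp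
  ultimately have c: "0 < ?c" by (rule less_le_trans[rotated])
  let ?A = "{real (Suc k) * v - \<eta>..real (Suc k) * v + \<eta>}"
  have "0 < ?c * emeasure (law_sum k) {real k * v - \<eta> / 2..real k * v + \<eta> / 2}"
    using c Suc.IH[of "\<eta> / 2"] Suc.prems by (simp add: ennreal_zero_less_mult_iff)
  also have "\<dots> = (\<integral>\<^sup>+y. ?c * indicator {real k * v - \<eta> / 2..real k * v + \<eta> / 2} y \<partial>law_sum k)"
    by (subst nn_integral_cmult_indicator) auto
  also have "\<dots> \<le> (\<integral>\<^sup>+y. emeasure law {a. a + y \<in> ?A} \<partial>law_sum k)"
  proof (intro nn_integral_mono)
    fix y
    have "?c \<le> emeasure law {a. a + y \<in> ?A}" if "y \<in> {real k * v - \<eta> / 2..real k * v + \<eta> / 2}"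
      using that th by (intro emeasure_mono) (auto simp: algebra_simps)
    then show "?c * indicator {real k * v - \<eta> / 2..real k * v + \<eta> / 2} y \<le> emeasure law {a. a + y \<in> ?A}"
      by (auto simp: indicator_def)
  qed
  also have "\<dots> = emeasure (law_sum (Suc k)) ?A" by (rule emeasure_law_sum_Suc[symmetric]) simp
  finally show ?case .
qed

text \<open>With k + 1 children, one near x and the sum of the others near k y, the mass that m W
  puts on a window around x + k y is at least linear in its width. If w vanished at the image point,
  continuity would make that mass smaller than this for narrow windows.\<close>

lemma w_pos_sum:
  assumes k: "p (Suc k) > 0" and x: "0 < x" "0 < w x" and y: "0 < y" "0 < w y"
  shows "0 < w ((x + real k * y) / m)"
proof (rule ccontr)
  define v where "v = x + real k * y"
  have v: "0 < v" using x y by (simp add: v_def add_pos_nonneg)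
  assume "\<not> ?thesis"
  then have w0: "w (v / m) = 0" using w_nonneg[of "v / m"] v m_gt1 by (simp add: v_def)
  obtain \<eta> where \<eta>: "\<eta> > 0" "\<eta> < x" "\<And>u. \<bar>u - x\<bar> \<le> \<eta> \<Longrightarrow> w x / 2 < w u"
    using w_near[OF x(1), of "w x / 2"] x(2) by auto
  define \<delta> where "\<delta> = w x / 2"
  have \<delta>: "\<delta> > 0" using x by (simp add: \<delta>_def)
  define I where "I = {real k * y - \<eta> / 2..real k * y + \<eta> / 2}"
  interpret L: prob_space "law_sum k" by (rule law_sum_prob_space)
  define c where "c = measure (law_sum k) I"
  have c: "c > 0" "emeasure (law_sum k) I = ennreal c"
    using law_sum_interval_pos[OF y, of "\<eta> / 2" k] \<eta> by (auto simp: c_def I_def L.emeasure_eq_measure)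
  \<comment> \<open>With w \<le> \<tau> near v / m, the window of half-width h has mass at most
    p(k+1) \<delta> c h, half of the lower bound 2 h p(k+1) \<delta> c.\<close>
  define \<tau> where "\<tau> = m * p (Suc k) * \<delta> * c / 2"
  have \<tau>: "\<tau> > 0" using m_gt1 k \<delta> c by (simp add: \<tau>_def)
  have "continuous (at (v / m)) w" using w_cont v m_gt1 by (auto simp: continuous_on_eq_continuous_at)
  then have "eventually (\<lambda>u. w u < \<tau>) (at (v / m))" using w0 \<tau> by (auto simp: continuous_at intro: order_tendstoD)
  then have "eventually (\<lambda>u. w u < \<tau>) (nhds (v / m))" using w0 \<tau> by (auto simp: eventually_at_filter elim: eventually_mono)
  then obtain e where e: "e > 0" "\<And>u. dist u (v / m) < e \<Longrightarrow> w u < \<tau>" by (auto simp: eventually_nhds_metric)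
  \<comment> \<open>The three caps keep the shifted windows within \<eta> of x, the window itself in
    the positive half-line, and its image under division by m in the neighbourhood where w <
    \<tau>.\<close>
  define h where "h = min (min (\<eta> / 2) (v / 2)) (m * e / 2)"
  have h: "0 < h" "h \<le> \<eta> / 2" "h < v" "h < m * e" using \<eta> v e m_gt1 by (auto simp: h_def min_def)
  have "ennreal (p (Suc k)) * (ennreal (2 * h * \<delta>) * ennreal c) \<le> ennreal (p (Suc k)) * emeasure (law_sum (Suc k)) {v - h..v + h}"
  proof (intro mult_left_mono)
    have "ennreal (2 * h * \<delta>) * ennreal c = (\<integral>\<^sup>+y. ennreal (2 * h * \<delta>) * indicator I y \<partial>law_sum k)"
      by (subst nn_integral_cmult_indicator) (auto simp: I_def c[unfolded I_def])
    also have "\<dots> \<le> (\<integral>\<^sup>+y. emeasure law {a. a + y \<in> {v - h..v + h}} \<partial>law_sum k)"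
    proof (intro nn_integral_mono)
      fix y'
      have "ennreal (2 * h * \<delta>) \<le> emeasure law {a. a + y' \<in> {v - h..v + h}}" if "y' \<in> I"
      proof -
        have "ennreal (\<delta> * ((v + h - y') - (v - h - y'))) \<le> emeasure law {v - h - y'..v + h - y'}"
        proof (rule law_interval_ge)
          show "0 < v - h - y'" using that h \<eta>(2) by (auto simp: I_def v_def)
          show "\<delta> \<le> w u" if "v - h - y' \<le> u" "u \<le> v + h - y'" for u
          proof -
            have "\<bar>u - x\<bar> \<le> \<eta>" using that \<open>y' \<in> I\<close> h by (auto simp: I_def v_def abs_le_iff)
            then show ?thesis using \<eta>(3) by (auto simp: \<delta>_def intro: less_imp_le)
          qed
        qed (use \<delta> h in auto)
        moreover have "{v - h - y'..v + h - y'} = {a. a + y' \<in> {v - h..v + h}}" by auto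
        ultimately show ?thesis by (simp add: mult_ac)
      qed
      then show "ennreal (2 * h * \<delta>) * indicator I y' \<le> emeasure law {a. a + y' \<in> {v - h..v + h}}"
        by (auto simp: indicator_def)
    qed
    also have "\<dots> = emeasure (law_sum (Suc k)) {v - h..v + h}" by (rule emeasure_law_sum_Suc[symmetric]) simp
    finally show "ennreal (2 * h * \<delta>) * ennreal c \<le> emeasure (law_sum (Suc k)) {v - h..v + h}" .
  qed simp
  also have "\<dots> \<le> (\<Sum>k. ennreal (p k) * emeasure (law_sum k) {v - h..v + h})"
    using sum_le_suminf[of "\<lambda>k. ennreal (p k) * emeasure (law_sum k) {v - h..v + h}" "{Suc k}"] by simp
  also have "\<dots> = emeasure M {x \<in> space M. m * W x \<in> {v - h..v + h}}" by (rule emeasure_scaled[symmetric]) simp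
  also have "{x \<in> space M. m * W x \<in> {v - h..v + h}} = {x \<in> space M. W x \<in> {(v - h) / m..(v + h) / m}}"
    using m_gt1 by (auto simp: field_simps)
  also have "emeasure M \<dots> = (\<integral>\<^sup>+u\<in>{(v - h) / m..(v + h) / m}. ennreal (w u) \<partial>lborel)"
    using h m_gt1 by (intro w_density) (auto intro: less_le_trans[rotated])
  also have "\<dots> \<le> (\<integral>\<^sup>+u\<in>{(v - h) / m..(v + h) / m}. ennreal \<tau> \<partial>lborel)"
  proof (intro nn_integral_mono)
    fix u
    have "w u \<le> \<tau>" if "u \<in> {(v - h) / m..(v + h) / m}"
    proof (rule less_imp_le, rule e)
      have "\<bar>u - v / m\<bar> \<le> h / m" using that m_gt1 by (auto simp: abs_le_iff field_simps)
      also have "\<dots> < e" using h m_gt1 by (simp add: divide_less_eq mult.commute)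
      finally show "dist u (v / m) < e" by (simp add: dist_real_def)
    qed
    then show "ennreal (w u) * indicator {(v - h) / m..(v + h) / m} u \<le> ennreal \<tau> * indicator {(v - h) / m..(v + h) / m} u"
      by (auto simp: indicator_def intro!: ennreal_leI)
  qed
  also have "\<dots> = ennreal \<tau> * ennreal ((v + h) / m - (v - h) / m)"
    using h m_gt1 by (subst nn_integral_cmult_indicator) (auto simp: divide_right_mono)
  finally have "ennreal (p (Suc k) * (2 * h * \<delta> * c)) \<le> ennreal (\<tau> * ((v + h) / m - (v - h) / m))"
    using k h \<delta> c \<tau> m_gt1 by (simp add: ennreal_mult divide_right_mono)
  then have "p (Suc k) * (2 * h * \<delta> * c) \<le> \<tau> * ((v + h) / m - (v - h) / m)"
    using k h \<delta> c \<tau> m_gt1 by (subst (asm) ennreal_le_iff) (auto simp: divide_right_mono)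
  also have "\<dots> = p (Suc k) * \<delta> * c * h" using m_gt1 by (simp add: \<tau>_def field_simps)
  finally have "2 * (p (Suc k) * \<delta> * c * h) \<le> p (Suc k) * \<delta> * c * h" by (simp add: mult_ac)
  moreover have "p (Suc k) * \<delta> * c * h > 0" using k h \<delta> c by simp
  ultimately show False by linarith
qed

lemma w_pos_scale:
  assumes "0 < u" "0 < w u"
  shows "0 < w (u / m ^ n)"
proof (induction n)
  case (Suc n)
  have "0 < m * \<gamma> * w (u / m ^ n)" using Suc m_gt1 by simp
  also have "\<dots> \<le> w (u / m ^ n / m)" using assms m_gt1 by (intro w_scale_ge) auto
  finally show ?case by (simp add: divide_divide_eq_left mult.commute)
qed (use assms in simp)

lemma w_pos_somewhere: obtains u where "0 < u" "0 < w u"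
proof -
  have "\<exists>u>0. 0 < w u"
  proof (rule ccontr)
    assume "\<not> ?thesis"
    then have "w u = 0" if "0 < u" for u using w_nonneg[OF that] that by force
    then have "(\<integral>\<^sup>+u\<in>{0<..}. ennreal (w u) \<partial>lborel) = (\<integral>\<^sup>+(u::real). 0 \<partial>lborel)"
      by (intro nn_integral_cong) (auto simp: indicator_def)
    then have "emeasure M {x \<in> space M. W x \<in> {0<..}} = 0" by (subst w_density) auto
    then show False using prob_W_pos by (simp add: emeasure_eq_measure)
  qed
  then show ?thesis using that by blast
qed

text \<open>Up to division by powers of m, the set of positivity is closed under x + k y, hence
  under multiplication by N = 1 + l k. The multiples N [a, b] of a small interval overlap once they
  are large, and t m^s is large for suitable s.\<close>

lemma w_eventually_pos:
  assumes "0 < t"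
  shows "\<exists>r. 0 < w (t / m ^ r)"
proof -
  obtain k where k: "p (Suc k) > 0" "k \<ge> 1"
  proof -
    obtain j where "j \<ge> 2" "p j > 0" using ex_two_children by blast
    then show ?thesis using that[of "j - 1"] by simp
  qed
  obtain u0 where u0: "0 < u0" "0 < w u0" using w_pos_somewhere by blast
  obtain \<eta> where \<eta>: "\<eta> > 0" "\<eta> < u0" "\<And>v. \<bar>v - u0\<bar> \<le> \<eta> \<Longrightarrow> 0 < w v"
    using w_near[OF u0] by blast
  \<comment> \<open>Positivity modulo powers of m; \<open>w_pos_scale\<close> lets two points be
    brought to a common exponent.\<close>
  define Reach where "Reach = {x. 0 < x \<and> (\<exists>r. 0 < w (x / m ^ r))}"
  have step: "x + real k * y \<in> Reach" if xR: "x \<in> Reach" and yR: "y \<in> Reach" for x y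
  proof -
    obtain r where r: "0 < x" "0 < w (x / m ^ r)" using xR by (auto simp: Reach_def)
    obtain s where s: "0 < y" "0 < w (y / m ^ s)" using yR by (auto simp: Reach_def)
    note rs = r s
    have "0 < w (x / m ^ r / m ^ s)" using rs m_gt1 by (intro w_pos_scale[of "x / m ^ r"]) auto
    moreover have "0 < w (y / m ^ s / m ^ r)" using rs m_gt1 by (intro w_pos_scale[of "y / m ^ s"]) auto
    ultimately have "0 < w (x / m ^ (r + s))" "0 < w (y / m ^ (r + s))"
      by (simp_all add: power_add mult.commute)
    then have "0 < w ((x / m ^ (r + s) + real k * (y / m ^ (r + s))) / m)"
      using rs m_gt1 by (intro w_pos_sum k) auto
    moreover have "(x / m ^ (r + s) + real k * (y / m ^ (r + s))) / m = (x + real k * y) / m ^ Suc (r + s)"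
      by (simp add: add_divide_distrib mult.commute)
    ultimately have "0 < w ((x + real k * y) / m ^ Suc (r + s))" by (simp only:)
    moreover have "0 < x + real k * y" using rs by (intro add_pos_nonneg) auto
    ultimately show ?thesis unfolding Reach_def by blast
  qed
  have mult: "(1 + real l * real k) * y \<in> Reach" if "y \<in> Reach" for l y
  proof (induction l)
    case (Suc l)
    have "(1 + real (Suc l) * real k) * y = (1 + real l * real k) * y + real k * y" by (simp add: algebra_simps)
    then show ?case using step[OF Suc that] by simp
  qed (use that in simp)
  define a where "a = u0 - \<eta> / 2"
  define b where "b = u0 + \<eta> / 2"
  have ab: "0 < a" "a < b" using \<eta> by (auto simp: a_def b_def)
  have near: "y \<in> Reach" if "a \<le> y" "y \<le> b" for y
  proof -
    have "0 < w (y / m ^ 0)" using that \<eta> by (simp, intro \<eta>(3)) (auto simp: a_def b_def abs_le_iff)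
    then show ?thesis using that ab unfolding Reach_def by (auto intro!: exI[of _ 0])
  qed
  \<comment> \<open>The threshold makes T = t m^s at least b and the interval [T / b, T / a] longer
    than k.\<close>
  obtain s where s: "(real k + 1) / (1 / a - 1 / b) + b < t * m ^ s"
  proof -
    have "filterlim (\<lambda>s. t * m ^ s) at_top sequentially"
      using assms by (intro filterlim_tendsto_pos_mult_at_top[OF tendsto_const _ power_m_at_top]) auto
    then have "eventually (\<lambda>s. (real k + 1) / (1 / a - 1 / b) + b < t * m ^ s) sequentially"
      by (simp add: filterlim_at_top_dense)
    then show ?thesis using that by (auto simp: eventually_sequentially)
  qed
  define T where "T = t * m ^ s"
  have diff: "1 / a - 1 / b > 0" using ab by (simp add: frac_less2)
  have T1: "b \<le> T" using s diff by (smt (verit) divide_nonneg_pos of_nat_0_le_iff T_def)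
  have T2: "real k < T / a - T / b"
  proof -
    have "(real k + 1) / (1 / a - 1 / b) < T" using s ab unfolding T_def by linarith
    then have "real k + 1 < T * (1 / a - 1 / b)" using diff by (simp add: divide_less_eq)
    then show ?thesis by (simp add: right_diff_distrib)
  qed
  \<comment> \<open>Admissible N are spaced by k, less than the length of [T / b, T / a]; this l is
    just large enough for N \<ge> T / b and so does not overshoot T / a.\<close>
  define l where "l = Suc (nat \<lfloor>(T / b - 1) / real k\<rfloor>)"
  have "0 \<le> (T / b - 1) / real k" using T1 ab by (simp add: field_simps)
  then have l: "(T / b - 1) / real k \<le> real l" "real l \<le> (T / b - 1) / real k + 1"
    unfolding l_def by linarith+
  define N where "N = 1 + real l * real k"
  have N: "T / b \<le> N" "N \<le> T / a"
  proof -
    show "T / b \<le> N" using l(1) k(2) by (simp add: N_def field_simps)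
    have "real l * real k \<le> ((T / b - 1) / real k + 1) * real k" using l(2) by (intro mult_right_mono) auto
    also have "\<dots> = T / b - 1 + real k" using k(2) by (simp add: field_simps)
    finally show "N \<le> T / a" using T2 by (simp add: N_def)
  qed
  have Npos: "N > 0" by (simp add: N_def add_pos_nonneg)
  have "T / N \<in> Reach"
    using N Npos ab by (intro near) (auto simp: field_simps)
  then have "N * (T / N) \<in> Reach" unfolding N_def by (rule mult)
  then have "T \<in> Reach" using Npos by simp
  then obtain r where r: "0 < T" "0 < w (T / m ^ r)" by (auto simp: Reach_def)
  then have "0 < w (T / m ^ r / m ^ s)" using m_gt1 by (intro w_pos_scale[of "T / m ^ r"]) auto
  then have "0 < w (t / m ^ r)" using m_gt1 by (simp add: T_def)
  then show ?thesis ..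
qed

text \<open>Since g(u) = u^(1-\<alpha>) w(u) does not decrease under division by m, its infimum near
  0 is controlled by one fundamental interval [1, m] / m^R, where it is continuous and positive,
  hence bounded below.\<close>

lemma w_lower_bound:
  obtains c \<delta> where "c > 0" "\<delta> > 0" "\<And>u. 0 < u \<Longrightarrow> u \<le> \<delta> \<Longrightarrow> c \<le> u powr (1 - \<alpha>) * w u"
proof -
  define g where "g u = u powr (1 - \<alpha>) * w u" for u
  have g1: "g u \<le> g (u / m)" if u: "0 < u" for u
  proof -
    have "u powr (1 - \<alpha>) = (u / m * m) powr (1 - \<alpha>)" using m_gt1 by simp
    also have "\<dots> = (u / m) powr (1 - \<alpha>) * m powr (1 - \<alpha>)" by (rule powr_mult)
    also have "m powr (1 - \<alpha>) = m * \<gamma>" using m_gt1 by (simp add: powr_diff powr_minus divide_inverse)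
    finally have "g u = (u / m) powr (1 - \<alpha>) * (m * \<gamma> * w u)" by (simp add: g_def)
    also have "\<dots> \<le> (u / m) powr (1 - \<alpha>) * w (u / m)"
      using u by (intro mult_left_mono w_scale_ge) auto
    finally show ?thesis by (simp add: g_def)
  qed
  have gstep: "g t \<le> g (t / m ^ n)" if "0 < t" for t n
  proof (induction n)
    case (Suc n)
    then show ?case using g1[of "t / m ^ n"] that m_gt1 by (simp add: mult.commute)
  qed simp
  define U where "U r = {0<..} \<inter> (\<lambda>t. w (t / m ^ r)) -` {0<..}" for r :: nat
  have contw: "continuous_on {0<..} (\<lambda>t. w (t / m ^ r))" for r
    using m_gt1 by (intro continuous_on_compose2[OF w_cont] continuous_intros) auto
  have openU: "open (U r)" for r unfolding U_def
    by (rule continuous_open_preimage[OF contw]) auto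
  have "{1..m} \<subseteq> (\<Union>r\<in>UNIV. U r)"
    using w_eventually_pos by (fastforce simp: U_def)
  then obtain R' where R': "finite R'" "{1..m} \<subseteq> (\<Union>r\<in>R'. U r)"
    using compactE_image[of "{1..m}" UNIV U] openU by auto
  \<comment> \<open>Positivity at t / m^r persists for larger exponents, so the finitely many r of
    the compact cover can be replaced by one.\<close>
  define R where "R = Max (insert 0 R')"
  have posR: "0 < w (t / m ^ R)" if tm: "t \<in> {1..m}" for t
  proof -
    obtain r where r: "r \<in> R'" "t \<in> U r" using R' tm by blast
    have "r \<le> R" using R' r by (simp add: R_def)
    have "0 < w (t / m ^ r / m ^ (R - r))" using r m_gt1 by (intro w_pos_scale[of "t / m ^ r"]) (auto simp: U_def)
    also have "t / m ^ r / m ^ (R - r) = t / m ^ R" using \<open>r \<le> R\<close> by (simp flip: power_add)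
    finally show ?thesis .
  qed
  have "continuous_on {1..m} (\<lambda>t. g (t / m ^ R))"
    unfolding g_def using m_gt1
    by (intro continuous_intros continuous_on_subset[OF contw]) auto
  from continuous_attains_inf[OF _ _ this] m_gt1
  obtain t0 where t0: "t0 \<in> {1..m}" "\<And>t. t \<in> {1..m} \<Longrightarrow> g (t0 / m ^ R) \<le> g (t / m ^ R)" by auto
  show ?thesis
  proof (rule that[of "g (t0 / m ^ R)" "1 / m ^ R"])
    show "0 < g (t0 / m ^ R)" using posR[OF t0(1)] t0(1) m_gt1 by (simp add: g_def)
    fix u assume u: "0 < u" "u \<le> 1 / m ^ R"
    then have "1 \<le> 1 / (u * m ^ R)" using m_gt1 by (simp add: field_simps)
    then obtain n where n: "m ^ n \<le> 1 / (u * m ^ R)" "1 / (u * m ^ R) < m ^ Suc n" by (rule ex_power_m)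
    define t where "t = u * m ^ R * m ^ Suc n"
    have "t \<in> {1..m}"
    proof -
      have pos: "u * m ^ R > 0" using u m_gt1 by simp
      have "u * m ^ R * m ^ n \<le> 1" "1 < u * m ^ R * m ^ Suc n" using n pos by (simp_all add: field_simps)
      then show ?thesis using m_gt1 mult_left_mono[of "u * m ^ R * m ^ n" 1 m] by (auto simp: t_def mult_ac)
    qed
    then have "g (t0 / m ^ R) \<le> g (t / m ^ R)" by (rule t0)
    also have "\<dots> \<le> g (t / m ^ R / m ^ Suc n)" using \<open>t \<in> {1..m}\<close> m_gt1 by (intro gstep) auto
    also have "t / m ^ R / m ^ Suc n = u" using m_gt1 by (simp add: t_def)
    finally show "g (t0 / m ^ R) \<le> u powr (1 - \<alpha>) * w u" by (simp add: g_def)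
  qed (use m_gt1 in auto)
qed

end

section \<open>Comparison of the process with its limit\<close>

lemma tendsto_lt_imp_bounded_lt:
  fixes a :: "nat \<Rightarrow> real"
  assumes "a \<longlonglongrightarrow> l" "l < b" "\<And>n. a n < b"
  obtains s where "s < b" "\<And>n. a n \<le> s"
proof -
  have "eventually (\<lambda>n. a n < (l + b) / 2) sequentially"
    using assms(1,2) by (intro order_tendstoD) auto
  then obtain N where N: "\<And>n. n \<ge> N \<Longrightarrow> a n < (l + b) / 2" by (auto simp: eventually_sequentially)
  define s where "s = Max (insert ((l + b) / 2) (a ` {..<N}))"
  have "(l + b) / 2 \<le> s" unfolding s_def by (rule Max_ge) auto
  moreover have "a n \<le> s" if "n < N" for n using that by (auto simp: s_def intro!: Max_ge)
  ultimately have "a n \<le> s" for n using N[of n] by (cases "n < N") auto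
  moreover have "s < b" unfolding s_def using assms by (subst Max_less_iff) auto
  ultimately show ?thesis using that by blast
qed

context schroeder_gw
begin

lemma rlap_tendsto:
  assumes "0 \<le> t"
  shows "(\<lambda>n. (pgf ^^ n) (exp (- (t / m ^ n)))) \<longlonglongrightarrow> rlap t"
proof -
  have "(\<lambda>n. Re ((pgf ^^ n) (exp (- (of_real t / of_real m ^ n))))) \<longlonglongrightarrow> Re (lap (of_real t))"
    using assms by (intro tendsto_Re lap_tendsto) auto
  moreover have "Re ((pgf ^^ n) (exp (- (of_real t / of_real m ^ n)))) = (pgf ^^ n) (exp (- (t / m ^ n)))" for n
  proof -
    have "exp (- (of_real t / of_real m ^ n)) = complex_of_real (exp (- (t / m ^ n)))"
      by (simp add: exp_of_real[symmetric])
    then show ?thesis using assms m_gt1 by (simp add: funpow_pgf_of_real)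
  qed
  ultimately show ?thesis by (simp add: lap_of_real)
qed

lemma funpow_pgf_exp_bounded:
  assumes "0 < t"
  obtains s where "s < 1" "\<And>n. (pgf ^^ n) (exp (- (t / m ^ n))) \<le> s"
proof -
  have "(pgf ^^ n) (exp (- (t / m ^ n))) < 1" for n
    using assms m_gt1 by (intro funpow_pgf_lt_1) auto
  from tendsto_lt_imp_bounded_lt[OF rlap_tendsto rlap_lt_1 this] assms that show ?thesis by auto
qed

lemma funpow_pgf_split: "j \<le> n \<Longrightarrow> (pgf ^^ n) s = (pgf ^^ (n - j)) ((pgf ^^ j) s)"
  for s :: "'b::{real_normed_field,banach}"
  using funpow_add[of "n - j" j "pgf :: 'b \<Rightarrow> 'b"] by (simp add: fun_eq_iff)

lemma gamma_power_diff: "j \<le> n \<Longrightarrow> \<gamma> ^ (n - j) = (m ^ j / m ^ n) powr \<alpha>"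
proof -
  assume "j \<le> n"
  then have "m ^ j / m ^ n = 1 / m ^ (n - j)" using m_gt1 by (simp add: power_diff)
  then show ?thesis using m_gt1 unfolding gamma_power by (simp add: powr_minus powr_divide inverse_eq_divide)
qed

lemma GW_comp_measurable: "(\<lambda>x. h (GW \<xi> n x)) \<in> borel_measurable M"
  for h :: "nat \<Rightarrow> 'b::topological_space"
  by (rule measurable_compose[OF GW_measurable]) simp

lemma expectation_exp_GW:
  assumes "0 \<le> s" "s \<le> (1::real)"
  shows "expectation (\<lambda>x. if GW \<xi> n x > 0 then s ^ GW \<xi> n x else 0) = (pgf ^^ n) s - (pgf ^^ n) 0"
proof -
  have int: "integrable M (\<lambda>x. t ^ GW \<xi> n x)" if "0 \<le> t" "t \<le> (1::real)" for t
    using that by (intro integrable_const_bound[where B=1] GW_comp_measurable) (auto simp: power_le_one)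
  \<comment> \<open>Since 0 ^ 0 = 1, the power of 0 is the indicator of extinction, and subtracting
    it restricts to survival.\<close>
  have "expectation (\<lambda>x. if GW \<xi> n x > 0 then s ^ GW \<xi> n x else 0) = expectation (\<lambda>x. s ^ GW \<xi> n x - 0 ^ GW \<xi> n x)"
    by (intro Bochner_Integration.integral_cong) auto
  also have "\<dots> = (pgf ^^ n) s - (pgf ^^ n) 0"
    using int[of s] int[of 0] assms by (subst Bochner_Integration.integral_diff) (auto simp: expectation_GW_real)
  finally show ?thesis .
qed

text \<open>Exponential Markov bound with t = exp(-1 / x). For m^j of order x the value f_j(t) stays
  away from 1, and the other n - j generations contract f_j(t) - f_j(0) by \<gamma>^(n-j), which is
  of order (x / m^n)^\<alpha>.\<close>

lemma prob_GW_small: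
  obtains C where "C > 0" "\<And>n x. 0 < x \<Longrightarrow> prob {z \<in> space M. 0 < GW \<xi> n z \<and> real (GW \<xi> n z) \<le> x} \<le> C * (x / m ^ n) powr \<alpha>"
proof -
  \<comment> \<open>The exponent 1 / m comes from x < m^(j+1), that is, (1 / m) / m^j < 1 /
    x.\<close>
  obtain s where s: "s < 1" "\<And>n. (pgf ^^ n) (exp (- ((1 / m) / m ^ n))) \<le> s"
    using funpow_pgf_exp_bounded[of "1 / m"] m_gt1 by auto
  obtain C where C: "C > 0" "\<And>n (a::real) b. norm a \<le> s \<Longrightarrow> norm b \<le> s \<Longrightarrow>
    norm ((pgf ^^ n) a - (pgf ^^ n) b) \<le> C * \<gamma> ^ n * norm (a - b)"
    using funpow_pgf_lipschitz[OF s(1), where 'b=real] by blast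
  define C' where "C' = max 1 (exp 1 * C)"
  have "prob {z \<in> space M. 0 < GW \<xi> n z \<and> real (GW \<xi> n z) \<le> x} \<le> C' * (x / m ^ n) powr \<alpha>" if x: "0 < x" for n x
  proof -
    have mn: "m ^ n > 0" using m_gt1 by simp
    consider "x < 1" | "m ^ n \<le> x" | "1 \<le> x" "x < m ^ n" by linarith
    then show ?thesis
    proof cases
      case 1
      then have "{z \<in> space M. 0 < GW \<xi> n z \<and> real (GW \<xi> n z) \<le> x} = {}" by auto
      then have "prob {z \<in> space M. 0 < GW \<xi> n z \<and> real (GW \<xi> n z) \<le> x} = 0" by (simp only: measure_empty)
      then show ?thesis by (simp add: C'_def)
    next
      case 2
      have "1 \<le> 1 * (x / m ^ n) powr \<alpha>" using 2 mn alpha_pos by (simp add: ge_one_powr_ge_zero)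
      also have "\<dots> \<le> C' * (x / m ^ n) powr \<alpha>" by (intro mult_right_mono) (auto simp: C'_def)
      finally show ?thesis using prob_le_1 order_trans by blast
    next
      case 3
      obtain j where j: "m ^ j \<le> x" "x < m ^ Suc j" using ex_power_m[OF 3(1)] by blast
      have jn: "j \<le> n" using power_less_imp_less_exp[OF m_gt1 le_less_trans[OF j(1) 3(2)]] by simp
      define t where "t = exp (- (1 / x))"
      have t: "0 \<le> t" "t \<le> 1" using x by (auto simp: t_def)
      have "prob {z \<in> space M. 0 < GW \<xi> n z \<and> real (GW \<xi> n z) \<le> x} = expectation (indicator {z \<in> space M. 0 < GW \<xi> n z \<and> real (GW \<xi> n z) \<le> x})"
        by simp
      also have "\<dots> \<le> expectation (\<lambda>z. exp 1 * (if GW \<xi> n z > 0 then t ^ GW \<xi> n z else 0))"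
      proof (rule integral_mono)
        show "integrable M (\<lambda>z. exp 1 * (if GW \<xi> n z > 0 then t ^ GW \<xi> n z else 0))"
          using t by (intro integrable_mult_right integrable_const_bound[where B=1]
              GW_comp_measurable[where h="\<lambda>k. if k > 0 then t ^ k else 0"]) (auto simp: power_le_one)
        fix z
        have "1 \<le> exp 1 * t ^ k" if "real k \<le> x" for k
        proof -
          have "exp 1 * t ^ k = exp (1 - real k / x)"
            by (simp add: t_def exp_of_nat_mult[symmetric] exp_add[symmetric])
          then show ?thesis using that x by simp
        qed
        then show "indicator {z \<in> space M. 0 < GW \<xi> n z \<and> real (GW \<xi> n z) \<le> x} z \<le> exp 1 * (if GW \<xi> n z > 0 then t ^ GW \<xi> n z else 0)"
          using t by (auto simp: indicator_def)
      qed (simp add: integrable_indicator_iff emeasure_eq_measure)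
      also have "\<dots> = exp 1 * ((pgf ^^ n) t - (pgf ^^ n) 0)" using t by (simp add: expectation_exp_GW)
      also have "(pgf ^^ n) t - (pgf ^^ n) 0 \<le> C * \<gamma> ^ (n - j) * 1"
      proof -
        have "(1 / m) / m ^ j \<le> 1 / x" using j x m_gt1 by (simp add: field_simps)
        then have "(pgf ^^ j) t \<le> (pgf ^^ j) (exp (- ((1 / m) / m ^ j)))"
          using t m_gt1 by (intro funpow_pgf_mono) (auto simp: t_def)
        then have 1: "(pgf ^^ j) t \<le> s" using s(2)[of j] by simp
        have 2: "(pgf ^^ j) 0 \<le> (pgf ^^ j) t" using t by (intro funpow_pgf_mono) auto
        have 3: "0 \<le> (pgf ^^ j) (0::real)" by (rule funpow_pgf_of_real) auto
        have "(pgf ^^ n) t - (pgf ^^ n) 0 \<le> norm ((pgf ^^ (n - j)) ((pgf ^^ j) t) - (pgf ^^ (n - j)) ((pgf ^^ j) 0))"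
          using funpow_pgf_split[OF jn, of t] funpow_pgf_split[OF jn, of "0::real"] by simp
        also have "\<dots> \<le> C * \<gamma> ^ (n - j) * norm ((pgf ^^ j) t - (pgf ^^ j) 0)"
          using 1 2 3 by (intro C) auto
        also have "\<dots> \<le> C * \<gamma> ^ (n - j) * 1"
          using 1 2 3 s C(1) by (intro mult_left_mono) auto
        finally show ?thesis .
      qed
      also have "\<gamma> ^ (n - j) = (m ^ j / m ^ n) powr \<alpha>" by (rule gamma_power_diff[OF jn])
      also have "\<dots> \<le> (x / m ^ n) powr \<alpha>"
        using j m_gt1 alpha_pos by (intro powr_mono2) (auto simp: divide_right_mono)
      finally have "prob {z \<in> space M. 0 < GW \<xi> n z \<and> real (GW \<xi> n z) \<le> x} \<le> exp 1 * (C * (x / m ^ n) powr \<alpha> * 1)"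
        using C(1) by (simp add: mult_left_mono)
      also have "\<dots> \<le> C' * (x / m ^ n) powr \<alpha>"
        by (simp add: C'_def mult.assoc[symmetric] mult_right_mono)
      finally show ?thesis .
    qed
  qed
  moreover have "C' > 0" by (simp add: C'_def)
  ultimately show ?thesis using that by blast
qed

text \<open>\<open>EW\<close> and \<open>EZ\<close> are the same functional of W and of Z_n / m^n,
  because \<epsilon>^2 Z_n = (\<epsilon>^2 m^n) (Z_n / m^n); the scale \<open>t\<close> stands for
  \<epsilon>^2 m^n.\<close>

definition EW :: "real \<Rightarrow> (real \<Rightarrow> real) \<Rightarrow> real" where
  "EW t h = expectation (\<lambda>x. if W x > 0 then h (t * W x) else 0)"

definition EZ :: "nat \<Rightarrow> real \<Rightarrow> (real \<Rightarrow> real) \<Rightarrow> real" where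
  "EZ n e h = expectation (\<lambda>x. if GW \<xi> n x > 0 then h (e\<^sup>2 * real (GW \<xi> n x)) else 0)"

lemma EZ_exp:
  assumes "0 \<le> \<mu>"
  shows "EZ n e (\<lambda>y. exp (- (\<mu> * y))) = (pgf ^^ n) (exp (- (\<mu> * e\<^sup>2))) - (pgf ^^ n) 0"
proof -
  have "exp (- (\<mu> * (e\<^sup>2 * real k))) = exp (- (\<mu> * e\<^sup>2)) ^ k" for k
    by (simp add: exp_of_nat_mult[symmetric] mult_ac)
  then show ?thesis unfolding EZ_def using assms by (simp only:) (rule expectation_exp_GW, auto)
qed

lemma EW_exp:
  assumes "0 \<le> \<mu>" "0 \<le> t"
  shows "EW t (\<lambda>y. exp (- (\<mu> * y))) = rlap (\<mu> * t) - ext"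
proof -
  have "EW t (\<lambda>y. exp (- (\<mu> * y))) = expectation (\<lambda>x. exp (- (\<mu> * t * W x)) - indicator {x \<in> space M. W x = 0} x)"
    unfolding EW_def
  proof (rule integral_cong_AE)
    show "AE x in M. (if 0 < W x then exp (- (\<mu> * (t * W x))) else 0) = exp (- (\<mu> * t * W x)) - indicator {x \<in> space M. W x = 0} x"
      using W_nonneg AE_space by eventually_elim (auto simp: indicator_def mult.assoc)
  qed auto
  also have "\<dots> = rlap (\<mu> * t) - expectation (indicator {x \<in> space M. W x = 0})"
    unfolding rlap_def using assms rlap_integrable[of "\<mu> * t"]
    by (subst Bochner_Integration.integral_diff) (auto simp: integrable_indicator_iff emeasure_eq_measure)
  finally show ?thesis using prob_W_0 by simp
qed

text \<open>Truncation at 1 lets almost sure convergence pass to the mean by dominated convergence;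
  the quantity bounds the differences of Laplace transforms.\<close>

definition dist_W :: "real \<Rightarrow> nat \<Rightarrow> real" where
  "dist_W \<mu> j = expectation (\<lambda>x. min 1 (\<mu> * \<bar>real (GW \<xi> j x) / m ^ j - W x\<bar>))"

lemma dist_W_tendsto: "dist_W \<mu> \<longlonglongrightarrow> 0"
  if "0 \<le> \<mu>"
proof -
  have "(\<lambda>j. expectation (\<lambda>x. min 1 (\<mu> * \<bar>real (GW \<xi> j x) / m ^ j - W x\<bar>))) \<longlonglongrightarrow> expectation (\<lambda>x. 0)"
  proof (rule integral_dominated_convergence[where w="\<lambda>_. 1"])
    show "AE x in M. (\<lambda>j. min 1 (\<mu> * \<bar>real (GW \<xi> j x) / m ^ j - W x\<bar>)) \<longlonglongrightarrow> 0"
      using W_lim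
    proof eventually_elim
      case (elim x)
      have "(\<lambda>j. min 1 (\<mu> * \<bar>real (GW \<xi> j x) / m ^ j - W x\<bar>)) \<longlonglongrightarrow> min 1 (\<mu> * \<bar>W x - W x\<bar>)"
        by (intro tendsto_intros elim)
      then show ?case by simp
    qed
  qed (use that in auto)
  then show ?thesis by (simp add: dist_W_def[abs_def])
qed

text \<open>The function exp(-y) is 1-Lipschitz with values in [0, 1] for y \<ge> 0. The bound is
  uniform in c, which is essential because c will move with n.\<close>

lemma funpow_pgf_near_rlap:
  assumes "0 \<le> \<mu>" "0 \<le> c" "c \<le> 1"
  shows "\<bar>(pgf ^^ j) (exp (- (\<mu> * c / m ^ j))) - rlap (\<mu> * c)\<bar> \<le> dist_W \<mu> j"
proof -
  have e: "exp (- (\<mu> * c / m ^ j)) ^ k = exp (- (\<mu> * c * (real k / m ^ j)))" for k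
    by (simp add: exp_of_nat_mult[symmetric] mult_ac)
  have i1: "integrable M (\<lambda>x. exp (- (\<mu> * c * (real (GW \<xi> j x) / m ^ j))))"
    using assms m_gt1 by (intro integrable_const_bound[where B=1]) auto
  have i2: "integrable M (\<lambda>x. exp (- (\<mu> * c * W x)))" using assms by (intro rlap_integrable) auto
  have "(pgf ^^ j) (exp (- (\<mu> * c / m ^ j))) = expectation (\<lambda>x. exp (- (\<mu> * c / m ^ j)) ^ GW \<xi> j x)"
    using assms m_gt1 by (intro expectation_GW_real[symmetric]) auto
  then have "(pgf ^^ j) (exp (- (\<mu> * c / m ^ j))) - rlap (\<mu> * c) =
     expectation (\<lambda>x. exp (- (\<mu> * c * (real (GW \<xi> j x) / m ^ j))) - exp (- (\<mu> * c * W x)))"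
    unfolding e rlap_def using i1 i2 by simp
  also have "\<bar>\<dots>\<bar> \<le> expectation (\<lambda>x. \<bar>exp (- (\<mu> * c * (real (GW \<xi> j x) / m ^ j))) - exp (- (\<mu> * c * W x))\<bar>)"
    by (rule integral_abs_bound)
  also have "\<dots> \<le> dist_W \<mu> j" unfolding dist_W_def
  proof (rule integral_mono_AE)
    show "integrable M (\<lambda>x. min 1 (\<mu> * \<bar>real (GW \<xi> j x) / m ^ j - W x\<bar>))"
      using assms by (intro integrable_const_bound[where B=1]) auto
    show "AE x in M. \<bar>exp (- (\<mu> * c * (real (GW \<xi> j x) / m ^ j))) - exp (- (\<mu> * c * W x))\<bar> \<le> min 1 (\<mu> * \<bar>real (GW \<xi> j x) / m ^ j - W x\<bar>)"
      using W_nonneg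
    proof eventually_elim
      case (elim x)
      define a where "a = \<mu> * c * (real (GW \<xi> j x) / m ^ j)"
      define b where "b = \<mu> * c * W x"
      have ab: "0 \<le> a" "0 \<le> b" using assms elim m_gt1 by (auto simp: a_def b_def)
      have "norm (exp (- complex_of_real a) - exp (- complex_of_real b)) \<le> norm (complex_of_real a - complex_of_real b)"
        using ab by (intro exp_minus_diff_le) auto
      moreover have "exp (- complex_of_real a) - exp (- complex_of_real b) = of_real (exp (- a) - exp (- b))"
        by (simp add: exp_of_real[symmetric])
      ultimately have 1: "\<bar>exp (- a) - exp (- b)\<bar> \<le> \<bar>a - b\<bar>"
        by (simp only: norm_of_real flip: of_real_diff)
      have "a - b = c * (\<mu> * (real (GW \<xi> j x) / m ^ j - W x))" by (simp add: a_def b_def algebra_simps)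
      then have "\<bar>a - b\<bar> = c * (\<mu> * \<bar>real (GW \<xi> j x) / m ^ j - W x\<bar>)"
        using assms by (simp add: abs_mult)
      also have "\<dots> \<le> \<mu> * \<bar>real (GW \<xi> j x) / m ^ j - W x\<bar>"
        using assms by (intro mult_left_le_one_le) auto
      finally have 2: "\<bar>exp (- a) - exp (- b)\<bar> \<le> \<mu> * \<bar>real (GW \<xi> j x) / m ^ j - W x\<bar>" using 1 by simp
      have "0 < exp (- a)" "exp (- a) \<le> 1" "0 < exp (- b)" "exp (- b) \<le> 1" using ab by auto
      then have "\<bar>exp (- a) - exp (- b)\<bar> \<le> 1" by linarith
      with 2 show ?case by (simp add: a_def b_def)
    qed
  qed (use i1 i2 in auto)
  finally show ?thesis .
qed

end

section \<open>Comparison of Z_n with W on the scale of the rate\<close>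

locale schroeder_rate = schroeder_gw +
  fixes \<epsilon> :: "nat \<Rightarrow> real"
  assumes eps_pos: "\<And>n. \<epsilon> n > 0"
    and eps_lim: "\<epsilon> \<longlonglongrightarrow> 0"
    and eps_big: "filterlim (\<lambda>n. (\<epsilon> n)\<^sup>2 * m ^ n) at_top sequentially"
begin

definition rate :: "nat \<Rightarrow> real" where "rate n = (\<epsilon> n)\<^sup>2 * m ^ n"

lemma rate_pos: "rate n > 0"
  using eps_pos[of n] m_gt1 by (simp add: rate_def)

text \<open>Splitting time at the generation \<open>j\<close> with \<open>m^j \<approx> \<epsilon>\<^sup>-\<^sup>2\<close>: the last \<open>j\<close> generations are governed by
  \<open>W\<close>, the first \<open>n - j\<close> by the contraction \<open>\<gamma>\<close> of the iterates near \<open>q\<close>.\<close>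

lemma rate_split:
  assumes "m ^ J \<le> 1 / (\<epsilon> n)\<^sup>2" "1 \<le> rate n"
  obtains j c where "J \<le> j" "j \<le> n" "1 / m \<le> c" "c \<le> 1" "(\<epsilon> n)\<^sup>2 = c / m ^ j" "rate n = m ^ (n - j) * c"
    "rate n powr \<alpha> * \<gamma> ^ (n - j) \<le> 1"
proof -
  define E where "E = (\<epsilon> n)\<^sup>2"
  have E: "E > 0" using eps_pos[of n] by (simp add: E_def)
  have "1 \<le> m ^ J" using m_gt1 by simp
  then have "1 \<le> 1 / E" using assms(1) by (simp add: E_def)
  then obtain j where j: "m ^ j \<le> 1 / E" "1 / E < m ^ Suc j" by (rule ex_power_m)
  have "m ^ J < m ^ Suc j" using assms(1) j(2) by (simp add: E_def)
  then have J: "J \<le> j" using m_gt1 power_less_imp_less_exp[of m J "Suc j"] by simp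
  have "1 / E \<le> m ^ n" using assms(2) E by (simp add: rate_def E_def field_simps)
  then have "m ^ j \<le> m ^ n" using j(1) by simp
  then have jn: "j \<le> n" using m_gt1 by (simp add: power_le_imp_le_exp)
  define c where "c = E * m ^ j"
  have c0: "0 \<le> c" using E m_gt1 by (simp add: c_def)
  have c: "1 / m \<le> c" "c \<le> 1" using j E m_gt1 by (simp_all add: c_def field_simps)
  have r: "rate n = m ^ (n - j) * c"
    using jn m_gt1 by (simp add: rate_def c_def E_def power_diff)
  have "rate n powr \<alpha> * \<gamma> ^ (n - j) = c powr \<alpha>"
  proof -
    have "rate n powr \<alpha> = (m ^ (n - j)) powr \<alpha> * c powr \<alpha>" unfolding r by (rule powr_mult)
    then show ?thesis using m_gt1 unfolding gamma_power by (simp add: powr_minus)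
  qed
  also have "\<dots> \<le> 1" using c c0 alpha_pos by (intro powr_le1) auto
  finally have "rate n powr \<alpha> * \<gamma> ^ (n - j) \<le> 1" .
  moreover have "(\<epsilon> n)\<^sup>2 = c / m ^ j" using m_gt1 by (simp add: c_def E_def)
  ultimately show ?thesis using J jn c r by (intro that)
qed

lemma eventually_rate_split: "eventually (\<lambda>n. m ^ J \<le> 1 / (\<epsilon> n)\<^sup>2 \<and> 1 \<le> rate n) sequentially"
proof -
  have "(\<lambda>n. (\<epsilon> n)\<^sup>2) \<longlonglongrightarrow> 0" using tendsto_power[OF eps_lim, of 2] by simp
  then have "eventually (\<lambda>n. (\<epsilon> n)\<^sup>2 < 1 / m ^ J) sequentially"
    by (rule order_tendstoD(2)) (use m_gt1 in simp)
  moreover have "eventually (\<lambda>n. 1 \<le> rate n) sequentially"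
    using eps_big unfolding rate_def filterlim_at_top by blast
  ultimately show ?thesis
  proof eventually_elim
    case (elim n)
    have "(\<epsilon> n)\<^sup>2 > 0" using eps_pos[of n] by simp
    then show ?case using elim m_gt1 by (simp add: field_simps)
  qed
qed

text \<open>Both expectations are differences of f_(n-j) at two points: f_j(exp(-\<mu> c / m^j)) and
  f_j(0) for Z_n, \<open>rlap (\<mu> * c)\<close> and \<open>ext\<close> for W. The points approach
  each other as j grows, and the contraction \<gamma>^(n-j) pays for the factor N^\<alpha>. The
  second claim bounds the weighted errors of the polynomial approximation later.\<close>

lemma laplace_compare:
  assumes "0 < \<mu>"
  shows "(\<lambda>n. rate n powr \<alpha> * (EZ n (\<epsilon> n) (\<lambda>y. exp (- (\<mu> * y))) - EW (rate n) (\<lambda>y. exp (- (\<mu> * y))))) \<longlonglongrightarrow> 0"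
    and "\<exists>C. eventually (\<lambda>n. rate n powr \<alpha> * EW (rate n) (\<lambda>y. exp (- (\<mu> * y))) \<le> C) sequentially"
proof -
  obtain s1 where s1: "s1 < 1" "\<And>n. (pgf ^^ n) (exp (- ((\<mu> / m) / m ^ n))) \<le> s1"
    using funpow_pgf_exp_bounded[of "\<mu> / m"] m_gt1 assms by auto
  \<comment> \<open>One radius below 1 for all four points; \<mu> / m enters because c \<ge> 1 / m,
    and f_j(0) is at most \<open>ext\<close>.\<close>
  define s where "s = max s1 (max (rlap (\<mu> / m)) ext)"
  have s: "s < 1" using s1 rlap_lt_1[of "\<mu> / m"] ext_lt_1 assms m_gt1 by (auto simp: s_def)
  obtain C where C: "C > 0" "\<And>n (a::real) b. norm a \<le> s \<Longrightarrow> norm b \<le> s \<Longrightarrow>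
    norm ((pgf ^^ n) a - (pgf ^^ n) b) \<le> C * \<gamma> ^ n * norm (a - b)"
    using funpow_pgf_lipschitz[OF s(1), where 'b=real] by blast
  define B where "B j = C * dist_W \<mu> j + C * \<bar>(pgf ^^ j) 0 - ext\<bar>" for j
  have B0: "B \<longlonglongrightarrow> 0"
  proof -
    have "(\<lambda>j. C * dist_W \<mu> j + C * \<bar>(pgf ^^ j) 0 - ext\<bar>) \<longlonglongrightarrow> C * 0 + C * \<bar>ext - ext\<bar>"
      using assms by (intro tendsto_intros dist_W_tendsto funpow_pgf_0_tendsto) auto
    then show ?thesis by (simp add: B_def[abs_def])
  qed
  \<comment> \<open>The lower bound J on j turns "n large" into "j large", which is what makes
    \<open>B j\<close> small.\<close>
  have main: "\<exists>j\<ge>J. \<bar>rate n powr \<alpha> * (EZ n (\<epsilon> n) (\<lambda>y. exp (- (\<mu> * y))) - EW (rate n) (\<lambda>y. exp (- (\<mu> * y))))\<bar> \<le> B j \<and>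
      rate n powr \<alpha> * EW (rate n) (\<lambda>y. exp (- (\<mu> * y))) \<le> C"
    if Jn: "m ^ J \<le> 1 / (\<epsilon> n)\<^sup>2" "1 \<le> rate n" for J n
  proof -
    obtain j c where jc: "J \<le> j" "j \<le> n" "1 / m \<le> c" "c \<le> 1" "(\<epsilon> n)\<^sup>2 = c / m ^ j" "rate n = m ^ (n - j) * c"
      "rate n powr \<alpha> * \<gamma> ^ (n - j) \<le> 1"
      using rate_split[OF Jn] by blast
    have c0: "0 < c" using jc(3) m_gt1 by (auto intro: less_le_trans[rotated])
    define a where "a = (pgf ^^ j) (exp (- (\<mu> * c / m ^ j)))"
    have EZ: "EZ n (\<epsilon> n) (\<lambda>y. exp (- (\<mu> * y))) = (pgf ^^ (n - j)) a - (pgf ^^ (n - j)) ((pgf ^^ j) 0)"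
      using assms funpow_pgf_split[OF jc(2), of "exp (- (\<mu> * c / m ^ j))"] funpow_pgf_split[OF jc(2), of "0::real"]
      by (simp add: EZ_exp jc(5) a_def)
    have EW: "EW (rate n) (\<lambda>y. exp (- (\<mu> * y))) = (pgf ^^ (n - j)) (rlap (\<mu> * c)) - (pgf ^^ (n - j)) ext"
      using assms rate_pos[of n] rlap_scale_power[of "\<mu> * c" "n - j"] c0
      EW_exp[of \<mu> "m ^ (n - j) * c"] by (simp add: jc(6) mult.left_commute)
    have a: "0 \<le> a" "a \<le> s"
    proof -
      show "0 \<le> a" unfolding a_def using assms c0 m_gt1 by (intro funpow_pgf_of_real) auto
      have "\<mu> / m \<le> \<mu> * c" using mult_left_mono[OF jc(3), of \<mu>] assms by simp
      then have "a \<le> (pgf ^^ j) (exp (- ((\<mu> / m) / m ^ j)))"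
        unfolding a_def using m_gt1 assms divide_right_mono[of "\<mu> / m" "\<mu> * c" "m ^ j"]
        by (intro funpow_pgf_mono) auto
      then show "a \<le> s" using s1(2)[of j] by (simp add: s_def)
    qed
    have l: "0 \<le> rlap (\<mu> * c)" "rlap (\<mu> * c) \<le> s"
    proof -
      show "0 \<le> rlap (\<mu> * c)" using assms c0 by (intro rlap_bounds) auto
      have "\<mu> / m \<le> \<mu> * c" using mult_left_mono[OF jc(3), of \<mu>] assms by simp
      then have "rlap (\<mu> * c) \<le> rlap (\<mu> / m)" using assms m_gt1 by (intro rlap_antimono) auto
      then show "rlap (\<mu> * c) \<le> s" by (simp add: s_def)
    qed
    have q: "0 \<le> ext" "ext \<le> s" using q_nonneg by (auto simp: s_def)
    have z: "0 \<le> (pgf ^^ j) (0::real)" "(pgf ^^ j) 0 \<le> s"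
    proof -
      show "0 \<le> (pgf ^^ j) (0::real)" by (rule funpow_pgf_of_real) auto
      have "(pgf ^^ j) 0 \<le> (pgf ^^ j) ext" using q_nonneg q_lt_1 by (intro funpow_pgf_mono) auto
      then show "(pgf ^^ j) 0 \<le> s" using q by simp
    qed
    define G where "G = rate n powr \<alpha> * \<gamma> ^ (n - j)"
    have G: "0 \<le> G" "G \<le> 1" using jc(7) m_gt1 by (auto simp: G_def)
    have "\<bar>EZ n (\<epsilon> n) (\<lambda>y. exp (- (\<mu> * y))) - EW (rate n) (\<lambda>y. exp (- (\<mu> * y)))\<bar> \<le>
       norm ((pgf ^^ (n - j)) a - (pgf ^^ (n - j)) (rlap (\<mu> * c))) + norm ((pgf ^^ (n - j)) ((pgf ^^ j) 0) - (pgf ^^ (n - j)) ext)"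
      unfolding EZ EW by (simp only: real_norm_def) linarith
    also have "\<dots> \<le> C * \<gamma> ^ (n - j) * norm (a - rlap (\<mu> * c)) + C * \<gamma> ^ (n - j) * norm ((pgf ^^ j) 0 - ext)"
      using a l q z by (intro add_mono C) auto
    also have "\<dots> \<le> C * \<gamma> ^ (n - j) * dist_W \<mu> j + C * \<gamma> ^ (n - j) * \<bar>(pgf ^^ j) 0 - ext\<bar>"
      using funpow_pgf_near_rlap[of \<mu> c j] assms c0 jc(4) C(1) m_gt1
      by (intro add_mono mult_left_mono) (auto simp: a_def)
    also have "\<dots> = \<gamma> ^ (n - j) * B j" by (simp add: B_def algebra_simps)
    finally have "\<bar>rate n powr \<alpha> * (EZ n (\<epsilon> n) (\<lambda>y. exp (- (\<mu> * y))) - EW (rate n) (\<lambda>y. exp (- (\<mu> * y))))\<bar> \<le> rate n powr \<alpha> * (\<gamma> ^ (n - j) * B j)"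
      by (simp add: abs_mult mult_left_mono)
    also have "\<dots> = G * B j" by (simp add: G_def)
    also have "\<dots> \<le> B j"
    proof (rule mult_left_le_one_le)
      have "0 \<le> dist_W \<mu> j" unfolding dist_W_def using assms by (intro Bochner_Integration.integral_nonneg) auto
      then show "0 \<le> B j" using C(1) by (simp add: B_def)
    qed (use G in auto)
    finally have 1: "\<bar>rate n powr \<alpha> * (EZ n (\<epsilon> n) (\<lambda>y. exp (- (\<mu> * y))) - EW (rate n) (\<lambda>y. exp (- (\<mu> * y))))\<bar> \<le> B j" .
    have "EW (rate n) (\<lambda>y. exp (- (\<mu> * y))) \<le> C * \<gamma> ^ (n - j) * norm (rlap (\<mu> * c) - ext)"
      using C(2)[of "rlap (\<mu> * c)" ext "n - j"] l q unfolding EW by simp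
    also have "\<dots> \<le> C * \<gamma> ^ (n - j) * 1"
      using C(1) m_gt1 l q s by (intro mult_left_mono) auto
    finally have "rate n powr \<alpha> * EW (rate n) (\<lambda>y. exp (- (\<mu> * y))) \<le> rate n powr \<alpha> * (C * \<gamma> ^ (n - j) * 1)"
      by (intro mult_left_mono) auto
    also have "\<dots> = C * G" by (simp add: G_def)
    also have "\<dots> \<le> C" using G C(1) by (simp add: mult_left_le)
    finally have 2: "rate n powr \<alpha> * EW (rate n) (\<lambda>y. exp (- (\<mu> * y))) \<le> C" .
    from 1 2 jc(1) show ?thesis by blast
  qed
  show "(\<lambda>n. rate n powr \<alpha> * (EZ n (\<epsilon> n) (\<lambda>y. exp (- (\<mu> * y))) - EW (rate n) (\<lambda>y. exp (- (\<mu> * y))))) \<longlonglongrightarrow> 0"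
  proof (rule tendsto_norm_zero_cancel, rule order_tendstoI)
    fix e :: real assume "0 < e"
    then have "eventually (\<lambda>j. B j < e) sequentially" using B0 by (intro order_tendstoD) auto
    then obtain J where J: "\<And>j. j \<ge> J \<Longrightarrow> B j < e" by (auto simp: eventually_sequentially)
    show "eventually (\<lambda>n. norm (rate n powr \<alpha> * (EZ n (\<epsilon> n) (\<lambda>y. exp (- (\<mu> * y))) - EW (rate n) (\<lambda>y. exp (- (\<mu> * y))))) < e) sequentially"
      using eventually_rate_split[of J]
    proof eventually_elim
      case (elim n)
      then show ?case using main[of J n] J by fastforce
    qed
  qed (auto intro!: always_eventually order.strict_trans2[OF _ norm_ge_zero])
  show "\<exists>C. eventually (\<lambda>n. rate n powr \<alpha> * EW (rate n) (\<lambda>y. exp (- (\<mu> * y))) \<le> C) sequentially"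
    by (rule exI[of _ C], rule eventually_mono[OF eventually_rate_split[of 0]]) (use main[of 0] in blast)
qed

lemma EW_integrable:
  fixes h :: "real \<Rightarrow> real"
  assumes [measurable]: "h \<in> borel_measurable borel" and "0 \<le> t" "\<And>y. 0 \<le> y \<Longrightarrow> \<bar>h y\<bar> \<le> B"
  shows "integrable M (\<lambda>x. if W x > 0 then h (t * W x) else 0)"
proof (rule integrable_const_bound[where B=B])
  have "0 \<le> B" using assms(3)[of 0] by simp
  then show "AE x in M. norm (if W x > 0 then h (t * W x) else 0) \<le> B" using assms by auto
qed simp

lemma EZ_integrable:
  fixes h :: "real \<Rightarrow> real"
  assumes "\<And>y. 0 \<le> y \<Longrightarrow> \<bar>h y\<bar> \<le> B"
  shows "integrable M (\<lambda>x. if GW \<xi> n x > 0 then h (e\<^sup>2 * real (GW \<xi> n x)) else 0)"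
proof (rule integrable_const_bound[where B=B])
  have "0 \<le> B" using assms[of 0] by simp
  then show "AE x in M. norm (if GW \<xi> n x > 0 then h (e\<^sup>2 * real (GW \<xi> n x)) else 0) \<le> B" using assms by auto
qed (rule GW_comp_measurable[where h="\<lambda>k. if k > 0 then h (e\<^sup>2 * real k) else 0"])

lemma compare_exp_sum:
  assumes b: "\<And>i. 0 < b i"
  shows "(\<lambda>n. rate n powr \<alpha> * (EZ n (\<epsilon> n) (\<lambda>y. \<Sum>i\<le>d. a i * exp (- (b i * y))) - EW (rate n) (\<lambda>y. \<Sum>i\<le>d. a i * exp (- (b i * y))))) \<longlonglongrightarrow> 0"
proof -
  have bd: "\<bar>exp (- (b i * y))\<bar> \<le> 1" if "0 \<le> y" for i y using that less_imp_le[OF b[of i]] by simp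
  have iW: "integrable M (\<lambda>x. if W x > 0 then exp (- (b i * (rate n * W x))) else 0)" for i n
    by (rule EW_integrable[where B=1 and h="\<lambda>y. exp (- (b i * y))"]) (use bd less_imp_le[OF rate_pos] in auto)
  have iZ: "integrable M (\<lambda>x. if GW \<xi> n x > 0 then exp (- (b i * ((\<epsilon> n)\<^sup>2 * real (GW \<xi> n x)))) else 0)" for i n
    by (rule EZ_integrable[where B=1 and h="\<lambda>y. exp (- (b i * y))"]) (use bd in auto)
  have "EW (rate n) (\<lambda>y. \<Sum>i\<le>d. a i * exp (- (b i * y))) = (\<Sum>i\<le>d. a i * EW (rate n) (\<lambda>y. exp (- (b i * y))))" for n
  proof -
    have "EW (rate n) (\<lambda>y. \<Sum>i\<le>d. a i * exp (- (b i * y))) =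
      expectation (\<lambda>x. \<Sum>i\<le>d. a i * (if W x > 0 then exp (- (b i * (rate n * W x))) else 0))"
      unfolding EW_def by (intro Bochner_Integration.integral_cong) auto
    also have "\<dots> = (\<Sum>i\<le>d. a i * EW (rate n) (\<lambda>y. exp (- (b i * y))))"
      unfolding EW_def using iW
      by (subst Bochner_Integration.integral_sum) auto
    finally show ?thesis .
  qed
  moreover have "EZ n (\<epsilon> n) (\<lambda>y. \<Sum>i\<le>d. a i * exp (- (b i * y))) = (\<Sum>i\<le>d. a i * EZ n (\<epsilon> n) (\<lambda>y. exp (- (b i * y))))" for n
  proof -
    have "EZ n (\<epsilon> n) (\<lambda>y. \<Sum>i\<le>d. a i * exp (- (b i * y))) =
      expectation (\<lambda>x. \<Sum>i\<le>d. a i * (if GW \<xi> n x > 0 then exp (- (b i * ((\<epsilon> n)\<^sup>2 * real (GW \<xi> n x)))) else 0))"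
      unfolding EZ_def by (intro Bochner_Integration.integral_cong) auto
    also have "\<dots> = (\<Sum>i\<le>d. a i * EZ n (\<epsilon> n) (\<lambda>y. exp (- (b i * y))))"
      unfolding EZ_def using iZ
      by (subst Bochner_Integration.integral_sum) auto
    finally show ?thesis .
  qed
  ultimately have "rate n powr \<alpha> * (EZ n (\<epsilon> n) (\<lambda>y. \<Sum>i\<le>d. a i * exp (- (b i * y))) - EW (rate n) (\<lambda>y. \<Sum>i\<le>d. a i * exp (- (b i * y)))) =
     (\<Sum>i\<le>d. a i * (rate n powr \<alpha> * (EZ n (\<epsilon> n) (\<lambda>y. exp (- (b i * y))) - EW (rate n) (\<lambda>y. exp (- (b i * y))))))" for n
    by (simp add: sum_distrib_left sum_subtractf[symmetric] right_diff_distrib mult_ac)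
  moreover have "(\<lambda>n. \<Sum>i\<le>d. a i * (rate n powr \<alpha> * (EZ n (\<epsilon> n) (\<lambda>y. exp (- (b i * y))) - EW (rate n) (\<lambda>y. exp (- (b i * y)))))) \<longlonglongrightarrow> (\<Sum>i\<le>d. a i * 0)"
    by (intro tendsto_intros laplace_compare b)
  ultimately show ?thesis by simp
qed

lemma EW_diff_le:
  assumes [measurable]: "h \<in> borel_measurable borel" "k \<in> borel_measurable borel"
    and bd: "\<And>y. 0 \<le> y \<Longrightarrow> \<bar>h y\<bar> \<le> B" "\<And>y. 0 \<le> y \<Longrightarrow> \<bar>k y\<bar> \<le> B" "0 \<le> \<mu>" "0 \<le> t"
    and le: "\<And>y. 0 \<le> y \<Longrightarrow> \<bar>h y - k y\<bar> \<le> \<eta> * exp (- (\<mu> * y))"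
  shows "\<bar>EW t h - EW t k\<bar> \<le> \<eta> * EW t (\<lambda>y. exp (- (\<mu> * y)))"
proof -
  have i1: "integrable M (\<lambda>x. if W x > 0 then h (t * W x) else 0)" by (rule EW_integrable[where B=B]) (use bd in auto)
  have i2: "integrable M (\<lambda>x. if W x > 0 then k (t * W x) else 0)" by (rule EW_integrable[where B=B]) (use bd in auto)
  have i3: "integrable M (\<lambda>x. if W x > 0 then exp (- (\<mu> * (t * W x))) else 0)"
    by (rule EW_integrable[where B=1 and h="\<lambda>y. exp (- (\<mu> * y))"]) (use bd in auto)
  have "\<bar>EW t h - EW t k\<bar> = \<bar>expectation (\<lambda>x. (if W x > 0 then h (t * W x) else 0) - (if W x > 0 then k (t * W x) else 0))\<bar>"
    unfolding EW_def using i1 i2 by simp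
  also have "\<dots> \<le> expectation (\<lambda>x. \<bar>(if W x > 0 then h (t * W x) else 0) - (if W x > 0 then k (t * W x) else 0)\<bar>)"
    by (rule integral_abs_bound)
  also have "\<dots> \<le> expectation (\<lambda>x. \<eta> * (if W x > 0 then exp (- (\<mu> * (t * W x))) else 0))"
    by (rule integral_mono) (use i1 i2 i3 le bd in auto)
  finally show ?thesis by (simp add: EW_def)
qed

lemma EZ_diff_le:
  assumes bd: "\<And>y. 0 \<le> y \<Longrightarrow> \<bar>h y\<bar> \<le> B" "\<And>y. 0 \<le> y \<Longrightarrow> \<bar>k y\<bar> \<le> B" "0 \<le> \<mu>"
    and le: "\<And>y. 0 \<le> y \<Longrightarrow> \<bar>h y - k y\<bar> \<le> \<eta> * exp (- (\<mu> * y))"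
  shows "\<bar>EZ n e h - EZ n e k\<bar> \<le> \<eta> * EZ n e (\<lambda>y. exp (- (\<mu> * y)))"
proof -
  have i1: "integrable M (\<lambda>x. if GW \<xi> n x > 0 then h (e\<^sup>2 * real (GW \<xi> n x)) else 0)" by (rule EZ_integrable[where B=B]) (use bd in auto)
  have i2: "integrable M (\<lambda>x. if GW \<xi> n x > 0 then k (e\<^sup>2 * real (GW \<xi> n x)) else 0)" by (rule EZ_integrable[where B=B]) (use bd in auto)
  have i3: "integrable M (\<lambda>x. if GW \<xi> n x > 0 then exp (- (\<mu> * (e\<^sup>2 * real (GW \<xi> n x)))) else 0)"
    by (rule EZ_integrable[where B=1 and h="\<lambda>y. exp (- (\<mu> * y))"]) (use bd in auto)
  have "\<bar>EZ n e h - EZ n e k\<bar> = \<bar>expectation (\<lambda>x. (if GW \<xi> n x > 0 then h (e\<^sup>2 * real (GW \<xi> n x)) else 0) - (if GW \<xi> n x > 0 then k (e\<^sup>2 * real (GW \<xi> n x)) else 0))\<bar>"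
    unfolding EZ_def using i1 i2 by simp
  also have "\<dots> \<le> expectation (\<lambda>x. \<bar>(if GW \<xi> n x > 0 then h (e\<^sup>2 * real (GW \<xi> n x)) else 0) - (if GW \<xi> n x > 0 then k (e\<^sup>2 * real (GW \<xi> n x)) else 0)\<bar>)"
    by (rule integral_abs_bound)
  also have "\<dots> \<le> expectation (\<lambda>x. \<eta> * (if GW \<xi> n x > 0 then exp (- (\<mu> * (e\<^sup>2 * real (GW \<xi> n x)))) else 0))"
    by (rule integral_mono) (use i1 i2 i3 le bd in auto)
  finally show ?thesis by (simp add: EZ_def)
qed

text \<open>One factor exp(-\<mu> y) stays outside the Weierstrass approximation, so the error is
  \<eta> exp(-\<mu> y), and its mean remains bounded after multiplication by N^\<alpha>; a plain
  uniform error would be amplified by N^\<alpha>.\<close>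

lemma compare_continuous:
  assumes mu: "0 < \<mu>" and H: "continuous_on {0..1} H" and h_meas: "h \<in> borel_measurable borel"
    and h: "\<And>y. 0 \<le> y \<Longrightarrow> h y = exp (- (\<mu> * y)) * H (exp (- (\<mu> * y)))"
  shows "(\<lambda>n. rate n powr \<alpha> * (EZ n (\<epsilon> n) h - EW (rate n) h)) \<longlonglongrightarrow> 0"
proof -
  let ?E = "\<lambda>y. exp (- (\<mu> * y))"
  let ?T = "\<lambda>n h. rate n powr \<alpha> * (EZ n (\<epsilon> n) h - EW (rate n) h)"
  obtain C where C: "eventually (\<lambda>n. rate n powr \<alpha> * EW (rate n) ?E \<le> C) sequentially"
    using laplace_compare(2)[OF mu] by blast
  have Tz: "eventually (\<lambda>n. \<bar>?T n ?E\<bar> < 1) sequentially"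
    using tendstoD[OF laplace_compare(1)[OF mu], of 1] by (simp add: dist_real_def)
  have "C \<ge> 0"
  proof -
    obtain n where n: "rate n powr \<alpha> * EW (rate n) ?E \<le> C" using eventually_happens'[OF _ C] by auto
    have "0 \<le> EW (rate n) ?E" unfolding EW_def by (rule Bochner_Integration.integral_nonneg) auto
    then show ?thesis using n by (metis mult_nonneg_nonneg order_trans powr_ge_zero)
  qed
  obtain B where B: "\<And>y. y \<in> {0..1} \<Longrightarrow> \<bar>H y\<bar> \<le> B"
    using compact_imp_bounded[OF compact_continuous_image[OF H]] unfolding bounded_iff by fastforce
  show ?thesis
  proof (rule tendsto_norm_zero_cancel, rule order_tendstoI)
    fix e :: real assume e: "0 < e"
    \<comment> \<open>The normalized means of exp(-\<mu> y) are at most C + 1 for Z_n and C for W,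
      so together the approximation errors cost e / 2.\<close>
    define \<eta> where "\<eta> = e / (2 * (2 * C + 1))"
    have \<eta>: "\<eta> > 0" using e \<open>C \<ge> 0\<close> by (simp add: \<eta>_def)
    obtain g where "real_polynomial_function g" and g: "\<And>y. y \<in> {0..1} \<Longrightarrow> \<bar>H y - g y\<bar> < \<eta>"
      using Stone_Weierstrass_real_polynomial_function[OF _ H \<eta>] by auto
    then obtain a d where gs: "g = (\<lambda>y. \<Sum>i\<le>d. a i * y ^ i)" by (auto simp: real_polynomial_function_iff_sum)
    \<comment> \<open>The outer factor raises every exponent by one, so the constant term of the
      polynomial also becomes a decaying exponential.\<close>
    define k where "k y = (\<Sum>i\<le>d. a i * exp (- (\<mu> * real (Suc i) * y)))" for y
    have k: "k y = ?E y * g (?E y)" for y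
      unfolding k_def gs by (simp add: sum_distrib_left exp_of_nat_mult[symmetric] exp_add[symmetric] algebra_simps)
    have [measurable]: "k \<in> borel_measurable borel" unfolding k_def[abs_def] by measurable
    have E01: "?E y \<in> {0..1}" if "0 \<le> y" for y using that mu by auto
    have le: "\<bar>h y - k y\<bar> \<le> \<eta> * ?E y" if "0 \<le> y" for y
    proof -
      have "\<bar>h y - k y\<bar> = ?E y * \<bar>H (?E y) - g (?E y)\<bar>"
        using that by (simp add: h k abs_mult flip: right_diff_distrib)
      also have "\<dots> \<le> ?E y * \<eta>" using g[OF E01[OF that]] by (intro mult_left_mono) auto
      finally show ?thesis by (simp add: mult.commute)
    qed
    have hb: "\<bar>h y\<bar> \<le> B" if "0 \<le> y" for y
    proof -
      have "\<bar>h y\<bar> = ?E y * \<bar>H (?E y)\<bar>" using that by (simp add: h abs_mult)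
      also have "\<dots> \<le> 1 * B" using B[OF E01[OF that]] E01[OF that] by (intro mult_mono) auto
      finally show ?thesis by simp
    qed
    have hb': "\<bar>h y\<bar> \<le> B + \<eta>" if "0 \<le> y" for y using hb[OF that] \<eta> by simp
    have kb: "\<bar>k y\<bar> \<le> B + \<eta>" if "0 \<le> y" for y
    proof -
      have "\<eta> * ?E y \<le> \<eta> * 1" using E01[OF that] \<eta> by (intro mult_left_mono) auto
      then show ?thesis using le[OF that] hb[OF that] by simp
    qed
    have "(\<lambda>n. ?T n k) \<longlonglongrightarrow> 0" unfolding k_def using mu by (intro compare_exp_sum) auto
    then have "eventually (\<lambda>n. \<bar>?T n k\<bar> < e / 2) sequentially"
      using tendstoD[of "\<lambda>n. ?T n k" 0 sequentially "e / 2"] e by (simp add: dist_real_def)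
    with C Tz show "eventually (\<lambda>n. norm (?T n h) < e) sequentially"
    proof eventually_elim
      case (elim n)
      define r where "r = rate n powr \<alpha>"
      have r: "0 \<le> r" by (simp add: r_def)
      have 1: "\<bar>EZ n (\<epsilon> n) h - EZ n (\<epsilon> n) k\<bar> \<le> \<eta> * EZ n (\<epsilon> n) ?E"
        by (rule EZ_diff_le[OF hb' kb _ le]) (use mu in auto)
      have 2: "\<bar>EW (rate n) h - EW (rate n) k\<bar> \<le> \<eta> * EW (rate n) ?E"
        by (rule EW_diff_le[OF h_meas _ hb' kb _ _ le]) (use mu rate_pos[of n] in auto)
      have 3: "r * EZ n (\<epsilon> n) ?E \<le> C + 1" using elim(1,2) by (simp add: r_def right_diff_distrib abs_less_iff)
      have "?T n h - ?T n k = r * ((EZ n (\<epsilon> n) h - EZ n (\<epsilon> n) k) - (EW (rate n) h - EW (rate n) k))"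
        unfolding r_def by (simp add: algebra_simps)
      then have "\<bar>?T n h - ?T n k\<bar> = r * \<bar>(EZ n (\<epsilon> n) h - EZ n (\<epsilon> n) k) - (EW (rate n) h - EW (rate n) k)\<bar>"
        using r by (simp add: abs_mult)
      also have "\<dots> \<le> r * (\<eta> * EZ n (\<epsilon> n) ?E + \<eta> * EW (rate n) ?E)"
        using 1 2 r by (intro mult_left_mono) auto
      also have "\<dots> = \<eta> * (r * EZ n (\<epsilon> n) ?E + r * EW (rate n) ?E)" by (simp add: algebra_simps)
      also have "\<dots> \<le> \<eta> * ((C + 1) + C)"
        using 3 elim(1) \<eta> by (intro mult_left_mono add_mono) (auto simp: r_def)
      also have "\<dots> = e / 2" using \<open>C \<ge> 0\<close> by (simp add: \<eta>_def field_simps)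
      finally show ?case using elim(3) unfolding real_norm_def by linarith
    qed
  qed (auto intro!: always_eventually order.strict_trans2[OF _ norm_ge_zero])
qed

end

section \<open>Gaussian tails\<close>

definition gauss_tail :: "real \<Rightarrow> real" where
  "gauss_tail x = measure std_normal_distribution {x<..}"

interpretation std_normal: real_distribution std_normal_distribution
  by (rule real_dist_normal_dist)

lemma gauss_tail_nn_integral:
  "ennreal (gauss_tail x) = (\<integral>\<^sup>+z. ennreal (std_normal_density z) * indicator {x<..} z \<partial>lborel)"
  unfolding gauss_tail_def std_normal.emeasure_eq_measure[symmetric] by (subst emeasure_density) auto

lemma gauss_tail_bounds: "0 \<le> gauss_tail x" "gauss_tail x \<le> 1"
  by (auto simp: gauss_tail_def)

lemma gauss_tail_cdf: "gauss_tail x = 1 - cdf std_normal_distribution x"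
proof -
  have "{x<..} = space std_normal_distribution - {..x}" by auto
  then show ?thesis unfolding gauss_tail_def cdf_def2 by (subst std_normal.prob_compl[symmetric]) auto
qed

lemma std_normal_density_le_1: "std_normal_density x \<le> 1"
proof -
  have "1 / sqrt (2 * pi) \<le> 1" using pi_ge_two by (simp add: divide_le_eq)
  then show ?thesis unfolding std_normal_density_def by (intro mult_le_one) auto
qed

lemma gauss_tail_diff:
  assumes "x \<le> y"
  shows "gauss_tail x - gauss_tail y \<le> y - x" "gauss_tail y \<le> gauss_tail x"
proof -
  show "gauss_tail y \<le> gauss_tail x" unfolding gauss_tail_def
    using assms by (intro std_normal.finite_measure_mono) auto
  have "gauss_tail x - gauss_tail y = measure std_normal_distribution ({x<..} - {y<..})"
    unfolding gauss_tail_def using assms by (subst std_normal.finite_measure_Diff) auto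
  also have "{x<..} - {y<..} = {x<..y}" by auto
  finally have eq: "gauss_tail x - gauss_tail y = measure std_normal_distribution {x<..y}" .
  have "ennreal (measure std_normal_distribution {x<..y}) = (\<integral>\<^sup>+z. ennreal (std_normal_density z) * indicator {x<..y} z \<partial>lborel)"
    unfolding std_normal.emeasure_eq_measure[symmetric] by (subst emeasure_density) auto
  also have "\<dots> \<le> (\<integral>\<^sup>+z. 1 * indicator {x<..y} z \<partial>lborel)"
    by (intro nn_integral_mono mult_right_mono) (auto simp: std_normal_density_le_1 simp flip: ennreal_1 intro!: ennreal_leI)
  also have "\<dots> = ennreal (y - x)" using assms by (subst nn_integral_cmult_indicator) auto
  finally show "gauss_tail x - gauss_tail y \<le> y - x" unfolding eq using assms by simp
qed

lemma continuous_gauss_tail: "continuous_on UNIV gauss_tail"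
  unfolding continuous_on_iff
proof (intro ballI allI impI)
  fix x e :: real assume "0 < e"
  have "\<bar>gauss_tail y - gauss_tail x\<bar> \<le> \<bar>y - x\<bar>" for y
    using gauss_tail_diff[of x y] gauss_tail_diff[of y x] by (cases "x \<le> y") auto
  then show "\<exists>d>0. \<forall>y\<in>UNIV. dist y x < d \<longrightarrow> dist (gauss_tail y) (gauss_tail x) < e"
    using \<open>0 < e\<close> by (auto simp: dist_real_def intro!: exI[of _ e] intro: le_less_trans)
qed

lemma gauss_tail_measurable [measurable]: "gauss_tail \<in> borel_measurable borel"
  by (rule borel_measurable_continuous_onI[OF continuous_gauss_tail])

text \<open>Shifting the variable by x, the density at x + z is at most exp(-x^2 / 2) times the
  density at z, because x z \<ge> 0.\<close>

lemma gauss_tail_le_exp: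
  assumes "0 \<le> x"
  shows "gauss_tail x \<le> exp (- (x\<^sup>2 / 2))"
proof -
  have "ennreal (gauss_tail x) = (\<integral>\<^sup>+z. ennreal (std_normal_density (x + 1 * z)) * indicator {x<..} (x + 1 * z) \<partial>lborel)"
    unfolding gauss_tail_nn_integral by (subst nn_integral_real_affine[where c=1 and t=x]) auto
  also have "\<dots> \<le> (\<integral>\<^sup>+z. ennreal (exp (- (x\<^sup>2 / 2))) * (ennreal (std_normal_density z) * indicator {0<..} z) \<partial>lborel)"
  proof (intro nn_integral_mono)
    fix z :: real
    have "std_normal_density (x + z) \<le> exp (- (x\<^sup>2 / 2)) * std_normal_density z" if "0 < z"
    proof -
      have "- (x + z)\<^sup>2 / 2 = - (x\<^sup>2 / 2) + - z\<^sup>2 / 2 - x * z" by (simp add: power2_eq_square field_simps)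
      also have "\<dots> \<le> - (x\<^sup>2 / 2) + - z\<^sup>2 / 2" using assms that by simp
      finally have "exp (- (x + z)\<^sup>2 / 2) \<le> exp (- (x\<^sup>2 / 2)) * exp (- z\<^sup>2 / 2)" by (simp flip: exp_add)
      then have "1 / sqrt (2 * pi) * exp (- (x + z)\<^sup>2 / 2) \<le> 1 / sqrt (2 * pi) * (exp (- (x\<^sup>2 / 2)) * exp (- z\<^sup>2 / 2))"
        by (intro mult_left_mono) auto
      then show ?thesis unfolding std_normal_density_def by (simp only: mult_ac)
    qed
    then show "ennreal (std_normal_density (x + 1 * z)) * indicator {x<..} (x + 1 * z) \<le> ennreal (exp (- (x\<^sup>2 / 2))) * (ennreal (std_normal_density z) * indicator {0<..} z)"
      by (auto simp: indicator_def ennreal_mult[symmetric] intro!: ennreal_leI)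
  qed
  also have "\<dots> = ennreal (exp (- (x\<^sup>2 / 2))) * ennreal (gauss_tail 0)"
    unfolding gauss_tail_nn_integral by (rule nn_integral_cmult) auto
  also have "\<dots> = ennreal (exp (- (x\<^sup>2 / 2)) * gauss_tail 0)" by (simp add: ennreal_mult gauss_tail_bounds)
  finally have "gauss_tail x \<le> exp (- (x\<^sup>2 / 2)) * gauss_tail 0"
    by (subst (asm) ennreal_le_iff) (auto simp: gauss_tail_bounds)
  also have "\<dots> \<le> exp (- (x\<^sup>2 / 2))" using gauss_tail_bounds[of 0] by (simp add: mult_left_le)
  finally show ?thesis .
qed

lemma power2_powr: "0 < z \<Longrightarrow> (z\<^sup>2) powr a = z powr (2 * a)" for z :: real
proof -
  assume "0 < z"
  then have "z\<^sup>2 = z powr 2" by simp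
  then show ?thesis by (simp only: powr_powr)
qed

lemma nn_integral_powr_0:
  assumes "0 < \<alpha>" "0 \<le> (b::real)"
  shows "(\<integral>\<^sup>+v. ennreal (v powr (\<alpha> - 1)) * indicator {0..b} v \<partial>lborel) = ennreal (b powr \<alpha> / \<alpha>)"
proof -
  have "((\<lambda>v. v powr (\<alpha> - 1)) has_integral (b powr (\<alpha> - 1 + 1) / (\<alpha> - 1 + 1))) {0..b}"
    using assms by (intro has_integral_powr_from_0) auto
  from nn_integral_has_integral_lebesgue'[OF _ this] show ?thesis by simp
qed

text \<open>The substitution s = z^2 / 2 turns the Gamma integral at \<alpha> + 1/2 into the
  Gaussian moment. It is carried out on [0, n] and passed to the half-line by monotone convergence
  on both sides.\<close>

lemma nn_integral_gauss_moment:
  assumes "0 < (\<alpha>::real)"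
  shows "(\<integral>\<^sup>+z. ennreal (z powr (2 * \<alpha>) * std_normal_density z) * indicator {0..} z \<partial>lborel) =
    ennreal (2 powr (\<alpha> - 1) * Gamma (\<alpha> + 1 / 2) / sqrt pi)"
proof -
  let ?f = "\<lambda>s. ennreal (s powr (\<alpha> + 1 / 2 - 1) / exp s)"
  have eq: "(\<integral>\<^sup>+s. ?f s * indicator {0..(real n)\<^sup>2 / 2} s \<partial>lborel) =
      (\<integral>\<^sup>+z. ennreal (2 powr (1 / 2 - \<alpha>) * sqrt (2 * pi)) * (ennreal (z powr (2 * \<alpha>) * std_normal_density z) * indicator {0..real n} z) \<partial>lborel)" if "n > 0" for n
  proof -
    have "(\<integral>\<^sup>+s. ?f s * indicator {0\<^sup>2 / 2..(real n)\<^sup>2 / 2} s \<partial>lborel) = (\<integral>\<^sup>+z. ?f (z\<^sup>2 / 2) * ennreal z * indicator {0..real n} z \<partial>lborel)"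
      by (rule nn_integral_substitution_aux[where g="\<lambda>z. z\<^sup>2 / 2" and g'="\<lambda>z. z"])
         (use that in \<open>auto intro!: derivative_eq_intros continuous_intros\<close>)
    also have "\<dots> = (\<integral>\<^sup>+z. ennreal (2 powr (1 / 2 - \<alpha>) * sqrt (2 * pi)) * (ennreal (z powr (2 * \<alpha>) * std_normal_density z) * indicator {0..real n} z) \<partial>lborel)"
    proof (intro nn_integral_cong)
      fix z :: real
      show "?f (z\<^sup>2 / 2) * ennreal z * indicator {0..real n} z = ennreal (2 powr (1 / 2 - \<alpha>) * sqrt (2 * pi)) * (ennreal (z powr (2 * \<alpha>) * std_normal_density z) * indicator {0..real n} z)"
      proof (cases "0 < z")
        case True
        have "(z\<^sup>2 / 2) powr (\<alpha> + 1 / 2 - 1) * z = 2 powr (1 / 2 - \<alpha>) * z powr (2 * \<alpha>)"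
        proof -
          have "(z\<^sup>2 / 2) powr (\<alpha> + 1 / 2 - 1) = (z\<^sup>2) powr (\<alpha> - 1 / 2) / 2 powr (\<alpha> - 1 / 2)"
            using True by (simp add: powr_divide)
          also have "(z\<^sup>2) powr (\<alpha> - 1 / 2) = z powr (2 * \<alpha> - 1)"
            using power2_powr[OF True, of "\<alpha> - 1 / 2"] by (simp add: right_diff_distrib)
          also have "\<dots> = z powr (2 * \<alpha>) / z" using True by (simp add: powr_diff)
          also have "2 powr (\<alpha> - 1 / 2) = 1 / 2 powr (1 / 2 - \<alpha>)"
            by (simp add: powr_minus_divide[symmetric])
          finally show ?thesis using True by simp
        qed
        then have "(z\<^sup>2 / 2) powr (\<alpha> + 1 / 2 - 1) / exp (z\<^sup>2 / 2) * z = 2 powr (1 / 2 - \<alpha>) * z powr (2 * \<alpha>) / exp (z\<^sup>2 / 2)"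
          by simp
        also have "\<dots> = 2 powr (1 / 2 - \<alpha>) * sqrt (2 * pi) * (z powr (2 * \<alpha>) * std_normal_density z)"
        proof -
          have "- z\<^sup>2 / 2 = - (z\<^sup>2 / 2)" by simp
          then have "exp (- z\<^sup>2 / 2) = 1 / exp (z\<^sup>2 / 2)" by (simp only: exp_minus inverse_eq_divide)
          then have d: "sqrt (2 * pi) * std_normal_density z = 1 / exp (z\<^sup>2 / 2)"
            unfolding std_normal_density_def by simp
          have "2 powr (1 / 2 - \<alpha>) * sqrt (2 * pi) * (z powr (2 * \<alpha>) * std_normal_density z) =
              2 powr (1 / 2 - \<alpha>) * z powr (2 * \<alpha>) * (sqrt (2 * pi) * std_normal_density z)"
            by (simp only: mult_ac)
          then show ?thesis unfolding d by simp
        qed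
        finally have eq: "(z\<^sup>2 / 2) powr (\<alpha> + 1 / 2 - 1) / exp (z\<^sup>2 / 2) * z =
            2 powr (1 / 2 - \<alpha>) * sqrt (2 * pi) * (z powr (2 * \<alpha>) * std_normal_density z)" .
        have "?f (z\<^sup>2 / 2) * ennreal z = ennreal ((z\<^sup>2 / 2) powr (\<alpha> + 1 / 2 - 1) / exp (z\<^sup>2 / 2) * z)"
          using True by (intro ennreal_mult[symmetric]) auto
        also have "\<dots> = ennreal (2 powr (1 / 2 - \<alpha>) * sqrt (2 * pi)) * ennreal (z powr (2 * \<alpha>) * std_normal_density z)"
          unfolding eq by (intro ennreal_mult) auto
        finally show ?thesis by (simp only: mult.assoc)
      qed (use assms in \<open>auto simp: indicator_def not_less\<close>)
    qed
    finally show ?thesis by simp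
  qed
  have lim1: "(\<lambda>n. \<integral>\<^sup>+s. ?f s * indicator {0..(real n)\<^sup>2 / 2} s \<partial>lborel) \<longlonglongrightarrow> (\<integral>\<^sup>+s. ?f s * indicator {0..} s \<partial>lborel)"
  proof (rule nn_integral_LIMSEQ)
    show "incseq (\<lambda>n s. ?f s * indicator {0..(real n)\<^sup>2 / 2} s)"
    proof (rule incseq_SucI, rule le_funI)
      fix n s
      have "(real n)\<^sup>2 \<le> (real (Suc n))\<^sup>2" by (intro power_mono) auto
      then show "?f s * indicator {0..(real n)\<^sup>2 / 2} s \<le> ?f s * indicator {0..(real (Suc n))\<^sup>2 / 2} s"
        by (intro mult_left_mono indicator_leI, simp_all only: atLeastAtMost_iff zero_le) linarith
    qed
    fix s :: real
    have "eventually (\<lambda>n. max s 2 \<le> real n) sequentially"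
      using filterlim_real_sequentially unfolding filterlim_at_top by blast
    then have "eventually (\<lambda>n. s \<le> (real n)\<^sup>2 / 2) sequentially"
    proof eventually_elim
      case (elim n)
      then have "2 * real n \<le> real n * real n" by (intro mult_right_mono) auto
      moreover have "s \<le> real n" using elim by simp
      ultimately show ?case unfolding power2_eq_square by linarith
    qed
    then have "eventually (\<lambda>n. ?f s * indicator {0..(real n)\<^sup>2 / 2} s = ?f s * indicator {0..} s) sequentially"
      by eventually_elim (auto simp: indicator_def)
    then show "(\<lambda>n. ?f s * indicator {0..(real n)\<^sup>2 / 2} s) \<longlonglongrightarrow> ?f s * indicator {0..} s"
      by (rule tendsto_eventually)
  qed auto
  have lim2: "(\<lambda>n. \<integral>\<^sup>+z. ennreal (2 powr (1 / 2 - \<alpha>) * sqrt (2 * pi)) * (ennreal (z powr (2 * \<alpha>) * std_normal_density z) * indicator {0..real n} z) \<partial>lborel)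
     \<longlonglongrightarrow> (\<integral>\<^sup>+z. ennreal (2 powr (1 / 2 - \<alpha>) * sqrt (2 * pi)) * (ennreal (z powr (2 * \<alpha>) * std_normal_density z) * indicator {0..} z) \<partial>lborel)"
  proof (rule nn_integral_LIMSEQ)
    show "incseq (\<lambda>n z. ennreal (2 powr (1 / 2 - \<alpha>) * sqrt (2 * pi)) * (ennreal (z powr (2 * \<alpha>) * std_normal_density z) * indicator {0..real n} z))"
      by (intro incseq_SucI le_funI mult_left_mono) (auto simp: indicator_def)
    fix z :: real
    have "eventually (\<lambda>n. z \<le> real n) sequentially" 
      using filterlim_real_sequentially unfolding filterlim_at_top by blast
    then have "eventually (\<lambda>n. ennreal (2 powr (1 / 2 - \<alpha>) * sqrt (2 * pi)) * (ennreal (z powr (2 * \<alpha>) * std_normal_density z) * indicator {0..real n} z) = ennreal (2 powr (1 / 2 - \<alpha>) * sqrt (2 * pi)) * (ennreal (z powr (2 * \<alpha>) * std_normal_density z) * indicator {0..} z)) sequentially"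
      by eventually_elim (auto simp: indicator_def)
    then show "(\<lambda>n. ennreal (2 powr (1 / 2 - \<alpha>) * sqrt (2 * pi)) * (ennreal (z powr (2 * \<alpha>) * std_normal_density z) * indicator {0..real n} z)) \<longlonglongrightarrow> ennreal (2 powr (1 / 2 - \<alpha>) * sqrt (2 * pi)) * (ennreal (z powr (2 * \<alpha>) * std_normal_density z) * indicator {0..} z)"
      by (rule tendsto_eventually)
  qed auto
  have "(\<integral>\<^sup>+s. ?f s * indicator {0..} s \<partial>lborel) = (\<integral>\<^sup>+z. ennreal (2 powr (1 / 2 - \<alpha>) * sqrt (2 * pi)) * (ennreal (z powr (2 * \<alpha>) * std_normal_density z) * indicator {0..} z) \<partial>lborel)"
    by (rule LIMSEQ_unique[OF lim1], rule Lim_transform_eventually[OF lim2])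
       (use eq in \<open>auto intro!: eventually_mono[OF eventually_gt_at_top[of 0]]\<close>)
  also have "\<dots> = ennreal (2 powr (1 / 2 - \<alpha>) * sqrt (2 * pi)) * (\<integral>\<^sup>+z. ennreal (z powr (2 * \<alpha>) * std_normal_density z) * indicator {0..} z \<partial>lborel)"
    by (rule nn_integral_cmult) auto
  finally have main: "ennreal (2 powr (1 / 2 - \<alpha>) * sqrt (2 * pi)) * (\<integral>\<^sup>+z. ennreal (z powr (2 * \<alpha>) * std_normal_density z) * indicator {0..} z \<partial>lborel) = (\<integral>\<^sup>+s. ?f s * indicator {0..} s \<partial>lborel)" ..
  also have "\<dots> = (\<integral>\<^sup>+s. ennreal (indicator {0..} s * s powr (\<alpha> + 1 / 2 - 1) / exp s) \<partial>lborel)"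
    by (intro nn_integral_cong) (auto simp: indicator_def)
  also have "\<dots> = ennreal (Gamma (\<alpha> + 1 / 2))"
    by (rule Gamma_conv_nn_integral_real[symmetric]) (use assms in auto)
  finally have main: "ennreal (2 powr (1 / 2 - \<alpha>) * sqrt (2 * pi)) * (\<integral>\<^sup>+z. ennreal (z powr (2 * \<alpha>) * std_normal_density z) * indicator {0..} z \<partial>lborel) = ennreal (Gamma (\<alpha> + 1 / 2))" .
  have c: "(2 powr (\<alpha> - 1) / sqrt pi) * (2 powr (1 / 2 - \<alpha>) * sqrt (2 * pi)) = 1"
  proof -
    have "2 powr (\<alpha> - 1) * 2 powr (1 / 2 - \<alpha>) * 2 powr (1 / 2) = (2::real) powr 0"
      by (simp flip: powr_add)
    then show ?thesis by (simp add: real_sqrt_mult powr_half_sqrt mult_ac)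
  qed
  define J where "J = (\<integral>\<^sup>+z. ennreal (z powr (2 * \<alpha>) * std_normal_density z) * indicator {0..} z \<partial>lborel)"
  have "J = ennreal ((2 powr (\<alpha> - 1) / sqrt pi) * (2 powr (1 / 2 - \<alpha>) * sqrt (2 * pi))) * J" unfolding c by simp
  also have "\<dots> = ennreal (2 powr (\<alpha> - 1) / sqrt pi) * (ennreal (2 powr (1 / 2 - \<alpha>) * sqrt (2 * pi)) * J)"
    by (subst ennreal_mult) (auto simp: mult.assoc)
  also have "\<dots> = ennreal (2 powr (\<alpha> - 1) / sqrt pi) * ennreal (Gamma (\<alpha> + 1 / 2))" using main by (simp add: J_def)
  also have "\<dots> = ennreal (2 powr (\<alpha> - 1) / sqrt pi * Gamma (\<alpha> + 1 / 2))"
    by (subst ennreal_mult) (use assms in \<open>auto intro!: less_imp_le[OF Gamma_real_pos]\<close>)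
  finally show ?thesis by (simp add: J_def)
qed

text \<open>Write the tail as an integral over z and exchange: sqrt v / \<sigma> < z means v <
  \<sigma>^2 z^2, and v^(\<alpha>-1) integrates over that range to (\<sigma>^2 z^2)^\<alpha> /
  \<alpha>.\<close>

lemma nn_integral_gauss_tail:
  assumes "0 < \<alpha>" "0 < \<sigma>"
  shows "(\<integral>\<^sup>+v. ennreal (gauss_tail (sqrt v / \<sigma>) * v powr (\<alpha> - 1)) * indicator {0<..} v \<partial>lborel) =
    ennreal (2 powr (\<alpha> - 1) * Gamma (\<alpha> + 1 / 2) / (\<alpha> * sqrt pi) * (\<sigma>\<^sup>2) powr \<alpha>)"
proof -
  have "(\<integral>\<^sup>+v. ennreal (gauss_tail (sqrt v / \<sigma>) * v powr (\<alpha> - 1)) * indicator {0<..} v \<partial>lborel) =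
    (\<integral>\<^sup>+v. (\<integral>\<^sup>+z. ennreal (std_normal_density z) * indicator {sqrt v / \<sigma><..} z * (ennreal (v powr (\<alpha> - 1)) * indicator {0<..} v) \<partial>lborel) \<partial>lborel)"
  proof (intro nn_integral_cong)
    fix v :: real
    have "(\<integral>\<^sup>+z. ennreal (std_normal_density z) * indicator {sqrt v / \<sigma><..} z * (ennreal (v powr (\<alpha> - 1)) * indicator {0<..} v) \<partial>lborel) =
       ennreal (gauss_tail (sqrt v / \<sigma>)) * (ennreal (v powr (\<alpha> - 1)) * indicator {0<..} v)"
      unfolding gauss_tail_nn_integral by (rule nn_integral_multc) auto
    then show "ennreal (gauss_tail (sqrt v / \<sigma>) * v powr (\<alpha> - 1)) * indicator {0<..} v = (\<integral>\<^sup>+z. ennreal (std_normal_density z) * indicator {sqrt v / \<sigma><..} z * (ennreal (v powr (\<alpha> - 1)) * indicator {0<..} v) \<partial>lborel)"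
      by (simp add: ennreal_mult gauss_tail_bounds mult.assoc)
  qed
  also have "\<dots> = (\<integral>\<^sup>+z. (\<integral>\<^sup>+v. ennreal (std_normal_density z) * indicator {sqrt v / \<sigma><..} z * (ennreal (v powr (\<alpha> - 1)) * indicator {0<..} v) \<partial>lborel) \<partial>lborel)"
    by (rule lborel_pair.Fubini') (simp add: indicator_def[abs_def] split_beta')
  also have "\<dots> = (\<integral>\<^sup>+z. ennreal ((\<sigma>\<^sup>2) powr \<alpha> / \<alpha>) * (ennreal (z powr (2 * \<alpha>) * std_normal_density z) * indicator {0..} z) \<partial>lborel)"
  proof (intro nn_integral_cong)
    fix z :: real
    show "(\<integral>\<^sup>+v. ennreal (std_normal_density z) * indicator {sqrt v / \<sigma><..} z * (ennreal (v powr (\<alpha> - 1)) * indicator {0<..} v) \<partial>lborel) =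
      ennreal ((\<sigma>\<^sup>2) powr \<alpha> / \<alpha>) * (ennreal (z powr (2 * \<alpha>) * std_normal_density z) * indicator {0..} z)"
    proof (cases "0 < z")
      case False
      have "(\<integral>\<^sup>+v. ennreal (std_normal_density z) * indicator {sqrt v / \<sigma><..} z * (ennreal (v powr (\<alpha> - 1)) * indicator {0<..} v) \<partial>lborel) = (\<integral>\<^sup>+(v::real). 0 \<partial>lborel)"
      proof (intro nn_integral_cong)
        fix v :: real
        have "\<not> sqrt v / \<sigma> < z" if "0 < v" using that False assms by (auto simp: not_less intro: order_trans[of _ 0])
        then show "ennreal (std_normal_density z) * indicator {sqrt v / \<sigma><..} z * (ennreal (v powr (\<alpha> - 1)) * indicator {0<..} v) = 0"
          by (auto simp: indicator_def)
      qed
      then show ?thesis using False by (auto simp: indicator_def not_less)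
    next
      case True
      have "(\<integral>\<^sup>+v. ennreal (std_normal_density z) * indicator {sqrt v / \<sigma><..} z * (ennreal (v powr (\<alpha> - 1)) * indicator {0<..} v) \<partial>lborel) =
        (\<integral>\<^sup>+v. ennreal (std_normal_density z) * (ennreal (v powr (\<alpha> - 1)) * indicator {0..\<sigma>\<^sup>2 * z\<^sup>2} v) \<partial>lborel)"
      proof (rule nn_integral_cong_AE)
        have "AE v in lborel. v \<notin> {0, \<sigma>\<^sup>2 * z\<^sup>2}"
          by (rule AE_not_in) (auto intro!: countable_imp_null_set_lborel)
        then show "AE v in lborel. ennreal (std_normal_density z) * indicator {sqrt v / \<sigma><..} z * (ennreal (v powr (\<alpha> - 1)) * indicator {0<..} v) =
          ennreal (std_normal_density z) * (ennreal (v powr (\<alpha> - 1)) * indicator {0..\<sigma>\<^sup>2 * z\<^sup>2} v)"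
        proof eventually_elim
          case (elim v)
          have "sqrt v / \<sigma> < z \<longleftrightarrow> v < \<sigma>\<^sup>2 * z\<^sup>2" if "0 < v"
          proof -
            have "sqrt v / \<sigma> < z \<longleftrightarrow> sqrt v < \<sigma> * z" using assms by (simp add: divide_less_eq mult.commute)
            also have "\<dots> \<longleftrightarrow> sqrt v < sqrt ((\<sigma> * z)\<^sup>2)" using assms True by simp
            also have "\<dots> \<longleftrightarrow> v < \<sigma>\<^sup>2 * z\<^sup>2" unfolding real_sqrt_less_iff by (simp add: power_mult_distrib)
            finally show ?thesis .
          qed
          then show ?case using elim by (auto simp: indicator_def)
        qed
      qed
      also have "\<dots> = ennreal (std_normal_density z) * ennreal ((\<sigma>\<^sup>2 * z\<^sup>2) powr \<alpha> / \<alpha>)"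
        using assms by (subst nn_integral_cmult) (auto simp: nn_integral_powr_0)
      also have "(\<sigma>\<^sup>2 * z\<^sup>2) powr \<alpha> = (\<sigma>\<^sup>2) powr \<alpha> * z powr (2 * \<alpha>)"
        using power2_powr[OF True, of \<alpha>] by (simp add: powr_mult)
      also have "ennreal (std_normal_density z) * ennreal ((\<sigma>\<^sup>2) powr \<alpha> * z powr (2 * \<alpha>) / \<alpha>) = ennreal ((\<sigma>\<^sup>2) powr \<alpha> / \<alpha> * (z powr (2 * \<alpha>) * std_normal_density z))"
        using assms by (subst ennreal_mult[symmetric]) (auto simp: mult_ac)
      also have "\<dots> = ennreal ((\<sigma>\<^sup>2) powr \<alpha> / \<alpha>) * ennreal (z powr (2 * \<alpha>) * std_normal_density z)"
        using assms by (intro ennreal_mult) auto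
      finally show ?thesis using True by (auto simp: indicator_def)
    qed
  qed
  also have "\<dots> = ennreal ((\<sigma>\<^sup>2) powr \<alpha> / \<alpha>) * ennreal (2 powr (\<alpha> - 1) * Gamma (\<alpha> + 1 / 2) / sqrt pi)"
    using nn_integral_gauss_moment[OF assms(1)] by (subst nn_integral_cmult) auto
  also have "\<dots> = ennreal ((\<sigma>\<^sup>2) powr \<alpha> / \<alpha> * (2 powr (\<alpha> - 1) * Gamma (\<alpha> + 1 / 2) / sqrt pi))"
    using assms Gamma_real_pos[of "\<alpha> + 1 / 2"] by (intro ennreal_mult[symmetric]) auto
  also have "(\<sigma>\<^sup>2) powr \<alpha> / \<alpha> * (2 powr (\<alpha> - 1) * Gamma (\<alpha> + 1 / 2) / sqrt pi) = 2 powr (\<alpha> - 1) * Gamma (\<alpha> + 1 / 2) / (\<alpha> * sqrt pi) * (\<sigma>\<^sup>2) powr \<alpha>"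
    by simp
  finally show ?thesis .
qed

section \<open>Expectations under W at large scales, from bounds on the density near 0\<close>

context schroeder_gw
begin

lemma EW_nonneg: "(\<And>y. 0 \<le> y \<Longrightarrow> 0 \<le> h y) \<Longrightarrow> 0 \<le> t \<Longrightarrow> 0 \<le> EW t h"
  unfolding EW_def by (intro Bochner_Integration.integral_nonneg) auto

lemma EW_eq_nn_integral:
  assumes [measurable]: "h \<in> borel_measurable borel" and h: "\<And>y. 0 \<le> y \<Longrightarrow> 0 \<le> h y" "\<And>y. 0 \<le> y \<Longrightarrow> h y \<le> B" and N: "0 < N"
  shows "ennreal (N powr \<alpha> * EW N h) =
    (\<integral>\<^sup>+v. ennreal (h v * v powr (\<alpha> - 1) * ((v / N) powr (1 - \<alpha>) * w0 (v / N))) * indicator {0<..} v \<partial>lborel)"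
proof -
  have "integrable M (\<lambda>x. if W x > 0 then h (N * W x) else 0)"
  proof (rule integrable_const_bound[where B=B])
    have "0 \<le> B" using h(1)[of 0] h(2)[of 0] by simp
    then show "AE x in M. norm (if W x > 0 then h (N * W x) else 0) \<le> B" using h N by auto
  qed simp
  then have "ennreal (EW N h) = (\<integral>\<^sup>+x. ennreal (if W x > 0 then h (N * W x) else 0) \<partial>M)"
    unfolding EW_def using h N by (intro nn_integral_eq_integral[symmetric]) auto
  also have "\<dots> = (\<integral>\<^sup>+x. (\<lambda>u. ennreal (h (N * u))) (W x) * indicator {0<..} (W x) \<partial>M)"
    by (intro nn_integral_cong) (auto simp: indicator_def)
  also have "\<dots> = (\<integral>\<^sup>+u. ennreal (h (N * u)) * ennreal (w0 u) \<partial>lborel)"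
    by (rule nn_integral_W) measurable
  also have "\<dots> = ennreal \<bar>1 / N\<bar> * (\<integral>\<^sup>+v. ennreal (h (N * (0 + 1 / N * v))) * ennreal (w0 (0 + 1 / N * v)) \<partial>lborel)"
    using N by (intro nn_integral_real_affine) auto
  finally have "ennreal (N powr \<alpha> * EW N h) = ennreal (N powr \<alpha>) * (ennreal \<bar>1 / N\<bar> * (\<integral>\<^sup>+v. ennreal (h (N * (0 + 1 / N * v))) * ennreal (w0 (0 + 1 / N * v)) \<partial>lborel))"
    using EW_nonneg[of h N, OF h(1)] N by (simp add: ennreal_mult)
  also have "\<dots> = ennreal (N powr \<alpha> / N) * (\<integral>\<^sup>+v. ennreal (h v) * ennreal (w0 (v / N)) \<partial>lborel)"
    using N by (simp add: mult.assoc[symmetric] ennreal_mult[symmetric])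
  also have "\<dots> = (\<integral>\<^sup>+v. ennreal (N powr \<alpha> / N) * (ennreal (h v) * ennreal (w0 (v / N))) \<partial>lborel)"
    by (rule nn_integral_cmult[symmetric]) measurable
  also have "\<dots> = (\<integral>\<^sup>+v. ennreal (h v * v powr (\<alpha> - 1) * ((v / N) powr (1 - \<alpha>) * w0 (v / N))) * indicator {0<..} v \<partial>lborel)"
  proof (intro nn_integral_cong)
    fix v :: real
    show "ennreal (N powr \<alpha> / N) * (ennreal (h v) * ennreal (w0 (v / N))) = ennreal (h v * v powr (\<alpha> - 1) * ((v / N) powr (1 - \<alpha>) * w0 (v / N))) * indicator {0<..} v"
    proof (cases "0 < v")
      case True
      have "v powr (\<alpha> - 1) * (v / N) powr (1 - \<alpha>) = v powr (\<alpha> - 1) * v powr (1 - \<alpha>) / N powr (1 - \<alpha>)"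
        using True N by (simp add: powr_divide)
      also have "\<dots> = N powr (\<alpha> - 1)" using True N by (simp add: powr_add[symmetric] powr_diff)
      also have "\<dots> = N powr \<alpha> / N" using N by (simp add: powr_diff)
      finally have eq: "h v * v powr (\<alpha> - 1) * ((v / N) powr (1 - \<alpha>) * w0 (v / N)) = N powr \<alpha> / N * (h v * w0 (v / N))"
        by (simp add: mult_ac)
      have "ennreal (N powr \<alpha> / N * (h v * w0 (v / N))) = ennreal (N powr \<alpha> / N) * (ennreal (h v) * ennreal (w0 (v / N)))"
        using True N h(1)[of v] w0_nonneg[of "v / N"] by (subst ennreal_mult, simp, simp, subst ennreal_mult) auto
      then show ?thesis unfolding eq using True by simp
    next
      case False
      then have "\<not> 0 < v / N" using N by (simp add: zero_less_divide_iff)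
      then show ?thesis using False by (simp add: w0_def indicator_def)
    qed
  qed
  finally show ?thesis .
qed

lemma EW_add:
  assumes "h1 \<in> borel_measurable borel" "h2 \<in> borel_measurable borel" "0 \<le> t"
    and "\<And>y. 0 \<le> y \<Longrightarrow> \<bar>h1 y\<bar> \<le> (B::real)" "\<And>y. 0 \<le> y \<Longrightarrow> \<bar>h2 y\<bar> \<le> B"
  shows "EW t (\<lambda>y. h1 y + h2 y) = EW t h1 + EW t h2"
proof -
  have "0 \<le> B" using assms(4)[of 0] by simp
  note [measurable] = assms(1,2)
  have i1: "integrable M (\<lambda>x. if W x > 0 then h1 (t * W x) else 0)"
    using assms \<open>0 \<le> B\<close> by (intro integrable_const_bound[where B=B]) auto
  have i2: "integrable M (\<lambda>x. if W x > 0 then h2 (t * W x) else 0)"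
    using assms \<open>0 \<le> B\<close> by (intro integrable_const_bound[where B=B]) auto
  have "EW t (\<lambda>y. h1 y + h2 y) = expectation (\<lambda>x. (if W x > 0 then h1 (t * W x) else 0) + (if W x > 0 then h2 (t * W x) else 0))"
    unfolding EW_def by (intro Bochner_Integration.integral_cong) auto
  then show ?thesis unfolding EW_def using i1 i2 by simp
qed

text \<open>Split at v = \<delta> N: below, the density bound c applies; above, h is at most
  exp(-\<mu> \<delta> N), which beats N^\<alpha>.\<close>

lemma EW_upper:
  assumes h_meas: "h \<in> borel_measurable borel" and h0: "\<And>y. 0 \<le> y \<Longrightarrow> 0 \<le> h y"
    and hK: "\<And>y. 0 \<le> y \<Longrightarrow> h y \<le> exp (- (\<mu> * y))" and mu: "0 < \<mu>"
    and J: "(\<integral>\<^sup>+v. ennreal (h v * v powr (\<alpha> - 1)) * indicator {0<..} v \<partial>lborel) = ennreal J" "0 \<le> J"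
    and c: "0 \<le> c" "0 < \<delta>" "\<And>u. 0 < u \<Longrightarrow> u \<le> \<delta> \<Longrightarrow> u powr (1 - \<alpha>) * w u \<le> c" and N: "0 < N"
  shows "N powr \<alpha> * EW N h \<le> c * J + N powr \<alpha> * exp (- (\<mu> * (\<delta> * N)))"
proof -
  note [measurable] = h_meas
  define h1 where "h1 v = (if v \<le> \<delta> * N then h v else 0)" for v
  define h2 where "h2 v = (if v \<le> \<delta> * N then 0 else h v)" for v
  have [measurable]: "h1 \<in> borel_measurable borel" "h2 \<in> borel_measurable borel" by (simp_all add: h1_def[abs_def] h2_def[abs_def])
  have h1: "h y \<le> 1" if "0 \<le> y" for y
    using hK[OF that] that mu by (smt (verit) exp_le_one_iff mult_nonneg_nonneg)
  have "EW N h = EW N (\<lambda>y. h1 y + h2 y)" by (intro arg_cong[where f="EW N"]) (auto simp: h1_def h2_def)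
  also have "\<dots> = EW N h1 + EW N h2"
    by (rule EW_add[where B=1]) (use N h0 h1 in \<open>auto simp: h1_def h2_def\<close>)
  also have "EW N h2 \<le> exp (- (\<mu> * (\<delta> * N)))"
  proof -
    have "EW N h2 \<le> expectation (\<lambda>x. exp (- (\<mu> * (\<delta> * N))))"
      unfolding EW_def
    proof (rule integral_mono)
      show "integrable M (\<lambda>x. if W x > 0 then h2 (N * W x) else 0)"
        by (rule integrable_const_bound[where B=1]) (use N h0 h1 in \<open>auto simp: h2_def\<close>)
      fix x
      have "h2 y \<le> exp (- (\<mu> * (\<delta> * N)))" if "0 \<le> y" for y
      proof -
        have "h y \<le> exp (- (\<mu> * (\<delta> * N)))" if "\<delta> * N < y"
          using hK[OF \<open>0 \<le> y\<close>] that mu by (smt (verit) exp_le_cancel_iff mult_strict_left_mono)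
        then show ?thesis by (auto simp: h2_def not_le)
      qed
      then show "(if W x > 0 then h2 (N * W x) else 0) \<le> exp (- (\<mu> * (\<delta> * N)))" using N by auto
    qed simp
    then show ?thesis by (simp add: prob_space)
  qed
  finally have 1: "EW N h \<le> EW N h1 + exp (- (\<mu> * (\<delta> * N)))" by simp
  have "ennreal (N powr \<alpha> * EW N h1) = (\<integral>\<^sup>+v. ennreal (h1 v * v powr (\<alpha> - 1) * ((v / N) powr (1 - \<alpha>) * w0 (v / N))) * indicator {0<..} v \<partial>lborel)"
    by (rule EW_eq_nn_integral[where B=1]) (use h0 h1 N in \<open>auto simp: h1_def\<close>)
  also have "\<dots> \<le> (\<integral>\<^sup>+v. ennreal c * (ennreal (h v * v powr (\<alpha> - 1)) * indicator {0<..} v) \<partial>lborel)"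
  proof (intro nn_integral_mono)
    fix v :: real
    have "h1 v * v powr (\<alpha> - 1) * ((v / N) powr (1 - \<alpha>) * w0 (v / N)) \<le> c * (h v * v powr (\<alpha> - 1))" if v: "0 < v"
    proof (cases "v \<le> \<delta> * N")
      case True
      have "(v / N) powr (1 - \<alpha>) * w0 (v / N) \<le> c"
        using c(3)[of "v / N"] v N True by (simp add: w0_def divide_le_eq)
      then have "h v * v powr (\<alpha> - 1) * ((v / N) powr (1 - \<alpha>) * w0 (v / N)) \<le> h v * v powr (\<alpha> - 1) * c"
        using h0[of v] v by (intro mult_left_mono) auto
      then show ?thesis using True by (simp add: h1_def mult_ac)
    next
      case False
      then show ?thesis using h0[of v] v c by (simp add: h1_def)
    qed
    then show "ennreal (h1 v * v powr (\<alpha> - 1) * ((v / N) powr (1 - \<alpha>) * w0 (v / N))) * indicator {0<..} v \<le> ennreal c * (ennreal (h v * v powr (\<alpha> - 1)) * indicator {0<..} v)"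
      using c(1) h0[of v] by (auto simp: indicator_def ennreal_mult[symmetric] intro!: ennreal_leI)
  qed
  also have "\<dots> = ennreal c * ennreal J" by (subst nn_integral_cmult) (auto simp: J)
  also have "\<dots> = ennreal (c * J)" using c J by (simp add: ennreal_mult)
  finally have "N powr \<alpha> * EW N h1 \<le> c * J" using c J by (subst (asm) ennreal_le_iff) auto
  moreover have "N powr \<alpha> * EW N h \<le> N powr \<alpha> * (EW N h1 + exp (- (\<mu> * (\<delta> * N))))"
    using 1 by (intro mult_left_mono) auto
  ultimately show ?thesis by (simp add: distrib_left)
qed

text \<open>On v \<le> k the density bound applies as soon as N \<ge> k / \<delta>, and by monotone
  convergence some fixed k already captures c J up to \<eta>.\<close>

lemma EW_lower:
  assumes h_meas: "h \<in> borel_measurable borel" and h0: "\<And>y. 0 \<le> y \<Longrightarrow> 0 \<le> h y" and h1: "\<And>y. 0 \<le> y \<Longrightarrow> h y \<le> 1"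
    and J: "(\<integral>\<^sup>+v. ennreal (h v * v powr (\<alpha> - 1)) * indicator {0<..} v \<partial>lborel) = ennreal J" "0 \<le> J"
    and c: "0 \<le> c" "0 < \<delta>" "\<And>u. 0 < u \<Longrightarrow> u \<le> \<delta> \<Longrightarrow> c \<le> u powr (1 - \<alpha>) * w u" and eta: "0 < \<eta>"
  shows "eventually (\<lambda>N. c * J - \<eta> \<le> N powr \<alpha> * EW N h) at_top"
proof -
  note [measurable] = h_meas
  define I where "I k = (\<integral>\<^sup>+v. ennreal (h v * v powr (\<alpha> - 1)) * indicator {0<..real k} v \<partial>lborel)" for k :: nat
  have "I \<longlonglongrightarrow> (\<integral>\<^sup>+v. ennreal (h v * v powr (\<alpha> - 1)) * indicator {0<..} v \<partial>lborel)"
    unfolding I_def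
  proof (rule nn_integral_LIMSEQ)
    show "incseq (\<lambda>k v. ennreal (h v * v powr (\<alpha> - 1)) * indicator {0<..real k} v)"
      by (intro incseq_SucI le_funI mult_left_mono) (auto simp: indicator_def)
    fix v :: real
    have "eventually (\<lambda>n. v \<le> real n) sequentially"
      using filterlim_real_sequentially unfolding filterlim_at_top by blast
    then have "eventually (\<lambda>k. ennreal (h v * v powr (\<alpha> - 1)) * indicator {0<..real k} v = ennreal (h v * v powr (\<alpha> - 1)) * indicator {0<..} v) sequentially"
      by eventually_elim (auto simp: indicator_def)
    then show "(\<lambda>k. ennreal (h v * v powr (\<alpha> - 1)) * indicator {0<..real k} v) \<longlonglongrightarrow> ennreal (h v * v powr (\<alpha> - 1)) * indicator {0<..} v"
      by (rule tendsto_eventually)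
  qed auto
  then have "(\<lambda>k. ennreal c * I k) \<longlonglongrightarrow> ennreal c * ennreal J" unfolding J by (intro ennreal_tendsto_cmult) auto
  then have lim: "(\<lambda>k. ennreal c * I k) \<longlonglongrightarrow> ennreal (c * J)" using c J by (simp add: ennreal_mult)
  obtain k where k: "ennreal (c * J - \<eta>) \<le> ennreal c * I k"
  proof (cases "0 \<le> c * J - \<eta>")
    case True
    have "ennreal (c * J - \<eta>) < ennreal (c * J)" using True eta by (intro ennreal_lessI) auto
    from order_tendstoD(1)[OF lim this] show ?thesis
      using that by (auto simp: eventually_sequentially intro: less_imp_le)
  next
    case False
    then show ?thesis using that[of 0] by (simp add: ennreal_neg)
  qed
  show ?thesis
    using eventually_gt_at_top[of 0] eventually_ge_at_top[of "real k / \<delta>"]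
  proof eventually_elim
    case (elim N)
    have kN: "real k \<le> \<delta> * N" using elim c(2) by (simp add: divide_le_eq mult.commute)
    have "ennreal (c * J - \<eta>) \<le> ennreal c * I k" by (rule k)
    also have "\<dots> = (\<integral>\<^sup>+v. ennreal c * (ennreal (h v * v powr (\<alpha> - 1)) * indicator {0<..real k} v) \<partial>lborel)"
      unfolding I_def by (rule nn_integral_cmult[symmetric]) auto
    also have "\<dots> \<le> (\<integral>\<^sup>+v. ennreal (h v * v powr (\<alpha> - 1) * ((v / N) powr (1 - \<alpha>) * w0 (v / N))) * indicator {0<..} v \<partial>lborel)"
    proof (intro nn_integral_mono)
      fix v :: real
      have "c * (h v * v powr (\<alpha> - 1)) \<le> h v * v powr (\<alpha> - 1) * ((v / N) powr (1 - \<alpha>) * w0 (v / N))" if v: "0 < v" "v \<le> real k"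
      proof -
        have "c \<le> (v / N) powr (1 - \<alpha>) * w0 (v / N)"
          using c(3)[of "v / N"] v elim kN by (simp add: w0_def divide_le_eq)
        then have "h v * v powr (\<alpha> - 1) * c \<le> h v * v powr (\<alpha> - 1) * ((v / N) powr (1 - \<alpha>) * w0 (v / N))"
          using h0[of v] v by (intro mult_left_mono) auto
        then show ?thesis by (simp add: mult_ac)
      qed
      then show "ennreal c * (ennreal (h v * v powr (\<alpha> - 1)) * indicator {0<..real k} v) \<le> ennreal (h v * v powr (\<alpha> - 1) * ((v / N) powr (1 - \<alpha>) * w0 (v / N))) * indicator {0<..} v"
        using c(1) h0[of v] by (auto simp: indicator_def ennreal_mult[symmetric] intro!: ennreal_leI)
    qed
    also have "\<dots> = ennreal (N powr \<alpha> * EW N h)"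
      by (rule EW_eq_nn_integral[symmetric, where B=1]) (use h0 h1 elim in auto)
    finally show ?case
      using EW_nonneg[of h N, OF h0] elim by (subst (asm) ennreal_le_iff) auto
  qed
qed

end

section \<open>Reindexing independent families and quadratic bounds for the exponential\<close>

lemma (in prob_space) indep_vars_reindex:
  assumes inj: "inj_on f I" and ind: "indep_vars M' Y (f ` I)"
  shows "indep_vars (\<lambda>i. M' (f i)) (\<lambda>i. Y (f i)) I"
proof -
  let ?F = "\<lambda>j. {Y j -` A \<inter> space M |A. A \<in> sets (M' j)}"
  have rv: "\<And>i. i \<in> I \<Longrightarrow> random_variable (M' (f i)) (Y (f i))" and isets: "indep_sets ?F (f ` I)"
    using ind by (auto simp: indep_vars_def2)
  have "indep_sets (\<lambda>i. ?F (f i)) I"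
  proof (rule indep_setsI)
    show "?F (f i) \<subseteq> events" if "i \<in> I" for i using rv[OF that] by (auto intro: measurable_sets)
    fix A J assume J: "J \<noteq> {}" "J \<subseteq> I" "finite J" and A: "\<forall>j\<in>J. A j \<in> ?F (f j)"
    have injJ: "inj_on f J" by (rule inj_on_subset[OF inj J(2)])
    define A' where "A' k = A (inv_into J f k)" for k
    have A': "A' (f j) = A j" if "j \<in> J" for j using that injJ by (simp add: A'_def)
    have "prob (\<Inter>k\<in>f ` J. A' k) = (\<Prod>k\<in>f ` J. prob (A' k))"
      by (rule indep_setsD[OF isets]) (use J A A' in auto)
    moreover have "(\<Inter>k\<in>f ` J. A' k) = (\<Inter>j\<in>J. A j)" using A' by auto
    moreover have "(\<Prod>k\<in>f ` J. prob (A' k)) = (\<Prod>j\<in>J. prob (A j))"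
      using A' by (subst prod.reindex[OF injJ]) auto
    ultimately show "prob (\<Inter>j\<in>J. A j) = (\<Prod>j\<in>J. prob (A j))" by simp
  qed
  then show ?thesis using rv by (auto simp: indep_vars_def2)
qed

text \<open>With s = -t, multiply by 1 + s + s^2 / 2 \<le> exp s: the product (1 + s + s^2 / 2) (1 -
  s + s^2 / 2) is 1 + s^4 / 4.\<close>

lemma exp_le_quadratic_neg:
  assumes "t \<le> (0::real)"
  shows "exp t \<le> 1 + t + t\<^sup>2 / 2"
proof -
  define s where "s = - t"
  have s: "0 \<le> s" using assms by (simp add: s_def)
  have pos: "0 < 1 + s + s\<^sup>2 / 2" using s by (intro add_pos_nonneg) auto
  have "(1 + s + s\<^sup>2 / 2) * exp t \<le> exp s * exp t"
    using exp_lower_Taylor_quadratic[OF s] by (intro mult_right_mono) auto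
  also have "\<dots> = 1" by (simp add: s_def flip: exp_add)
  also have "1 \<le> 1 + s ^ 4 / 4" by simp
  also have "\<dots> = (1 + s + s\<^sup>2 / 2) * (1 + t + t\<^sup>2 / 2)"
    by (simp add: s_def field_simps power2_eq_square power4_eq_xxxx)
  finally show ?thesis using pos by (simp add: mult_le_cancel_left_pos)
qed

text \<open>The quotient (exp t - 1 - t) / t^2 increases for t > 0, as its series has nonnegative
  coefficients, so its value at T bounds it; for t \<le> 0 it is at most 1/2, which exp T / T^2
  exceeds.\<close>

lemma exp_le_quadratic:
  fixes t T :: real
  assumes "t \<le> T" "0 < T"
  shows "exp t \<le> 1 + t + t\<^sup>2 * (exp T / T\<^sup>2)"
proof (cases "t \<le> 0")
  case True
  have "T\<^sup>2 / 2 \<le> exp T" using exp_lower_Taylor_quadratic[of T] assms by simp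
  then have "1 / 2 \<le> exp T / T\<^sup>2" using assms by (simp add: field_simps)
  then have "t\<^sup>2 * (1 / 2) \<le> t\<^sup>2 * (exp T / T\<^sup>2)" by (intro mult_left_mono) auto
  then show ?thesis using exp_le_quadratic_neg[OF True] by linarith
next
  case False
  define S where "S x = (\<Sum>n. x ^ n / fact (n + 2))" for x :: real
  have sm: "summable (\<lambda>n. x ^ n / fact n)" for x :: real
    using summable_exp_generic[of x] by (simp add: scaleR_conv_of_real divide_inverse mult.commute)
  have sm2: "summable (\<lambda>n. x ^ (n + 2) / fact (n + 2))" for x :: real
    using summable_ignore_initial_segment[OF sm[of x], of 2] by simp
  have eq: "x ^ n / fact (n + 2) = (x ^ (n + 2) / fact (n + 2)) / x\<^sup>2" if "0 < x" for x :: real and n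
  proof -
    have "a / F = (a * b / F) / b" if "b \<noteq> 0" for a b F :: real using that by simp
    from this[of "x\<^sup>2" "x ^ n" "fact (n + 2)"] show ?thesis using that by (simp only: power_add) simp
  qed
  have smS: "summable (\<lambda>n. x ^ n / fact (n + 2))" if "0 < x" for x :: real
    unfolding eq[OF that] by (intro summable_divide sm2)
  have exp: "exp x = 1 + x + x\<^sup>2 * S x" if "0 < x" for x
  proof -
    have "exp x = (\<Sum>n. x ^ n / fact n)"
      by (simp add: exp_def scaleR_conv_of_real divide_inverse mult.commute)
    also have "\<dots> = (\<Sum>n. x ^ (n + 2) / fact (n + 2)) + (\<Sum>n<2. x ^ n / fact n)"
      by (rule suminf_split_initial_segment[OF sm])
    also have "(\<Sum>n. x ^ (n + 2) / fact (n + 2)) = (\<Sum>n. x\<^sup>2 * (x ^ n / fact (n + 2)))"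
      by (intro suminf_cong) (simp add: power2_eq_square)
    also have "\<dots> = x\<^sup>2 * S x" unfolding S_def by (rule suminf_mult[OF smS[OF that]])
    finally show ?thesis by (simp add: numeral_2_eq_2)
  qed
  have "S t \<le> S T" unfolding S_def using False assms
    by (intro suminf_le smS divide_right_mono power_mono) auto
  also have "S T \<le> exp T / T\<^sup>2" using exp[of T] assms by (simp add: field_simps)
  finally have "t\<^sup>2 * S t \<le> t\<^sup>2 * (exp T / T\<^sup>2)" by (intro mult_left_mono) auto
  then show ?thesis using exp[of t] False by simp
qed

section \<open>Tails of the random walk\<close>

locale gw_walk = schroeder_rate M p m \<xi> X W w \<alpha> \<epsilon>
  for M :: "'a measure" and p m \<xi> X W w \<alpha> \<epsilon> +
  fixes \<sigma> :: real
  assumes X_ident: "\<And>k. k \<ge> 1 \<Longrightarrow> distr M borel (X k) = distr M borel (X 1)"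
    and X_int: "integrable M (X 1)"
    and X_mean: "expectation (X 1) = 0"
    and X_sq_int: "integrable M (\<lambda>x. (X 1 x)\<^sup>2)"
    and sigma_def: "\<sigma>\<^sup>2 = expectation (\<lambda>x. (X 1 x)\<^sup>2)"
    and sigma_pos: "\<sigma> > 0"
    and X_mom: "integrable M (\<lambda>x. (max (X 1 x) 0) powr (1 + \<alpha>))"
begin

lemma X_indep: "indep_vars (\<lambda>_. borel) (\<lambda>i. X (Suc i)) UNIV"
proof -
  have "indep_vars (\<lambda>_. borel) (joint_family \<xi> X) ((\<lambda>i. Inr (Suc i)) ` UNIV)"
    by (rule indep_vars_subset[OF indep]) (auto simp: joint_index_def)
  then have "indep_vars (\<lambda>_. borel) (\<lambda>i. joint_family \<xi> X (Inr (Suc i))) UNIV"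
    using indep_vars_reindex[of "\<lambda>i. Inr (Suc i)" UNIV "\<lambda>_. borel" "joint_family \<xi> X"] by (simp add: inj_on_def)
  moreover have "joint_family \<xi> X (Inr (Suc i)) = X (Suc i)" for i by (simp add: fun_eq_iff joint_family_def)
  ultimately show ?thesis by simp
qed

lemma X1_meas [measurable]: "X (Suc i) \<in> borel_measurable M"
  by (rule X_measurable) simp

lemma X_transfer:
  fixes f :: "real \<Rightarrow> real"
  assumes "f \<in> borel_measurable borel"
  shows "expectation (\<lambda>x. f (X (Suc i) x)) = expectation (\<lambda>x. f (X 1 x))"
    and "integrable M (\<lambda>x. f (X (Suc i) x)) \<longleftrightarrow> integrable M (\<lambda>x. f (X 1 x))"
proof -
  note [measurable] = assms
  have eq: "distr M borel (X (Suc i)) = distr M borel (X 1)" by (rule X_ident) simp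
  have "integral\<^sup>L (distr M borel (X (Suc i))) f = integral\<^sup>L (distr M borel (X 1)) f" unfolding eq ..
  then show "expectation (\<lambda>x. f (X (Suc i) x)) = expectation (\<lambda>x. f (X 1 x))"
    by (simp add: integral_distr)
  have "integrable (distr M borel (X (Suc i))) f \<longleftrightarrow> integrable (distr M borel (X 1)) f" unfolding eq ..
  then show "integrable M (\<lambda>x. f (X (Suc i) x)) \<longleftrightarrow> integrable M (\<lambda>x. f (X 1 x))"
    by (simp add: integrable_distr_eq)
qed

lemma psum_eq: "psum X k x = (\<Sum>i<k. X (Suc i) x)"
  unfolding psum_def using sum.atLeast1_atMost_eq[of "\<lambda>i. X i x" k] by simp

lemma clt_tail: "(\<lambda>k. prob {x \<in> space M. t < psum X k x / sqrt (real k * \<sigma>\<^sup>2)}) \<longlonglongrightarrow> gauss_tail t"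
proof -
  have "weak_conv_m (\<lambda>n. distr M borel (\<lambda>x. (\<Sum>i<n. X (Suc i) x) / sqrt (n * \<sigma>\<^sup>2))) std_normal_distribution"
  proof (rule central_limit_theorem_zero_mean[OF X_indep _ sigma_pos])
    show "expectation (X (Suc n)) = 0" for n using X_transfer(1)[of "\<lambda>x. x" n] X_mean by simp
    show "integrable M (\<lambda>x. (X (Suc n) x)\<^sup>2)" for n using X_transfer(2)[of "\<lambda>x. x\<^sup>2" n] X_sq_int by simp
    show "variance (X (Suc n)) = \<sigma>\<^sup>2" for n
      using X_transfer(1)[of "\<lambda>x. x" n] X_transfer(1)[of "\<lambda>x. x\<^sup>2" n] X_mean sigma_def by simp
    show "distr M borel (X (Suc n)) = distr M borel (X 1)" for n by (rule X_ident) simp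
  qed
  then have "(\<lambda>k. cdf (distr M borel (\<lambda>x. psum X k x / sqrt (real k * \<sigma>\<^sup>2))) t) \<longlonglongrightarrow> cdf std_normal_distribution t"
  proof -
    have "measure std_normal_distribution {t} = 0"
    proof -
      have "emeasure std_normal_distribution {t} = (\<integral>\<^sup>+z\<in>{t}. ennreal (std_normal_density z) \<partial>lborel)"
        by (rule emeasure_density) auto
      also have "\<dots> = 0" by (rule nn_integral_null_set) (auto intro: countable_imp_null_set_lborel)
      finally show ?thesis by (simp add: measure_def)
    qed
    then have "isCont (cdf std_normal_distribution) t" by (simp add: std_normal.isCont_cdf)
    with \<open>weak_conv_m _ _\<close> show ?thesis by (simp add: weak_conv_m_def weak_conv_def psum_eq)
  qed
  then have "(\<lambda>k. 1 - cdf (distr M borel (\<lambda>x. psum X k x / sqrt (real k * \<sigma>\<^sup>2))) t) \<longlonglongrightarrow> 1 - cdf std_normal_distribution t"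
    by (intro tendsto_intros)
  moreover have "1 - cdf (distr M borel (\<lambda>x. psum X k x / sqrt (real k * \<sigma>\<^sup>2))) t = prob {x \<in> space M. t < psum X k x / sqrt (real k * \<sigma>\<^sup>2)}" for k
  proof -
    have "cdf (distr M borel (\<lambda>x. psum X k x / sqrt (real k * \<sigma>\<^sup>2))) t = prob {x \<in> space M. psum X k x / sqrt (real k * \<sigma>\<^sup>2) \<le> t}"
      unfolding cdf_def2 by (subst measure_distr) (auto intro!: arg_cong[where f=prob])
    also have "1 - \<dots> = prob (space M - {x \<in> space M. psum X k x / sqrt (real k * \<sigma>\<^sup>2) \<le> t})"
      by (rule prob_compl[symmetric]) measurable
    finally show ?thesis by (auto intro!: arg_cong[where f=prob])
  qed
  ultimately show ?thesis by (simp add: gauss_tail_cdf)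
qed

text \<open>Polya's argument: pointwise convergence at a finite grid, monotonicity of both tails
  between grid points, and the Lipschitz bound for the Gaussian tail.\<close>

lemma clt_uniform:
  assumes "0 < a" "0 < \<eta>"
  shows "\<exists>K. \<forall>k\<ge>K. \<forall>x. 0 < x \<longrightarrow> x \<le> a \<longrightarrow>
    \<bar>prob {z \<in> space M. x \<le> psum X k z / sqrt (real k * \<sigma>\<^sup>2)} - gauss_tail x\<bar> \<le> \<eta>"
proof -
  define T where "T k t = prob {z \<in> space M. t < psum X k z / sqrt (real k * \<sigma>\<^sup>2)}" for k t
  \<comment> \<open>Half of \<eta> for the error at the grid points, half for the variation of the
    Gaussian tail over one mesh.\<close>
  define \<delta> where "\<delta> = \<eta> / 2"
  have d: "\<delta> > 0" using assms by (simp add: \<delta>_def)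
  define n where "n = nat \<lceil>a / \<delta>\<rceil>"
  have "eventually (\<lambda>k. \<forall>i\<in>{..n}. \<bar>T k (real i * \<delta>) - gauss_tail (real i * \<delta>)\<bar> < \<delta>) sequentially"
  proof (rule eventually_ball_finite[OF finite_atMost], rule ballI)
    fix i
    show "eventually (\<lambda>k. \<bar>T k (real i * \<delta>) - gauss_tail (real i * \<delta>)\<bar> < \<delta>) sequentially"
      using tendstoD[OF clt_tail[of "real i * \<delta>"] d] by (simp add: T_def dist_real_def)
  qed
  then obtain K where K: "\<And>k i. k \<ge> K \<Longrightarrow> i \<le> n \<Longrightarrow> \<bar>T k (real i * \<delta>) - gauss_tail (real i * \<delta>)\<bar> < \<delta>"
    by (auto simp: eventually_sequentially)
  have "\<bar>prob {z \<in> space M. x \<le> psum X k z / sqrt (real k * \<sigma>\<^sup>2)} - gauss_tail x\<bar> \<le> \<eta>"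
    if k: "k \<ge> K" and x: "0 < x" "x \<le> a" for k x
  proof -
    define j where "j = nat \<lceil>x / \<delta>\<rceil>"
    have xd: "0 < x / \<delta>" "x / \<delta> \<le> a / \<delta>" using x d by (auto simp: divide_right_mono)
    have j1: "x / \<delta> \<le> real j" "real j < x / \<delta> + 1" using xd unfolding j_def by linarith+
    have j2: "1 \<le> j" "j \<le> n"
    proof -
      show "1 \<le> j" using xd(1) unfolding j_def by linarith
      show "j \<le> n" unfolding j_def n_def by (intro nat_mono ceiling_mono xd)
    qed
    \<comment> \<open>The left grid point is strictly below x, so the event with \<le> lies inside
      the event with < of \<open>clt_tail\<close>.\<close>
    have g1: "real (j - 1) * \<delta> < x" "x \<le> real j * \<delta>" "real j * \<delta> - x \<le> \<delta>" "x - real (j - 1) * \<delta> \<le> \<delta>"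
      using j1 j2 d by (simp_all add: field_simps of_nat_diff)
    let ?P = "prob {z \<in> space M. x \<le> psum X k z / sqrt (real k * \<sigma>\<^sup>2)}"
    have up: "?P \<le> T k (real (j - 1) * \<delta>)" unfolding T_def
      using g1 by (intro finite_measure_mono) auto
    have lo: "T k (real j * \<delta>) \<le> ?P" unfolding T_def
      using g1 by (intro finite_measure_mono) auto
    have "\<bar>T k (real (j - 1) * \<delta>) - gauss_tail (real (j - 1) * \<delta>)\<bar> < \<delta>" "\<bar>T k (real j * \<delta>) - gauss_tail (real j * \<delta>)\<bar> < \<delta>"
      by (rule K[OF k], use j2 in simp)+
    moreover have "gauss_tail (real (j - 1) * \<delta>) - gauss_tail x \<le> \<delta>" "gauss_tail x - gauss_tail (real j * \<delta>) \<le> \<delta>"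
      using gauss_tail_diff(1)[of "real (j - 1) * \<delta>" x] gauss_tail_diff(1)[of x "real j * \<delta>"] g1 by auto
    moreover have "\<eta> = \<delta> + \<delta>" by (simp add: \<delta>_def)
    ultimately show ?thesis using up lo by linarith
  qed
  then show ?thesis by blast
qed

lemma tail_prob_normalized:
  assumes "k > 0" and that: "e > 0"
  shows "tail_prob e k = prob {z \<in> space M. sqrt (e\<^sup>2 * real k) / \<sigma> \<le> psum X k z / sqrt (real k * \<sigma>\<^sup>2)}"
proof -
  have "e \<le> s / real k \<longleftrightarrow> sqrt (e\<^sup>2 * real k) / \<sigma> \<le> s / sqrt (real k * \<sigma>\<^sup>2)" for s
  proof -
    have k: "sqrt (real k) > 0" "real k = sqrt (real k) * sqrt (real k)" using assms by auto
    have "sqrt (e\<^sup>2 * real k) / \<sigma> \<le> s / sqrt (real k * \<sigma>\<^sup>2) \<longleftrightarrow> e * sqrt (real k) / \<sigma> \<le> s / (sqrt (real k) * \<sigma>)"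
      using that sigma_pos by (simp add: real_sqrt_mult)
    also have "\<dots> \<longleftrightarrow> e * (sqrt (real k) * sqrt (real k)) \<le> s"
      using k(1) sigma_pos by (simp add: field_simps)
    also have "\<dots> \<longleftrightarrow> e \<le> s / real k" using assms by (simp add: field_simps)
    finally show ?thesis by simp
  qed
  then show ?thesis unfolding tail_prob_def by simp
qed

text \<open>Truncating from above only keeps the mean \<le> 0 and the second moment \<le>
  \<sigma>^2, so the linear term of the quadratic bound, taken with T = h y, drops out.\<close>

lemma truncated_exp_moment:
  assumes "0 < h" "0 < y"
  shows "expectation (\<lambda>x. exp (h * min (X (Suc i) x) y)) \<le> exp (\<sigma>\<^sup>2 * exp (h * y) / y\<^sup>2)"
    and "integrable M (\<lambda>x. exp (h * min (X (Suc i) x) y))"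
proof -
  show int: "integrable M (\<lambda>x. exp (h * min (X (Suc i) x) y))"
    by (rule integrable_const_bound[where B="exp (h * y)"]) (use assms in auto)
  define X' where "X' x = min (X 1 x) y" for x
  have X1[measurable]: "X 1 \<in> borel_measurable M" by (rule X_measurable) simp
  have [measurable]: "X' \<in> borel_measurable M" by (simp add: X'_def[abs_def])
  have abs: "\<bar>X' x\<bar> \<le> \<bar>X 1 x\<bar>" for x using assms by (auto simp: X'_def min_def)
  have i1: "integrable M X'" by (rule Bochner_Integration.integrable_bound[OF X_int]) (use abs in auto)
  have i2: "integrable M (\<lambda>x. (X' x)\<^sup>2)"
    by (rule Bochner_Integration.integrable_bound[OF X_sq_int]) (use abs in \<open>auto simp: abs_le_square_iff[symmetric]\<close>)
  have int1: "integrable M (\<lambda>x. exp (h * X' x))"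
    by (rule integrable_const_bound[where B="exp (h * y)"]) (use assms in \<open>auto simp: X'_def\<close>)
  have "expectation (\<lambda>x. exp (h * min (X (Suc i) x) y)) = expectation (\<lambda>x. exp (h * X' x))"
    using X_transfer(1)[of "\<lambda>x. exp (h * min x y)" i] by (simp add: X'_def)
  also have "\<dots> \<le> expectation (\<lambda>x. 1 + h * X' x + (X' x)\<^sup>2 * (exp (h * y) / y\<^sup>2))"
  proof (rule integral_mono[OF int1])
    show "integrable M (\<lambda>x. 1 + h * X' x + (X' x)\<^sup>2 * (exp (h * y) / y\<^sup>2))"
      using i1 i2 by (intro Bochner_Integration.integrable_add integrable_mult_left integrable_mult_right) auto
    fix x
    have "exp (h * X' x) \<le> 1 + h * X' x + (h * X' x)\<^sup>2 * (exp (h * y) / (h * y)\<^sup>2)"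
      using assms by (intro exp_le_quadratic) (auto simp: X'_def)
    also have "(h * X' x)\<^sup>2 * (exp (h * y) / (h * y)\<^sup>2) = (X' x)\<^sup>2 * (exp (h * y) / y\<^sup>2)"
      using assms by (simp add: power_mult_distrib)
    finally show "exp (h * X' x) \<le> 1 + h * X' x + (X' x)\<^sup>2 * (exp (h * y) / y\<^sup>2)" .
  qed
  also have "\<dots> = 1 + h * expectation X' + expectation (\<lambda>x. (X' x)\<^sup>2) * (exp (h * y) / y\<^sup>2)"
    using i1 i2 by (simp add: prob_space)
  also have "\<dots> \<le> 1 + 0 + \<sigma>\<^sup>2 * (exp (h * y) / y\<^sup>2)"
  proof (intro add_mono mult_right_mono order_refl)
    have "expectation X' \<le> expectation (X 1)" by (rule integral_mono[OF i1 X_int]) (auto simp: X'_def)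
    then show "h * expectation X' \<le> 0" using X_mean assms by (simp add: mult_nonneg_nonpos)
    show "expectation (\<lambda>x. (X' x)\<^sup>2) \<le> \<sigma>\<^sup>2" unfolding sigma_def
      by (rule integral_mono[OF i2 X_sq_int]) (use abs in \<open>auto simp: abs_le_square_iff[symmetric]\<close>)
  qed auto
  also have "\<dots> \<le> exp (\<sigma>\<^sup>2 * exp (h * y) / y\<^sup>2)"
    using exp_ge_add_one_self[of "\<sigma>\<^sup>2 * exp (h * y) / y\<^sup>2"] by simp
  finally show "expectation (\<lambda>x. exp (h * min (X (Suc i) x) y)) \<le> exp (\<sigma>\<^sup>2 * exp (h * y) / y\<^sup>2)" .
qed

text \<open>Either one jump exceeds y = e k / L, or the sum of the jumps truncated at y reaches e k;
  the latter is bounded exponentially, with h y = ln v.\<close>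

lemma fuk_nagaev:
  assumes e: "0 < e" and L: "L \<ge> (1::nat)" and k: "real L * \<sigma>\<^sup>2 < e\<^sup>2 * real k"
  shows "tail_prob e k \<le> real k * prob {x \<in> space M. e * real k / real L < X 1 x} + (exp 1 * (real L * \<sigma>\<^sup>2) / (e\<^sup>2 * real k)) ^ L"
proof -
  have s2: "0 < \<sigma>\<^sup>2" using sigma_pos by simp
  have kpos: "k > 0"
  proof (rule ccontr)
    assume "\<not> 0 < k"
    then have "real L * \<sigma>\<^sup>2 < 0" using k by simp
    then show False using s2 by (simp add: mult_less_0_iff)
  qed
  define y where "y = e * real k / real L"
  have y: "0 < y" using e kpos L by (simp add: y_def)
  \<comment> \<open>This value makes the moment exponent k \<sigma>^2 v / y^2 equal to L, while h e
    k = L ln v; the bound becomes (exp 1 / v)^L. The hypothesis on k is v > 1, which makes h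
    positive.\<close>
  define v where "v = e\<^sup>2 * real k / (real L * \<sigma>\<^sup>2)"
  have v: "1 < v" using k s2 L by (simp add: v_def)
  define h where "h = ln v / y"
  have h: "0 < h" using v y by (simp add: h_def)
  have hy: "exp (h * y) = v" using v y by (simp add: h_def)
  define S' where "S' x = (\<Sum>i<k. min (X (Suc i) x) y)" for x
  have [measurable]: "S' \<in> borel_measurable M" by (simp add: S'_def[abs_def])
  have [measurable]: "X 1 \<in> borel_measurable M" by (rule X_measurable) simp
  have "tail_prob e k \<le> prob ((\<Union>i<k. {x \<in> space M. y < X (Suc i) x}) \<union> {x \<in> space M. e * real k \<le> S' x})"
    unfolding tail_prob_def
  proof (rule finite_measure_mono)
    show "{x \<in> space M. e \<le> psum X k x / real k} \<subseteq> (\<Union>i<k. {x \<in> space M. y < X (Suc i) x}) \<union> {x \<in> space M. e * real k \<le> S' x}"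
    proof
      fix x assume x: "x \<in> {x \<in> space M. e \<le> psum X k x / real k}"
      show "x \<in> (\<Union>i<k. {x \<in> space M. y < X (Suc i) x}) \<union> {x \<in> space M. e * real k \<le> S' x}"
      proof (cases "\<exists>i<k. y < X (Suc i) x")
        case False
        then have "X (Suc i) x \<le> y" if "i < k" for i using that not_less by blast
        then have "S' x = psum X k x" unfolding S'_def psum_eq by (intro sum.cong) (auto simp: min_def)
        then show ?thesis using x kpos by (simp add: le_divide_eq)
      qed (use x in auto)
    qed
  qed measurable
  also have "\<dots> \<le> prob (\<Union>i<k. {x \<in> space M. y < X (Suc i) x}) + prob {x \<in> space M. e * real k \<le> S' x}"
    by (rule measure_Un_le) auto
  also have "prob (\<Union>i<k. {x \<in> space M. y < X (Suc i) x}) \<le> (\<Sum>i<k. prob {x \<in> space M. y < X (Suc i) x})"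
    by (rule measure_UNION_le) auto
  also have "\<dots> = real k * prob {x \<in> space M. y < X 1 x}"
  proof -
    have "prob {x \<in> space M. y < X (Suc i) x} = prob {x \<in> space M. y < X 1 x}" for i
    proof -
      have "measure (distr M borel (X (Suc i))) {y<..} = measure (distr M borel (X 1)) {y<..}"
        using X_ident[of "Suc i"] by simp
      moreover have "measure (distr M borel (X j)) {y<..} = prob {x \<in> space M. y < X j x}" if "j \<ge> 1" for j
        using X_measurable[OF that] by (subst measure_distr) (auto intro!: arg_cong[where f=prob])
      ultimately show ?thesis by simp
    qed
    then have "(\<Sum>i<k. prob {x \<in> space M. y < X (Suc i) x}) = (\<Sum>i<k. prob {x \<in> space M. y < X 1 x})"
      by (intro sum.cong refl)
    then show ?thesis by simp
  qed
  also have "prob {x \<in> space M. e * real k \<le> S' x} \<le> (exp 1 * (real L * \<sigma>\<^sup>2) / (e\<^sup>2 * real k)) ^ L"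
  proof -
    have iv: "indep_vars (\<lambda>_. borel) (\<lambda>i x. exp (h * min (X (Suc i) x) y)) {..<k}"
      by (rule indep_vars_compose2[where Y="\<lambda>i z. exp (h * min z y)", OF indep_vars_subset[OF X_indep subset_UNIV]]) measurable
    have ePi: "exp (h * S' x) = (\<Prod>i<k. exp (h * min (X (Suc i) x) y))" for x
      by (simp add: S'_def sum_distrib_left exp_sum)
    have int: "integrable M (\<lambda>x. exp (h * S' x))"
      unfolding ePi by (rule indep_vars_integrable[OF _ iv truncated_exp_moment(2)[OF h y]]) auto
    have "prob {x \<in> space M. e * real k \<le> S' x} = prob {x \<in> space M. exp (h * (e * real k)) \<le> exp (h * S' x)}"
      using h by simp
    also have "\<dots> \<le> expectation (\<lambda>x. exp (h * S' x)) / exp (h * (e * real k))"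
      by (rule integral_Markov_inequality_measure[OF int sets.top]) auto
    also have "expectation (\<lambda>x. exp (h * S' x)) = (\<Prod>i<k. expectation (\<lambda>x. exp (h * min (X (Suc i) x) y)))"
      unfolding ePi by (rule indep_vars_lebesgue_integral[OF _ iv truncated_exp_moment(2)[OF h y]]) auto
    also have "\<dots> \<le> (\<Prod>i<k. exp (\<sigma>\<^sup>2 * exp (h * y) / y\<^sup>2))"
      by (intro prod_mono conjI truncated_exp_moment(1)[OF h y] Bochner_Integration.integral_nonneg) auto
    also have "\<dots> = exp (real k * (\<sigma>\<^sup>2 * v / y\<^sup>2))" by (simp add: hy flip: exp_of_nat_mult)
    also have "real k * (\<sigma>\<^sup>2 * v / y\<^sup>2) = real L"
      using e L kpos sigma_pos by (simp add: v_def y_def power2_eq_square field_simps)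
    also have "exp (h * (e * real k)) = v ^ L"
    proof -
      have "h * (e * real k) = real L * ln v" using e kpos L by (simp add: h_def y_def field_simps)
      then show ?thesis using v by (simp add: exp_of_nat_mult)
    qed
    also have "exp (real L) / v ^ L = (exp 1 * (real L * \<sigma>\<^sup>2) / (e\<^sup>2 * real k)) ^ L"
    proof -
      have "exp (real L) / v ^ L = (exp 1 / v) ^ L" by (simp add: power_divide exp_of_nat_mult[symmetric])
      also have "exp 1 / v = exp 1 * (real L * \<sigma>\<^sup>2) / (e\<^sup>2 * real k)" by (simp add: v_def)
      finally show ?thesis .
    qed
    finally show ?thesis by (simp add: divide_right_mono)
  qed
  finally show ?thesis by (simp add: y_def)
qed

end

section \<open>Negligible ranges of Z_n and replacement of the walk by Gaussian tails\<close>

context gw_walk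
begin

text \<open>Fatou's lemma as for W, now with the Lipschitz constant m^n of f_n. The first moment
  dominates the big-jump term, which grows at most linearly in Z_n.\<close>

lemma GW_integrable: "integrable M (\<lambda>x. real (GW \<xi> n x))"
proof (rule integrableI_bounded)
  let ?h = "\<lambda>k. inverse (real (Suc k))"
  have "(\<integral>\<^sup>+x. ennreal (norm (real (GW \<xi> n x))) \<partial>M) = (\<integral>\<^sup>+x. liminf (\<lambda>k. ennreal ((1 - exp (- (?h k * real (GW \<xi> n x)))) / ?h k)) \<partial>M)"
  proof (intro nn_integral_cong)
    fix x
    define v where "v = real (GW \<xi> n x)"
    have "((\<lambda>h. exp (- (h * v))) has_field_derivative - v) (at 0)" by (auto intro!: derivative_eq_intros)
    then have lim: "((\<lambda>h. (exp (- (h * v)) - 1) / h) \<longlongrightarrow> - v) (at 0)" by (simp add: DERIV_def)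
    have "filterlim ?h (at 0) sequentially"
      unfolding filterlim_at using LIMSEQ_inverse_real_of_nat by auto
    from tendsto_minus[OF filterlim_compose[OF lim this]]
    have "(\<lambda>k. (1 - exp (- (?h k * v))) / ?h k) \<longlonglongrightarrow> v" by (simp only: minus_divide_left minus_diff_eq minus_minus)
    then have "ennreal v = liminf (\<lambda>k. ennreal ((1 - exp (- (?h k * v))) / ?h k))"
      by (intro lim_imp_Liminf[symmetric] tendsto_ennrealI) auto
    then show "ennreal (norm (real (GW \<xi> n x))) = liminf (\<lambda>k. ennreal ((1 - exp (- (?h k * real (GW \<xi> n x)))) / ?h k))"
      by (simp add: v_def)
  qed
  also have "\<dots> \<le> liminf (\<lambda>k. \<integral>\<^sup>+x. ennreal ((1 - exp (- (?h k * real (GW \<xi> n x)))) / ?h k) \<partial>M)"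
    by (rule nn_integral_liminf) measurable
  also have "\<dots> \<le> liminf (\<lambda>k::nat. ennreal (m ^ n))"
  proof (intro Liminf_mono always_eventually allI)
    fix k
    define h where "h = ?h k"
    have h: "h > 0" by (simp add: h_def)
    have pow: "exp (- (h * real l)) = exp (- h) ^ l" for l by (simp add: exp_of_nat_mult[symmetric] mult.commute)
    have int: "integrable M (\<lambda>x. exp (- (h * real (GW \<xi> n x))))"
      using h by (intro integrable_const_bound[where B=1]) auto
    have "(\<integral>\<^sup>+x. ennreal ((1 - exp (- (h * real (GW \<xi> n x)))) / h) \<partial>M) = ennreal (expectation (\<lambda>x. (1 - exp (- (h * real (GW \<xi> n x)))) / h))"
      using int h by (intro nn_integral_eq_integral) auto
    also have "expectation (\<lambda>x. (1 - exp (- (h * real (GW \<xi> n x)))) / h) = (1 - (pgf ^^ n) (exp (- h))) / h"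
      using int expectation_GW_real[of "exp (- h)" n] h by (simp add: prob_space pow)
    also have "\<dots> \<le> m ^ n"
    proof -
      have one: "(pgf ^^ n) 1 = (1::real)" by (induction n) auto
      have "1 - (pgf ^^ n) (exp (- h)) \<le> m ^ n * \<bar>1 - exp (- h)\<bar>"
        using funpow_pgf_lipschitz_1[of "1::real" "exp (- h)" n] h by (simp add: one)
      also have "\<dots> \<le> m ^ n * h"
        using exp_ge_add_one_self[of "- h"] h m_gt1 by (intro mult_left_mono) auto
      finally show ?thesis using h by (simp add: divide_le_eq)
    qed
    finally show "(\<integral>\<^sup>+x. ennreal ((1 - exp (- (?h k * real (GW \<xi> n x)))) / ?h k) \<partial>M) \<le> ennreal (m ^ n)"
      by (simp only: h_def ennreal_leI)
  qed
  finally show "(\<integral>\<^sup>+x. ennreal (norm (real (GW \<xi> n x))) \<partial>M) < \<infinity>"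
    by (simp add: Liminf_const le_less_trans)
qed (rule GW_comp_measurable)

text \<open>Dyadic blocks 2^i A < \<epsilon>^2 Z_n \<le> 2^(i+1) A: the block probability times
  N^\<alpha> is of order (2^i A)^\<alpha>, the integrand at most (2^i A)^(-L), and the sum is
  geometric because \<alpha> < L.\<close>

lemma inverse_power_tail:
  assumes L: "\<alpha> < real L"
  obtains C where "C > 0" "\<And>n A. 0 < A \<Longrightarrow>
    rate n powr \<alpha> * expectation (\<lambda>x. if A < (\<epsilon> n)\<^sup>2 * real (GW \<xi> n x) then (1 / ((\<epsilon> n)\<^sup>2 * real (GW \<xi> n x))) ^ L else 0) \<le> C * A powr (\<alpha> - real L)"
proof -
  obtain Cp where Cp: "Cp > 0" "\<And>n x. 0 < x \<Longrightarrow> prob {z \<in> space M. 0 < GW \<xi> n z \<and> real (GW \<xi> n z) \<le> x} \<le> Cp * (x / m ^ n) powr \<alpha>"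
    using prob_GW_small by blast
  define \<rho> where "\<rho> = 2 powr (\<alpha> - real L)"
  have rho: "0 < \<rho>" "\<rho> < 1" using L by (auto simp: \<rho>_def powr_less_one)
  define C where "C = Cp * 2 powr \<alpha> / (1 - \<rho>)"
  have "rate n powr \<alpha> * expectation (\<lambda>x. if A < (\<epsilon> n)\<^sup>2 * real (GW \<xi> n x) then (1 / ((\<epsilon> n)\<^sup>2 * real (GW \<xi> n x))) ^ L else 0) \<le> C * A powr (\<alpha> - real L)"
    if A: "0 < A" for n A
  proof -
    define E where "E = (\<epsilon> n)\<^sup>2"
    have E: "E > 0" using eps_pos[of n] by (simp add: E_def)
    define N where "N = rate n"
    have N: "N > 0" "N = E * m ^ n" using rate_pos[of n] by (auto simp: N_def rate_def E_def)
    define g where "g x = (if A < E * real (GW \<xi> n x) then (1 / (E * real (GW \<xi> n x))) ^ L else 0)" for x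
    define a where "a i = (1 / (2 ^ i * A)) ^ L" for i :: nat
    define D where "D i = {z \<in> space M. 0 < GW \<xi> n z \<and> real (GW \<xi> n z) \<le> 2 ^ Suc i * A / E}" for i :: nat
    have Dm[measurable]: "D i \<in> sets M" for i by (simp add: D_def)
    have a0: "0 \<le> a i" for i using A by (simp add: a_def)
    have gm: "g \<in> borel_measurable M"
      unfolding g_def[abs_def] by (rule GW_comp_measurable[where h="\<lambda>k. if A < E * real k then (1 / (E * real k)) ^ L else 0"])
    have g0: "0 \<le> g x" for x using A by (auto simp: g_def)
    have gle: "ennreal (g x) \<le> (\<Sum>i. ennreal (a i) * indicator (D i) x)" if "x \<in> space M" for x
    proof (cases "A < E * real (GW \<xi> n x)")
      case True
      define y where "y = E * real (GW \<xi> n x)"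
      have y: "A < y" using True by (simp add: y_def)
      have "\<exists>i. 2 ^ i * A < y \<and> y \<le> 2 ^ Suc i * A"
      proof -
        obtain j where "y / A < 2 ^ j" using real_arch_pow[of 2 "y / A"] by auto
        then have ex: "\<exists>j. y \<le> 2 ^ j * A" using A by (intro exI[of _ j]) (simp add: field_simps)
        define j0 where "j0 = (LEAST j. y \<le> 2 ^ j * A)"
        have j0: "y \<le> 2 ^ j0 * A" unfolding j0_def by (rule LeastI_ex[OF ex])
        have "j0 \<noteq> 0" using j0 y by (intro notI) simp
        then obtain i where i: "j0 = Suc i" by (cases j0) auto
        have "\<not> y \<le> 2 ^ i * A" using not_less_Least[of i "\<lambda>j. y \<le> 2 ^ j * A"] i by (simp add: j0_def)
        then show ?thesis using j0 i by (intro exI[of _ i]) auto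
      qed
      then obtain i where i: "2 ^ i * A < y" "y \<le> 2 ^ Suc i * A" by blast
      have "0 < GW \<xi> n x" using True A E by (cases "GW \<xi> n x") auto
      moreover have "real (GW \<xi> n x) \<le> 2 ^ Suc i * A / E"
        using i(2) E by (simp only: y_def pos_le_divide_eq mult.commute)
      ultimately have xD: "x \<in> D i" using that by (simp add: D_def)
      have "g x = (1 / y) ^ L" using True by (simp add: g_def y_def)
      also have "\<dots> \<le> a i" unfolding a_def using i(1) A y by (intro power_mono divide_left_mono) (auto intro!: mult_pos_pos)
      finally have "ennreal (g x) \<le> ennreal (a i) * indicator (D i) x" using xD by (simp add: ennreal_leI)
      also have "\<dots> \<le> (\<Sum>i. ennreal (a i) * indicator (D i) x)"
      proof -
        define f where "f j = ennreal (a j) * indicator (D j) x" for j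
        have "f i \<le> (\<Sum>j. f j)" using sum_le_suminf[of f "{i}"] by simp
        then show ?thesis by (simp only: f_def)
      qed
      finally show ?thesis .
    qed (simp add: g_def)
    have summand: "ennreal (a i) * emeasure M (D i) \<le> ennreal (Cp * 2 powr \<alpha> * A powr (\<alpha> - real L) / N powr \<alpha> * \<rho> ^ i)" for i
    proof -
      have "ennreal (a i) * emeasure M (D i) = ennreal (a i * prob (D i))"
        using a0 by (simp add: emeasure_eq_measure ennreal_mult)
      also have "a i * prob (D i) \<le> a i * (Cp * (2 ^ Suc i * A / E / m ^ n) powr \<alpha>)"
        unfolding D_def using A E a0 by (intro mult_left_mono Cp) auto
      also have "(2 ^ Suc i * A / E / m ^ n) powr \<alpha> = 2 powr \<alpha> * (2 ^ i * A) powr \<alpha> / N powr \<alpha>"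
      proof -
        have "2 ^ Suc i * A / E / m ^ n = 2 * (2 ^ i * A) / N" by (simp add: N mult.assoc)
        then show ?thesis by (simp add: powr_divide powr_mult)
      qed
      also have "a i * (Cp * (2 powr \<alpha> * (2 ^ i * A) powr \<alpha> / N powr \<alpha>)) = Cp * 2 powr \<alpha> / N powr \<alpha> * (a i * (2 ^ i * A) powr \<alpha>)"
        by simp
      also have "a i * (2 ^ i * A) powr \<alpha> = A powr (\<alpha> - real L) * \<rho> ^ i"
      proof -
        have pos: "0 < 2 ^ i * A" using A by simp
        have "a i = (2 ^ i * A) powr (- real L)"
          using pos by (simp add: a_def power_one_over powr_minus powr_realpow inverse_eq_divide)
        then have "a i * (2 ^ i * A) powr \<alpha> = (2 ^ i * A) powr (\<alpha> - real L)"
          using pos by (simp flip: powr_add)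
        also have "\<dots> = (2 ^ i) powr (\<alpha> - real L) * A powr (\<alpha> - real L)" by (rule powr_mult)
        also have "(2 ^ i) powr (\<alpha> - real L) = \<rho> ^ i"
          by (simp add: \<rho>_def powr_powr powr_realpow[symmetric] mult.commute)
        finally show ?thesis by simp
      qed
      finally show ?thesis by (simp add: ennreal_leI mult_ac)
    qed
    have gint: "integrable M g"
    proof (rule integrable_const_bound[where B="(1 / A) ^ L"])
      have "g x \<le> (1 / A) ^ L" for x
      proof (cases "A < E * real (GW \<xi> n x)")
        case True
        define y where "y = E * real (GW \<xi> n x)"
        have "A < y" using True by (simp add: y_def)
        then have "(1 / y) ^ L \<le> (1 / A) ^ L" using A by (intro power_mono divide_left_mono) auto
        then show ?thesis using True by (simp add: g_def y_def)
      next
        case False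
        then show ?thesis using A by (simp add: g_def)
      qed
      then show "AE x in M. norm (g x) \<le> (1 / A) ^ L" using g0 by simp
    qed (rule gm)
    have "ennreal (expectation g) = (\<integral>\<^sup>+x. ennreal (g x) \<partial>M)"
      using gint g0 by (intro nn_integral_eq_integral[symmetric]) auto
    also have "\<dots> \<le> (\<integral>\<^sup>+x. (\<Sum>i. ennreal (a i) * indicator (D i) x) \<partial>M)"
      by (intro nn_integral_mono gle)
    also have "\<dots> = (\<Sum>i. ennreal (a i) * emeasure M (D i))"
      by (subst nn_integral_suminf) (auto simp: nn_integral_cmult_indicator)
    also have "\<dots> \<le> (\<Sum>i. ennreal (Cp * 2 powr \<alpha> * A powr (\<alpha> - real L) / N powr \<alpha> * \<rho> ^ i))"
      by (intro suminf_le summand) auto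
    also have "\<dots> = ennreal (\<Sum>i. Cp * 2 powr \<alpha> * A powr (\<alpha> - real L) / N powr \<alpha> * \<rho> ^ i)"
      using rho Cp by (intro suminf_ennreal2 summable_mult summable_geometric) auto
    also have "(\<Sum>i. Cp * 2 powr \<alpha> * A powr (\<alpha> - real L) / N powr \<alpha> * \<rho> ^ i) = Cp * 2 powr \<alpha> * A powr (\<alpha> - real L) / N powr \<alpha> * (1 / (1 - \<rho>))"
      using rho by (subst suminf_mult) (auto simp: suminf_geometric summable_geometric)
    finally have "expectation g \<le> Cp * 2 powr \<alpha> * A powr (\<alpha> - real L) / N powr \<alpha> * (1 / (1 - \<rho>))"
      using rho Cp by (subst (asm) ennreal_le_iff) auto
    then have "N powr \<alpha> * expectation g \<le> N powr \<alpha> * (Cp * 2 powr \<alpha> * A powr (\<alpha> - real L) / N powr \<alpha> * (1 / (1 - \<rho>)))"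
      by (intro mult_left_mono) auto
    also have "\<dots> = C * A powr (\<alpha> - real L)" using N(1) by (simp add: C_def)
    finally show ?thesis unfolding N_def g_def[abs_def] E_def .
  qed
  moreover have "C > 0" using Cp rho by (simp add: C_def)
  ultimately show ?thesis using that by blast
qed

text \<open>Exchange the integrations. For a fixed jump x0 only 0 < Z_n \<le> b = L x0 / \<epsilon>
  counts, and N^\<alpha> b P(0 < Z_n \<le> b) is at most a constant times \<epsilon>^(\<alpha>-1)
  x0^(1+\<alpha>). Only jumps above A / (L \<epsilon>) matter, so the remaining expectation is a
  tail of an integrable variable.\<close>

lemma big_jump_tail:
  assumes L: "1 \<le> (L::nat)" and A: "0 < A"
  shows "(\<lambda>n. rate n powr \<alpha> * expectation (\<lambda>x. if A < (\<epsilon> n)\<^sup>2 * real (GW \<xi> n x)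
    then real (GW \<xi> n x) * prob {z \<in> space M. \<epsilon> n * real (GW \<xi> n x) / real L < X 1 z} else 0)) \<longlonglongrightarrow> 0"
proof -
  obtain Cp where Cp: "Cp > 0" "\<And>n x. 0 < x \<Longrightarrow> prob {z \<in> space M. 0 < GW \<xi> n z \<and> real (GW \<xi> n z) \<le> x} \<le> Cp * (x / m ^ n) powr \<alpha>"
    using prob_GW_small by blast
  have X1[measurable]: "X 1 \<in> borel_measurable M" by (rule X_measurable) simp
  define c where "c = Cp * real L powr (1 + \<alpha>) * max 1 ((A / real L) powr (\<alpha> - 1))"
  have c: "0 \<le> c" using Cp by (simp add: c_def)
  \<comment> \<open>Covers both cases of the estimate: the power 1 + \<alpha> for \<alpha> \<ge> 1,
    the square for \<alpha> < 1.\<close>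
  define Y where "Y x = (X 1 x)\<^sup>2 + (max (X 1 x) 0) powr (1 + \<alpha>)" for x
  have Ym[measurable]: "Y \<in> borel_measurable M" by (simp add: Y_def[abs_def])
  have Y0: "0 \<le> Y x" for x by (simp add: Y_def)
  have Yint: "integrable M Y" unfolding Y_def[abs_def] using X_sq_int X_mom by simp
  define R where "R n = expectation (\<lambda>x. if A / (real L * \<epsilon> n) < X 1 x then Y x else 0)" for n
  have R0: "R \<longlonglongrightarrow> 0"
  proof -
    have "(\<lambda>n. expectation (\<lambda>x. if A / (real L * \<epsilon> n) < X 1 x then Y x else 0)) \<longlonglongrightarrow> expectation (\<lambda>x. 0)"
    proof (rule integral_dominated_convergence[OF _ _ Yint])
      show "AE x in M. (\<lambda>n. if A / (real L * \<epsilon> n) < X 1 x then Y x else 0) \<longlonglongrightarrow> 0"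
      proof (rule AE_I2)
        fix x
        define b where "b = A / (real L * (\<bar>X 1 x\<bar> + 1))"
        have "b > 0" using A L by (auto simp: b_def intro!: divide_pos_pos mult_pos_pos)
        then have "eventually (\<lambda>n. \<epsilon> n < b) sequentially" using eps_lim by (intro order_tendstoD(2))
        then have "eventually (\<lambda>n. (if A / (real L * \<epsilon> n) < X 1 x then Y x else 0) = 0) sequentially"
        proof eventually_elim
          case (elim n)
          have "\<epsilon> n * (real L * (\<bar>X 1 x\<bar> + 1)) < A"
            using elim L by (simp add: b_def less_divide_eq mult_pos_pos add_nonneg_pos)
          then have "\<bar>X 1 x\<bar> + 1 < A / (real L * \<epsilon> n)"
            using eps_pos[of n] L by (simp add: less_divide_eq mult_ac)
          then show ?case by auto
        qed
        then show "(\<lambda>n. if A / (real L * \<epsilon> n) < X 1 x then Y x else 0) \<longlonglongrightarrow> 0" by (rule tendsto_eventually)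
      qed
    qed (use Y0 in auto)
    then show ?thesis by (simp add: R_def[abs_def])
  qed
  define T where "T n = rate n powr \<alpha> * expectation (\<lambda>x. if A < (\<epsilon> n)\<^sup>2 * real (GW \<xi> n x)
    then real (GW \<xi> n x) * prob {z \<in> space M. \<epsilon> n * real (GW \<xi> n x) / real L < X 1 z} else 0)" for n
  have T0: "0 \<le> T n" for n unfolding T_def by (intro mult_nonneg_nonneg Bochner_Integration.integral_nonneg) auto
  have TR: "T n \<le> c * R n" if e1: "\<epsilon> n \<le> 1" for n
  proof -
    define e where "e = \<epsilon> n"
    have e: "0 < e" "e \<le> 1" using eps_pos[of n] e1 by (auto simp: e_def)
    define N where "N = rate n powr \<alpha>"
    let ?q = "\<lambda>k. prob {z \<in> space M. e * real k / real L < X 1 z}"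
    define g where "g x = (if A < e\<^sup>2 * real (GW \<xi> n x) then real (GW \<xi> n x) * ?q (GW \<xi> n x) else 0)" for x
    have gm: "g \<in> borel_measurable M"
      unfolding g_def[abs_def] by (rule GW_comp_measurable[where h="\<lambda>k. if A < e\<^sup>2 * real k then real k * ?q k else 0"])
    have g0: "0 \<le> g x" for x by (simp add: g_def)
    \<comment> \<open>The jump probability is a separate integral inside the expectation over Z_n,
      so the exchange takes place on the product of M with itself.\<close>
    interpret MM: pair_sigma_finite M M ..
    define F where "F x z = (if A < e\<^sup>2 * real (GW \<xi> n x) \<and> e * real (GW \<xi> n x) / real L < X 1 z then ennreal (real (GW \<xi> n x)) else 0)" for x z
    have Fm: "(\<lambda>(x, z). F x z) \<in> borel_measurable (M \<Otimes>\<^sub>M M)"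
      unfolding F_def split_beta' by measurable
    have gF: "ennreal (g x) = (\<integral>\<^sup>+z. F x z \<partial>M)" for x
    proof -
      have "(\<integral>\<^sup>+z. F x z \<partial>M) = (\<integral>\<^sup>+z. ennreal (if A < e\<^sup>2 * real (GW \<xi> n x) then real (GW \<xi> n x) else 0) *
          indicator {z \<in> space M. e * real (GW \<xi> n x) / real L < X 1 z} z \<partial>M)"
        by (intro nn_integral_cong) (auto simp: F_def indicator_def)
      also have "\<dots> = ennreal (if A < e\<^sup>2 * real (GW \<xi> n x) then real (GW \<xi> n x) else 0) * emeasure M {z \<in> space M. e * real (GW \<xi> n x) / real L < X 1 z}"
        by (rule nn_integral_cmult_indicator) measurable
      also have "\<dots> = ennreal (g x)" by (auto simp: g_def emeasure_eq_measure ennreal_mult)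
      finally show ?thesis ..
    qed
    have inner: "ennreal N * (\<integral>\<^sup>+x. F x z \<partial>M) \<le> ennreal (c * (if A / (real L * e) < X 1 z then Y z else 0))" for z
    proof (cases "A / (real L * e) < X 1 z")
      case False
      have "F x z = 0" for x
      proof -
        have "\<not> (A < e\<^sup>2 * real k \<and> e * real k / real L < X 1 z)" for k
        proof
          assume "A < e\<^sup>2 * real k \<and> e * real k / real L < X 1 z"
          moreover from this have "A / (real L * e) < e * real k / real L"
            using e L by (simp add: field_simps power2_eq_square)
          ultimately show False using False by linarith
        qed
        from this[of "GW \<xi> n x"] show ?thesis unfolding F_def by (rule if_not_P)
      qed
      then show ?thesis using c Y0 by simp
    next
      case True
      define x0 where "x0 = X 1 z"
      have x0: "A / (real L * e) < x0" using True by (simp add: x0_def)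
      have x0p: "0 < x0" by (rule less_trans[OF _ x0]) (use A L e in auto)
      define b where "b = real L * x0 / e"
      have b: "0 < b" using x0p L e by (simp add: b_def)
      have "(\<integral>\<^sup>+x. F x z \<partial>M) \<le> (\<integral>\<^sup>+x. ennreal b * indicator {x \<in> space M. 0 < GW \<xi> n x \<and> real (GW \<xi> n x) \<le> b} x \<partial>M)"
      proof (intro nn_integral_mono)
        fix x assume x: "x \<in> space M"
        show "F x z \<le> ennreal b * indicator {x \<in> space M. 0 < GW \<xi> n x \<and> real (GW \<xi> n x) \<le> b} x"
        proof (cases "A < e\<^sup>2 * real (GW \<xi> n x) \<and> e * real (GW \<xi> n x) / real L < X 1 z")
          case True
          then have "real (GW \<xi> n x) < b" using e L by (simp add: b_def x0_def field_simps)
          moreover have "0 < GW \<xi> n x" using True A by (cases "GW \<xi> n x") auto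
          ultimately show ?thesis using x by (auto simp: F_def intro!: ennreal_leI)
        qed (auto simp: F_def)
      qed
      also have "\<dots> = ennreal b * emeasure M {x \<in> space M. 0 < GW \<xi> n x \<and> real (GW \<xi> n x) \<le> b}"
        by (rule nn_integral_cmult_indicator) measurable
      also have "\<dots> \<le> ennreal b * ennreal (Cp * (b / m ^ n) powr \<alpha>)"
        unfolding emeasure_eq_measure using b by (intro mult_left_mono ennreal_leI Cp) auto
      also have "\<dots> = ennreal (b * (Cp * (b / m ^ n) powr \<alpha>))" using b Cp by (simp add: ennreal_mult)
      finally have "ennreal N * (\<integral>\<^sup>+x. F x z \<partial>M) \<le> ennreal N * ennreal (b * (Cp * (b / m ^ n) powr \<alpha>))"
        by (intro mult_left_mono) auto
      also have "\<dots> = ennreal (N * (b * (Cp * (b / m ^ n) powr \<alpha>)))"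
        using b Cp by (intro ennreal_mult[symmetric]) (auto simp: N_def)
      also have "N * (b * (Cp * (b / m ^ n) powr \<alpha>)) \<le> c * Y z"
      proof -
        have "N * (b / m ^ n) powr \<alpha> = (rate n * (b / m ^ n)) powr \<alpha>" unfolding N_def by (rule powr_mult[symmetric])
        also have "rate n * (b / m ^ n) = real L * (e * x0)"
          using m_gt1 e by (simp add: rate_def b_def e_def power2_eq_square)
        also have "(real L * (e * x0)) powr \<alpha> = real L powr \<alpha> * (e powr \<alpha> * x0 powr \<alpha>)" by (simp add: powr_mult)
        finally have "N * (b * (Cp * (b / m ^ n) powr \<alpha>)) = Cp * (real L * real L powr \<alpha>) * ((e powr \<alpha> / e) * (x0 * x0 powr \<alpha>))"
          by (simp add: b_def mult_ac)
        also have "real L * real L powr \<alpha> = real L powr (1 + \<alpha>)" using L by (simp add: powr_add)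
        also have "e powr \<alpha> / e = e powr (\<alpha> - 1)" using e by (simp add: powr_diff)
        also have "x0 * x0 powr \<alpha> = x0 powr (1 + \<alpha>)" using x0p by (simp add: powr_add)
        \<comment> \<open>For \<alpha> \<ge> 1 the power of \<epsilon> is at most 1. For \<alpha> <
          1 it blows up, and x0 > A / (L \<epsilon>) is used to trade it against x0^(\<alpha>-1),
          which leaves x0^2.\<close>
        also have "e powr (\<alpha> - 1) * x0 powr (1 + \<alpha>) \<le> max 1 ((A / real L) powr (\<alpha> - 1)) * Y z"
        proof (cases "1 \<le> \<alpha>")
          case True
          have "e powr (\<alpha> - 1) * x0 powr (1 + \<alpha>) \<le> 1 * x0 powr (1 + \<alpha>)"
            using e True by (intro mult_right_mono powr_le1) auto
          also have "\<dots> \<le> 1 * Y z" using x0p by (simp add: Y_def x0_def)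
          also have "\<dots> \<le> max 1 ((A / real L) powr (\<alpha> - 1)) * Y z" using Y0 by (intro mult_right_mono) auto
          finally show ?thesis .
        next
          case False
          have "x0 powr (1 + \<alpha>) = x0 powr (\<alpha> - 1) * x0\<^sup>2"
            using x0p by (simp flip: powr_numeral powr_add)
          also have "x0 powr (\<alpha> - 1) \<le> (A / (real L * e)) powr (\<alpha> - 1)"
            using x0 A L e False by (intro powr_mono2') auto
          also have "(A / (real L * e)) powr (\<alpha> - 1) = (A / real L) powr (\<alpha> - 1) / e powr (\<alpha> - 1)"
            using A L e by (simp add: divide_divide_eq_left[symmetric] powr_divide del: divide_divide_eq_left)
          finally have "x0 powr (1 + \<alpha>) \<le> (A / real L) powr (\<alpha> - 1) / e powr (\<alpha> - 1) * x0\<^sup>2"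
            by (simp add: mult_right_mono)
          then have "e powr (\<alpha> - 1) * x0 powr (1 + \<alpha>) \<le> e powr (\<alpha> - 1) * ((A / real L) powr (\<alpha> - 1) / e powr (\<alpha> - 1) * x0\<^sup>2)"
            by (intro mult_left_mono) auto
          also have "\<dots> = (A / real L) powr (\<alpha> - 1) * x0\<^sup>2" using e by simp
          also have "\<dots> \<le> max 1 ((A / real L) powr (\<alpha> - 1)) * Y z"
            by (intro mult_mono) (auto simp: Y_def x0_def)
          finally show ?thesis .
        qed
        finally show ?thesis using Cp by (simp add: c_def mult.assoc mult_left_mono)
      qed
      finally show ?thesis using True by (simp add: ennreal_leI)
    qed
    have "T n = N * expectation g" unfolding T_def N_def g_def e_def ..
    then have "ennreal (T n) = ennreal N * ennreal (expectation g)"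
      using Bochner_Integration.integral_nonneg[of M g] g0 by (simp add: ennreal_mult N_def)
    also have "\<dots> \<le> ennreal N * (\<integral>\<^sup>+x. ennreal (g x) \<partial>M)"
    proof (intro mult_left_mono)
      \<comment> \<open>A non-integrable g would have expectation 0, so the inequality holds in
        either case.\<close>
      show "ennreal (expectation g) \<le> (\<integral>\<^sup>+x. ennreal (g x) \<partial>M)"
        using integral_eq_nn_integral[OF gm] g0 by (simp add: ennreal_enn2real_if)
    qed simp
    also have "\<dots> = ennreal N * (\<integral>\<^sup>+x. (\<integral>\<^sup>+z. F x z \<partial>M) \<partial>M)" by (simp add: gF)
    also have "(\<integral>\<^sup>+x. (\<integral>\<^sup>+z. F x z \<partial>M) \<partial>M) = (\<integral>\<^sup>+z. (\<integral>\<^sup>+x. F x z \<partial>M) \<partial>M)"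
      by (rule MM.Fubini'[OF Fm, symmetric])
    also have "ennreal N * \<dots> = (\<integral>\<^sup>+z. ennreal N * (\<integral>\<^sup>+x. F x z \<partial>M) \<partial>M)"
    proof (rule nn_integral_cmult[symmetric])
      have "(\<lambda>(z, x). F x z) \<in> borel_measurable (M \<Otimes>\<^sub>M M)" unfolding F_def split_beta' by measurable
      then show "(\<lambda>z. \<integral>\<^sup>+x. F x z \<partial>M) \<in> borel_measurable M" by (rule borel_measurable_nn_integral)
    qed
    also have "\<dots> \<le> (\<integral>\<^sup>+z. ennreal (c * (if A / (real L * e) < X 1 z then Y z else 0)) \<partial>M)"
      by (intro nn_integral_mono inner)
    also have "\<dots> = ennreal (expectation (\<lambda>z. c * (if A / (real L * e) < X 1 z then Y z else 0)))"
    proof (rule nn_integral_eq_integral)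
      show "integrable M (\<lambda>z. c * (if A / (real L * e) < X 1 z then Y z else 0))"
        by (intro integrable_mult_right Bochner_Integration.integrable_bound[OF Yint]) (use Y0 in auto)
    qed (use c Y0 in auto)
    also have "expectation (\<lambda>z. c * (if A / (real L * e) < X 1 z then Y z else 0)) = c * R n"
      by (simp add: R_def e_def)
    finally show ?thesis
      using c Y0 unfolding R_def by (subst (asm) ennreal_le_iff) (auto intro!: mult_nonneg_nonneg Bochner_Integration.integral_nonneg)
  qed
  have "T \<longlonglongrightarrow> 0"
  proof (rule tendsto_sandwich[where f="\<lambda>_. 0" and h="\<lambda>n. c * R n"])
    show "eventually (\<lambda>n. T n \<le> c * R n) sequentially"
      using order_tendstoD(2)[OF eps_lim zero_less_one] by eventually_elim (simp add: TR)
    show "(\<lambda>n. c * R n) \<longlonglongrightarrow> 0" using tendsto_mult_right_zero[OF R0] .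
  qed (auto simp: T0)
  then show ?thesis by (simp add: T_def[abs_def])
qed

definition psi :: "real \<Rightarrow> real" where "psi y = gauss_tail (sqrt y / \<sigma>)"

lemma psi_bounds: "0 \<le> psi y" "psi y \<le> 1"
  by (simp_all add: psi_def gauss_tail_bounds)

lemma psi_measurable [measurable]: "psi \<in> borel_measurable borel"
  unfolding psi_def[abs_def] by measurable

lemma psi_le_exp: "0 \<le> y \<Longrightarrow> psi y \<le> exp (- (1 / (2 * \<sigma>\<^sup>2) * y))"
  using gauss_tail_le_exp[of "sqrt y / \<sigma>"] sigma_pos by (simp add: psi_def power_divide mult.commute)

lemma psi_le_inverse_power:
  assumes "1 \<le> L" "0 < y"
  shows "psi y \<le> (2 * \<sigma>\<^sup>2 * real L) ^ L * (1 / y) ^ L"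
proof -
  define x where "x = 1 / (2 * \<sigma>\<^sup>2) * y"
  have x: "0 < x" using assms sigma_pos by (simp add: x_def)
  have "(x / real L) ^ L \<le> (1 + x / real L) ^ L" using x by (intro power_mono) auto
  also have "\<dots> \<le> exp x" using assms x by (intro exp_ge_one_plus_x_over_n_power_n) auto
  finally have "exp (- x) \<le> 1 / (x / real L) ^ L"
    using x assms by (simp add: exp_minus inverse_eq_divide frac_le)
  also have "\<dots> = (2 * \<sigma>\<^sup>2 * real L) ^ L * (1 / y) ^ L"
    unfolding power_mult_distrib[symmetric] power_one_over[symmetric] using assms sigma_pos by (simp add: x_def)
  finally show ?thesis using psi_le_exp[of y] assms by (simp add: x_def)
qed

text \<open>Three ranges of k = Z_n: up to K' (rare), up to A / \<epsilon>^2 (uniform central limit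
  theorem), and beyond (Fuk-Nagaev and the Gaussian bound). The choices are made in the order A,
  \<eta>, K, n.\<close>

lemma prob_ratio_vs_psi:
  "(\<lambda>n. rate n powr \<alpha> * (expectation (\<lambda>x. if GW \<xi> n x > 0 then tail_prob (\<epsilon> n) (GW \<xi> n x) else 0) - EZ n (\<epsilon> n) psi)) \<longlonglongrightarrow> 0"
proof -
  obtain L where L: "\<alpha> < real L" using reals_Archimedean2 by blast
  have L1: "1 \<le> L" using L alpha_pos by (cases L) auto
  obtain C1 where C1: "C1 > 0" "\<And>n A. 0 < A \<Longrightarrow>
    rate n powr \<alpha> * expectation (\<lambda>x. if A < (\<epsilon> n)\<^sup>2 * real (GW \<xi> n x) then (1 / ((\<epsilon> n)\<^sup>2 * real (GW \<xi> n x))) ^ L else 0) \<le> C1 * A powr (\<alpha> - real L)"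
    using inverse_power_tail[OF L] by blast
  obtain Cp where Cp: "Cp > 0" "\<And>n x. 0 < x \<Longrightarrow> prob {z \<in> space M. 0 < GW \<xi> n z \<and> real (GW \<xi> n z) \<le> x} \<le> Cp * (x / m ^ n) powr \<alpha>"
    using prob_GW_small by blast
  define c where "c = (exp 1 * (real L * \<sigma>\<^sup>2)) ^ L + (2 * \<sigma>\<^sup>2 * real L) ^ L"
  have c: "c > 0" using L1 sigma_pos by (simp add: c_def add_pos_pos)
  let ?T = "\<lambda>n. rate n powr \<alpha> * (expectation (\<lambda>x. if GW \<xi> n x > 0 then tail_prob (\<epsilon> n) (GW \<xi> n x) else 0) - EZ n (\<epsilon> n) psi)"
  show ?thesis
  proof (rule tendsto_norm_zero_cancel, rule order_tendstoI)
    fix \<tau> :: real assume tau: "0 < \<tau>"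
    have "((\<lambda>A. c * C1 * A powr (\<alpha> - real L)) \<longlongrightarrow> c * C1 * 0) at_top"
      using L by (intro tendsto_intros tendsto_neg_powr filterlim_ident) auto
    then have "eventually (\<lambda>A. c * C1 * A powr (\<alpha> - real L) < \<tau> / 4) at_top"
      using tau by (intro order_tendstoD(2)) auto
    then have "eventually (\<lambda>A. c * C1 * A powr (\<alpha> - real L) < \<tau> / 4 \<and> max 1 (real L * \<sigma>\<^sup>2) < A) at_top"
      by (rule eventually_conj[OF _ eventually_gt_at_top])
    then obtain A where A: "c * C1 * A powr (\<alpha> - real L) < \<tau> / 4" "max 1 (real L * \<sigma>\<^sup>2) < A"
      using eventually_happens'[OF trivial_limit_at_top_linorder] by blast
    have A1: "1 < A" "real L * \<sigma>\<^sup>2 < A" using A(2) by auto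
    \<comment> \<open>The middle range has N^\<alpha>-weighted probability at most Cp A^\<alpha>, so
      the error \<eta> there contributes at most \<tau> / 8.\<close>
    define \<eta> where "\<eta> = \<tau> / (8 * Cp * A powr \<alpha>)"
    have eta: "0 < \<eta>" using tau Cp A1 by (simp add: \<eta>_def)
    have "0 < sqrt A / \<sigma>" using A1 sigma_pos by simp
    then obtain K where K: "\<And>k x. k \<ge> K \<Longrightarrow> 0 < x \<Longrightarrow> x \<le> sqrt A / \<sigma> \<Longrightarrow>
      \<bar>prob {z \<in> space M. x \<le> psum X k z / sqrt (real k * \<sigma>\<^sup>2)} - gauss_tail x\<bar> \<le> \<eta>"
      using clt_uniform[OF _ eta, of "sqrt A / \<sigma>"] by blast
    define K' where "K' = real K + 1"
    have "(\<lambda>n. Cp * (K' * (\<epsilon> n)\<^sup>2) powr \<alpha>) \<longlonglongrightarrow> Cp * (K' * 0\<^sup>2) powr \<alpha>"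
      using eps_lim alpha_pos
      by (intro tendsto_mult tendsto_const tendsto_powr' tendsto_power) (auto simp: K'_def)
    then have ev1: "eventually (\<lambda>n. Cp * (K' * (\<epsilon> n)\<^sup>2) powr \<alpha> < \<tau> / 4) sequentially"
      using tau by (intro order_tendstoD(2)) auto
    have ev2: "eventually (\<lambda>n. rate n powr \<alpha> * expectation (\<lambda>x. if A < (\<epsilon> n)\<^sup>2 * real (GW \<xi> n x)
        then real (GW \<xi> n x) * prob {z \<in> space M. \<epsilon> n * real (GW \<xi> n x) / real L < X 1 z} else 0) < \<tau> / 4) sequentially"
      using A1 tau by (intro order_tendstoD(2)[OF big_jump_tail[OF L1]]) auto
    show "eventually (\<lambda>n. norm (?T n) < \<tau>) sequentially"
      using ev1 ev2
    proof eventually_elim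
      case (elim n)
      define e where "e = \<epsilon> n"
      have e: "0 < e" using eps_pos by (simp add: e_def)
      define N where "N = rate n powr \<alpha>"
      define u1 where "u1 k = (if 0 < k \<and> real k \<le> K' then 1 else 0 :: real)" for k :: nat
      define u2 where "u2 k = (if 0 < k \<and> real k \<le> A / e\<^sup>2 then 1 else 0 :: real)" for k :: nat
      define u3 where "u3 k = (if A < e\<^sup>2 * real k then real k * prob {z \<in> space M. e * real k / real L < X 1 z} else 0)" for k :: nat
      define u4 where "u4 k = (if A < e\<^sup>2 * real k then (1 / (e\<^sup>2 * real k)) ^ L else 0)" for k :: nat
      define d where "d k = (if 0 < k then tail_prob e k - psi (e\<^sup>2 * real k) else 0)" for k
      have u0: "0 \<le> u1 k" "0 \<le> u2 k" "0 \<le> u3 k" "0 \<le> u4 k" for k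
        using A1 by (auto simp: u1_def u2_def u3_def u4_def)
      \<comment> \<open>Each k falls into one range, where one of the four nonnegative terms alone,
        or the last two together, dominates.\<close>
      have le: "\<bar>d k\<bar> \<le> u1 k + \<eta> * u2 k + u3 k + c * u4 k" for k
      proof (cases "0 < k")
        case k: True
        have tp: "0 \<le> tail_prob e k" "tail_prob e k \<le> 1" by (rule tail_prob_bounds)+
        have ps: "0 \<le> psi (e\<^sup>2 * real k)" "psi (e\<^sup>2 * real k) \<le> 1" by (rule psi_bounds)+
        have y: "0 < e\<^sup>2 * real k" using e k by simp
        have nn: "0 \<le> \<eta> * u2 k" "0 \<le> c * u4 k" using u0[of k] eta c by simp_all
        consider "real k \<le> K'" | "K' < real k" "e\<^sup>2 * real k \<le> A" | "A < e\<^sup>2 * real k" by linarith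
        then show ?thesis
        proof cases
          case 1
          have "\<bar>d k\<bar> \<le> 1" using tp ps k by (simp add: d_def abs_le_iff)
          also have "1 = u1 k" using 1 k by (simp add: u1_def)
          finally show ?thesis using nn u0[of k] by linarith
        next
          case 2
          have "K \<le> k" using 2(1) by (simp add: K'_def)
          moreover have "0 < sqrt (e\<^sup>2 * real k) / \<sigma>" using y sigma_pos by simp
          moreover have "sqrt (e\<^sup>2 * real k) / \<sigma> \<le> sqrt A / \<sigma>" using 2(2) sigma_pos by (simp add: divide_right_mono)
          ultimately have "\<bar>d k\<bar> \<le> \<eta>"
            using K[of k "sqrt (e\<^sup>2 * real k) / \<sigma>"] k e by (simp add: d_def psi_def tail_prob_normalized)
          also have "\<eta> = \<eta> * u2 k" using 2(2) k e by (simp add: u2_def pos_le_divide_eq mult.commute)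
          finally show ?thesis using nn u0[of k] by linarith
        next
          case 3
          have "tail_prob e k \<le> real k * prob {x \<in> space M. e * real k / real L < X 1 x} + (exp 1 * (real L * \<sigma>\<^sup>2) / (e\<^sup>2 * real k)) ^ L"
            using 3 A1 by (intro fuk_nagaev[OF e L1]) simp
          also have "(exp 1 * (real L * \<sigma>\<^sup>2) / (e\<^sup>2 * real k)) ^ L = (exp 1 * (real L * \<sigma>\<^sup>2)) ^ L * (1 / (e\<^sup>2 * real k)) ^ L"
            by (simp add: power_divide power_one_over)
          finally have t: "tail_prob e k \<le> u3 k + (exp 1 * (real L * \<sigma>\<^sup>2)) ^ L * u4 k" using 3 by (simp add: u3_def u4_def)
          have p: "psi (e\<^sup>2 * real k) \<le> (2 * \<sigma>\<^sup>2 * real L) ^ L * u4 k"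
            using psi_le_inverse_power[OF L1 y] 3 by (simp add: u4_def)
          have "\<bar>d k\<bar> \<le> tail_prob e k + psi (e\<^sup>2 * real k)" using tp ps k by (simp add: d_def abs_le_iff)
          also have "\<dots> \<le> u3 k + c * u4 k" using t p by (simp add: c_def distrib_right)
          finally show ?thesis using nn u0[of k] by linarith
        qed
      qed (use u0 eta c in \<open>auto simp: d_def intro!: add_nonneg_nonneg mult_nonneg_nonneg\<close>)
      have bdi: "integrable M (\<lambda>x. h (GW \<xi> n x))" if hb: "\<And>k. \<bar>h k\<bar> \<le> b" for h :: "nat \<Rightarrow> real" and b
        by (rule integrable_const_bound[where B=b]) (use hb GW_comp_measurable in auto)
      have i1: "integrable M (\<lambda>x. u1 (GW \<xi> n x))" by (rule bdi[of _ 1]) (auto simp: u1_def)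
      have i2: "integrable M (\<lambda>x. u2 (GW \<xi> n x))" by (rule bdi[of _ 1]) (auto simp: u2_def)
      have i4: "integrable M (\<lambda>x. u4 (GW \<xi> n x))"
      proof (rule bdi[of _ 1])
        fix k
        have "(1 / (e\<^sup>2 * real k)) ^ L \<le> 1" if "A < e\<^sup>2 * real k"
          using that A1 by (intro power_le_one) (auto simp: divide_le_eq_1)
        then show "\<bar>u4 k\<bar> \<le> 1" using u0(4)[of k] by (simp add: u4_def)
      qed
      have GWint: "integrable M (\<lambda>x. real (GW \<xi> n x))" by (rule GW_integrable)
      have i3: "integrable M (\<lambda>x. u3 (GW \<xi> n x))"
      proof (rule Bochner_Integration.integrable_bound[OF GWint GW_comp_measurable])
        have "u3 k \<le> real k" for k unfolding u3_def by (auto intro!: mult_left_le)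
        then show "AE x in M. norm (u3 (GW \<xi> n x)) \<le> norm (real (GW \<xi> n x))" using u0(3) by auto
      qed
      have id: "integrable M (\<lambda>x. d (GW \<xi> n x))"
      proof (rule bdi[of _ 2])
        show "\<bar>d k\<bar> \<le> 2" for k using tail_prob_bounds[of e k] psi_bounds[of "e\<^sup>2 * real k"] by (simp add: d_def abs_le_iff)
      qed
      have "expectation (\<lambda>x. if GW \<xi> n x > 0 then tail_prob (\<epsilon> n) (GW \<xi> n x) else 0) - EZ n (\<epsilon> n) psi = expectation (\<lambda>x. d (GW \<xi> n x))"
      proof -
        have "integrable M (\<lambda>x. if GW \<xi> n x > 0 then tail_prob e (GW \<xi> n x) else 0)"
          by (rule bdi[of "\<lambda>k. if k > 0 then tail_prob e k else 0" 1]) (auto simp: tail_prob_bounds)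
        moreover have "integrable M (\<lambda>x. if GW \<xi> n x > 0 then psi (e\<^sup>2 * real (GW \<xi> n x)) else 0)"
          by (rule bdi[of "\<lambda>k. if k > 0 then psi (e\<^sup>2 * real k) else 0" 1]) (auto simp: psi_bounds)
        ultimately have "expectation (\<lambda>x. if GW \<xi> n x > 0 then tail_prob e (GW \<xi> n x) else 0) - EZ n e psi =
          expectation (\<lambda>x. (if GW \<xi> n x > 0 then tail_prob e (GW \<xi> n x) else 0) - (if GW \<xi> n x > 0 then psi (e\<^sup>2 * real (GW \<xi> n x)) else 0))"
          unfolding EZ_def by simp
        also have "\<dots> = expectation (\<lambda>x. d (GW \<xi> n x))" by (intro Bochner_Integration.integral_cong) (auto simp: d_def)
        finally show ?thesis unfolding e_def .
      qed
      then have "norm (?T n) = N * \<bar>expectation (\<lambda>x. d (GW \<xi> n x))\<bar>" by (simp add: N_def abs_mult)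
      also have "\<dots> \<le> N * expectation (\<lambda>x. \<bar>d (GW \<xi> n x)\<bar>)"
        by (intro mult_left_mono integral_abs_bound) (simp add: N_def)
      also have "\<dots> \<le> N * expectation (\<lambda>x. u1 (GW \<xi> n x) + \<eta> * u2 (GW \<xi> n x) + u3 (GW \<xi> n x) + c * u4 (GW \<xi> n x))"
        using i1 i2 i3 i4 id le
        by (intro mult_left_mono integral_mono Bochner_Integration.integrable_add integrable_mult_right integrable_abs) (auto simp: N_def)
      also have "\<dots> = N * expectation (\<lambda>x. u1 (GW \<xi> n x)) + \<eta> * (N * expectation (\<lambda>x. u2 (GW \<xi> n x))) + N * expectation (\<lambda>x. u3 (GW \<xi> n x)) + c * (N * expectation (\<lambda>x. u4 (GW \<xi> n x)))"
        using i1 i2 i3 i4 by (simp add: algebra_simps)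
      also have "\<dots> < \<tau>"
      proof -
        have small: "N * expectation (\<lambda>x. if 0 < GW \<xi> n x \<and> real (GW \<xi> n x) \<le> b then 1 else 0) \<le> Cp * (b * e\<^sup>2) powr \<alpha>" if "0 < b" for b
        proof -
          have "expectation (\<lambda>x. if 0 < GW \<xi> n x \<and> real (GW \<xi> n x) \<le> b then 1 else 0 :: real) =
            expectation (indicator {z \<in> space M. 0 < GW \<xi> n z \<and> real (GW \<xi> n z) \<le> b})"
            by (intro Bochner_Integration.integral_cong) (auto simp: indicator_def)
          also have "\<dots> = prob {z \<in> space M. 0 < GW \<xi> n z \<and> real (GW \<xi> n z) \<le> b}" by simp
          also have "\<dots> \<le> Cp * (b / m ^ n) powr \<alpha>" by (rule Cp(2)[OF that])
          finally have "N * expectation (\<lambda>x. if 0 < GW \<xi> n x \<and> real (GW \<xi> n x) \<le> b then 1 else 0) \<le> N * (Cp * (b / m ^ n) powr \<alpha>)"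
            by (intro mult_left_mono) (auto simp: N_def)
          also have "N * (b / m ^ n) powr \<alpha> = (b * e\<^sup>2) powr \<alpha>"
          proof -
            have "N * (b / m ^ n) powr \<alpha> = (rate n * (b / m ^ n)) powr \<alpha>" unfolding N_def by (rule powr_mult[symmetric])
            also have "rate n * (b / m ^ n) = b * e\<^sup>2" using m_gt1 by (simp add: rate_def e_def)
            finally show ?thesis .
          qed
          then have "N * (Cp * (b / m ^ n) powr \<alpha>) = Cp * (b * e\<^sup>2) powr \<alpha>" by (simp add: mult.left_commute)
          finally show ?thesis .
        qed
        have "N * expectation (\<lambda>x. u1 (GW \<xi> n x)) \<le> Cp * (K' * e\<^sup>2) powr \<alpha>"
          unfolding u1_def by (rule small) (simp add: K'_def add_nonneg_pos)
        then have 1: "N * expectation (\<lambda>x. u1 (GW \<xi> n x)) < \<tau> / 4" using elim(1) by (simp add: e_def)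
        have "N * expectation (\<lambda>x. u2 (GW \<xi> n x)) \<le> Cp * (A / e\<^sup>2 * e\<^sup>2) powr \<alpha>"
          unfolding u2_def by (rule small) (use A1 e in simp)
        then have "\<eta> * (N * expectation (\<lambda>x. u2 (GW \<xi> n x))) \<le> \<eta> * (Cp * A powr \<alpha>)"
          using eta e by (intro mult_left_mono) auto
        also have "\<dots> = \<tau> / 8" using Cp A1 by (simp add: \<eta>_def)
        finally have 2: "\<eta> * (N * expectation (\<lambda>x. u2 (GW \<xi> n x))) < \<tau> / 4" using tau by simp
        have 3: "N * expectation (\<lambda>x. u3 (GW \<xi> n x)) < \<tau> / 4" using elim(2) unfolding u3_def N_def e_def .
        have "N * expectation (\<lambda>x. u4 (GW \<xi> n x)) \<le> C1 * A powr (\<alpha> - real L)"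
          using C1(2)[of A n] A1 unfolding u4_def N_def e_def by simp
        then have "c * (N * expectation (\<lambda>x. u4 (GW \<xi> n x))) \<le> c * (C1 * A powr (\<alpha> - real L))"
          using c by (intro mult_left_mono) auto
        then have 4: "c * (N * expectation (\<lambda>x. u4 (GW \<xi> n x))) < \<tau> / 4" using A(1) by (simp add: mult.assoc)
        show ?thesis using 1 2 3 4 by linarith
      qed
      finally show ?case .
    qed
  qed (auto intro!: always_eventually order.strict_trans2[OF _ norm_ge_zero])
qed

end

section \<open>Asymptotics of the normalized probability\<close>

lemma powr_times_exp_tendsto_0:
  assumes "0 < (k::real)"
  shows "((\<lambda>x. x powr a * exp (- (k * x))) \<longlongrightarrow> 0) at_top"
proof -
  define n where "n = nat \<lceil>a\<rceil>"
  have "((\<lambda>x. (k * x) ^ n / exp (k * x)) \<longlongrightarrow> 0) at_top"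
    using assms by (intro filterlim_compose[OF tendsto_power_div_exp_0] filterlim_tendsto_pos_mult_at_top[OF tendsto_const] filterlim_ident)
  then have "((\<lambda>x. (1 / k) ^ n * ((k * x) ^ n / exp (k * x))) \<longlongrightarrow> 0) at_top"
    by (rule tendsto_mult_right_zero)
  moreover have "(\<lambda>x. (1 / k) ^ n * ((k * x) ^ n / exp (k * x))) = (\<lambda>x. x ^ n * exp (- (k * x)))"
    using assms by (simp add: fun_eq_iff power_mult_distrib power_one_over exp_minus divide_inverse power_inverse)
  ultimately have lim: "((\<lambda>x. x ^ n * exp (- (k * x))) \<longlongrightarrow> 0) at_top" by simp
  have ev: "eventually (\<lambda>x. x powr a * exp (- (k * x)) \<le> x ^ n * exp (- (k * x))) at_top"
    using eventually_ge_at_top[of 1]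
  proof eventually_elim
    case (elim x)
    have "a \<le> real n" unfolding n_def by (rule real_nat_ceiling_ge)
    then have "x powr a \<le> x powr real n" using elim by (intro powr_mono) auto
    then show ?case using elim by (simp add: powr_realpow)
  qed
  show ?thesis by (rule tendsto_sandwich[OF _ ev tendsto_const lim]) auto
qed

context gw_walk
begin

text \<open>In the variable s = exp(-\<mu> y) the function psi must be s times a continuous function
  H on [0, 1]; only the endpoint s = 0, that is y at infinity, is delicate.\<close>

lemma psi_compare: "(\<lambda>n. rate n powr \<alpha> * (EZ n (\<epsilon> n) psi - EW (rate n) psi)) \<longlonglongrightarrow> 0"
proof -
  \<comment> \<open>Half the exponent of the bound psi(y) \<le> exp(-y / (2 \<sigma>^2)), so psi is
    at most s^2 and the quotient H at most s.\<close>
  define \<mu> where "\<mu> = 1 / (4 * \<sigma>\<^sup>2)"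
  have mu: "0 < \<mu>" using sigma_pos by (simp add: \<mu>_def)
  define H where "H s = psi (- ln s / \<mu>) / s" for s
  have H_le: "\<bar>H s\<bar> \<le> s" if s: "0 < s" "s \<le> 1" for s
  proof -
    have "psi (- ln s / \<mu>) \<le> exp (- (1 / (2 * \<sigma>\<^sup>2) * (- ln s / \<mu>)))"
      using s mu by (intro psi_le_exp) (simp add: divide_nonpos_pos)
    also have "- (1 / (2 * \<sigma>\<^sup>2) * (- ln s / \<mu>)) = ln s + ln s"
      using sigma_pos by (simp add: \<mu>_def field_simps)
    also have "exp (ln s + ln s) = s * s" unfolding exp_add using s by simp
    finally show ?thesis using s psi_bounds(1)[of "- ln s / \<mu>"] by (simp add: H_def divide_le_eq)
  qed
  have psi_cont: "isCont psi y" for y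
    unfolding psi_def[abs_def] using continuous_gauss_tail sigma_pos
    by (intro isCont_o2[OF _ continuous_on_interior[where S=UNIV and f=gauss_tail]]) (auto intro!: continuous_intros)
  have cont: "continuous_on {0..1} H"
    unfolding continuous_on_eq_continuous_within
  proof
    fix s :: real assume s: "s \<in> {0..1}"
    show "continuous (at s within {0..1}) H"
    proof (cases "s = 0")
      case True
      have "(H \<longlongrightarrow> 0) (at 0 within {0..1})"
      proof (rule tendsto_rabs_zero_cancel, rule tendsto_sandwich[where f="\<lambda>_. 0" and h="\<lambda>s. s"])
        show "eventually (\<lambda>s. \<bar>H s\<bar> \<le> s) (at 0 within {0..1})"
          by (auto simp: eventually_at_filter intro!: always_eventually H_le)
      qed (auto intro!: tendsto_eq_intros)
      \<comment> \<open>Division by zero gives H the value 0 at s = 0, which agrees with its limit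
        there.\<close>
      then show ?thesis using True by (simp add: continuous_within H_def)
    next
      case False
      then have "isCont H s"
        unfolding H_def[abs_def] using s mu
        by (intro continuous_intros isCont_o2[OF _ psi_cont]) auto
      then show ?thesis by (rule continuous_at_imp_continuous_at_within)
    qed
  qed
  show ?thesis
    by (rule compare_continuous[OF mu cont psi_measurable]) (use mu in \<open>simp add: H_def\<close>)
qed

definition normalized_prob :: "nat \<Rightarrow> real" where
  "normalized_prob n = (\<epsilon> n) powr (2 * \<alpha>) * m powr (\<alpha> * real n) *
     prob {x \<in> space M. GW \<xi> n x > 0 \<and> psum X (GW \<xi> n x) x / real (GW \<xi> n x) \<ge> \<epsilon> n}"

lemma normalized_prob_compare: "(\<lambda>n. normalized_prob n - rate n powr \<alpha> * EW (rate n) psi) \<longlonglongrightarrow> 0"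
proof -
  have "(\<epsilon> n) powr (2 * \<alpha>) * m powr (\<alpha> * real n) = rate n powr \<alpha>" for n
  proof -
    have "rate n powr \<alpha> = ((\<epsilon> n)\<^sup>2) powr \<alpha> * (m ^ n) powr \<alpha>" unfolding rate_def by (rule powr_mult)
    also have "((\<epsilon> n)\<^sup>2) powr \<alpha> = (\<epsilon> n) powr (2 * \<alpha>)" by (rule power2_powr[OF eps_pos])
    also have "m ^ n = m powr real n" using m_gt1 by (simp add: powr_realpow)
    also have "(m powr real n) powr \<alpha> = m powr (\<alpha> * real n)" by (simp add: powr_powr mult.commute)
    finally show ?thesis ..
  qed
  then have "normalized_prob n - rate n powr \<alpha> * EW (rate n) psi =
      rate n powr \<alpha> * (expectation (\<lambda>x. if GW \<xi> n x > 0 then tail_prob (\<epsilon> n) (GW \<xi> n x) else 0) - EZ n (\<epsilon> n) psi) +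
      rate n powr \<alpha> * (EZ n (\<epsilon> n) psi - EW (rate n) psi)" for n
    unfolding normalized_prob_def prob_ratio_ge by (simp only: right_diff_distrib)
  then show ?thesis
    using tendsto_add[OF prob_ratio_vs_psi psi_compare] by simp
qed

definition gauss_const :: real where
  "gauss_const = 2 powr (\<alpha> - 1) * Gamma (\<alpha> + 1 / 2) / (\<alpha> * sqrt pi) * (\<sigma>\<^sup>2) powr \<alpha>"

lemma gauss_const_pos: "0 < gauss_const"
  using alpha_pos sigma_pos by (auto simp: gauss_const_def intro!: mult_pos_pos divide_pos_pos Gamma_real_pos)

lemma psi_integral: "(\<integral>\<^sup>+v. ennreal (psi v * v powr (\<alpha> - 1)) * indicator {0<..} v \<partial>lborel) = ennreal gauss_const"
  unfolding psi_def gauss_const_def by (rule nn_integral_gauss_tail[OF alpha_pos sigma_pos])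

lemma rate_at_top: "filterlim rate at_top sequentially"
  using eps_big by (simp add: rate_def[abs_def])

lemma liminf_normalized_prob:
  assumes "Liminf (at_right 0) (\<lambda>u. ereal (u powr (1 - \<alpha>) * w u)) = ereal a" "0 < a"
  shows "ereal (a * gauss_const) \<le> liminf (\<lambda>n. ereal (normalized_prob n))"
  unfolding le_Liminf_iff
proof (intro allI impI)
  fix y assume y: "y < ereal (a * gauss_const)"
  show "eventually (\<lambda>n. y < ereal (normalized_prob n)) sequentially"
  proof (cases y)
    case (real r)
    define t where "t = r / gauss_const"
    \<comment> \<open>A level strictly between r / \<open>gauss_const\<close> and a, cut at 0
      because \<open>EW_lower\<close> takes a nonnegative level while r may be negative.\<close>
    define c where "c = max 0 ((t + a) / 2)"
    have t: "t < a" using y real gauss_const_pos by (simp add: t_def pos_divide_less_eq)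
    have c: "0 \<le> c" "c < a" "t < c" using t assms(2) by (auto simp: c_def max_def)
    have cr: "r < c * gauss_const" using c(3) gauss_const_pos by (simp add: t_def pos_divide_less_eq)
    have "eventually (\<lambda>u. ereal c < ereal (u powr (1 - \<alpha>) * w u)) (at_right 0)"
      using assms(1) c(2) by (intro less_LiminfD) simp
    then obtain b where b: "0 < b" "\<And>u. 0 < u \<Longrightarrow> u < b \<Longrightarrow> c < u powr (1 - \<alpha>) * w u"
      by (auto simp: eventually_at_right_field)
    \<comment> \<open>One third of the gap for \<open>EW_lower\<close>, one for the comparison
      error, one left to keep the inequality strict.\<close>
    define \<eta> where "\<eta> = (c * gauss_const - r) / 3"
    have eta: "0 < \<eta>" using cr by (simp add: \<eta>_def)
    have "eventually (\<lambda>N. c * gauss_const - \<eta> \<le> N powr \<alpha> * EW N psi) at_top"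
      using b gauss_const_pos
      by (intro EW_lower[OF psi_measurable psi_bounds psi_integral _ c(1) _ _ eta, of "b / 2"]) (auto intro: less_imp_le)
    then have "eventually (\<lambda>n. c * gauss_const - \<eta> \<le> rate n powr \<alpha> * EW (rate n) psi) sequentially"
      using rate_at_top by (rule eventually_compose_filterlim)
    moreover have "eventually (\<lambda>n. - \<eta> < normalized_prob n - rate n powr \<alpha> * EW (rate n) psi) sequentially"
      using eta by (intro order_tendstoD(1)[OF normalized_prob_compare]) simp
    ultimately show ?thesis
    proof eventually_elim
      case (elim n)
      have "c * gauss_const - r = 3 * \<eta>" by (simp add: \<eta>_def)
      then have "r < normalized_prob n" using elim eta by linarith
      then show ?case by (simp add: real)
    qed
  qed (use y in auto)
qed

lemma limsup_normalized_prob: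
  assumes "Limsup (at_right 0) (\<lambda>u. ereal (u powr (1 - \<alpha>) * w u)) = ereal a" "0 < a"
  shows "limsup (\<lambda>n. ereal (normalized_prob n)) \<le> ereal (a * gauss_const)"
  unfolding Limsup_le_iff
proof (intro allI impI)
  fix y assume y: "ereal (a * gauss_const) < y"
  show "eventually (\<lambda>n. ereal (normalized_prob n) < y) sequentially"
  proof (cases y)
    case (real r)
    define t where "t = r / gauss_const"
    define c where "c = (t + a) / 2"
    have t: "a < t" using y real gauss_const_pos by (simp add: t_def pos_less_divide_eq)
    have c: "0 \<le> c" "a < c" "c < t" using t assms(2) by (auto simp: c_def)
    have cr: "c * gauss_const < r" using c(3) gauss_const_pos by (simp add: t_def pos_less_divide_eq)
    have "eventually (\<lambda>u. ereal (u powr (1 - \<alpha>) * w u) < ereal c) (at_right 0)"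
      using assms(1) c(2) by (intro Limsup_lessD) simp
    then obtain b where b: "0 < b" "\<And>u. 0 < u \<Longrightarrow> u < b \<Longrightarrow> u powr (1 - \<alpha>) * w u < c"
      by (auto simp: eventually_at_right_field)
    define \<eta> where "\<eta> = (r - c * gauss_const) / 3"
    have eta: "0 < \<eta>" using cr by (simp add: \<eta>_def)
    let ?\<mu> = "1 / (2 * \<sigma>\<^sup>2)"
    have mu: "0 < ?\<mu>" using sigma_pos by simp
    have up: "rate n powr \<alpha> * EW (rate n) psi \<le> c * gauss_const + rate n powr \<alpha> * exp (- (?\<mu> * (b / 2 * rate n)))" for n
      using b gauss_const_pos
      by (intro EW_upper[OF psi_measurable psi_bounds(1) psi_le_exp mu psi_integral _ c(1) _ _ rate_pos]) (auto intro: less_imp_le)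
    have "0 < ?\<mu> * (b / 2)" using mu b(1) by simp
    from filterlim_compose[OF powr_times_exp_tendsto_0[OF this] rate_at_top]
    have "(\<lambda>n. rate n powr \<alpha> * exp (- (?\<mu> * (b / 2 * rate n)))) \<longlonglongrightarrow> 0" by (simp only: mult.assoc)
    then have "eventually (\<lambda>n. rate n powr \<alpha> * exp (- (?\<mu> * (b / 2 * rate n))) < \<eta>) sequentially"
      using eta by (rule order_tendstoD(2))
    moreover have "eventually (\<lambda>n. normalized_prob n - rate n powr \<alpha> * EW (rate n) psi < \<eta>) sequentially"
      using eta by (rule order_tendstoD(2)[OF normalized_prob_compare])
    ultimately show ?thesis
    proof eventually_elim
      case (elim n)
      have "r - c * gauss_const = 3 * \<eta>" by (simp add: \<eta>_def)
      then have "normalized_prob n < r" using elim eta up[of n] by linarith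
      then show ?case by (simp add: real)
    qed
  qed (use y in auto)
qed

text \<open>The two-sided bounds on the density make both limits finite and positive, so the
  products in the extended reals become real ones.\<close>

lemma density_limits:
  obtains a b where "0 < a" "0 < b"
    "Liminf (at_right 0) (\<lambda>u. ereal (u powr (1 - \<alpha>) * w u)) = ereal a"
    "Limsup (at_right 0) (\<lambda>u. ereal (u powr (1 - \<alpha>) * w u)) = ereal b"
proof -
  let ?g = "\<lambda>u. ereal (u powr (1 - \<alpha>) * w u)"
  obtain C where C: "C > 0" "\<And>u. 0 < u \<Longrightarrow> u \<le> 1 \<Longrightarrow> u powr (1 - \<alpha>) * w u \<le> C"
    using w_upper_bound by blast
  obtain c \<delta> where c: "c > 0" "\<delta> > 0" "\<And>u. 0 < u \<Longrightarrow> u \<le> \<delta> \<Longrightarrow> c \<le> u powr (1 - \<alpha>) * w u"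
    using w_lower_bound by blast
  have "eventually (\<lambda>u. ?g u \<le> ereal C) (at_right 0)"
    unfolding eventually_at_right_field using C(2) by (intro exI[of _ 1]) auto
  then have up: "Limsup (at_right 0) ?g \<le> ereal C" by (rule Limsup_bounded)
  have "eventually (\<lambda>u. ereal c \<le> ?g u) (at_right 0)"
    unfolding eventually_at_right_field using c(2,3) by (intro exI[of _ \<delta>]) auto
  then have low: "ereal c \<le> Liminf (at_right 0) ?g" by (rule Liminf_bounded)
  have mid: "Liminf (at_right 0) ?g \<le> Limsup (at_right 0) ?g"
    by (rule Liminf_le_Limsup) (rule trivial_limit_at_right_real)
  have "ereal c \<le> Limsup (at_right 0) ?g" "Liminf (at_right 0) ?g \<le> ereal C"
    using low mid up by (blast intro: order_trans)+
  then obtain a b where "Liminf (at_right 0) ?g = ereal a" "Limsup (at_right 0) ?g = ereal b"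
    using low up by (cases "Liminf (at_right 0) ?g"; cases "Limsup (at_right 0) ?g") auto
  moreover have "0 < a" "0 < b"
    using c(1) low \<open>ereal c \<le> Limsup (at_right 0) ?g\<close> calculation by auto
  ultimately show thesis using that by blast
qed

end

theorem theorem1:
  fixes M :: "'a measure"
    and p :: "nat \<Rightarrow> real"
    and \<xi> :: "nat \<Rightarrow> nat \<Rightarrow> 'a \<Rightarrow> nat"
    and X :: "nat \<Rightarrow> 'a \<Rightarrow> real"
    and W :: "'a \<Rightarrow> real"
    and w :: "real \<Rightarrow> real"
    and m q \<gamma> \<alpha> \<sigma> :: real
    and \<epsilon> :: "nat \<Rightarrow> real"
  assumes M: "prob_space M"
    \<comment> \<open>offspring law\<close>
    and p_nonneg: "\<And>k. p k \<ge> 0"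
    and p_sums: "p sums 1"
    and m_def: "m = (\<Sum>k. real k * p k)"
    and m_summ: "summable (\<lambda>k. real k * p k)"
    and m_gt1: "m > 1"
    and ZlogZ: "summable (\<lambda>k. real k * ln (real k) * p k)"
    \<comment> \<open>independence of all offspring variables and of the X_k (k >= 1)\<close>
    and indep: "prob_space.indep_vars M (\<lambda>_. borel) (joint_family \<xi> X) joint_index"
    and xi_law: "\<And>n i k. measure M {x \<in> space M. \<xi> n i x = k} = p k"
    \<comment> \<open>X i.i.d., mean 0, finite positive variance\<close>
    and X_ident: "\<And>k. k \<ge> 1 \<Longrightarrow> distr M borel (X k) = distr M borel (X 1)"
    and X_int: "integrable M (X 1)"
    and X_mean: "prob_space.expectation M (X 1) = 0"
    and X_sq_int: "integrable M (\<lambda>x. (X 1 x)\<^sup>2)"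
    and \<sigma>_def: "\<sigma>\<^sup>2 = prob_space.expectation M (\<lambda>x. (X 1 x)\<^sup>2)"
    and \<sigma>_pos: "\<sigma> > 0"
    \<comment> \<open>extinction probability, Schroeder case and Schroeder constant\<close>
    and q_def: "q = measure M {x \<in> space M. \<exists>n. GW \<xi> n x = 0}"
    and \<gamma>_def: "\<gamma> = deriv (gen_fun p) q"
    and schroeder: "p 0 + p 1 > 0"
    and \<alpha>_def: "\<gamma> = m powr (- \<alpha>)"
    \<comment> \<open>moment condition on the positive part\<close>
    and X_mom: "integrable M (\<lambda>x. (max (X 1 x) 0) powr (1 + \<alpha>))"
    \<comment> \<open>martingale limit W and its (continuous) density on (0,oo)\<close>
    and W_meas: "W \<in> borel_measurable M"
    and W_lim: "AE x in M. (\<lambda>n. real (GW \<xi> n x) / m ^ n) \<longlonglongrightarrow> W x"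
    and w_nonneg: "\<And>u. u > 0 \<Longrightarrow> w u \<ge> 0"
    and w_cont: "continuous_on {0<..} w"
    and w_density: "\<And>A. A \<in> sets borel \<Longrightarrow> A \<subseteq> {0<..} \<Longrightarrow>
        emeasure M {x \<in> space M. W x \<in> A} = (\<integral>\<^sup>+ u\<in>A. ennreal (w u) \<partial>lborel)"
    \<comment> \<open>the sequence eps_n\<close>
    and \<epsilon>_pos: "\<And>n. \<epsilon> n > 0"
    and \<epsilon>_lim: "\<epsilon> \<longlonglongrightarrow> 0"
    and \<epsilon>_big: "filterlim (\<lambda>n. (\<epsilon> n)\<^sup>2 * m ^ n) at_top sequentially"
  shows
    "let V_low = Liminf (at_right 0) (\<lambda>u. ereal (u powr (1 - \<alpha>) * w u));
         V_up = Limsup (at_right 0) (\<lambda>u. ereal (u powr (1 - \<alpha>) * w u));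
         \<Gamma>\<alpha> = 2 powr (\<alpha> - 1) * Gamma (\<alpha> + 1 / 2) / (\<alpha> * sqrt pi) * (\<sigma>\<^sup>2) powr \<alpha>;
         L = (\<lambda>n. ereal ((\<epsilon> n) powr (2 * \<alpha>) * m powr (\<alpha> * real n) *
               measure M {x \<in> space M. GW \<xi> n x > 0 \<and>
                  psum X (GW \<xi> n x) x / real (GW \<xi> n x) \<ge> \<epsilon> n}))
     in 0 < V_low * ereal \<Gamma>\<alpha> \<and> V_low * ereal \<Gamma>\<alpha> \<le> liminf L \<and> liminf L \<le> limsup L \<and>
        limsup L \<le> V_up * ereal \<Gamma>\<alpha> \<and> V_up * ereal \<Gamma>\<alpha> < \<infinity>"
proof -
  \<comment> \<open>The interpretation has two stages: the derivative of the generating function at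
    q is identified with \<open>dpgf\<close> only below 1, and \<open>ext\<close> < 1 is a result of
    the first stage.\<close>
  interpret galton_watson_limit M p m \<xi> X W
    by (intro galton_watson_limit.intro galton_watson.intro offspring_law.intro
      galton_watson_axioms.intro galton_watson_limit_axioms.intro) (fact assms)+
  have q: "q = ext" by (simp add: q_def ext_def)
  have dpgf_ext: "dpgf ext = m powr (- \<alpha>)"
    using deriv_gen_fun[of ext] ext_lt_1 \<gamma>_def \<alpha>_def q by (simp add: ext_def)
  interpret gw_walk M p m \<xi> X W w \<alpha> \<epsilon> \<sigma>
    by unfold_locales (fact assms dpgf_ext)+
  obtain a b where ab: "0 < a" "0 < b"
    "Liminf (at_right 0) (\<lambda>u. ereal (u powr (1 - \<alpha>) * w u)) = ereal a"
    "Limsup (at_right 0) (\<lambda>u. ereal (u powr (1 - \<alpha>) * w u)) = ereal b"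
    by (rule density_limits)
  have "liminf (\<lambda>n. ereal (normalized_prob n)) \<le> limsup (\<lambda>n. ereal (normalized_prob n))"
    by (rule Liminf_le_Limsup) simp
  then have "0 < ereal a * ereal gauss_const \<and>
      ereal a * ereal gauss_const \<le> liminf (\<lambda>n. ereal (normalized_prob n)) \<and>
      liminf (\<lambda>n. ereal (normalized_prob n)) \<le> limsup (\<lambda>n. ereal (normalized_prob n)) \<and>
      limsup (\<lambda>n. ereal (normalized_prob n)) \<le> ereal b * ereal gauss_const \<and>
      ereal b * ereal gauss_const < \<infinity>"
    using liminf_normalized_prob[OF ab(3,1)] limsup_normalized_prob[OF ab(4,2)] ab(1) gauss_const_pos by simp
  then show ?thesis
    unfolding Let_def ab(3,4) normalized_prob_def gauss_const_def .
qed

end
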